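(* Let $\nu,\nu',\nu^*$ be L\'evy measures on $\mathbb R^d$ such that $\nu$ and $\nu'$ are absolutely continuous with respect to $\nu^*$ with densities $g_\nu$ and $g_{\nu'}$, respectively, satisfying $$\int(1-g_\nu)^2\,\mathrm d\nu^*+\int(1-g_{\nu'})^2\,\mathrm d\nu^*<\infty,$$ $$\int_{|x|\le1}|x|\,|1-g_\nu(x)|\,\nu^*(\mathrm dx)+\int_{|x|\le1}|x|\,|1-g_{\nu'}(x)|\,\nu^*(\mathrm dx)<\infty.$$ Let $b,b',b^*\in\mathbb R^d$ be such that $$b=b^*+\int_{|x|\le1}x(g_\nu(x)-1)\,\nu^*(\mathrm dx),\qquad b'=b^*+\int_{|x|\le1}x(g_{\nu'}(x)-1)\,\nu^*(\mathrm dx).$$ Let $f:\mathbf D\to\mathbb R$ be $\mathcal A_{t_0}$-measurable for some $t_0>0$ and assume that $\mathbb E_{b^*,\nu^*}f(X)^2<\infty$. Then $$\sum_{n=0}^\infty\frac1{n!}\int\big|\mathbb E_{b,\nu}\Delta^nf(X)\big|\,|g_{\nu'}-g_\nu|^{\otimes n}\,\mathrm d(\lambda_1\otimes\nu^* )^n<\infty$$ and $$\mathbb E_{b',\nu'}f(X)=\mathbb E_{b,\nu}f(X)+\sum_{n=1}^\infty\frac1{n!}\int\big(\mathbb E_{b,\nu}\Delta^nf(X)\big)(g_{\nu'}-g_\nu)^{\otimes n}\,\mathrm d(\lambda_1\otimes\nu^* )^n.$$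
   Context: A L\'evy measure on $\mathbb R^d$ is a measure $\nu$ with $\nu(\{0\})=0$ and $\int(|x|^2\wedge1)\,\nu(\mathrm dx)<\infty$. $\lambda_1$ is Lebesgue measure on $[0,\infty)$. A covariance matrix $\Sigma\in\mathbb R^{d\times d}$ is fixed. $\mathbf D$ is the space of $\mathbb R^d$-valued right-continuous functions on $[0,\infty)$ with left-hand limits on $(0,\infty)$, with the Kolmogorov product $\sigma$-field. For $b\in\mathbb R^d$ and a L\'evy measure $\nu$, $\mathbb P_{b,\nu}$ (expectation $\mathbb E_{b,\nu}$) is a probability measure under which the $\mathbf D$-valued random element $X=(X_t)_{t\ge0}$ is a L\'evy process with characteristic triplet $(\Sigma,b,\nu)$, i.e. has the law of $$bt+W_t+\int_{|x|\le1}\int_0^tx\,(\Phi(\mathrm ds,\mathrm dx)-\mathrm ds\,\nu(\mathrm dx))+\int_{|x|>1}\int_0^tx\,\Phi(\mathrm ds,\mathrm dx),\quad t\ge0,$$ with $W$ a $d$-dimensional Wiener process with covariance matrix $\Sigma$ and $\Phi$ an independent Poisson process on $[0,\infty)\times\mathbb R^d$ with intensity measure $\lambda_1\otimes\nu$ (integrals as limits in probability). For $s>0$, $\mathcal A_s$ is the $\sigma$-field on $\mathbf D$ generated by $w\mapsto w^{(s)}$, $w^{(s)}(t):=w(t\wedge s)$. For a path $w$ and $(t_1,x_1)\in[0,\infty)\times\mathbb R^d$ let $w^{t_1,x_1}_t:=w_t+\mathbf 1\{t\ge t_1\}x_1$, and $\Delta_{t_1,x_1}f(w):=f(w^{t_1,x_1})-f(w)$;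 inductively $\Delta^n_{t_1,x_1,\ldots,t_n,x_n}f:=\Delta_{t_1,x_1}(\Delta^{n-1}_{t_2,x_2,\ldots,t_n,x_n}f)$, $\Delta^1:=\Delta$, $\Delta^0f:=f$. $\mathbb E_{b,\nu}\Delta^nf(X)$ denotes the function $(t_1,x_1,\ldots,t_n,x_n)\mapsto\mathbb E_{b,\nu}\Delta^n_{t_1,x_1,\ldots,t_n,x_n}f(X)$, understood almost everywhere with respect to the (total variation of the) measure against which it is integrated. For $g:\mathbb R^d\to\mathbb R$, $g^{\otimes n}$ is regarded as the function $(t_1,x_1,\ldots,t_n,x_n)\mapsto\prod_{j=1}^ng(x_j)$ on $([0,\infty)\times\mathbb R^d)^n$. The $n=0$ summand of the first series is $|\mathbb E_{b,\nu}f(X)|$. *)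

theory Defs
  imports "HOL-Probability.Probability"
begin

text \<open>
  A path on \<open>[0,\<infinity>)\<close> is a function on the reals that is \<open>undefined\<close> at negative times, as
  for every element of the space of \<^const>\<open>PiM\<close>.
\<close>

definition cadlag_paths :: "(real \<Rightarrow> real ^ 'd) set" where
  "cadlag_paths = {w \<in> extensional {0..}.
     (\<forall>t\<ge>0. continuous (at_right t) w) \<and> (\<forall>t>0. \<exists>l. (w \<longlongrightarrow> l) (at_left t))}"

abbreviation product_space :: "(real \<Rightarrow> real ^ 'd) measure" where
  "product_space \<equiv> PiM {0..} (\<lambda>_. borel)"

definition path_space :: "(real \<Rightarrow> real ^ 'd) measure" where
  "path_space = restrict_space product_space cadlag_paths"

definition stopped_path :: "real \<Rightarrow> (real \<Rightarrow> real ^ 'd) \<Rightarrow> real \<Rightarrow> real ^ 'd" where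
  "stopped_path s w = (\<lambda>t\<in>{0..}. w (min t s))"

definition path_algebra_upto :: "real \<Rightarrow> (real \<Rightarrow> real ^ 'd) measure" where
  "path_algebra_upto s = vimage_algebra cadlag_paths (stopped_path s) path_space"

definition add_jump :: "real \<times> (real ^ 'd) \<Rightarrow> (real \<Rightarrow> real ^ 'd) \<Rightarrow> real \<Rightarrow> real ^ 'd" where
  "add_jump z w = (\<lambda>t\<in>{0..}. w t + (if t \<ge> fst z then snd z else 0))"

primrec difference ::
  "(real \<times> (real ^ 'd)) list \<Rightarrow> ((real \<Rightarrow> real ^ 'd) \<Rightarrow> real) \<Rightarrow> (real \<Rightarrow> real ^ 'd) \<Rightarrow> real" where
  "difference [] f w = f w"
| "difference (z # zs) f w = difference zs f (add_jump z w) - difference zs f w"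

definition half_line :: "real measure" where
  "half_line = restrict_space lborel {0..}"

definition levy_measure :: "(real ^ 'd) measure \<Rightarrow> bool" where
  "levy_measure \<nu> \<longleftrightarrow> sets \<nu> = sets borel \<and> emeasure \<nu> {0} = 0 \<and>
     (\<integral>\<^sup>+ x. ennreal (min ((norm x)\<^sup>2) 1) \<partial>\<nu>) < \<infinity>"

definition covariance_matrix :: "real ^ 'd ^ 'd \<Rightarrow> bool" where
  "covariance_matrix \<Sigma> \<longleftrightarrow> transpose \<Sigma> = \<Sigma> \<and> (\<forall>u. 0 \<le> u \<bullet> (\<Sigma> *v u))"

text \<open>
  A centred Gaussian vector is one all of whose linear functionals are centred Gaussian; \<open>\<Sigma>\<close>
  may be singular, and \<^const>\<open>normal_density\<close> does not cover the point mass at \<open>0\<close>.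
\<close>

definition centred_gaussian :: "'w measure \<Rightarrow> real ^ 'd ^ 'd \<Rightarrow> ('w \<Rightarrow> real ^ 'd) \<Rightarrow> bool" where
  "centred_gaussian M \<Sigma> Z \<longleftrightarrow> Z \<in> borel_measurable M \<and>
     (\<forall>u. distr M borel (\<lambda>\<omega>. u \<bullet> Z \<omega>) =
       (if u \<bullet> (\<Sigma> *v u) = 0 then return borel 0
        else density lborel (normal_density 0 (sqrt (u \<bullet> (\<Sigma> *v u))))))"

locale wiener_process = prob_space M
  for M :: "'w measure" and \<Sigma> :: "real ^ 'd ^ 'd" and W :: "real \<Rightarrow> 'w \<Rightarrow> real ^ 'd" +
  assumes wiener_measurable: "t \<ge> 0 \<Longrightarrow> W t \<in> borel_measurable M"
    and wiener_zero: "AE \<omega> in M. W 0 \<omega> = 0"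
    and wiener_continuous: "AE \<omega> in M. continuous_on {0..} (\<lambda>t. W t \<omega>)"
    and wiener_increment: "0 \<le> s \<Longrightarrow> s \<le> t \<Longrightarrow>
      centred_gaussian M ((t - s) *\<^sub>R \<Sigma>) (\<lambda>\<omega>. W t \<omega> - W s \<omega>)"
    and wiener_indep: "\<And>(\<tau> :: nat \<Rightarrow> real) n. 0 \<le> \<tau> 0 \<Longrightarrow> mono \<tau> \<Longrightarrow>
      indep_vars (\<lambda>_. borel) (\<lambda>i \<omega>. W (\<tau> (Suc i)) \<omega> - W (\<tau> i) \<omega>) {..<n}"

text \<open>A Poisson process with intensity \<open>\<mu>\<close> is a random integer-valued measure.\<close>

locale poisson_process = prob_space M
  for M :: "'w measure" and \<mu> :: "'x measure" and \<Phi> :: "'w \<Rightarrow> 'x measure" +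
  assumes poisson_sets: "\<omega> \<in> space M \<Longrightarrow> sets (\<Phi> \<omega>) = sets \<mu>"
    and poisson_integer_valued: "\<omega> \<in> space M \<Longrightarrow> B \<in> sets \<mu> \<Longrightarrow>
      emeasure (\<Phi> \<omega>) B \<in> insert \<infinity> (range of_nat)"
    and poisson_measurable: "B \<in> sets \<mu> \<Longrightarrow> (\<lambda>\<omega>. emeasure (\<Phi> \<omega>) B) \<in> borel_measurable M"
    and poisson_finite: "B \<in> sets \<mu> \<Longrightarrow> emeasure \<mu> B < \<infinity> \<Longrightarrow>
      prob {\<omega> \<in> space M. emeasure (\<Phi> \<omega>) B = of_nat k} =
        measure \<mu> B ^ k / fact k * exp (- measure \<mu> B)"
    and poisson_infinite: "B \<in> sets \<mu> \<Longrightarrow> emeasure \<mu> B = \<infinity> \<Longrightarrow>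
      AE \<omega> in M. emeasure (\<Phi> \<omega>) B = \<infinity>"
    and poisson_indep: "\<And>(B :: nat \<Rightarrow> 'x set) n. (\<And>i. i < n \<Longrightarrow> B i \<in> sets \<mu>) \<Longrightarrow>
      disjoint_family_on B {..<n} \<Longrightarrow>
      indep_vars (\<lambda>_. borel) (\<lambda>i \<omega>. emeasure (\<Phi> \<omega>) (B i)) {..<n}"

text \<open>
  The compensated integral over the jumps of size in \<open>(0,1]\<close> up to time \<open>t\<close> is the random
  variable \<open>J t\<close>, the limit in probability as \<open>\<epsilon> \<rightarrow> 0\<close> of the integrals over the jumps of size
  in \<open>(\<epsilon>,1]\<close>, where the intensity is finite and the compensator can be split off. By
  finiteness of the intensity, the integral over the jumps of size above \<open>1\<close> is almost surely
  a finite sum.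
\<close>

definition small_jumps :: "real \<Rightarrow> real \<Rightarrow> (real \<times> (real ^ 'd)) set" where
  "small_jumps \<epsilon> t = {0..t} \<times> {x. \<epsilon> < norm x \<and> norm x \<le> 1}"

definition large_jumps :: "real \<Rightarrow> (real \<times> (real ^ 'd)) set" where
  "large_jumps t = {0..t} \<times> {x. norm x > 1}"

locale levy_ito =
  wiener_process M \<Sigma> W + poisson_process M "half_line \<Otimes>\<^sub>M \<nu>" \<Phi>
  for M :: "'w measure" and \<Sigma> :: "real ^ 'd ^ 'd" and W :: "real \<Rightarrow> 'w \<Rightarrow> real ^ 'd"
    and \<nu> :: "(real ^ 'd) measure" and \<Phi> :: "'w \<Rightarrow> (real \<times> (real ^ 'd)) measure"
    and J :: "real \<Rightarrow> 'w \<Rightarrow> real ^ 'd" +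
  assumes wiener_poisson_indep:
      "indep_set
         (sets (vimage_algebra (space M) (\<lambda>\<omega>. \<lambda>t\<in>{0..}. W t \<omega>) product_space))
         (sets (vimage_algebra (space M)
           (\<lambda>\<omega>. \<lambda>B\<in>sets (half_line \<Otimes>\<^sub>M \<nu>). emeasure (\<Phi> \<omega>) B)
           (PiM (sets (half_line \<Otimes>\<^sub>M \<nu>)) (\<lambda>_. borel))))"
    and compensated_measurable: "t \<ge> 0 \<Longrightarrow> J t \<in> borel_measurable M"
    and compensated_limit: "t \<ge> 0 \<Longrightarrow> \<delta> > 0 \<Longrightarrow>
      ((\<lambda>\<epsilon>. prob {\<omega> \<in> space M.
          norm ((LINT z:small_jumps \<epsilon> t|\<Phi> \<omega>. snd z)
                - (LINT z:small_jumps \<epsilon> t|half_line \<Otimes>\<^sub>M \<nu>. snd z) - J t \<omega>) > \<delta>})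
        \<longlongrightarrow> 0) (at_right 0)"

text \<open>
  \<open>X\<close> has, on the product \<open>\<sigma>\<close>-field, the law of the Levy-Ito process built on some probability
  space whose points have type \<open>'w\<close>. That type is an explicit parameter because it cannot be
  quantified existentially; a theorem assuming \<open>levy_process\<close> with an arbitrary \<open>'w\<close>
  covers all probability spaces.
\<close>

definition levy_process :: "'w itself \<Rightarrow> real ^ 'd ^ 'd \<Rightarrow> real ^ 'd \<Rightarrow> (real ^ 'd) measure \<Rightarrow>
    'o measure \<Rightarrow> ('o \<Rightarrow> real \<Rightarrow> real ^ 'd) \<Rightarrow> bool" where
  "levy_process (T :: 'w itself) \<Sigma> b \<nu> P X \<longleftrightarrow>
     prob_space P \<and> X \<in> measurable P path_space \<and>
     (\<exists>(M :: 'w measure) W \<Phi> J. levy_ito M \<Sigma> W \<nu> \<Phi> J \<and>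
        distr P product_space X =
        distr M product_space (\<lambda>\<omega>. \<lambda>t\<in>{0..}.
          t *\<^sub>R b + W t \<omega> + J t \<omega> + (LINT z:large_jumps t|\<Phi> \<omega>. snd z)))"

text \<open>
  Points of \<open>([0,\<infinity>) \<times> \<real>\<^sup>d)\<^sup>n\<close> are functions \<open>z\<close> on \<open>{..<n}\<close>.
\<close>

abbreviation difference_at :: "nat \<Rightarrow> (nat \<Rightarrow> real \<times> (real ^ 'd)) \<Rightarrow>
    ((real \<Rightarrow> real ^ 'd) \<Rightarrow> real) \<Rightarrow> (real \<Rightarrow> real ^ 'd) \<Rightarrow> real" where
  "difference_at n z \<equiv> difference (map z [0..<n])"

abbreviation jump_power :: "nat \<Rightarrow> (real ^ 'd) measure \<Rightarrow> (nat \<Rightarrow> real \<times> (real ^ 'd)) measure" where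
  "jump_power n \<nu> \<equiv> PiM {..<n} (\<lambda>_. half_line \<Otimes>\<^sub>M \<nu>)"

definition tensor_power :: "nat \<Rightarrow> (real ^ 'd \<Rightarrow> real) \<Rightarrow> (nat \<Rightarrow> real \<times> (real ^ 'd)) \<Rightarrow> real" where
  "tensor_power n g z = (\<Prod>j<n. g (snd (z j)))"

end

theory Submission
  imports Defs
begin

text \<open>
  For a trigonometric functional \<open>w \<mapsto> exp (i \<Sum> \<theta>\<^sub>k \<bullet> w s\<^sub>k)\<close>, adding a jump \<open>z\<close> multiplies the value by
  \<open>exp (i \<phi> z)\<close> with \<open>\<phi> (t, x) = \<Sum>\<^bsub>s\<^sub>k \<ge> t\<^esub> \<theta>\<^sub>k \<bullet> x\<close>, so its \<open>n\<close>-th difference is the functional times a product of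
  factors \<open>exp (i \<phi> z\<^sub>j) - 1\<close>. By the Levy-Khintchine formula, replacing \<open>\<nu>\<close> by \<open>\<nu>'\<close> multiplies the
  expectation by \<open>exp (\<integral> (exp (i \<phi>) - 1) (g' - g))\<close>, and the expansion is the exponential series.

  For the passage to all \<open>f\<close> with \<open>f(X)\<close> square integrable under the reference law, no density between the
  laws is used. The squared norms of the chaos components of a trigonometric polynomial, weighted by \<open>1/n!\<close>,
  sum to at most its second moment under the reference law (a Bessel inequality; the Gaussian part only
  contributes a positive semidefinite kernel). By the Cauchy-Schwarz inequality this bounds the series under
  the perturbed law, and likewise its expectations. Trigonometric polynomials are dense, and the expected
  differences converge almost everywhere along a rapidly approximating sequence.
\<close>

section \<open>Integrals against a Poisson process\<close>

text \<open>The functional \<open>f\<close> is square integrable under the reference law only, while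
  each term of the series evaluates it at paths with extra jumps and under another law. The laws
  enter through their finite-dimensional characteristic functions, so every estimate is a statement
  about the kernel \<open>exp (gram u v)\<close> built from the inner products of the jump symbols;
  this is the inner product of exponential vectors in a symmetric Fock space. Two costs arise: the
  change from the reference law to the perturbed law multiplies the coefficient of each exponential
  by \<open>exp (\<integral> \<phi> h)\<close>, and the absolute convergence of the series costs a
  second exponential. Writing the kernel as the product of two copies of
  \<open>exp (gram u v / 2)\<close> pays for one cost with each factor; this is the origin of the
  doubled exponents in the bounds. The deviations \<open>g - 1\<close> and \<open>g' - 1\<close> are
  truncated at time \<open>t0\<close>: this makes them square integrable over time and jump size,
  and nothing is lost because a functional of the path up to \<open>t0\<close> does not see later
  jumps.\<close>

lemma simple_integral_finite_set:
  fixes F :: "'a \<Rightarrow> 'b::{banach,second_countable_topology}"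
  assumes F: "simple_function N F" and B: "B \<in> sets N" and fin: "emeasure N B < \<infinity>"
  shows "(LINT z:B|N. F z) = (\<Sum>y\<in>F ` space N. measure N (B \<inter> (F -` {y} \<inter> space N)) *\<^sub>R y)"
proof -
  have fs: "finite (F ` space N)" using F by (simp add: simple_functionD)
  have ms: "B \<inter> (F -` {y} \<inter> space N) \<in> sets N" for y
    using simple_functionD(2)[OF F, of "{y}"] B by auto
  have lt: "emeasure N (B \<inter> (F -` {y} \<inter> space N)) < \<infinity>" for y
    by (rule le_less_trans[OF emeasure_mono fin]) (use B in auto)
  have "(LINT z:B|N. F z) = (LINT z|N. (\<Sum>y\<in>F ` space N. indicator (B \<inter> (F -` {y} \<inter> space N)) z *\<^sub>R y))"
    unfolding set_lebesgue_integral_def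
  proof (rule Bochner_Integration.integral_cong[OF refl])
    fix z assume z: "z \<in> space N"
    have "(\<Sum>y\<in>F ` space N. indicator (B \<inter> (F -` {y} \<inter> space N)) z *\<^sub>R y)
      = (\<Sum>y\<in>F ` space N. if y = F z then indicator B z *\<^sub>R F z else 0)"
      using z by (intro sum.cong) (auto simp: indicator_def)
    then show "indicator B z *\<^sub>R F z = (\<Sum>y\<in>F ` space N. indicator (B \<inter> (F -` {y} \<inter> space N)) z *\<^sub>R y)"
      using z fs by simp
  qed
  also have "\<dots> = (\<Sum>y\<in>F ` space N. measure N (B \<inter> (F -` {y} \<inter> space N)) *\<^sub>R y)"
    using ms lt by (subst Bochner_Integration.integral_sum) (auto simp: less_top[symmetric])
  finally show ?thesis .
qed

text \<open>Convergence and bound hold at every point and not merely almost everywhere: one sequence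
  is later integrated against all realizations \<open>\<Phi> \<omega>\<close>, whose null sets are
  unrelated to those of the intensity.\<close>

lemma simple_function_approximation:
  fixes \<psi> :: "'a \<Rightarrow> 'b::{banach,second_countable_topology}"
  assumes "\<psi> \<in> borel_measurable N"
  shows "\<exists>F. (\<forall>i. simple_function N (F i)) \<and> (\<forall>x\<in>space N. (\<lambda>i. F i x) \<longlonglongrightarrow> \<psi> x) \<and>
    (\<forall>i. \<forall>x\<in>space N. norm (F i x) \<le> 2 * norm (\<psi> x))"
proof -
  from borel_measurable_implies_sequence_metric[OF assms, of 0]
  obtain F where "\<forall>i. simple_function N (F i)" "\<forall>x\<in>space N. (\<lambda>i. F i x) \<longlonglongrightarrow> \<psi> x"
    "\<forall>i. \<forall>x\<in>space N. dist (F i x) 0 \<le> 2 * dist (\<psi> x) 0" by metis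
  then show ?thesis by (intro exI[of _ F]) simp
qed

context poisson_process
begin

lemma measurable_poisson_eq: "\<omega> \<in> space M \<Longrightarrow> f \<in> borel_measurable \<mu> \<Longrightarrow> f \<in> borel_measurable (\<Phi> \<omega>)"
  using poisson_sets measurable_cong_sets by blast

lemma space_poisson: "\<omega> \<in> space M \<Longrightarrow> space (\<Phi> \<omega>) = space \<mu>"
  using poisson_sets sets_eq_imp_space_eq by blast

text \<open>Integrality replaces an integrability assumption. The counts of the sets where
  \<open>norm (\<psi> z)\<close> exceeds \<open>n\<close> decrease to 0, and a value in the integers
  below 1 is 0, so \<open>\<psi>\<close> is essentially bounded on a set of finite count.\<close>

lemma poisson_integrable:
  fixes \<psi> :: "'x \<Rightarrow> 'c::{banach,second_countable_topology}"
  assumes \<omega>: "\<omega> \<in> space M" and B: "B \<in> sets \<mu>" and fin: "emeasure (\<Phi> \<omega>) B < \<infinity>"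
    and \<psi>: "\<psi> \<in> borel_measurable \<mu>"
  shows "set_integrable (\<Phi> \<omega>) B \<psi>"
proof -
  define A where "A n = B \<inter> {z \<in> space \<mu>. real n < norm (\<psi> z)}" for n
  have A[measurable]: "A n \<in> sets \<mu>" for n using B \<psi> unfolding A_def by measurable
  then have A': "A n \<in> sets (\<Phi> \<omega>)" for n using poisson_sets[OF \<omega>] by simp
  have B': "B \<in> sets (\<Phi> \<omega>)" using B poisson_sets[OF \<omega>] by simp
  have Afin: "emeasure (\<Phi> \<omega>) (A n) \<noteq> \<infinity>" for n
    using le_less_trans[OF emeasure_mono fin, of "A n"] B' by (auto simp: A_def)
  have "(\<lambda>n. emeasure (\<Phi> \<omega>) (A n)) \<longlonglongrightarrow> emeasure (\<Phi> \<omega>) (\<Inter>n. A n)"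
    using A' Afin by (intro Lim_emeasure_decseq) (auto simp: decseq_def A_def)
  moreover have "(\<Inter>n. A n) = {}"
  proof -
    have "\<exists>n. \<not> real n < norm (\<psi> z)" for z using reals_Archimedean2[of "norm (\<psi> z)"] by (auto simp: not_less intro: less_imp_le)
    then show ?thesis unfolding A_def by blast
  qed
  ultimately have "(\<lambda>n. emeasure (\<Phi> \<omega>) (A n)) \<longlonglongrightarrow> 0" by simp
  then have "\<forall>\<^sub>F n in sequentially. emeasure (\<Phi> \<omega>) (A n) < 1" by (rule order_tendstoD) simp
  then obtain n where n: "emeasure (\<Phi> \<omega>) (A n) < 1" by (auto simp: eventually_sequentially)
  with poisson_integer_valued[OF \<omega> A, of n] have z: "emeasure (\<Phi> \<omega>) (A n) = 0"
    by auto
  have ae: "AE z in \<Phi> \<omega>. z \<notin> A n" using A'[of n] z by (intro AE_I[of _ _ "A n"]) (auto)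
  have ms: "\<psi> \<in> borel_measurable (\<Phi> \<omega>)" by (rule measurable_poisson_eq[OF \<omega> \<psi>])
  show ?thesis unfolding set_integrable_def
  proof (rule integrableI_bounded_set[where A=B and B="real n"])
    show "AE x in \<Phi> \<omega>. x \<in> B \<longrightarrow> norm (indicator B x *\<^sub>R \<psi> x) \<le> real n"
      using ae AE_space by eventually_elim (auto simp: A_def space_poisson[OF \<omega>])
  qed (use B' ms fin in auto)
qed

lemma poisson_measure_measurable:
  assumes "B \<in> sets \<mu>" shows "(\<lambda>\<omega>. measure (\<Phi> \<omega>) B) \<in> borel_measurable M"
  unfolding measure_def using poisson_measurable[OF assms] by measurable

lemma poisson_integral_LIMSEQ:
  fixes \<psi> :: "'x \<Rightarrow> 'c::{banach,second_countable_topology}"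
  assumes \<omega>: "\<omega> \<in> space M" and B: "B \<in> sets \<mu>" and fin: "emeasure (\<Phi> \<omega>) B < \<infinity>"
    and \<psi>: "\<psi> \<in> borel_measurable \<mu>" and F: "\<And>i. simple_function \<mu> (F i)"
    and lim: "\<And>x. x \<in> space \<mu> \<Longrightarrow> (\<lambda>i. F i x) \<longlonglongrightarrow> \<psi> x"
    and bnd: "\<And>i x. x \<in> space \<mu> \<Longrightarrow> norm (F i x) \<le> 2 * norm (\<psi> x)"
  shows "(\<lambda>i. LINT z:B|\<Phi> \<omega>. F i z) \<longlonglongrightarrow> (LINT z:B|\<Phi> \<omega>. \<psi> z)"
  unfolding set_lebesgue_integral_def
proof (rule integral_dominated_convergence[where w="\<lambda>z. 2 * norm (indicator B z *\<^sub>R \<psi> z)"])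
  have B': "B \<in> sets (\<Phi> \<omega>)" using B poisson_sets[OF \<omega>] by simp
  have F': "F i \<in> borel_measurable \<mu>" for i using F by (simp add: borel_measurable_simple_function)
  show "(\<lambda>x. indicator B x *\<^sub>R \<psi> x) \<in> borel_measurable (\<Phi> \<omega>)"
    "(\<lambda>x. indicator B x *\<^sub>R F i x) \<in> borel_measurable (\<Phi> \<omega>)" for i
    using B' measurable_poisson_eq[OF \<omega> \<psi>] measurable_poisson_eq[OF \<omega> F'] by auto
  show "integrable (\<Phi> \<omega>) (\<lambda>z. 2 * norm (indicator B z *\<^sub>R \<psi> z))"
    using poisson_integrable[OF \<omega> B fin \<psi>] unfolding set_integrable_def
    by (intro integrable_mult_right integrable_norm)
  show "AE x in \<Phi> \<omega>. (\<lambda>i. indicator B x *\<^sub>R F i x) \<longlonglongrightarrow> indicator B x *\<^sub>R \<psi> x"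
    using AE_space by eventually_elim (auto intro!: tendsto_intros lim simp: space_poisson[OF \<omega>])
  show "AE x in \<Phi> \<omega>. norm (indicator B x *\<^sub>R F i x) \<le> 2 * norm (indicator B x *\<^sub>R \<psi> x)" for i
    using AE_space by eventually_elim (auto simp: indicator_def bnd space_poisson[OF \<omega>])
qed

lemma poisson_integral_simple:
  fixes F :: "'x \<Rightarrow> 'c::{banach,second_countable_topology}"
  assumes \<omega>: "\<omega> \<in> space M" and F: "simple_function \<mu> F" and B: "B \<in> sets \<mu>"
    and fin: "emeasure (\<Phi> \<omega>) B < \<infinity>"
  shows "(LINT z:B|\<Phi> \<omega>. F z) = (\<Sum>y\<in>F ` space \<mu>. measure (\<Phi> \<omega>) (B \<inter> (F -` {y} \<inter> space \<mu>)) *\<^sub>R y)"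
  using simple_integral_finite_set[of "\<Phi> \<omega>" F B] assms poisson_sets[OF \<omega>] space_poisson[OF \<omega>]
  by (simp add: simple_function_def)

text \<open>On realizations with finite count the integral is a pointwise limit of finite linear
  combinations of counts; the others receive the value 0 by hand.\<close>

lemma poisson_integral_measurable:
  fixes \<psi> :: "'x \<Rightarrow> 'c::{banach,second_countable_topology}"
  assumes B: "B \<in> sets \<mu>" and \<psi>: "\<psi> \<in> borel_measurable \<mu>"
  shows "(\<lambda>\<omega>. if emeasure (\<Phi> \<omega>) B < \<infinity> then LINT z:B|\<Phi> \<omega>. \<psi> z else 0) \<in> borel_measurable M"
proof -
  obtain F where F: "\<And>i. simple_function \<mu> (F i)" "\<And>x. x \<in> space \<mu> \<Longrightarrow> (\<lambda>i. F i x) \<longlonglongrightarrow> \<psi> x"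
    "\<And>i x. x \<in> space \<mu> \<Longrightarrow> norm (F i x) \<le> 2 * norm (\<psi> x)"
    using simple_function_approximation[OF \<psi>] by blast
  have ms: "B \<inter> (F i -` {y} \<inter> space \<mu>) \<in> sets \<mu>" for i y
    using simple_functionD(2)[OF F(1), of i "{y}"] B by auto
  note [measurable] = poisson_measurable[OF B] poisson_measure_measurable[OF ms]
  show ?thesis
  proof (rule borel_measurable_LIMSEQ_metric)
    show "(\<lambda>\<omega>. if emeasure (\<Phi> \<omega>) B < \<infinity> then
        (\<Sum>y\<in>F i ` space \<mu>. measure (\<Phi> \<omega>) (B \<inter> (F i -` {y} \<inter> space \<mu>)) *\<^sub>R y) else 0) \<in> borel_measurable M" for i
      by measurable
    fix \<omega> assume \<omega>: "\<omega> \<in> space M"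
    show "(\<lambda>i. if emeasure (\<Phi> \<omega>) B < \<infinity> then
        (\<Sum>y\<in>F i ` space \<mu>. measure (\<Phi> \<omega>) (B \<inter> (F i -` {y} \<inter> space \<mu>)) *\<^sub>R y) else 0)
        \<longlonglongrightarrow> (if emeasure (\<Phi> \<omega>) B < \<infinity> then LINT z:B|\<Phi> \<omega>. \<psi> z else 0)"
    proof (cases "emeasure (\<Phi> \<omega>) B < \<infinity>")
      case True
      with poisson_integral_LIMSEQ[OF \<omega> B True \<psi> F] poisson_integral_simple[OF \<omega> F(1) B True]
      show ?thesis by simp
    qed simp
  qed
qed

section \<open>Counts on sets of finite intensity and the characteristic functional\<close>

lemma poisson_sums:
  assumes B: "B \<in> sets \<mu>" and fin: "emeasure \<mu> B < \<infinity>"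
  defines "A \<equiv> \<lambda>k::nat. {\<omega> \<in> space M. emeasure (\<Phi> \<omega>) B = of_nat k}"
  shows "range A \<subseteq> events" "disjoint_family A" "prob (\<Union>k. A k) = 1"
proof -
  note [measurable] = poisson_measurable[OF B]
  show *: "range A \<subseteq> events" unfolding A_def by auto
  show **: "disjoint_family A" by (auto simp: disjoint_family_on_def A_def)
  have "(\<lambda>k. prob (A k)) sums prob (\<Union>k. A k)" by (rule finite_measure_UNION[OF * **])
  moreover have "prob (A k) = measure \<mu> B ^ k / fact k * exp (- measure \<mu> B)" for k
    unfolding A_def by (rule poisson_finite[OF B fin])
  moreover have "(\<lambda>k. measure \<mu> B ^ k / fact k * exp (- measure \<mu> B)) sums (exp (measure \<mu> B) * exp (- measure \<mu> B))"
    using exp_converges[of "measure \<mu> B"] by (intro sums_mult2) (simp add: divide_inverse mult.commute)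
  ultimately show "prob (\<Union>k. A k) = 1"
    using sums_unique2 by (fastforce simp flip: exp_add)
qed

text \<open>The Poisson weights sum to 1, so the finite values of the count exhaust the sample space
  up to a null set.\<close>

lemma poisson_AE_finite:
  assumes B: "B \<in> sets \<mu>" and fin: "emeasure \<mu> B < \<infinity>"
  shows "AE \<omega> in M. emeasure (\<Phi> \<omega>) B < \<infinity>"
proof -
  have "AE \<omega> in M. \<omega> \<in> (\<Union>k::nat. {\<omega> \<in> space M. emeasure (\<Phi> \<omega>) B = of_nat k})"
    using poisson_sums[OF assms] by (subst prob_eq_1[symmetric]) auto
  then show ?thesis by eventually_elim (auto simp: less_top[symmetric])
qed

text \<open>The integral is split over the values of the count, and the resulting series is an
  exponential series in \<open>measure \<mu> B * cis c\<close>.\<close>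

lemma poisson_count_cf:
  assumes B: "B \<in> sets \<mu>" and fin: "emeasure \<mu> B < \<infinity>"
  shows "(LINT \<omega>|M. cis (c * measure (\<Phi> \<omega>) B)) = exp (of_real (measure \<mu> B) * (cis c - 1))"
proof -
  define A where "A = (\<lambda>k::nat. {\<omega> \<in> space M. emeasure (\<Phi> \<omega>) B = of_nat k})"
  note S = poisson_sums[OF B fin, folded A_def]
  note [measurable] = poisson_measure_measurable[OF B]
  have A[measurable]: "A k \<in> events" for k using S(1) by auto
  let ?f = "\<lambda>\<omega>. cis (c * measure (\<Phi> \<omega>) B)"
  have int: "integrable M ?f" by (rule integrable_const_bound[of _ 1]) (auto simp: cis_conv_exp)
  have ae: "AE \<omega> in M. \<omega> \<in> (\<Union>k. A k)"
    using S by (subst prob_eq_1[symmetric]) auto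
  have "(LINT \<omega>|M. ?f \<omega>) = (LINT \<omega>:(\<Union>k. A k)|M. ?f \<omega>)"
    unfolding set_lebesgue_integral_def
    by (rule integral_cong_AE) (use ae in \<open>auto simp: cis_conv_exp\<close>)
  also have "\<dots> = (\<Sum>k. LINT \<omega>:A k|M. ?f \<omega>)"
    using S(2) int by (intro lebesgue_integral_countable_add A)
      (auto simp: disjoint_family_on_def set_integrable_def simp del: scaleR_complex.simps intro!: integrable_mult_indicator)
  also have "\<dots> = (\<Sum>k. of_real (exp (- measure \<mu> B)) * ((of_real (measure \<mu> B) * cis c) ^ k /\<^sub>R fact k))"
  proof (rule suminf_cong)
    fix k
    have "(LINT \<omega>:A k|M. ?f \<omega>) = (LINT \<omega>:A k|M. cis c ^ k)"
      unfolding set_lebesgue_integral_def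
      by (rule Bochner_Integration.integral_cong) (auto simp: A_def indicator_def measure_def Complex.DeMoivre mult.commute)
    also have "\<dots> = prob (A k) *\<^sub>R cis c ^ k"
      unfolding set_lebesgue_integral_def by (subst integral_scaleR_left) (auto simp: less_top[symmetric])
    also have "prob (A k) = measure \<mu> B ^ k / fact k * exp (- measure \<mu> B)"
      unfolding A_def by (rule poisson_finite[OF B fin])
    finally show "(LINT \<omega>:A k|M. ?f \<omega>) = of_real (exp (- measure \<mu> B)) * ((of_real (measure \<mu> B) * cis c) ^ k /\<^sub>R fact k)"
      by (simp add: scaleR_conv_of_real power_mult_distrib field_simps)
  qed
  also have "\<dots> = of_real (exp (- measure \<mu> B)) * exp (of_real (measure \<mu> B) * cis c)"
    using exp_converges[of "of_real (measure \<mu> B) * cis c"] by (intro sums_unique[symmetric] sums_mult)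
  also have "\<dots> = exp (of_real (measure \<mu> B) * (cis c - 1))"
    by (simp flip: exp_of_real exp_add add: algebra_simps)
  finally show ?thesis .
qed

abbreviation "poisson_map \<equiv> \<lambda>\<omega>. \<lambda>B\<in>sets \<mu>. emeasure (\<Phi> \<omega>) B"

text \<open>Independence in the weak form of a factorization against bounded functions of the
  counts. A complex factor \<open>Z\<close>, later the exponential of the Wiener part, can then be
  carried through all Poisson computations as a weight.\<close>

definition independent_of_poisson :: "('w \<Rightarrow> complex) \<Rightarrow> bool" where
  "independent_of_poisson Z \<longleftrightarrow> integrable M Z \<and> 
    (\<forall>h \<in> borel_measurable (PiM (sets \<mu>) (\<lambda>_. borel)). (\<forall>x. norm (h x) \<le> (1::real)) \<longrightarrow>
      (LINT \<omega>|M. Z \<omega> * h (poisson_map \<omega>)) = (LINT \<omega>|M. Z \<omega>) * (LINT \<omega>|M. h (poisson_map \<omega>)))"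

text \<open>The level sets of \<open>F\<close> inside \<open>B\<close> are disjoint, so their counts
  are independent and the Poisson characteristic functions multiply.\<close>

lemma poisson_simple_cf:
  assumes Z: "independent_of_poisson Z" and B: "B \<in> sets \<mu>" and fin: "emeasure \<mu> B < \<infinity>"
    and F: "simple_function \<mu> F"
  shows "(LINT \<omega>|M. Z \<omega> * cis (\<Sum>y\<in>F ` space \<mu>. measure (\<Phi> \<omega>) (B \<inter> (F -` {y} \<inter> space \<mu>)) *\<^sub>R y))
    = (LINT \<omega>|M. Z \<omega>) * exp (LINT z:B|\<mu>. cis (F z) - 1)"
proof -
  define D where "D y = B \<inter> (F -` {y} \<inter> space \<mu>)" for y
  have D: "D y \<in> sets \<mu>" for y
    using simple_functionD(2)[OF F, of "{y}"] B unfolding D_def by auto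
  have Dfin: "emeasure \<mu> (D y) < \<infinity>" for y
    by (rule le_less_trans[OF emeasure_mono fin]) (use B in \<open>auto simp: D_def\<close>)
  let ?V = "F ` space \<mu>"
  have fs: "finite ?V" using F by (simp add: simple_functionD)
  let ?h = "\<lambda>x. cis (\<Sum>y\<in>?V. enn2real (x (D y)) * y)"
  have h: "?h \<in> borel_measurable (PiM (sets \<mu>) (\<lambda>_. borel))"
    using D by (simp add: cis_conv_exp)
  have eq: "cis (\<Sum>y\<in>?V. measure (\<Phi> \<omega>) (D y) *\<^sub>R y) = ?h (poisson_map \<omega>)" for \<omega>
    using D by (simp add: measure_def)
  have "(LINT \<omega>|M. Z \<omega> * cis (\<Sum>y\<in>?V. measure (\<Phi> \<omega>) (D y) *\<^sub>R y)) =
    (LINT \<omega>|M. Z \<omega>) * (LINT \<omega>|M. ?h (poisson_map \<omega>))"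
    unfolding eq using Z h unfolding independent_of_poisson_def by auto
  also have "(LINT \<omega>|M. ?h (poisson_map \<omega>)) = (LINT \<omega>|M. (\<Prod>y\<in>?V. cis (y * measure (\<Phi> \<omega>) (D y))))"
    unfolding eq[symmetric] by (simp add: cis_conv_exp exp_sum[symmetric] fs sum_distrib_left mult.commute)
  also have "\<dots> = (\<Prod>y\<in>?V. LINT \<omega>|M. cis (y * measure (\<Phi> \<omega>) (D y)))"
  proof -
    \<comment> \<open>Independence is stated for sets numbered by naturals, whereas the level sets
      are labelled by the values of \<open>F\<close>; hence the enumeration.\<close>
    obtain e where e: "bij_betw e {..<card ?V} ?V" using ex_bij_betw_nat_finite[OF fs] atLeast0LessThan by metis
    have ind: "indep_vars (\<lambda>_. borel) (\<lambda>i \<omega>. emeasure (\<Phi> \<omega>) (D (e i))) {..<card ?V}"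
      using e D by (intro poisson_indep) (auto simp: disjoint_family_on_def D_def bij_betw_def inj_on_def)
    have ind2: "indep_vars (\<lambda>_. borel) (\<lambda>i \<omega>. cis (e i * measure (\<Phi> \<omega>) (D (e i)))) {..<card ?V}"
      using indep_vars_compose2[OF ind, of "\<lambda>i x. cis (e i * enn2real x)" "\<lambda>_. borel"]
      by (simp add: measure_def cis_conv_exp)
    have [measurable]: "(\<lambda>\<omega>. cis (y * measure (\<Phi> \<omega>) (D y))) \<in> borel_measurable M" for y
      using poisson_measure_measurable[OF D] by (simp add: cis_conv_exp)
    have "(LINT \<omega>|M. (\<Prod>i\<in>{..<card ?V}. cis (e i * measure (\<Phi> \<omega>) (D (e i))))) = (\<Prod>i\<in>{..<card ?V}. LINT \<omega>|M. cis (e i * measure (\<Phi> \<omega>) (D (e i))))"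
      by (rule indep_vars_lebesgue_integral[OF _ ind2]) (auto intro!: integrable_const_bound[of _ 1])
    then show ?thesis by (simp add: prod.reindex_bij_betw[OF e, of "\<lambda>y. cis (y * measure (\<Phi> _) (D y))"]
      prod.reindex_bij_betw[OF e, of "\<lambda>y. LINT \<omega>|M. cis (y * measure (\<Phi> \<omega>) (D y))"])
  qed
  also have "\<dots> = (\<Prod>y\<in>?V. exp (of_real (measure \<mu> (D y)) * (cis y - 1)))"
    by (simp add: poisson_count_cf[OF D Dfin])
  also have "\<dots> = exp (\<Sum>y\<in>?V. of_real (measure \<mu> (D y)) * (cis y - 1))"
    by (simp add: exp_sum fs)
  also have "(\<Sum>y\<in>?V. of_real (measure \<mu> (D y)) * (cis y - 1)) = (LINT z:B|\<mu>. cis (F z) - 1)"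
  proof -
    have "(LINT z:B|\<mu>. cis (F z) - 1) = (LINT z|\<mu>. (\<Sum>y\<in>?V. indicator (D y) z *\<^sub>R (cis y - 1)))"
      unfolding set_lebesgue_integral_def
    proof (rule Bochner_Integration.integral_cong[OF refl])
      fix z assume z: "z \<in> space \<mu>"
      have "(\<Sum>y\<in>?V. indicator (D y) z *\<^sub>R (cis y - 1)) = (\<Sum>y\<in>?V. if y = F z then indicator B z *\<^sub>R (cis (F z) - 1) else 0)"
        using z by (intro sum.cong) (auto simp: indicator_def D_def)
      then show "indicator B z *\<^sub>R (cis (F z) - 1) = (\<Sum>y\<in>?V. indicator (D y) z *\<^sub>R (cis y - 1))"
        using z fs by simp
    qed
    also have "\<dots> = (\<Sum>y\<in>?V. measure \<mu> (D y) *\<^sub>R (cis y - 1))"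
      using D Dfin by (subst Bochner_Integration.integral_sum) (auto simp: less_top[symmetric])
    finally show ?thesis by (simp add: scaleR_conv_of_real)
  qed
  finally show ?thesis unfolding D_def .
qed

text \<open>The exponential formula for Poisson integrals, with an independent weight. Simple
  functions are passed to the limit by dominated convergence on both sides, with majorant
  \<open>norm (Z \<omega>)\<close> on the left and the constant 2 on the set of finite intensity on
  the right.\<close>

lemma poisson_cf:
  assumes Z: "independent_of_poisson Z" and B: "B \<in> sets \<mu>" and fin: "emeasure \<mu> B < \<infinity>"
    and \<psi>: "\<psi> \<in> borel_measurable \<mu>"
  shows "(LINT \<omega>|M. Z \<omega> * cis (if emeasure (\<Phi> \<omega>) B < \<infinity> then LINT z:B|\<Phi> \<omega>. \<psi> z else 0))
    = (LINT \<omega>|M. Z \<omega>) * exp (LINT z:B|\<mu>. cis (\<psi> z) - 1)"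
proof -
  obtain F where F: "\<And>i. simple_function \<mu> (F i)" "\<And>x. x \<in> space \<mu> \<Longrightarrow> (\<lambda>i. F i x) \<longlonglongrightarrow> \<psi> x"
    "\<And>i x. x \<in> space \<mu> \<Longrightarrow> norm (F i x) \<le> 2 * norm (\<psi> x)"
    using simple_function_approximation[OF \<psi>] by blast
  have Fm[measurable]: "F i \<in> borel_measurable \<mu>" for i using F by (simp add: borel_measurable_simple_function)
  note [measurable] = B \<psi>
  have ms: "B \<inter> (F i -` {y} \<inter> space \<mu>) \<in> sets \<mu>" for i y
    using simple_functionD(2)[OF F(1), of i "{y}"] B by auto
  note [measurable] = poisson_measure_measurable[OF ms] poisson_integral_measurable[OF B \<psi>]
  have intZ: "integrable M Z" using Z unfolding independent_of_poisson_def by auto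
  then have [measurable]: "Z \<in> borel_measurable M" by auto
  define S where "S i \<omega> = (\<Sum>y\<in>F i ` space \<mu>. measure (\<Phi> \<omega>) (B \<inter> (F i -` {y} \<inter> space \<mu>)) *\<^sub>R y)" for i \<omega>
  have "(\<lambda>i. LINT \<omega>|M. Z \<omega> * cis (S i \<omega>)) \<longlonglongrightarrow> (LINT \<omega>|M. Z \<omega> * cis (if emeasure (\<Phi> \<omega>) B < \<infinity> then LINT z:B|\<Phi> \<omega>. \<psi> z else 0))"
  proof (rule integral_dominated_convergence[where w="\<lambda>\<omega>. norm (Z \<omega>)"])
    show "(\<lambda>\<omega>. Z \<omega> * cis (if emeasure (\<Phi> \<omega>) B < \<infinity> then LINT z:B|\<Phi> \<omega>. \<psi> z else 0)) \<in> borel_measurable M"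
      unfolding cis_conv_exp by measurable
    show "(\<lambda>\<omega>. Z \<omega> * cis (S i \<omega>)) \<in> borel_measurable M" for i
      unfolding cis_conv_exp S_def by measurable
    show "AE \<omega> in M. (\<lambda>i. Z \<omega> * cis (S i \<omega>)) \<longlonglongrightarrow> Z \<omega> * cis (if emeasure (\<Phi> \<omega>) B < \<infinity> then LINT z:B|\<Phi> \<omega>. \<psi> z else 0)"
      using poisson_AE_finite[OF B fin] AE_space
    proof eventually_elim
      case (elim \<omega>)
      have "(\<lambda>i. S i \<omega>) \<longlonglongrightarrow> (LINT z:B|\<Phi> \<omega>. \<psi> z)"
        using poisson_integral_LIMSEQ[OF elim(2) B elim(1) \<psi> F] poisson_integral_simple[OF elim(2) F(1) B elim(1)]
        by (simp add: S_def)
      then show ?case unfolding cis_conv_exp using elim by (auto intro!: tendsto_intros)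
    qed
  qed (use intZ in \<open>auto simp: norm_mult\<close>)
  moreover have "(\<lambda>i. LINT \<omega>|M. Z \<omega> * cis (S i \<omega>)) \<longlonglongrightarrow> (LINT \<omega>|M. Z \<omega>) * exp (LINT z:B|\<mu>. cis (\<psi> z) - 1)"
  proof -
    have "(\<lambda>i. LINT z:B|\<mu>. cis (F i z) - 1) \<longlonglongrightarrow> (LINT z:B|\<mu>. cis (\<psi> z) - 1)"
      unfolding set_lebesgue_integral_def
    proof (rule integral_dominated_convergence[where w="\<lambda>z. indicator B z * (2::real)"])
      show "AE x in \<mu>. (\<lambda>i. indicator B x *\<^sub>R (cis (F i x) - 1)) \<longlonglongrightarrow> indicator B x *\<^sub>R (cis (\<psi> x) - 1)"
        unfolding cis_conv_exp by (auto intro!: tendsto_intros F)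
      show "AE x in \<mu>. norm (indicator B x *\<^sub>R (cis (F i x) - 1)) \<le> indicator B x * 2" for i
        using norm_triangle_ineq4[of "cis (F i _)" 1] by (auto simp: indicator_def)
      show "integrable \<mu> (\<lambda>z. indicator B z * (2::real))"
        using B fin by (intro integrable_mult_left) (auto simp: less_top[symmetric])
    qed (simp_all add: cis_conv_exp)
    then show ?thesis unfolding S_def poisson_simple_cf[OF Z B fin F(1)] by (intro tendsto_intros)
  qed
  ultimately show ?thesis by (rule LIMSEQ_unique)
qed

end

section \<open>Characteristic functions of the Wiener part\<close>

lemma measurable_cis [measurable (raw)]:
  assumes "f \<in> borel_measurable M" shows "(\<lambda>x. cis (f x)) \<in> borel_measurable M"
  unfolding cis_conv_exp using assms by measurable

definition path_pairing :: "(real \<times> (real ^ 'd)) list \<Rightarrow> (real \<Rightarrow> real ^ 'd) \<Rightarrow> real" where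
  "path_pairing u w = (\<Sum>p\<leftarrow>u. snd p \<bullet> w (fst p))"

text \<open>The total frequency with which a jump at time \<open>s\<close> enters the pairing: it is
  seen by all observation times from \<open>s\<close> on, including \<open>s\<close> itself.\<close>

definition tail_sum :: "(real \<times> (real ^ 'd)) list \<Rightarrow> real \<Rightarrow> real ^ 'd" where
  "tail_sum u s = (\<Sum>p\<leftarrow>u. if s \<le> fst p then snd p else 0)"

definition grid :: "(real \<times> (real ^ 'd)) list \<Rightarrow> real list" where
  "grid u = sorted_list_of_set (insert 0 (fst ` set u))"

text \<open>The index is capped so that the sequence is monotone on all naturals, which is the form
  in which independence of the increments is assumed.\<close>

definition grid_time :: "(real \<times> (real ^ 'd)) list \<Rightarrow> nat \<Rightarrow> real" where
  "grid_time u i = grid u ! min i (length (grid u) - 1)"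

text \<open>Depends on \<Sigma> and \<open>u\<close> alone, hence is a common factor of the
  characteristic functions of all three laws.\<close>

definition wiener_cf :: "real ^ 'd ^ 'd \<Rightarrow> (real \<times> (real ^ 'd)) list \<Rightarrow> complex" where
  "wiener_cf \<Sigma> u = (\<Prod>i<length (grid u) - 1. let v = tail_sum u (grid_time u (Suc i)) in
     exp (of_real (- ((grid_time u (Suc i) - grid_time u i) * (v \<bullet> (\<Sigma> *v v))) / 2)))"

lemma integral_cis_normal:
  assumes "\<sigma> > 0"
  shows "(LINT x|density lborel (normal_density 0 \<sigma>). cis x) = exp (of_real (- \<sigma>\<^sup>2 / 2))"
proof -
  interpret N: prob_space std_normal_distribution by (rule prob_space_normal_density) simp
  have "distributed std_normal_distribution lborel (\<lambda>x. x) (normal_density 0 1)"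
    unfolding distributed_def by (auto simp: distr_id2 intro!: distr_id2)
  from N.normal_density_affine[OF this, of \<sigma> 0] assms
  have "distributed std_normal_distribution lborel (\<lambda>x. \<sigma> * x) (normal_density 0 \<sigma>)"
    by simp
  then have *: "density lborel (normal_density 0 \<sigma>) = distr std_normal_distribution lborel (\<lambda>x. \<sigma> * x)"
    unfolding distributed_def by simp
  have "(LINT x|density lborel (normal_density 0 \<sigma>). cis x) = char std_normal_distribution \<sigma>"
    unfolding * by (subst integral_distr) (auto simp: char_def cis_conv_exp)
  also have "\<dots> = exp (of_real (- \<sigma>\<^sup>2 / 2))"
    by (subst char_std_normal_distribution) (simp flip: exp_of_real)
  finally show ?thesis .
qed

lemma centred_gaussian_cf:
  assumes Z: "centred_gaussian M \<Sigma> Z" and pos: "0 \<le> v \<bullet> (\<Sigma> *v v)"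
  shows "(LINT \<omega>|M. cis (v \<bullet> Z \<omega>)) = exp (of_real (- (v \<bullet> (\<Sigma> *v v)) / 2))"
proof -
  have [measurable]: "Z \<in> borel_measurable M" using Z unfolding centred_gaussian_def by auto
  have cm: "cis \<in> borel_measurable borel" using measurable_cis[of "\<lambda>x. x"] by simp
  have "(LINT \<omega>|M. cis (v \<bullet> Z \<omega>)) = (LINT x|distr M borel (\<lambda>\<omega>. v \<bullet> Z \<omega>). cis x)"
    by (rule integral_distr[symmetric]) (use cm in auto)
  also have "\<dots> = exp (of_real (- (v \<bullet> (\<Sigma> *v v)) / 2))"
  proof (cases "v \<bullet> (\<Sigma> *v v) = 0")
    case True
    then have "distr M borel (\<lambda>\<omega>. v \<bullet> Z \<omega>) = return borel 0" using Z unfolding centred_gaussian_def by simp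
    then show ?thesis using True cm by (simp add: integral_return)
  next
    case False
    then have "distr M borel (\<lambda>\<omega>. v \<bullet> Z \<omega>) = density lborel (normal_density 0 (sqrt (v \<bullet> (\<Sigma> *v v))))"
      using Z unfolding centred_gaussian_def by simp
    then show ?thesis using integral_cis_normal[of "sqrt (v \<bullet> (\<Sigma> *v v))"] False pos by simp
  qed
  finally show ?thesis .
qed

context
  fixes u :: "(real \<times> (real ^ 'd)) list"
  assumes nonneg: "\<forall>p\<in>set u. 0 \<le> fst p"
begin

lemma set_grid: "set (grid u) = insert 0 (fst ` set u)"
  unfolding grid_def by (rule set_sorted_list_of_set) simp

lemma grid_nonempty: "0 < length (grid u)"
  using set_grid by force

lemma grid_sorted: "sorted (grid u)" "distinct (grid u)"
  unfolding grid_def by (rule sorted_sorted_list_of_set distinct_sorted_list_of_set)+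

lemma grid_time_mono: "mono (grid_time u)"
  unfolding grid_time_def mono_def using grid_nonempty
  by (intro allI impI sorted_nth_mono[OF grid_sorted(1)]) (auto simp: min_less_iff_disj)

lemma grid_time_nonneg: "0 \<le> grid_time u i"
proof -
  have "grid_time u i \<in> set (grid u)"
    unfolding grid_time_def using grid_nonempty by (intro nth_mem) (auto simp: min_less_iff_disj)
  then show ?thesis using nonneg by (auto simp: set_grid)
qed

lemma grid_time_less:
  assumes "i < j" "j \<le> length (grid u) - 1" shows "grid_time u i < grid_time u j"
proof -
  have "grid_time u i \<le> grid_time u j" using grid_time_mono assms by (simp add: mono_def)
  moreover have "grid_time u i \<noteq> grid_time u j"
    using assms grid_sorted(2) grid_nonempty by (auto simp: grid_time_def nth_eq_iff_index_eq)
  ultimately show ?thesis by simp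
qed

lemma grid_time_0: "grid_time u 0 = 0"
proof -
  have "0 \<in> set (grid u)" by (simp add: set_grid)
  then obtain k where k: "k < length (grid u)" "grid u ! k = 0" by (auto simp: in_set_conv_nth)
  then have "grid_time u k = 0" by (simp add: grid_time_def min_absorb1)
  then show ?thesis using grid_time_mono grid_time_nonneg[of 0] by (metis le0 monoD order_antisym)
qed

text \<open>Increments beyond \<open>t\<close> are switched off rather than dropped from the sum.
  The index range then does not depend on \<open>t\<close>, and the expansions at different
  observation times can be added termwise.\<close>

lemma telescope_grid:
  fixes f :: "real \<Rightarrow> real ^ 'd"
  assumes t: "t \<in> set (grid u)"
  shows "f t = f 0 + (\<Sum>i<length (grid u) - 1. if grid_time u (Suc i) \<le> t
    then f (grid_time u (Suc i)) - f (grid_time u i) else 0)"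
proof -
  obtain k where k: "k < length (grid u)" "grid u ! k = t" using t by (auto simp: in_set_conv_nth)
  then have tk: "t = grid_time u k" by (simp add: grid_time_def min_absorb1)
  have "(\<Sum>i<length (grid u) - 1. if grid_time u (Suc i) \<le> t
    then f (grid_time u (Suc i)) - f (grid_time u i) else 0)
    = (\<Sum>i<k. f (grid_time u (Suc i)) - f (grid_time u i))"
  proof (rule sum.mono_neutral_cong_right)
    show "\<forall>i\<in>{..<length (grid u) - 1} - {..<k}. (if grid_time u (Suc i) \<le> t
      then f (grid_time u (Suc i)) - f (grid_time u i) else 0) = 0"
    proof (rule ballI)
      fix i assume i: "i \<in> {..<length (grid u) - 1} - {..<k}"
      then have "grid_time u k < grid_time u (Suc i)" by (intro grid_time_less) auto
      then show "(if grid_time u (Suc i) \<le> t then f (grid_time u (Suc i)) - f (grid_time u i) else 0) = 0"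
        unfolding tk by simp
    qed
    show "\<And>x. x \<in> {..<k} \<Longrightarrow> (if grid_time u (Suc x) \<le> t
        then f (grid_time u (Suc x)) - f (grid_time u x) else 0) = f (grid_time u (Suc x)) - f (grid_time u x)"
      using grid_time_mono unfolding tk by (auto simp: mono_def)
  qed (use k in auto)
  also have "\<dots> = f t - f 0" using sum_lessThan_telescope[of "\<lambda>i. f (grid_time u i)" k] by (simp add: tk grid_time_0)
  finally show ?thesis by simp
qed

lemma path_pairing_increments:
  "path_pairing u f = tail_sum u 0 \<bullet> f 0 + (\<Sum>i<length (grid u) - 1.
     tail_sum u (grid_time u (Suc i)) \<bullet> (f (grid_time u (Suc i)) - f (grid_time u i)))"
proof -
  \<comment> \<open>The induction runs over lists \<open>u'\<close> whose times lie in the grid of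
    the fixed list \<open>u\<close>, since the grid itself must not shrink along the way. The claim
    is an Abel summation.\<close>
  have "fst ` set u' \<subseteq> set (grid u) \<Longrightarrow> path_pairing u' f = tail_sum u' 0 \<bullet> f 0 + (\<Sum>i<length (grid u) - 1.
     tail_sum u' (grid_time u (Suc i)) \<bullet> (f (grid_time u (Suc i)) - f (grid_time u i)))" for u'
  proof (induction u')
    case Nil
    then show ?case by (simp add: path_pairing_def tail_sum_def)
  next
    case (Cons p u')
    let ?d = "\<lambda>i. f (grid_time u (Suc i)) - f (grid_time u i)"
    have "0 \<le> fst p" using Cons.prems nonneg by (auto simp: set_grid)
    then have ts: "tail_sum (p # u') 0 = snd p + tail_sum u' 0" by (simp add: tail_sum_def)
    have "path_pairing (p # u') f = snd p \<bullet> f (fst p) + path_pairing u' f" by (simp add: path_pairing_def)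
    also have "snd p \<bullet> f (fst p) = snd p \<bullet> f 0 + (\<Sum>i<length (grid u) - 1. (if grid_time u (Suc i) \<le> fst p then snd p else 0) \<bullet> ?d i)"
      using Cons.prems by (subst telescope_grid[of "fst p" f])
        (auto simp: inner_add_right inner_sum_right intro!: sum.cong)
    also have "path_pairing u' f = tail_sum u' 0 \<bullet> f 0 + (\<Sum>i<length (grid u) - 1.
       tail_sum u' (grid_time u (Suc i)) \<bullet> ?d i)" using Cons by simp
    finally show ?case unfolding ts
      by (simp add: inner_add_left sum.distrib tail_sum_def)
  qed
  from this[of u] show ?thesis using set_grid by blast
qed

end

lemma (in wiener_process) wiener_cf:
  assumes cov: "covariance_matrix \<Sigma>" and nonneg: "\<forall>p\<in>set u. 0 \<le> fst p"
  shows "(LINT \<omega>|M. cis (path_pairing u (\<lambda>t. W t \<omega>))) = wiener_cf \<Sigma> u"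
proof -
  note G = grid_time_mono[OF nonneg] grid_time_nonneg[OF nonneg] path_pairing_increments[OF nonneg]
  let ?n = "length (grid u) - 1" and ?\<tau> = "grid_time u"
  let ?v = "\<lambda>i. tail_sum u (?\<tau> (Suc i))"
  let ?d = "\<lambda>i \<omega>. W (?\<tau> (Suc i)) \<omega> - W (?\<tau> i) \<omega>"
  note [measurable] = wiener_measurable[OF G(2)] wiener_measurable[OF order_refl]
  have pm: "(\<lambda>\<omega>. path_pairing u (\<lambda>t. W t \<omega>)) \<in> borel_measurable M"
    unfolding G(3)
    by (intro borel_measurable_add borel_measurable_inner borel_measurable_sum borel_measurable_diff
      wiener_measurable G(2) borel_measurable_const order_refl)
  have "(LINT \<omega>|M. cis (path_pairing u (\<lambda>t. W t \<omega>))) = (LINT \<omega>|M. (\<Prod>i<?n. cis (?v i \<bullet> ?d i \<omega>)))"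
  proof (rule integral_cong_AE)
    show "AE \<omega> in M. cis (path_pairing u (\<lambda>t. W t \<omega>)) = (\<Prod>i<?n. cis (?v i \<bullet> ?d i \<omega>))"
      using wiener_zero by eventually_elim (simp add: G(3) cis_conv_exp exp_sum[symmetric] sum_distrib_left)
  qed (use pm in \<open>simp_all add: cis_conv_exp\<close>)
  also have "\<dots> = (\<Prod>i<?n. LINT \<omega>|M. cis (?v i \<bullet> ?d i \<omega>))"
  proof (rule indep_vars_lebesgue_integral)
    have "indep_vars (\<lambda>_. borel) ?d {..<?n}"
      using G by (intro wiener_indep) auto
    from indep_vars_compose2[OF this, of "\<lambda>i x. cis (?v i \<bullet> x)" "\<lambda>_. borel"]
    show "indep_vars (\<lambda>_. borel) (\<lambda>i \<omega>. cis (?v i \<bullet> ?d i \<omega>)) {..<?n}"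
      by (simp add: cis_conv_exp)
    show "integrable M (\<lambda>\<omega>. cis (?v i \<bullet> ?d i \<omega>))" for i
      by (rule integrable_const_bound[of _ 1]) (simp_all add: cis_conv_exp)
  qed simp
  also have "\<dots> = wiener_cf \<Sigma> u"
    unfolding wiener_cf_def Let_def
  proof (rule prod.cong[OF refl])
    fix i
    have le: "?\<tau> i \<le> ?\<tau> (Suc i)" using G(1) by (simp add: mono_def)
    have e: "?v i \<bullet> (((?\<tau> (Suc i) - ?\<tau> i) *\<^sub>R \<Sigma>) *v ?v i) = (?\<tau> (Suc i) - ?\<tau> i) * (?v i \<bullet> (\<Sigma> *v ?v i))"
      by (simp add: scaleR_matrix_vector_assoc[symmetric])
    have "0 \<le> ?v i \<bullet> (\<Sigma> *v ?v i)" using cov unfolding covariance_matrix_def by auto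
    then have "0 \<le> ?v i \<bullet> (((?\<tau> (Suc i) - ?\<tau> i) *\<^sub>R \<Sigma>) *v ?v i)" unfolding e using le by simp
    from centred_gaussian_cf[OF wiener_increment[OF G(2) le] this]
    show "(LINT \<omega>|M. cis (?v i \<bullet> ?d i \<omega>)) = exp (of_real (- ((?\<tau> (Suc i) - ?\<tau> i) * (?v i \<bullet> (\<Sigma> *v ?v i))) / 2))"
      unfolding e by simp
  qed
  finally show ?thesis .
qed

section \<open>Characteristic functions of the jump part\<close>

lemma space_half_line [simp]: "space half_line = {0..}"
  by (simp add: half_line_def space_restrict_space)

lemma measurable_half_line: "(\<lambda>x. x) \<in> borel_measurable half_line"
  by (simp add: half_line_def measurable_restrict_space1)

lemma sigma_finite_half_line: "sigma_finite_measure half_line"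
  unfolding half_line_def by (intro sigma_finite_measure_restrict_space sigma_finite_lborel) simp

lemma Icc_half_line: "{0..T} \<in> sets half_line"
  by (auto simp: half_line_def sets_restrict_space image_iff intro!: bexI[of _ "{0..T}"])

lemma emeasure_half_line_Icc: "0 \<le> T \<Longrightarrow> emeasure half_line {0..T} = ennreal T"
  unfolding half_line_def by (subst emeasure_restrict_space) (auto simp: Int_absorb1)

lemma levy_measure_sets: "levy_measure \<nu> \<Longrightarrow> sets \<nu> = sets borel"
  by (simp add: levy_measure_def)

lemma levy_measure_zero: "levy_measure \<nu> \<Longrightarrow> emeasure \<nu> {0} = 0"
  by (simp add: levy_measure_def)

lemma levy_measure_space: "levy_measure \<nu> \<Longrightarrow> space \<nu> = UNIV"
  using sets_eq_imp_space_eq[OF levy_measure_sets] by simp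

lemma levy_measure_borel: "levy_measure \<nu> \<Longrightarrow> borel_measurable \<nu> = borel_measurable borel"
  by (intro measurable_cong_sets) (simp_all add: levy_measure_sets)

text \<open>Markov's inequality: for \<open>\<epsilon> \<le> 1\<close> the weight
  \<open>min ((norm x)\<^sup>2) 1\<close> is at least the square of \<epsilon> on the tail
  set.\<close>

lemma levy_measure_tail_finite:
  assumes \<nu>: "levy_measure \<nu>" and \<epsilon>: "0 < \<epsilon>" "\<epsilon> \<le> 1"
  shows "emeasure \<nu> {x. \<epsilon> < norm x} < \<infinity>"
proof -
  note \<nu>_simps [simp] = levy_measure_sets[OF \<nu>] levy_measure_space[OF \<nu>] levy_measure_borel[OF \<nu>]
  have "ennreal (\<epsilon>\<^sup>2) * emeasure \<nu> {x. \<epsilon> < norm x} = (\<integral>\<^sup>+x. ennreal (\<epsilon>\<^sup>2) * indicator {x. \<epsilon> < norm x} x \<partial>\<nu>)"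
    using \<nu> by (subst nn_integral_cmult_indicator) simp_all
  also have "\<dots> \<le> (\<integral>\<^sup>+ x. ennreal (min ((norm x)\<^sup>2) 1) \<partial>\<nu>)"
  proof (intro nn_integral_mono)
    fix x :: "real ^ 'a"
    have "\<epsilon>\<^sup>2 \<le> (norm x)\<^sup>2" if "\<epsilon> < norm x" using that \<epsilon> by (intro power_mono) auto
    moreover have "\<epsilon>\<^sup>2 \<le> 1" using \<epsilon> by (simp add: power_le_one)
    ultimately show "ennreal (\<epsilon>\<^sup>2) * indicator {x. \<epsilon> < norm x} x \<le> ennreal (min ((norm x)\<^sup>2) 1)"
      by (auto simp: indicator_def intro!: ennreal_leI)
  qed
  also have "\<dots> < \<infinity>" using \<nu> by (simp add: levy_measure_def)
  finally show ?thesis using \<epsilon> by (auto simp: ennreal_mult_less_top less_top[symmetric])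
qed

lemma levy_measure_sigma_finite:
  fixes \<nu> :: "(real ^ 'd) measure"
  assumes \<nu>: "levy_measure \<nu>"
  shows "sigma_finite_measure \<nu>"
proof
  note \<nu>_simps [simp] = levy_measure_sets[OF \<nu>] levy_measure_space[OF \<nu>] levy_measure_borel[OF \<nu>]
  let ?A = "insert {0} (range (\<lambda>n. {x :: real ^ 'd. 1 / real (Suc n) < norm x}))"
  have "x \<in> \<Union>?A" for x :: "real ^ 'd"
  proof (cases "x = 0")
    case False
    then obtain n where "inverse (real (Suc n)) < norm x"
      using reals_Archimedean[of "norm x"] by auto
    then have "x \<in> {x. 1 / real (Suc n) < norm x}"
      by (simp add: inverse_eq_divide del: of_nat_Suc)
    then show ?thesis by (rule UnionI[OF insertI2[OF rangeI]])
  qed simp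
  note * = this
  have "\<Union>?A = UNIV" by (intro equalityI subsetI UNIV_I *)
  moreover have "\<forall>a\<in>?A. emeasure \<nu> a \<noteq> \<infinity>"
    using levy_measure_tail_finite[OF \<nu>, of "1 / real (Suc _)"] levy_measure_zero[OF \<nu>] less_irrefl
    by (auto simp: less_top)
  ultimately show "\<exists>A. countable A \<and> A \<subseteq> sets \<nu> \<and> \<Union>A = space \<nu> \<and> (\<forall>a\<in>A. emeasure \<nu> a \<noteq> \<infinity>)"
    by (intro exI[of _ ?A] conjI) auto
qed

lemma measurable_fst_jump [measurable]: "fst \<in> borel_measurable (half_line \<Otimes>\<^sub>M N)"
  by (rule measurable_compose[OF measurable_fst measurable_half_line])

lemma measurable_snd_jump: "sets N = sets borel \<Longrightarrow> snd \<in> borel_measurable (half_line \<Otimes>\<^sub>M N)"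
  using measurable_compose[OF measurable_snd, of "\<lambda>x. x"] measurable_cong_sets[of N borel borel borel] by simp

abbreviation jump_intensity :: "(real ^ 'd) measure \<Rightarrow> (real \<times> (real ^ 'd)) measure" where
  "jump_intensity \<nu> \<equiv> half_line \<Otimes>\<^sub>M \<nu>"

lemma sigma_finite_jump_intensity: "levy_measure \<nu> \<Longrightarrow> sigma_finite_measure (jump_intensity \<nu>)"
  by (intro sigma_finite_pair_measure sigma_finite_half_line levy_measure_sigma_finite)

definition phase :: "(real \<times> (real ^ 'd)) list \<Rightarrow> real \<times> (real ^ 'd) \<Rightarrow> real" where
  "phase u z = tail_sum u (fst z) \<bullet> snd z"

text \<open>The Levy-Khintchine integrand at the phase. The truncation at norm 1 matches the
  compensated range of jump sizes, and the time integration is part of the jump intensity.\<close>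

definition levy_integrand :: "(real \<times> (real ^ 'd)) list \<Rightarrow> real \<times> (real ^ 'd) \<Rightarrow> complex" where
  "levy_integrand u z = cis (phase u z) - 1 - (if norm (snd z) \<le> 1 then \<i> * phase u z else 0)"

definition levy_cf :: "real ^ 'd \<Rightarrow> (real ^ 'd) measure \<Rightarrow> (real \<times> (real ^ 'd)) list \<Rightarrow> complex" where
  "levy_cf b \<nu> u = exp (\<i> * (b \<bullet> (\<Sum>p\<leftarrow>u. fst p *\<^sub>R snd p)) + (LINT z|jump_intensity \<nu>. levy_integrand u z))"

text \<open>An integrable majorant, up to constants, both of the Levy-Khintchine integrand and of
  the squared jump symbol when all observation times are at most \<open>T\<close>.\<close>

definition jump_weight :: "real \<Rightarrow> real \<times> (real ^ 'd) \<Rightarrow> real" where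
  "jump_weight T z = (if fst z \<le> T then min ((norm (snd z))\<^sup>2) 1 else 0)"

lemma tail_sum_simps [simp]: "tail_sum [] s = 0"
  "tail_sum (p # u) s = (if s \<le> fst p then snd p else 0) + tail_sum u s"
  by (simp_all add: tail_sum_def)

lemma phase_simps [simp]: "phase [] z = 0"
  "phase (p # u) z = (if fst z \<le> fst p then snd p \<bullet> snd z else 0) + phase u z"
  by (simp_all add: phase_def inner_add_left)

lemma path_pairing_simps [simp]: "path_pairing [] w = 0"
  "path_pairing (p # u) w = snd p \<bullet> w (fst p) + path_pairing u w"
  by (simp_all add: path_pairing_def)

lemma measurable_phase:
  assumes "sets N = sets borel"
  shows "phase u \<in> borel_measurable (half_line \<Otimes>\<^sub>M N)"
proof (induction u)
  case Nil
  then show ?case by (simp add: phase_simps(1)[abs_def])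
next
  case (Cons p u)
  note [measurable] = Cons measurable_snd_jump[OF assms]
  have "(\<lambda>z. (if fst z \<le> fst p then snd p \<bullet> snd z else 0) + phase u z) \<in> borel_measurable (half_line \<Otimes>\<^sub>M N)"
    by measurable
  then show ?case by (simp add: phase_simps(2)[abs_def])
qed

lemma norm_tail_sum: "norm (tail_sum u s) \<le> (\<Sum>p\<leftarrow>u. norm (snd p))"
  by (induction u) (auto intro!: order_trans[OF norm_triangle_ineq] add_mono simp: add_increasing)

lemma tail_sum_eq_0: "(\<forall>p\<in>set u. fst p \<le> T) \<Longrightarrow> T < s \<Longrightarrow> tail_sum u s = 0"
  by (induction u) auto

lemma abs_phase_le: "\<bar>phase u z\<bar> \<le> (\<Sum>p\<leftarrow>u. norm (snd p)) * norm (snd z)"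
  unfolding phase_def
  by (rule order_trans[OF Cauchy_Schwarz_ineq2]) (intro mult_right_mono norm_tail_sum norm_ge_zero)

lemma norm_cis_minus_1: "norm (cis y - 1) \<le> \<bar>y\<bar>"
  using iexp_approx1[of y 0] by (simp add: cis_conv_exp)

lemma norm_cis_minus_1': "norm (cis y - 1) \<le> 2"
  using norm_triangle_ineq4[of "cis y" 1] by simp

text \<open>For small jumps the second order Taylor remainder is quadratic in the phase; for large
  jumps 2 is a bound. After \<open>T\<close> there is no observation left and the phase is
  0.\<close>

lemma norm_levy_integrand_le:
  assumes "\<forall>p\<in>set u. fst p \<le> T"
  shows "norm (levy_integrand u z) \<le> ((\<Sum>p\<leftarrow>u. norm (snd p))\<^sup>2 + 2) * jump_weight T z"
proof (cases "fst z \<le> T")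
  case False
  then show ?thesis using tail_sum_eq_0[OF assms, of "fst z"] by (simp add: levy_integrand_def phase_def jump_weight_def)
next
  case True
  let ?K = "\<Sum>p\<leftarrow>u. norm (snd p)"
  show ?thesis
  proof (cases "norm (snd z) \<le> 1")
    case le: True
    have "norm (levy_integrand u z) \<le> \<bar>phase u z\<bar>\<^sup>2 / 2"
      using iexp_approx1[of "phase u z" 1] le by (simp add: cis_conv_exp levy_integrand_def power2_eq_square algebra_simps)
    also have "\<dots> \<le> \<bar>phase u z\<bar>\<^sup>2" by simp
    also have "\<dots> \<le> (?K * norm (snd z))\<^sup>2"
      by (rule power_mono[OF abs_phase_le abs_ge_zero])
    also have "\<dots> \<le> (?K\<^sup>2 + 2) * (norm (snd z))\<^sup>2" by (simp add: power_mult_distrib mult_right_mono)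
    finally show ?thesis using True le by (simp add: jump_weight_def power_le_one min_absorb1)
  next
    case False
    have "norm (levy_integrand u z) \<le> 2"
      using norm_cis_minus_1'[of "phase u z"] False by (simp add: levy_integrand_def)
    also have "\<dots> \<le> ?K\<^sup>2 + 2" by simp
    finally show ?thesis using True False by (simp add: jump_weight_def min_absorb2 one_le_power)
  qed
qed

text \<open>The symbol is only of first order at small jumps, so its square is what the Levy weight
  controls. For this reason the jump symbols are treated as elements of L2 of the jump intensity
  throughout.\<close>

lemma norm_jump_symbol_le:
  assumes "\<forall>p\<in>set u. fst p \<le> T"
  shows "(norm (cis (phase u z) - 1))\<^sup>2 \<le> ((\<Sum>p\<leftarrow>u. norm (snd p))\<^sup>2 + 4) * jump_weight T z"
proof (cases "fst z \<le> T")
  case False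
  then show ?thesis using tail_sum_eq_0[OF assms, of "fst z"] by (simp add: phase_def jump_weight_def)
next
  case True
  let ?K = "\<Sum>p\<leftarrow>u. norm (snd p)"
  show ?thesis
  proof (cases "norm (snd z) \<le> 1")
    case le: True
    have "norm (cis (phase u z) - 1) \<le> ?K * norm (snd z)"
      using norm_cis_minus_1[of "phase u z"] abs_phase_le[of u z] by simp
    then have "(norm (cis (phase u z) - 1))\<^sup>2 \<le> (?K * norm (snd z))\<^sup>2"
      by (intro power_mono) auto
    also have "\<dots> \<le> (?K\<^sup>2 + 4) * (norm (snd z))\<^sup>2" by (simp add: power_mult_distrib mult_right_mono)
    finally show ?thesis using True le by (simp add: jump_weight_def power_le_one min_absorb1)
  next
    case False
    have "(norm (cis (phase u z) - 1))\<^sup>2 \<le> 2\<^sup>2"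
      by (intro power_mono norm_cis_minus_1') simp
    also have "\<dots> \<le> ?K\<^sup>2 + 4" by simp
    finally show ?thesis using True False by (simp add: jump_weight_def min_absorb2 one_le_power)
  qed
qed

lemma jump_weight_bounds: "0 \<le> jump_weight T z" "jump_weight T z \<le> 1"
  by (auto simp: jump_weight_def)

lemma measurable_jump_weight:
  assumes "sets N = sets borel"
  shows "jump_weight T \<in> borel_measurable (half_line \<Otimes>\<^sub>M N)"
proof -
  note [measurable] = measurable_snd_jump[OF assms]
  show ?thesis unfolding jump_weight_def[abs_def] by measurable
qed

lemma nn_integral_time_product:
  assumes "sigma_finite_measure N" and f: "f \<in> borel_measurable N" and "0 \<le> T"
  shows "(\<integral>\<^sup>+z. indicator {0..T} (fst z) * f (snd z) \<partial>(half_line \<Otimes>\<^sub>M N)) = ennreal T * (\<integral>\<^sup>+x. f x \<partial>N)"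
proof -
  interpret N: sigma_finite_measure N by fact
  note [measurable] = f Icc_half_line[of T]
  have "(\<integral>\<^sup>+z. indicator {0..T} (fst z) * f (snd z) \<partial>(half_line \<Otimes>\<^sub>M N)) =
    (\<integral>\<^sup>+s. \<integral>\<^sup>+x. indicator {0..T} s * f x \<partial>N \<partial>half_line)"
    by (subst N.nn_integral_fst[symmetric]) auto
  also have "\<dots> = (\<integral>\<^sup>+s. indicator {0..T} s * (\<integral>\<^sup>+x. f x \<partial>N) \<partial>half_line)"
    by (intro nn_integral_cong) (simp add: nn_integral_cmult)
  also have "\<dots> = ennreal T * (\<integral>\<^sup>+x. f x \<partial>N)"
    by (subst nn_integral_multc) (simp_all add: Icc_half_line emeasure_half_line_Icc assms)
  finally show ?thesis .
qed

lemma integrable_jump_weight: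
  assumes \<nu>: "levy_measure \<nu>" and T: "0 \<le> T"
  shows "integrable (jump_intensity \<nu>) (jump_weight T)"
proof -
  note \<nu>_simps [simp] = levy_measure_sets[OF \<nu>] levy_measure_space[OF \<nu>] levy_measure_borel[OF \<nu>]
  show ?thesis
proof (rule integrableI_nonneg)
  have "(\<integral>\<^sup>+ z. ennreal (jump_weight T z) \<partial>jump_intensity \<nu>)
    = (\<integral>\<^sup>+ z. indicator {0..T} (fst z) * ennreal (min ((norm (snd z))\<^sup>2) 1) \<partial>jump_intensity \<nu>)"
    by (intro nn_integral_cong) (auto simp: jump_weight_def space_pair_measure)
  also have "\<dots> = ennreal T * (\<integral>\<^sup>+ x. ennreal (min ((norm x)\<^sup>2) 1) \<partial>\<nu>)"
    using \<nu> T by (intro nn_integral_time_product levy_measure_sigma_finite) simp_all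
  also have "\<dots> < \<infinity>"
  proof -
    have "(\<integral>\<^sup>+ x. ennreal (min ((norm x)\<^sup>2) 1) \<partial>\<nu>) < \<top>" using \<nu> unfolding levy_measure_def by simp
    then show ?thesis by (simp add: ennreal_mult_less_top)
  qed
  finally show "(\<integral>\<^sup>+ z. ennreal (jump_weight T z) \<partial>jump_intensity \<nu>) < \<infinity>" .
qed (use \<nu> in \<open>auto simp: measurable_jump_weight jump_weight_bounds\<close>)
qed

lemma measurable_levy_integrand:
  assumes "sets N = sets borel"
  shows "levy_integrand u \<in> borel_measurable (half_line \<Otimes>\<^sub>M N)"
proof -
  note [measurable] = measurable_snd_jump[OF assms] measurable_phase[OF assms]
  show ?thesis unfolding levy_integrand_def[abs_def] by measurable
qed

lemma integrable_levy_integrand: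
  assumes \<nu>: "levy_measure \<nu>" and u: "\<forall>p\<in>set u. 0 \<le> fst p"
  shows "integrable (jump_intensity \<nu>) (levy_integrand u)"
proof -
  note \<nu>_simps [simp] = levy_measure_sets[OF \<nu>] levy_measure_space[OF \<nu>] levy_measure_borel[OF \<nu>]
  obtain T where T: "0 \<le> T" "\<forall>p\<in>set u. fst p \<le> T"
    using that[of "Max (insert 0 (fst ` set u))"] by simp
  show ?thesis
  proof (rule Bochner_Integration.integrable_bound)
    show "integrable (jump_intensity \<nu>) (\<lambda>z. ((\<Sum>p\<leftarrow>u. norm (snd p))\<^sup>2 + 2) * jump_weight T z)"
      by (intro integrable_mult_right integrable_jump_weight \<nu> T)
    show "AE z in jump_intensity \<nu>. norm (levy_integrand u z) \<le> norm (((\<Sum>p\<leftarrow>u. norm (snd p))\<^sup>2 + 2) * jump_weight T z)"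
      by (intro AE_I2, rule order_trans[OF norm_levy_integrand_le[OF T(2)]]) simp
  qed (use \<nu> in \<open>simp add: measurable_levy_integrand\<close>)
qed

text \<open>Convergence in probability implies convergence of expectations of bounded continuous
  functions; this is how the limit in probability that defines \<open>J\<close> reaches
  characteristic functions.\<close>

lemma (in prob_space) expectation_min_tendsto_0:
  fixes D :: "nat \<Rightarrow> 'a \<Rightarrow> real"
  assumes D: "\<And>k. D k \<in> borel_measurable M" and c: "0 \<le> c" and nn: "\<And>k \<omega>. 0 \<le> D k \<omega>"
    and lim: "\<And>\<delta>. 0 < \<delta> \<Longrightarrow> (\<lambda>k. prob {\<omega> \<in> space M. D k \<omega> > \<delta>}) \<longlonglongrightarrow> 0"
  shows "(\<lambda>k. expectation (\<lambda>\<omega>. min 2 (c * D k \<omega>))) \<longlonglongrightarrow> 0"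
proof (rule LIMSEQ_I)
  fix r :: real assume r: "0 < r"
  note [measurable] = D
  \<comment> \<open>Off the exceptional event the integrand is at most
    \<open>c * \<delta> < r / 2\<close>; on it the bound 2 meets a probability below
    \<open>r / 4\<close>. The summand 1 covers \<open>c = 0\<close>.\<close>
  define \<delta> where "\<delta> = r / (2 * (c + 1))"
  have \<delta>: "0 < \<delta>" using r c by (simp add: \<delta>_def)
  have "c * \<delta> < (c + 1) * \<delta>" using \<delta> by simp
  also have "\<dots> = r / 2" using c unfolding \<delta>_def by (simp add: field_simps)
  finally have c\<delta>: "c * \<delta> < r / 2" .
  have "\<forall>\<^sub>F k in sequentially. prob {\<omega> \<in> space M. D k \<omega> > \<delta>} < r / 4"
    using lim[OF \<delta>] r by (intro order_tendstoD) auto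
  then obtain N where N: "\<And>k. N \<le> k \<Longrightarrow> prob {\<omega> \<in> space M. D k \<omega> > \<delta>} < r / 4"
    by (auto simp: eventually_sequentially)
  show "\<exists>no. \<forall>n\<ge>no. norm (expectation (\<lambda>\<omega>. min 2 (c * D n \<omega>)) - 0) < r"
  proof (intro exI allI impI)
    fix k assume k: "N \<le> k"
    have int: "integrable M (\<lambda>\<omega>. min 2 (c * D k \<omega>))"
      using c nn by (intro integrable_const_bound[of _ 2]) (auto simp: min_def)
    have ev: "{\<omega> \<in> space M. D k \<omega> > \<delta>} \<in> events" by measurable
    have indi: "integrable M (indicat_real {\<omega> \<in> space M. D k \<omega> > \<delta>})"
      by (rule integrable_real_indicator[OF ev]) (simp add: emeasure_eq_measure)
    have "expectation (\<lambda>\<omega>. min 2 (c * D k \<omega>)) \<le> expectation (\<lambda>\<omega>. c * \<delta> + 2 * indicator {\<omega> \<in> space M. D k \<omega> > \<delta>} \<omega>)"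
    proof (intro integral_mono int)
      fix \<omega> assume "\<omega> \<in> space M"
      show "min 2 (c * D k \<omega>) \<le> c * \<delta> + 2 * indicator {\<omega> \<in> space M. D k \<omega> > \<delta>} \<omega>"
      proof (cases "D k \<omega> > \<delta>")
        case True
        moreover have "0 \<le> c * \<delta>" using c \<delta> by simp
        ultimately show ?thesis using \<open>\<omega> \<in> space M\<close> by (simp add: indicator_def)
      next
        case False
        then have "c * D k \<omega> \<le> c * \<delta>" using c by (intro mult_left_mono) auto
        then show ?thesis by (auto simp: indicator_def)
      qed
    qed (use indi in simp)
    also have "\<dots> = c * \<delta> + 2 * prob {\<omega> \<in> space M. D k \<omega> > \<delta>}"
      using indi ev by (subst Bochner_Integration.integral_add) (simp_all add: prob_space)
    also have "\<dots> < r" using c\<delta> N[OF k] by simp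
    finally have "expectation (\<lambda>\<omega>. min 2 (c * D k \<omega>)) < r" .
    moreover have "0 \<le> expectation (\<lambda>\<omega>. min 2 (c * D k \<omega>))"
      using c nn by (intro integral_nonneg_AE) auto
    ultimately show "norm (expectation (\<lambda>\<omega>. min 2 (c * D k \<omega>)) - 0) < r" by simp
  qed
qed

section \<open>The Levy-Khintchine formula for the Levy-Ito process\<close>

context levy_ito begin

text \<open>With infinitely many jumps larger than \<epsilon> the Bochner integral does not exist
  and takes its default value 0. It therefore agrees with the version set to 0 by hand, whose
  measurability is known.\<close>

lemma integral_tail_not_finite:
  assumes \<omega>: "\<omega> \<in> space M" and S: "S \<in> sets (jump_intensity \<nu>)" and \<epsilon>: "0 < \<epsilon>"
    and sub: "\<And>z. z \<in> S \<Longrightarrow> \<epsilon> < norm (snd z)" and inf: "\<not> emeasure (\<Phi> \<omega>) S < \<infinity>"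
  shows "(LINT z:S|\<Phi> \<omega>. snd z) = 0"
proof -
  have S': "S \<in> sets (\<Phi> \<omega>)" using S poisson_sets[OF \<omega>] by simp
  have "\<not> integrable (\<Phi> \<omega>) (\<lambda>z. indicator S z *\<^sub>R snd z)"
  proof
    assume "integrable (\<Phi> \<omega>) (\<lambda>z. indicator S z *\<^sub>R snd z)"
    then have "(\<integral>\<^sup>+z. ennreal (norm (indicator S z *\<^sub>R snd z)) \<partial>\<Phi> \<omega>) < \<infinity>"
      by (simp add: integrable_iff_bounded)
    moreover have "ennreal \<epsilon> * emeasure (\<Phi> \<omega>) S \<le> (\<integral>\<^sup>+z. ennreal (norm (indicator S z *\<^sub>R snd z)) \<partial>\<Phi> \<omega>)"
      using S' sub by (subst nn_integral_cmult_indicator[symmetric])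
        (auto intro!: nn_integral_mono ennreal_leI simp: indicator_def less_imp_le)
    ultimately have "ennreal \<epsilon> * emeasure (\<Phi> \<omega>) S < \<top>" by simp
    with inf \<epsilon> show False by (auto simp: ennreal_mult_less_top)
  qed
  then show ?thesis unfolding set_lebesgue_integral_def by (rule not_integrable_integral_eq)
qed

context
  assumes \<nu>: "levy_measure \<nu>"
begin

lemmas \<nu>_simps [simp] = levy_measure_sets[OF \<nu>] levy_measure_space[OF \<nu>] levy_measure_borel[OF \<nu>]

lemma Icc_times: "A \<in> sets borel \<Longrightarrow> {0..t} \<times> A \<in> sets (jump_intensity \<nu>)"
  using \<nu> by (intro pair_measureI Icc_half_line) simp

lemma small_jumps_sets: "small_jumps \<epsilon> t \<in> sets (jump_intensity \<nu>)"
  unfolding small_jumps_def by (rule Icc_times) measurable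

lemma large_jumps_sets: "large_jumps t \<in> sets (jump_intensity \<nu>)"
  unfolding large_jumps_def by (rule Icc_times) measurable

text \<open>For \<open>\<epsilon> \<le> 1\<close> this contains
  \<open>small_jumps \<epsilon> t\<close> and \<open>large_jumps t\<close> for all
  \<open>t \<le> T\<close> at once, so a single integral over a set of finite intensity carries both
  kinds of jumps at all observation times.\<close>

definition cutoff :: "real \<Rightarrow> real \<Rightarrow> (real \<times> (real ^ 'd)) set" where
  "cutoff \<epsilon> T = {0..T} \<times> {x. \<epsilon> < norm x}"

lemma cutoff_sets: "cutoff \<epsilon> T \<in> sets (jump_intensity \<nu>)"
  unfolding cutoff_def by (rule Icc_times) measurable

lemma cutoff_finite:
  assumes "0 < \<epsilon>" "\<epsilon> \<le> 1" "0 \<le> T"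
  shows "emeasure (jump_intensity \<nu>) (cutoff \<epsilon> T) < \<infinity>"
proof -
  interpret N: sigma_finite_measure \<nu> by (rule levy_measure_sigma_finite[OF \<nu>])
  have "emeasure (jump_intensity \<nu>) (cutoff \<epsilon> T) = ennreal T * emeasure \<nu> {x. \<epsilon> < norm x}"
    unfolding cutoff_def using \<nu> assms
    by (subst N.emeasure_pair_measure_Times) (simp_all add: Icc_half_line emeasure_half_line_Icc)
  then show ?thesis using levy_measure_tail_finite[OF \<nu> assms(1,2)] by (simp add: ennreal_mult_less_top)
qed

lemma measurable_snd_intensity: "snd \<in> borel_measurable (jump_intensity \<nu>)"
  using \<nu> by (simp add: measurable_snd_jump)

lemma small_jumps_integral_measurable:
  assumes "0 < \<epsilon>" shows "(\<lambda>\<omega>. LINT z:small_jumps \<epsilon> t|\<Phi> \<omega>. snd z) \<in> borel_measurable M"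
proof -
  have "(LINT z:small_jumps \<epsilon> t|\<Phi> \<omega>. snd z) = (if emeasure (\<Phi> \<omega>) (small_jumps \<epsilon> t) < \<infinity>
     then LINT z:small_jumps \<epsilon> t|\<Phi> \<omega>. snd z else 0)" if "\<omega> \<in> space M" for \<omega>
    using integral_tail_not_finite[OF that small_jumps_sets assms] by (auto simp: small_jumps_def)
  then have "(\<lambda>\<omega>. LINT z:small_jumps \<epsilon> t|\<Phi> \<omega>. snd z) \<in> borel_measurable M \<longleftrightarrow>
    (\<lambda>\<omega>. if emeasure (\<Phi> \<omega>) (small_jumps \<epsilon> t) < \<infinity> then LINT z:small_jumps \<epsilon> t|\<Phi> \<omega>. snd z else 0) \<in> borel_measurable M"
    by (rule measurable_cong)
  then show ?thesis
    using poisson_integral_measurable[OF small_jumps_sets measurable_snd_intensity] by simp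
qed

lemma large_jumps_integral_measurable:
  "(\<lambda>\<omega>. LINT z:large_jumps t|\<Phi> \<omega>. snd z) \<in> borel_measurable M"
proof -
  have "(LINT z:large_jumps t|\<Phi> \<omega>. snd z) = (if emeasure (\<Phi> \<omega>) (large_jumps t) < \<infinity>
     then LINT z:large_jumps t|\<Phi> \<omega>. snd z else 0)" if "\<omega> \<in> space M" for \<omega>
    using integral_tail_not_finite[OF that large_jumps_sets zero_less_one] by (auto simp: large_jumps_def)
  then have "(\<lambda>\<omega>. LINT z:large_jumps t|\<Phi> \<omega>. snd z) \<in> borel_measurable M \<longleftrightarrow>
    (\<lambda>\<omega>. if emeasure (\<Phi> \<omega>) (large_jumps t) < \<infinity> then LINT z:large_jumps t|\<Phi> \<omega>. snd z else 0) \<in> borel_measurable M"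
    by (rule measurable_cong)
  then show ?thesis
    using poisson_integral_measurable[OF large_jumps_sets measurable_snd_intensity] by simp
qed

text \<open>The exponential is a measurable function of the Wiener path and \<open>h\<close> of the
  family of counts. The generated \<sigma>-fields are contained in the two independent ones, and
  independent integrable variables have the product formula.\<close>

lemma wiener_independent_of_poisson:
  assumes u: "\<forall>p\<in>set u. 0 \<le> fst p"
  shows "independent_of_poisson (\<lambda>\<omega>. cis (path_pairing u (\<lambda>t. W t \<omega>)))"
proof -
  let ?W = "\<lambda>\<omega>. \<lambda>t\<in>{0..}. W t \<omega>" and ?N = "PiM (sets (jump_intensity \<nu>)) (\<lambda>_. borel) :: ((real \<times> (real ^ 'd)) set \<Rightarrow> ennreal) measure"
  have Wm: "?W \<in> measurable M product_space" using wiener_measurable by (intro measurable_restrict) simp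
  have Pm: "poisson_map \<in> measurable M ?N" using poisson_measurable by (intro measurable_restrict) simp
  let ?z = "\<lambda>w. cis (path_pairing u w)"
  have zm: "?z \<in> borel_measurable product_space"
    using u by (induction u) (auto simp: cis_mult[symmetric] intro!: borel_measurable_times)
  have eq: "?z (?W \<omega>) = cis (path_pairing u (\<lambda>t. W t \<omega>))" for \<omega>
    using u by (induction u) (auto simp: cis_mult[symmetric])
  have zW: "(\<lambda>\<omega>. ?z (?W \<omega>)) \<in> borel_measurable M" using measurable_comp[OF Wm zm] by (simp add: comp_def)
  show ?thesis unfolding independent_of_poisson_def
  proof (intro conjI ballI impI)
    show int: "integrable M (\<lambda>\<omega>. cis (path_pairing u (\<lambda>t. W t \<omega>)))"
      using zW unfolding eq by (intro integrable_const_bound[of _ 1]) auto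
    fix h :: "_ \<Rightarrow> complex" assume h: "h \<in> borel_measurable ?N" "\<forall>x. norm (h x) \<le> 1"
    have hP: "(\<lambda>\<omega>. h (poisson_map \<omega>)) \<in> borel_measurable M" using measurable_comp[OF Pm h(1)] by (simp add: comp_def)
    have vimage: "sigma_sets (space M) {(\<lambda>\<omega>. k (Y \<omega>)) -` A \<inter> space M |A. A \<in> sets borel} \<subseteq> sets (vimage_algebra (space M) Y L)"
      if "Y \<in> measurable M L" "k \<in> borel_measurable L" for Y :: "'w \<Rightarrow> 'y" and L and k :: "'y \<Rightarrow> complex"
    proof -
      have "(\<lambda>\<omega>. k (Y \<omega>)) -` A \<inter> space M \<in> sets (vimage_algebra (space M) Y L)" if "A \<in> sets borel" for A
      proof -
        have "(\<lambda>\<omega>. k (Y \<omega>)) -` A \<inter> space M = Y -` (k -` A \<inter> space L) \<inter> space M"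
          using measurable_space[OF \<open>Y \<in> measurable M L\<close>] by auto
        then show ?thesis
          by (simp only:) (rule in_vimage_algebra[OF measurable_sets[OF \<open>k \<in> borel_measurable L\<close> that]])
      qed
      then have "{(\<lambda>\<omega>. k (Y \<omega>)) -` A \<inter> space M |A. A \<in> sets borel} \<subseteq> sets (vimage_algebra (space M) Y L)"
        by blast
      from sets.sigma_sets_subset[OF this] show ?thesis by (simp only: space_vimage_algebra)
    qed
    have "indep_var borel (\<lambda>\<omega>. ?z (?W \<omega>)) borel (\<lambda>\<omega>. h (poisson_map \<omega>))"
      unfolding indep_var_eq
    proof (intro conjI zW hP)
      show "indep_set (sigma_sets (space M) {(\<lambda>\<omega>. ?z (?W \<omega>)) -` A \<inter> space M |A. A \<in> sets borel})
        (sigma_sets (space M) {(\<lambda>\<omega>. h (poisson_map \<omega>)) -` A \<inter> space M |A. A \<in> sets borel})"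
        unfolding indep_set_def
        by (rule indep_sets_mono_sets[OF wiener_poisson_indep[unfolded indep_set_def]])
          (use vimage[OF Wm zm] vimage[OF Pm h(1)] in \<open>auto split: bool.split\<close>)
    qed
    then have "indep_var borel (\<lambda>\<omega>. cis (path_pairing u (\<lambda>t. W t \<omega>))) borel (\<lambda>\<omega>. h (poisson_map \<omega>))"
      by (simp only: eq)
    moreover have "integrable M (\<lambda>\<omega>. h (poisson_map \<omega>))"
      using measurable_comp[OF Pm h(1)] h(2) by (intro integrable_const_bound[of _ 1]) (auto simp: comp_def)
    ultimately show "(LINT \<omega>|M. cis (path_pairing u (\<lambda>t. W t \<omega>)) * h (poisson_map \<omega>)) =
      (LINT \<omega>|M. cis (path_pairing u (\<lambda>t. W t \<omega>))) * (LINT \<omega>|M. h (poisson_map \<omega>))"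
      using int by (intro indep_var_lebesgue_integral)
  qed
qed

lemma inner_set_integral:
  fixes v :: "real ^ 'd"
  assumes "set_integrable N A snd"
  shows "v \<bullet> (LINT z:A|N. snd z) = (LINT z|N. indicator A z * (v \<bullet> snd z))"
  using assms unfolding set_lebesgue_integral_def set_integrable_def
  by (subst integral_inner_right[symmetric]) auto

text \<open>A jump at time \<open>s\<close> contributes to every observation time from
  \<open>s\<close> on. Collecting these contributions jump by jump, for a fixed realization, turns
  the pairing into one integral of the phase.\<close>

lemma cutoff_integral_phase:
  assumes \<omega>: "\<omega> \<in> space M" and fin: "emeasure (\<Phi> \<omega>) (cutoff \<epsilon> T) < \<infinity>" and \<epsilon>: "0 < \<epsilon>" "\<epsilon> \<le> 1"
    and u: "\<forall>p\<in>set u. fst p \<in> {0..T}"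
  shows "(\<Sum>p\<leftarrow>u. snd p \<bullet> ((LINT z:small_jumps \<epsilon> (fst p)|\<Phi> \<omega>. snd z) + (LINT z:large_jumps (fst p)|\<Phi> \<omega>. snd z)))
    = (LINT z:cutoff \<epsilon> T|\<Phi> \<omega>. phase u z)"
  using u
proof (induction u)
  case Nil
  then show ?case by simp
next
  case (Cons p u)
  let ?t = "fst p"
  have sub: "small_jumps \<epsilon> ?t \<subseteq> cutoff \<epsilon> T" "large_jumps ?t \<subseteq> cutoff \<epsilon> T"
    using Cons.prems \<epsilon> by (auto simp: small_jumps_def large_jumps_def cutoff_def)
  have C': "cutoff \<epsilon> T \<in> sets (\<Phi> \<omega>)" using cutoff_sets poisson_sets[OF \<omega>] by simp
  have i: "set_integrable (\<Phi> \<omega>) (small_jumps \<epsilon> ?t) snd" "set_integrable (\<Phi> \<omega>) (large_jumps ?t) snd"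
    using le_less_trans[OF emeasure_mono[OF sub(1) C'] fin] le_less_trans[OF emeasure_mono[OF sub(2) C'] fin]
    by (auto intro!: poisson_integrable[OF \<omega>] small_jumps_sets large_jumps_sets measurable_snd_intensity)
  have ip: "set_integrable (\<Phi> \<omega>) (cutoff \<epsilon> T) (phase u)"
    using \<nu> by (intro poisson_integrable[OF \<omega> cutoff_sets fin] measurable_phase) simp
  have ii: "integrable (\<Phi> \<omega>) (\<lambda>z. indicator A z * (snd p \<bullet> snd z))" if "set_integrable (\<Phi> \<omega>) A snd" for A
    using integrable_inner_right[of "snd p", OF that[unfolded set_integrable_def]] by simp
  have "snd p \<bullet> ((LINT z:small_jumps \<epsilon> ?t|\<Phi> \<omega>. snd z) + (LINT z:large_jumps ?t|\<Phi> \<omega>. snd z))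
    = (LINT z|\<Phi> \<omega>. indicator (small_jumps \<epsilon> ?t) z * (snd p \<bullet> snd z) + indicator (large_jumps ?t) z * (snd p \<bullet> snd z))"
    unfolding inner_add_right inner_set_integral[OF i(1)] inner_set_integral[OF i(2)]
    by (rule Bochner_Integration.integral_add[symmetric]) (intro ii i)+
  also have "\<dots> + (LINT z:cutoff \<epsilon> T|\<Phi> \<omega>. phase u z) = (LINT z|\<Phi> \<omega>. (indicator (small_jumps \<epsilon> ?t) z * (snd p \<bullet> snd z) + indicator (large_jumps ?t) z * (snd p \<bullet> snd z))
     + indicator (cutoff \<epsilon> T) z * phase u z)"
    using ip unfolding set_lebesgue_integral_def set_integrable_def
    by (subst Bochner_Integration.integral_add) (auto intro!: ii i)
  also have "\<dots> = (LINT z:cutoff \<epsilon> T|\<Phi> \<omega>. phase (p # u) z)"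
    unfolding set_lebesgue_integral_def
  proof (rule Bochner_Integration.integral_cong[OF refl])
    fix z assume "z \<in> space (\<Phi> \<omega>)"
    \<comment> \<open>The phase tests only \<open>fst z \<le> fst p\<close>, the jump sets use the
      interval from 0; the two agree because negative times lie outside the space.\<close>
    then have "0 \<le> fst z" by (auto simp: space_poisson[OF \<omega>] space_pair_measure)
    then show "indicator (small_jumps \<epsilon> ?t) z * (snd p \<bullet> snd z) + indicator (large_jumps ?t) z * (snd p \<bullet> snd z)
     + indicator (cutoff \<epsilon> T) z * phase u z = indicator (cutoff \<epsilon> T) z *\<^sub>R phase (p # u) z"
      using \<epsilon> Cons.prems
      by (cases z) (auto simp: indicator_def small_jumps_def large_jumps_def cutoff_def algebra_simps)
  qed
  finally show ?case using Cons by simp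
qed

text \<open>The deterministic counterpart of \<open>cutoff_integral_phase\<close>: only jumps of
  norm at most 1 are compensated, whence the truncated phase.\<close>

lemma compensator_phase:
  assumes \<epsilon>: "0 < \<epsilon>" "\<epsilon> \<le> 1" and T: "0 \<le> T" and u: "\<forall>p\<in>set u. fst p \<in> {0..T}"
  shows "integrable (jump_intensity \<nu>) (\<lambda>z. indicator (cutoff \<epsilon> T) z * (if norm (snd z) \<le> 1 then phase u z else 0))"
    "(\<Sum>p\<leftarrow>u. snd p \<bullet> (LINT z:small_jumps \<epsilon> (fst p)|jump_intensity \<nu>. snd z))
    = (LINT z|jump_intensity \<nu>. indicator (cutoff \<epsilon> T) z * (if norm (snd z) \<le> 1 then phase u z else 0))"
proof -
  note [measurable] = cutoff_sets measurable_snd_intensity small_jumps_sets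
  have ph[measurable]: "phase u \<in> borel_measurable (jump_intensity \<nu>)" for u
    using \<nu> by (simp add: measurable_phase)
  have fin: "emeasure (jump_intensity \<nu>) (cutoff \<epsilon> T) < \<infinity>" by (rule cutoff_finite[OF \<epsilon> T])
  show int: "integrable (jump_intensity \<nu>) (\<lambda>z. indicator (cutoff \<epsilon> T) z * (if norm (snd z) \<le> 1 then phase u z else 0))" for u
  proof (rule integrableI_bounded_set[where A="cutoff \<epsilon> T" and B="\<Sum>p\<leftarrow>u. norm (snd p)"])
    have nn: "0 \<le> (\<Sum>p\<leftarrow>u. norm (snd p))" by (rule sum_list_nonneg) auto
    have "\<bar>phase u z\<bar> \<le> (\<Sum>p\<leftarrow>u. norm (snd p))" if "norm (snd z) \<le> 1" for z
      using order_trans[OF abs_phase_le mult_left_mono[OF that nn]] by simp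
    with nn show "AE z in jump_intensity \<nu>. z \<in> cutoff \<epsilon> T \<longrightarrow>
      norm (indicator (cutoff \<epsilon> T) z * (if norm (snd z) \<le> 1 then phase u z else 0)) \<le> (\<Sum>p\<leftarrow>u. norm (snd p))"
      by (auto simp: indicator_def)
    show "cutoff \<epsilon> T \<in> sets (jump_intensity \<nu>)" by (rule cutoff_sets)
    show "(\<lambda>z. indicator (cutoff \<epsilon> T) z * (if norm (snd z) \<le> 1 then phase u z else 0)) \<in> borel_measurable (jump_intensity \<nu>)"
      by measurable
  qed (use fin in auto)
  show "(\<Sum>p\<leftarrow>u. snd p \<bullet> (LINT z:small_jumps \<epsilon> (fst p)|jump_intensity \<nu>. snd z))
    = (LINT z|jump_intensity \<nu>. indicator (cutoff \<epsilon> T) z * (if norm (snd z) \<le> 1 then phase u z else 0))"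
    using u
  proof (induction u)
    case Nil
    have "(\<lambda>z. indicator (cutoff \<epsilon> T) z * (if norm (snd z) \<le> 1 then phase [] z else 0)) = (\<lambda>z. 0 :: real)"
      by (auto simp: fun_eq_iff)
    then show ?case by (simp only:) simp
  next
    case (Cons p u)
    let ?t = "fst p"
    have sub: "small_jumps \<epsilon> ?t \<subseteq> cutoff \<epsilon> T"
      using Cons.prems \<epsilon> by (auto simp: small_jumps_def large_jumps_def cutoff_def)
    have i: "set_integrable (jump_intensity \<nu>) (small_jumps \<epsilon> ?t) snd"
      unfolding set_integrable_def
    proof (rule integrableI_bounded_set[where A="small_jumps \<epsilon> ?t" and B=1])
      show "emeasure (jump_intensity \<nu>) (small_jumps \<epsilon> ?t) < \<infinity>"
        using le_less_trans[OF emeasure_mono[OF sub cutoff_sets] fin] .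
      show "small_jumps \<epsilon> ?t \<in> sets (jump_intensity \<nu>)" by (rule small_jumps_sets)
      show "(\<lambda>z. indicator (small_jumps \<epsilon> ?t) z *\<^sub>R snd z) \<in> borel_measurable (jump_intensity \<nu>)"
        by (intro borel_measurable_scaleR borel_measurable_indicator small_jumps_sets measurable_snd_intensity)
      show "AE z in jump_intensity \<nu>. z \<in> small_jumps \<epsilon> ?t \<longrightarrow> norm (indicator (small_jumps \<epsilon> ?t) z *\<^sub>R snd z) \<le> 1"
        by (rule AE_I2) (auto simp: small_jumps_def indicator_def)
      show "AE z in jump_intensity \<nu>. z \<notin> small_jumps \<epsilon> ?t \<longrightarrow> indicator (small_jumps \<epsilon> ?t) z *\<^sub>R snd z = 0"
        by (rule AE_I2) simp
    qed
    have "snd p \<bullet> (LINT z:small_jumps \<epsilon> ?t|jump_intensity \<nu>. snd z) + 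
      (LINT z|jump_intensity \<nu>. indicator (cutoff \<epsilon> T) z * (if norm (snd z) \<le> 1 then phase u z else 0))
      = (LINT z|jump_intensity \<nu>. indicator (small_jumps \<epsilon> ?t) z * (snd p \<bullet> snd z) +
        indicator (cutoff \<epsilon> T) z * (if norm (snd z) \<le> 1 then phase u z else 0))"
      unfolding inner_set_integral[OF i]
      using integrable_inner_right[of "snd p", OF i[unfolded set_integrable_def]]
      by (intro Bochner_Integration.integral_add[symmetric] int) simp
    also have "\<dots> = (LINT z|jump_intensity \<nu>. indicator (cutoff \<epsilon> T) z * (if norm (snd z) \<le> 1 then phase (p # u) z else 0))"
    proof (rule Bochner_Integration.integral_cong[OF refl])
      fix z assume "z \<in> space (jump_intensity \<nu>)"
      then have "0 \<le> fst z" by (auto simp: space_pair_measure)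
      then show "indicator (small_jumps \<epsilon> ?t) z * (snd p \<bullet> snd z) +
        indicator (cutoff \<epsilon> T) z * (if norm (snd z) \<le> 1 then phase u z else 0)
        = indicator (cutoff \<epsilon> T) z * (if norm (snd z) \<le> 1 then phase (p # u) z else 0)"
        using \<epsilon> Cons.prems
        by (cases z) (auto simp: indicator_def small_jumps_def cutoff_def algebra_simps)
    qed
    finally show ?case using Cons by simp
  qed
qed


lemma path_pairing_measurable:
  fixes f :: "real \<Rightarrow> 'o \<Rightarrow> real ^ 'd"
  assumes "\<And>t. 0 \<le> t \<Longrightarrow> f t \<in> borel_measurable N" "\<forall>p\<in>set u. 0 \<le> fst p"
  shows "(\<lambda>\<omega>. path_pairing u (\<lambda>t. f t \<omega>)) \<in> borel_measurable N"
  using assms by (induction u) auto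

text \<open>\<open>J\<close> is replaced by the compensated sum over jumps larger than
  \<open>\<epsilon> k\<close>. The error \<open>D k\<close> is small in probability and changes the
  characteristic function little; for fixed \<open>k\<close> the Poisson formula is exact; the
  exponents then converge by dominated convergence.\<close>

lemma levy_ito_cf:
  assumes cov: "covariance_matrix \<Sigma>" and u: "\<forall>p\<in>set u. 0 \<le> fst p"
  shows "(LINT \<omega>|M. cis (path_pairing u (\<lambda>t. t *\<^sub>R b + W t \<omega> + J t \<omega> + (LINT z:large_jumps t|\<Phi> \<omega>. snd z))))
    = wiener_cf \<Sigma> u * levy_cf b \<nu> u"
proof -
  obtain T where T: "0 \<le> T" "\<forall>p\<in>set u. fst p \<le> T"
    using that[of "Max (insert 0 (fst ` set u))"] by simp
  with u have uT: "\<forall>p\<in>set u. fst p \<in> {0..T}" by auto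
  define \<epsilon> where "\<epsilon> k = 1 / real (Suc k)" for k
  have \<epsilon>: "0 < \<epsilon> k" "\<epsilon> k \<le> 1" for k by (auto simp: \<epsilon>_def)
  have \<epsilon>n: "\<epsilon> k \<noteq> 0" for k using \<epsilon>(1)[of k] by simp
  have \<epsilon>0: "\<epsilon> \<longlonglongrightarrow> 0" unfolding \<epsilon>_def[abs_def] by (rule LIMSEQ_inverse_real_of_nat[unfolded inverse_eq_divide])
  define L where "L t \<omega> = (LINT z:large_jumps t|\<Phi> \<omega>. snd z)" for t \<omega>
  define S where "S k t \<omega> = (LINT z:small_jumps (\<epsilon> k) t|\<Phi> \<omega>. snd z)" for k t \<omega>
  define C where "C k t = (LINT z:small_jumps (\<epsilon> k) t|jump_intensity \<nu>. snd z)" for k t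
  define D where "D k t \<omega> = S k t \<omega> - C k t - J t \<omega>" for k t \<omega>
  define Y where "Y t \<omega> = t *\<^sub>R b + W t \<omega> + J t \<omega> + L t \<omega>" for t \<omega>
  have Lm: "L t \<in> borel_measurable M" for t unfolding L_def[abs_def] by (rule large_jumps_integral_measurable)
  have Sm: "S k t \<in> borel_measurable M" for k t unfolding S_def[abs_def] by (rule small_jumps_integral_measurable[OF \<epsilon>(1)])
  have Dm: "D k t \<in> borel_measurable M" if "0 \<le> t" for k t
    unfolding D_def[abs_def] by (intro borel_measurable_diff Sm borel_measurable_const compensated_measurable that)
  have Ym: "Y t \<in> borel_measurable M" if "0 \<le> t" for t
    unfolding Y_def[abs_def]
    by (intro borel_measurable_add Lm borel_measurable_const compensated_measurable wiener_measurable that)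
  have Yk: "(\<lambda>\<omega>. Y t \<omega> + D k t \<omega>) \<in> borel_measurable M" if "0 \<le> t" for t k
    by (intro borel_measurable_add Ym Dm that)
  have Dlim: "(\<lambda>k. prob {\<omega> \<in> space M. norm (D k t \<omega>) > \<delta>}) \<longlonglongrightarrow> 0" if "0 \<le> t" "0 < \<delta>" for t \<delta>
    using filterlim_compose[OF compensated_limit[OF that], of \<epsilon> sequentially] \<epsilon>0 \<epsilon> \<epsilon>n
    unfolding D_def S_def C_def by (simp add: filterlim_at)
  have R: "(\<forall>k. integrable M (\<lambda>\<omega>. \<Sum>p\<leftarrow>v. min 2 (norm (snd p) * norm (D k (fst p) \<omega>)))) \<and>
    (\<lambda>k. expectation (\<lambda>\<omega>. \<Sum>p\<leftarrow>v. min 2 (norm (snd p) * norm (D k (fst p) \<omega>)))) \<longlonglongrightarrow> 0"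
    if "\<forall>p\<in>set v. 0 \<le> fst p" for v :: "(real \<times> (real ^ 'd)) list"
    using that
  proof (induction v)
    case (Cons p v)
    have p: "0 \<le> fst p" using Cons.prems by simp
    note [measurable] = Dm[OF p]
    have i: "integrable M (\<lambda>\<omega>. min 2 (norm (snd p) * norm (D k (fst p) \<omega>)))" for k
      by (rule integrable_const_bound[of _ 2]) auto
    have l: "(\<lambda>k. expectation (\<lambda>\<omega>. min 2 (norm (snd p) * norm (D k (fst p) \<omega>)))) \<longlonglongrightarrow> 0"
      by (rule expectation_min_tendsto_0) (use Dlim[OF p] in auto)
    show ?case using Cons tendsto_add[OF l, of _ 0] i by simp
  qed simp
  have lim1: "(\<lambda>k. LINT \<omega>|M. cis (path_pairing u (\<lambda>t. Y t \<omega> + D k t \<omega>))) \<longlonglongrightarrow> (LINT \<omega>|M. cis (path_pairing u (\<lambda>t. Y t \<omega>)))"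
  proof (rule LIM_zero_cancel, rule Lim_null_comparison)
    show "(\<lambda>k. expectation (\<lambda>\<omega>. \<Sum>p\<leftarrow>u. min 2 (norm (snd p) * norm (D k (fst p) \<omega>)))) \<longlonglongrightarrow> 0" using R[OF u] by simp
    have i: "integrable M (\<lambda>\<omega>. cis (path_pairing u (\<lambda>t. Y t \<omega> + D k t \<omega>)))" "integrable M (\<lambda>\<omega>. cis (path_pairing u (\<lambda>t. Y t \<omega>)))" for k
      using path_pairing_measurable[OF Yk u] path_pairing_measurable[OF Ym u]
      by (auto intro!: integrable_const_bound[of _ 1])
    have pt: "norm (cis (path_pairing u (\<lambda>t. Y t \<omega> + D k t \<omega>)) - cis (path_pairing u (\<lambda>t. Y t \<omega>))) \<le>
      (\<Sum>p\<leftarrow>u. min 2 (norm (snd p) * norm (D k (fst p) \<omega>)))" for k \<omega>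
    proof -
      have cm: "norm (cis (a + d) - cis a) = norm (cis d - 1)" for a d
      proof -
        have "cis (a + d) - cis a = cis a * (cis d - 1)" unfolding cis_mult[symmetric] by (simp only: right_diff_distrib mult_1_right)
        then show ?thesis by (simp only: norm_mult norm_cis mult_1_left)
      qed
      have sp: "path_pairing v (\<lambda>t. Y t \<omega> + D k t \<omega>) = path_pairing v (\<lambda>t. Y t \<omega>) + path_pairing v (\<lambda>t. D k t \<omega>)" for v
        by (induction v) (auto simp: inner_add_right)
      \<comment> \<open>Since \<open>cis\<close> turns sums into products of unimodular factors, the
        distance to 1 is subadditive in the phase; each term has the trivial bound 2 and the
        Lipschitz bound.\<close>
      have "norm (cis (path_pairing v (\<lambda>t. D k t \<omega>)) - 1) \<le> (\<Sum>p\<leftarrow>v. min 2 (norm (snd p) * norm (D k (fst p) \<omega>)))" for v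
      proof (induction v)
        case (Cons p v)
        let ?a = "snd p \<bullet> D k (fst p) \<omega>" and ?b = "path_pairing v (\<lambda>t. D k t \<omega>)"
        have "cis (?a + ?b) - 1 = cis ?a * (cis ?b - 1) + (cis ?a - 1)"
          unfolding cis_mult[symmetric] by (simp only: right_diff_distrib mult_1_right) simp
        then have "norm (cis (?a + ?b) - 1) \<le> norm (cis ?a * (cis ?b - 1)) + norm (cis ?a - 1)"
          by (simp only: norm_triangle_ineq)
        then have "norm (cis (?a + ?b) - 1) \<le> norm (cis ?b - 1) + norm (cis ?a - 1)"
          by (simp only: norm_mult norm_cis mult_1_left)
        moreover have "norm (cis ?a - 1) \<le> min 2 (norm (snd p) * norm (D k (fst p) \<omega>))"
          using norm_cis_minus_1'[of ?a] order_trans[OF norm_cis_minus_1 Cauchy_Schwarz_ineq2, of "snd p" "D k (fst p) \<omega>"] by simp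
        ultimately show ?case using Cons.IH
          by (simp only: path_pairing_simps list.map sum_list.Cons)
      qed simp
      then show ?thesis unfolding sp cm .
    qed
    show "\<forall>\<^sub>F k in sequentially. norm ((LINT \<omega>|M. cis (path_pairing u (\<lambda>t. Y t \<omega> + D k t \<omega>))) - (LINT \<omega>|M. cis (path_pairing u (\<lambda>t. Y t \<omega>))))
      \<le> expectation (\<lambda>\<omega>. \<Sum>p\<leftarrow>u. min 2 (norm (snd p) * norm (D k (fst p) \<omega>)))"
    proof (intro always_eventually allI)
      fix k
      have "norm ((LINT \<omega>|M. cis (path_pairing u (\<lambda>t. Y t \<omega> + D k t \<omega>))) - (LINT \<omega>|M. cis (path_pairing u (\<lambda>t. Y t \<omega>))))
        = norm (LINT \<omega>|M. cis (path_pairing u (\<lambda>t. Y t \<omega> + D k t \<omega>)) - cis (path_pairing u (\<lambda>t. Y t \<omega>)))"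
        using i by (subst Bochner_Integration.integral_diff) auto
      also have "\<dots> \<le> (LINT \<omega>|M. norm (cis (path_pairing u (\<lambda>t. Y t \<omega> + D k t \<omega>)) - cis (path_pairing u (\<lambda>t. Y t \<omega>))))"
        by (rule integral_norm_bound)
      also have "\<dots> \<le> expectation (\<lambda>\<omega>. \<Sum>p\<leftarrow>u. min 2 (norm (snd p) * norm (D k (fst p) \<omega>)))"
        using R[OF u] i by (intro integral_mono pt) auto
      finally show "norm ((LINT \<omega>|M. cis (path_pairing u (\<lambda>t. Y t \<omega> + D k t \<omega>))) - (LINT \<omega>|M. cis (path_pairing u (\<lambda>t. Y t \<omega>))))
        \<le> expectation (\<lambda>\<omega>. \<Sum>p\<leftarrow>u. min 2 (norm (snd p) * norm (D k (fst p) \<omega>)))" .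
    qed
  qed
  define m where "m = (\<Sum>p\<leftarrow>u. fst p *\<^sub>R snd p)"
  define B where "B k = cutoff (\<epsilon> k) T" for k
  have Bs: "B k \<in> sets (jump_intensity \<nu>)" and Bf: "emeasure (jump_intensity \<nu>) (B k) < \<infinity>" for k
    unfolding B_def by (rule cutoff_sets cutoff_finite[OF \<epsilon> T(1)])+
  have ph: "phase u \<in> borel_measurable (jump_intensity \<nu>)" by (simp add: measurable_phase)
  define c where "c k = (LINT z|jump_intensity \<nu>. indicator (B k) z * (if norm (snd z) \<le> 1 then phase u z else 0))" for k
  have ck: "(\<Sum>p\<leftarrow>u. snd p \<bullet> C k (fst p)) = c k"
    and ci: "integrable (jump_intensity \<nu>) (\<lambda>z. indicator (B k) z * (if norm (snd z) \<le> 1 then phase u z else 0))" for k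
    unfolding C_def c_def B_def by (rule compensator_phase[OF \<epsilon> T(1) uT])+
  \<comment> \<open>In \<open>Y + D k\<close> the term \<open>J\<close> cancels. What remains is
    drift, Wiener part and the jumps larger than \<open>\<epsilon> k\<close> minus a deterministic
    compensator, so the jump part is a Poisson integral over a set of finite intensity.\<close>
  have E: "(LINT \<omega>|M. cis (path_pairing u (\<lambda>t. Y t \<omega> + D k t \<omega>))) =
    wiener_cf \<Sigma> u * exp (\<i> * (b \<bullet> m) + (LINT z|jump_intensity \<nu>. indicator (B k) z *\<^sub>R levy_integrand u z))" for k
  proof -
    let ?Z = "\<lambda>\<omega>. cis (path_pairing u (\<lambda>t. W t \<omega>))"
    let ?I = "\<lambda>\<omega>. if emeasure (\<Phi> \<omega>) (B k) < \<infinity> then LINT z:B k|\<Phi> \<omega>. phase u z else 0"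
    have sp: "path_pairing v (\<lambda>t. Y t \<omega> + D k t \<omega>) = b \<bullet> (\<Sum>p\<leftarrow>v. fst p *\<^sub>R snd p) - (\<Sum>p\<leftarrow>v. snd p \<bullet> C k (fst p))
       + path_pairing v (\<lambda>t. W t \<omega>) + (\<Sum>p\<leftarrow>v. snd p \<bullet> (S k (fst p) \<omega> + L (fst p) \<omega>))" for v \<omega>
      by (induction v) (auto simp: inner_add_right inner_diff_right Y_def D_def inner_commute[of b] inner_scaleR_right inner_scaleR_left inner_add_left algebra_simps)
    have "(LINT \<omega>|M. cis (path_pairing u (\<lambda>t. Y t \<omega> + D k t \<omega>))) = (LINT \<omega>|M. cis (b \<bullet> m - c k) * (?Z \<omega> * cis (?I \<omega>)))"
    proof (rule integral_cong_AE)
      show "AE \<omega> in M. cis (path_pairing u (\<lambda>t. Y t \<omega> + D k t \<omega>)) = cis (b \<bullet> m - c k) * (?Z \<omega> * cis (?I \<omega>))"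
        using poisson_AE_finite[OF Bs Bf, of k] AE_space
      proof eventually_elim
        case (elim \<omega>)
        have "(\<Sum>p\<leftarrow>u. snd p \<bullet> (S k (fst p) \<omega> + L (fst p) \<omega>)) = ?I \<omega>"
          using cutoff_integral_phase[OF elim(2) _ \<epsilon> uT, of k] elim(1) unfolding S_def L_def B_def by simp
        then show ?case unfolding sp ck m_def[symmetric] by (simp add: cis_mult add.assoc)
      qed
      show "(\<lambda>\<omega>. cis (path_pairing u (\<lambda>t. Y t \<omega> + D k t \<omega>))) \<in> borel_measurable M"
        using path_pairing_measurable[OF Yk u] by measurable
      show "(\<lambda>\<omega>. cis (b \<bullet> m - c k) * (?Z \<omega> * cis (?I \<omega>))) \<in> borel_measurable M"
        using path_pairing_measurable[OF wiener_measurable u] poisson_integral_measurable[OF Bs ph] by measurable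
    qed
    also have "\<dots> = cis (b \<bullet> m - c k) * ((LINT \<omega>|M. ?Z \<omega>) * exp (LINT z:B k|jump_intensity \<nu>. cis (phase u z) - 1))"
      using poisson_cf[OF wiener_independent_of_poisson[OF u] Bs Bf ph] by simp
    also have "(LINT \<omega>|M. ?Z \<omega>) = wiener_cf \<Sigma> u" by (rule wiener_cf[OF cov u])
    also have "cis (b \<bullet> m - c k) * (wiener_cf \<Sigma> u * exp (LINT z:B k|jump_intensity \<nu>. cis (phase u z) - 1))
      = wiener_cf \<Sigma> u * exp (\<i> * (b \<bullet> m) + ((LINT z:B k|jump_intensity \<nu>. cis (phase u z) - 1) - \<i> * c k))"
      by (simp add: cis_conv_exp exp_add[symmetric] algebra_simps mult_exp_exp)
    \<comment> \<open>The compensator is exactly the linear term of the Levy-Khintchine integrand on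
      \<open>B k\<close>. Both integrals exist separately because \<open>B k\<close> has finite
      intensity.\<close>
    also have "(LINT z:B k|jump_intensity \<nu>. cis (phase u z) - 1) - \<i> * c k =
       (LINT z|jump_intensity \<nu>. indicator (B k) z *\<^sub>R levy_integrand u z)"
    proof -
      have i1: "integrable (jump_intensity \<nu>) (\<lambda>z. indicator (B k) z *\<^sub>R (cis (phase u z) - 1))"
      proof (rule integrableI_bounded_set[where A="B k" and B=2])
        show "AE z in jump_intensity \<nu>. z \<in> B k \<longrightarrow> norm (indicator (B k) z *\<^sub>R (cis (phase u z) - 1)) \<le> 2"
          using norm_cis_minus_1' by (auto simp: indicator_def)
        show "(\<lambda>z. indicator (B k) z *\<^sub>R (cis (phase u z) - 1)) \<in> borel_measurable (jump_intensity \<nu>)"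
          using ph Bs by measurable
        show "B k \<in> sets (jump_intensity \<nu>)" by (rule Bs)
      qed (use Bf in auto)
      have i2: "integrable (jump_intensity \<nu>) (\<lambda>z. \<i> * of_real (indicator (B k) z * (if norm (snd z) \<le> 1 then phase u z else 0)))"
        by (intro integrable_mult_right integrable_of_real ci)
      have "(LINT z:B k|jump_intensity \<nu>. cis (phase u z) - 1) - \<i> * c k =
        (LINT z|jump_intensity \<nu>. indicator (B k) z *\<^sub>R (cis (phase u z) - 1) - \<i> * of_real (indicator (B k) z * (if norm (snd z) \<le> 1 then phase u z else 0)))"
        unfolding c_def set_lebesgue_integral_def Bochner_Integration.integral_diff[OF i1 i2]
        by (simp only: integral_mult_right_zero integral_complex_of_real)
      also have "\<dots> = (LINT z|jump_intensity \<nu>. indicator (B k) z *\<^sub>R levy_integrand u z)"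
        by (intro Bochner_Integration.integral_cong refl) (auto simp: levy_integrand_def indicator_def)
      finally show ?thesis .
    qed
    finally show ?thesis .
  qed
  have "(\<lambda>k. LINT z|jump_intensity \<nu>. indicator (B k) z *\<^sub>R levy_integrand u z) \<longlonglongrightarrow> (LINT z|jump_intensity \<nu>. levy_integrand u z)"
  proof (rule integral_dominated_convergence[where w="\<lambda>z. norm (levy_integrand u z)"])
    have lm: "levy_integrand u \<in> borel_measurable (jump_intensity \<nu>)" by (simp add: measurable_levy_integrand)
    then show "levy_integrand u \<in> borel_measurable (jump_intensity \<nu>)" .
    show "(\<lambda>z. indicator (B k) z *\<^sub>R levy_integrand u z) \<in> borel_measurable (jump_intensity \<nu>)" for k
      using lm Bs by measurable
    show "integrable (jump_intensity \<nu>) (\<lambda>z. norm (levy_integrand u z))"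
      by (intro integrable_norm integrable_levy_integrand \<nu> u)
    show "AE z in jump_intensity \<nu>. norm (indicator (B k) z *\<^sub>R levy_integrand u z) \<le> norm (levy_integrand u z)" for k
      by (auto simp: indicator_def)
    show "AE z in jump_intensity \<nu>. (\<lambda>k. indicator (B k) z *\<^sub>R levy_integrand u z) \<longlonglongrightarrow> levy_integrand u z"
    proof (rule AE_I2)
      fix z assume z: "z \<in> space (jump_intensity \<nu>)"
      show "(\<lambda>k. indicator (B k) z *\<^sub>R levy_integrand u z) \<longlonglongrightarrow> levy_integrand u z"
      proof (cases "fst z \<le> T \<and> snd z \<noteq> 0")
        case True
        have "\<forall>\<^sub>F k in sequentially. \<epsilon> k < norm (snd z)"
          using \<epsilon>0 True by (intro order_tendstoD) auto
        then have "\<forall>\<^sub>F k in sequentially. indicator (B k) z *\<^sub>R levy_integrand u z = levy_integrand u z"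
        proof eventually_elim
          case (elim k)
          then have "z \<in> B k" using z True by (cases z) (auto simp: B_def cutoff_def space_pair_measure)
          then show ?case by simp
        qed
        then show ?thesis by (rule tendsto_eventually)
      next
        case False
        \<comment> \<open>Jump size 0 and times after \<open>T\<close> belong to no cutoff set, but
          the integrand vanishes there.\<close>
        then have "jump_weight T z = 0" by (auto simp: jump_weight_def)
        then have "levy_integrand u z = 0" using norm_levy_integrand_le[OF T(2), of z] by simp
        then show ?thesis by simp
      qed
    qed
  qed
  then have "(\<lambda>k. LINT \<omega>|M. cis (path_pairing u (\<lambda>t. Y t \<omega> + D k t \<omega>))) \<longlonglongrightarrow>
     wiener_cf \<Sigma> u * exp (\<i> * (b \<bullet> m) + (LINT z|jump_intensity \<nu>. levy_integrand u z))"
    unfolding E by (intro tendsto_intros)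
  from LIMSEQ_unique[OF lim1 this] show ?thesis
    unfolding Y_def L_def levy_cf_def m_def .
qed

end
end

section \<open>Density of the trigonometric polynomials\<close>

definition expo :: "(real \<times> (real ^ 'd)) list \<Rightarrow> (real \<Rightarrow> real ^ 'd) \<Rightarrow> complex" where
  "expo u w = cis (path_pairing u w)"

definition times_upto :: "real \<Rightarrow> (real \<times> (real ^ 'd)) list set" where
  "times_upto T = {u. \<forall>p\<in>set u. fst p \<in> {0..T}}"

text \<open>Distinct lists may represent the same exponential. All quadratic forms are taken over
  the index set \<open>K\<close> as it stands, so linear independence never enters.\<close>

definition trig_poly :: "(real \<times> (real ^ 'd)) list set \<Rightarrow> ((real \<times> (real ^ 'd)) list \<Rightarrow> complex) \<Rightarrow>
    (real \<Rightarrow> real ^ 'd) \<Rightarrow> complex" where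
  "trig_poly K a w = (\<Sum>u\<in>K. a u * expo u w)"

definition trig :: "real \<Rightarrow> ((real \<Rightarrow> real ^ 'd) \<Rightarrow> complex) set" where
  "trig T = {trig_poly K a |K a. finite K \<and> K \<subseteq> times_upto T}"

lemma norm_expo [simp]: "norm (expo u w) = 1"
  by (simp add: expo_def)

lemma path_pairing_append: "path_pairing (u @ v) w = path_pairing u w + path_pairing v w"
  by (simp add: path_pairing_def)

lemma expo_append: "expo (u @ v) w = expo u w * expo v w"
  by (simp add: expo_def path_pairing_append cis_mult)

lemma expo_Nil [simp]: "expo [] w = 1"
  by (simp add: expo_def path_pairing_def)

text \<open>Coefficients of equal exponents are collected, so that sums and products may be indexed
  by disjoint unions and products of index sets without an injectivity condition.\<close>

lemma trig_sumI:
  assumes I: "finite I" and U: "\<And>i. i \<in> I \<Longrightarrow> U i \<in> times_upto T"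
  shows "(\<lambda>w. \<Sum>i\<in>I. c i * expo (U i) w) \<in> trig T"
proof -
  have "(\<Sum>i\<in>I. c i * expo (U i) w) = trig_poly (U ` I) (\<lambda>u. \<Sum>i\<in>{i\<in>I. U i = u}. c i) w" for w
    unfolding trig_poly_def sum_distrib_right
    by (subst sum.image_gen[OF I, of _ U]) (auto intro!: sum.cong)
  then show ?thesis unfolding trig_def using I U
    by (intro CollectI exI[of _ "U ` I"] exI[of _ "\<lambda>u. \<Sum>i\<in>{i\<in>I. U i = u}. c i"]) auto
qed

lemma trigE:
  assumes "p \<in> trig T"
  obtains K a where "finite K" "K \<subseteq> times_upto T" "p = trig_poly K a"
  using assms by (auto simp: trig_def)

lemma trig_expo: "u \<in> times_upto T \<Longrightarrow> (\<lambda>w. c * expo u w) \<in> trig T"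
  using trig_sumI[of "{u}" "\<lambda>u. u" T "\<lambda>_. c"] by simp

lemma trig_const: "(\<lambda>w. c) \<in> trig T"
  using trig_expo[of "[]" T c] by (simp add: times_upto_def)

lemma trig_add:
  assumes "p \<in> trig T" "q \<in> trig T" shows "(\<lambda>w. p w + q w) \<in> trig T"
proof -
  obtain K a where p: "finite K" "K \<subseteq> times_upto T" "p = trig_poly K a" using assms(1) by (rule trigE)
  obtain L b where q: "finite L" "L \<subseteq> times_upto T" "q = trig_poly L b" using assms(2) by (rule trigE)
  have "(\<lambda>w. \<Sum>i\<in>K <+> L. case_sum a b i * expo (case_sum id id i) w) \<in> trig T"
    using p q by (intro trig_sumI) auto
  then show ?thesis using p q by (simp add: sum.Plus trig_poly_def)
qed

lemma times_upto_append: "u @ v \<in> times_upto T \<longleftrightarrow> u \<in> times_upto T \<and> v \<in> times_upto T"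
  by (auto simp: times_upto_def)

lemma trig_mult:
  assumes "p \<in> trig T" "q \<in> trig T" shows "(\<lambda>w. p w * q w) \<in> trig T"
proof -
  obtain K a where p: "finite K" "K \<subseteq> times_upto T" "p = trig_poly K a" using assms(1) by (rule trigE)
  obtain L b where q: "finite L" "L \<subseteq> times_upto T" "q = trig_poly L b" using assms(2) by (rule trigE)
  have "(\<lambda>w. \<Sum>i\<in>K \<times> L. (a (fst i) * b (snd i)) * expo (fst i @ snd i) w) \<in> trig T"
    using p q by (intro trig_sumI) (auto simp: times_upto_append)
  moreover have "(\<Sum>i\<in>K \<times> L. (a (fst i) * b (snd i)) * expo (fst i @ snd i) w) = p w * q w" for w
    unfolding p q trig_poly_def sum_product sum.cartesian_product
    by (intro sum.cong) (auto simp: expo_append)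
  ultimately show ?thesis by simp
qed

lemma trig_cmult: "p \<in> trig T \<Longrightarrow> (\<lambda>w. c * p w) \<in> trig T"
  using trig_mult[OF trig_const] .

lemma trig_diff:
  assumes "p \<in> trig T" "q \<in> trig T" shows "(\<lambda>w. p w - q w) \<in> trig T"
  using trig_add[OF assms(1) trig_cmult[OF assms(2), of "-1"]] by simp

lemma path_pairing_product_measurable:
  "u \<in> times_upto T \<Longrightarrow> path_pairing u \<in> borel_measurable product_space"
proof (induction u)
  case (Cons p u)
  have "fst p \<in> {0..}" using Cons.prems by (auto simp: times_upto_def)
  then have [measurable]: "(\<lambda>w. w (fst p)) \<in> borel_measurable product_space" by (rule measurable_component_singleton)
  have [measurable]: "path_pairing u \<in> borel_measurable product_space" using Cons by (auto simp: times_upto_def)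
  have "(\<lambda>w. snd p \<bullet> w (fst p) + path_pairing u w) \<in> borel_measurable product_space" by measurable
  then show ?case by (simp add: path_pairing_def)
qed (simp add: path_pairing_def[abs_def])

lemma expo_measurable: "u \<in> times_upto T \<Longrightarrow> expo u \<in> borel_measurable product_space"
  unfolding expo_def[abs_def] by (intro measurable_cis path_pairing_product_measurable)

lemma trig_measurable: "p \<in> trig T \<Longrightarrow> p \<in> borel_measurable product_space"
  by (auto elim!: trigE simp: trig_poly_def[abs_def] intro!: borel_measurable_sum borel_measurable_times expo_measurable)

lemma trig_bounded: "p \<in> trig T \<Longrightarrow> \<exists>B\<ge>0. \<forall>w. norm (p w) \<le> B"
proof (erule trigE)
  fix K a assume *: "finite K" "K \<subseteq> times_upto T" "p = trig_poly K a"
  have "norm (p w) \<le> (\<Sum>u\<in>K. norm (a u))" for w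
    unfolding * trig_poly_def by (rule order_trans[OF norm_sum]) (simp add: norm_mult)
  then show "\<exists>B\<ge>0. \<forall>w. norm (p w) \<le> B" by (intro exI[of _ "\<Sum>u\<in>K. norm (a u)"]) (auto intro: sum_nonneg)
qed

section \<open>Mean square approximation under two laws at once\<close>

definition restrict_path :: "real \<Rightarrow> (real \<Rightarrow> real ^ 'd) \<Rightarrow> real \<Rightarrow> real ^ 'd" where
  "restrict_path T w = restrict w {0..T}"

abbreviation path_upto :: "real \<Rightarrow> (real \<Rightarrow> real ^ 'd) measure" where
  "path_upto T \<equiv> PiM {0..T} (\<lambda>_. borel)"

lemma restrict_path_measurable [measurable]: "restrict_path T \<in> measurable product_space (path_upto T)"
  unfolding restrict_path_def[abs_def] by (rule measurable_restrict_subset) auto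

lemma norm_square_add: "(norm (a + b :: complex))\<^sup>2 \<le> 2 * (norm a)\<^sup>2 + 2 * (norm b)\<^sup>2"
proof -
  have "(norm (a + b))\<^sup>2 \<le> (norm a + norm b)\<^sup>2" by (intro power_mono norm_triangle_ineq) simp
  also have "\<dots> \<le> 2 * (norm a)\<^sup>2 + 2 * (norm b)\<^sup>2"
    using sum_squares_bound[of "norm a" "norm b"] by (simp add: power2_sum)
  finally show ?thesis .
qed

text \<open>Two laws are indexed by \<open>bool\<close> because one trigonometric polynomial has to
  be close to a given functional both under the reference law and under a law to be compared with
  it.\<close>

locale path_laws =
  fixes Q :: "bool \<Rightarrow> (real \<Rightarrow> real ^ 'd) measure" and T :: real
  assumes prob: "prob_space (Q i)" and sets_Q: "sets (Q i) = sets product_space"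
begin

lemma measurable_Q: "f \<in> borel_measurable product_space \<Longrightarrow> f \<in> borel_measurable (Q i)"
  using measurable_cong_sets[OF sets_Q refl] by blast

lemma space_Q: "space (Q i) = space product_space"
  using sets_eq_imp_space_eq[OF sets_Q] .

definition square_int :: "((real \<Rightarrow> real ^ 'd) \<Rightarrow> complex) \<Rightarrow> bool" where
  "square_int \<psi> \<longleftrightarrow> \<psi> \<in> borel_measurable product_space \<and> (\<forall>i. integrable (Q i) (\<lambda>w. (norm (\<psi> w))\<^sup>2))"

definition approximable :: "((real \<Rightarrow> real ^ 'd) \<Rightarrow> complex) \<Rightarrow> bool" where
  "approximable \<psi> \<longleftrightarrow> square_int \<psi> \<and>
    (\<forall>\<epsilon>>0. \<exists>p\<in>trig T. \<forall>i. (LINT w|Q i. (norm (\<psi> w - p w))\<^sup>2) < \<epsilon>)"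

lemma square_int_bounded:
  assumes "\<psi> \<in> borel_measurable product_space" "\<And>w. w \<in> space product_space \<Longrightarrow> norm (\<psi> w) \<le> B"
  shows "square_int \<psi>"
  unfolding square_int_def
proof (intro conjI allI assms)
  fix i
  interpret prob_space "Q i" by (rule prob)
  have "norm ((norm (\<psi> w))\<^sup>2) \<le> B\<^sup>2" if "w \<in> space product_space" for w using power_mono[OF assms(2)[OF that], of 2] by simp
  then show "integrable (Q i) (\<lambda>w. (norm (\<psi> w))\<^sup>2)"
    using measurable_Q[OF assms(1)] by (intro integrable_const_bound[of _ "B\<^sup>2"] AE_I2) (auto simp: space_Q)
qed

lemma square_int_trig: "p \<in> trig T \<Longrightarrow> square_int p"
  using trig_bounded[of p T] trig_measurable[of p T] square_int_bounded by blast

lemma square_int_add: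
  assumes "square_int \<psi>" "square_int \<eta>" shows "square_int (\<lambda>w. \<psi> w + \<eta> w)"
  unfolding square_int_def
proof (intro conjI allI)
  have [measurable]: "\<psi> \<in> borel_measurable product_space" "\<eta> \<in> borel_measurable product_space"
    using assms by (auto simp: square_int_def)
  show *: "(\<lambda>w. \<psi> w + \<eta> w) \<in> borel_measurable product_space" by measurable
  fix i
  show "integrable (Q i) (\<lambda>w. (norm (\<psi> w + \<eta> w))\<^sup>2)"
  proof (rule Bochner_Integration.integrable_bound)
    show "integrable (Q i) (\<lambda>w. 2 * (norm (\<psi> w))\<^sup>2 + 2 * (norm (\<eta> w))\<^sup>2)"
      using assms by (auto simp: square_int_def)
    show "AE w in Q i. norm ((norm (\<psi> w + \<eta> w))\<^sup>2) \<le> norm (2 * (norm (\<psi> w))\<^sup>2 + 2 * (norm (\<eta> w))\<^sup>2)"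
      using norm_square_add by auto
  qed (use measurable_Q[OF *] in measurable)
qed

lemma square_int_cmult: "square_int \<psi> \<Longrightarrow> square_int (\<lambda>w. c * \<psi> w)"
  unfolding square_int_def by (auto simp: norm_mult power_mult_distrib)

lemma square_int_diff: "square_int \<psi> \<Longrightarrow> square_int \<eta> \<Longrightarrow> square_int (\<lambda>w. \<psi> w - \<eta> w)"
  using square_int_add[of \<psi> "\<lambda>w. (-1) * \<eta> w"] square_int_cmult[of \<eta> "-1"] by simp

lemma square_dist_triangle:
  assumes "square_int \<psi>" "square_int \<phi>" "square_int p"
  shows "(LINT w|Q i. (norm (\<psi> w - p w))\<^sup>2) \<le> 2 * (LINT w|Q i. (norm (\<psi> w - \<phi> w))\<^sup>2) + 2 * (LINT w|Q i. (norm (\<phi> w - p w))\<^sup>2)"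
proof -
  have "(LINT w|Q i. (norm (\<psi> w - p w))\<^sup>2) \<le> (LINT w|Q i. 2 * (norm (\<psi> w - \<phi> w))\<^sup>2 + 2 * (norm (\<phi> w - p w))\<^sup>2)"
  proof (rule integral_mono)
    show "(norm (\<psi> w - p w))\<^sup>2 \<le> 2 * (norm (\<psi> w - \<phi> w))\<^sup>2 + 2 * (norm (\<phi> w - p w))\<^sup>2" for w
      using norm_square_add[of "\<psi> w - \<phi> w" "\<phi> w - p w"] by simp
  qed (use square_int_diff[OF assms(1,2)] square_int_diff[OF assms(2,3)] square_int_diff[OF assms(1,3)] in \<open>auto simp: square_int_def\<close>)
  also have "\<dots> = 2 * (LINT w|Q i. (norm (\<psi> w - \<phi> w))\<^sup>2) + 2 * (LINT w|Q i. (norm (\<phi> w - p w))\<^sup>2)"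
    using square_int_diff[OF assms(1,2)] square_int_diff[OF assms(2,3)]
    by (subst Bochner_Integration.integral_add) (auto simp: square_int_def)
  finally show ?thesis .
qed

lemma approximable_limit:
  assumes \<psi>: "square_int \<psi>"
    and lim: "\<And>\<epsilon>. 0 < \<epsilon> \<Longrightarrow> \<exists>\<phi>. approximable \<phi> \<and> (\<forall>i. (LINT w|Q i. (norm (\<psi> w - \<phi> w))\<^sup>2) < \<epsilon>)"
  shows "approximable \<psi>"
  unfolding approximable_def
proof (intro conjI allI impI \<psi>)
  fix \<epsilon> :: real assume "0 < \<epsilon>"
  \<comment> \<open>The squared distance satisfies a triangle inequality with factor 2, so two
    errors below \<open>\<epsilon> / 4\<close> add up to less than \<epsilon>.\<close>
  then have e: "0 < \<epsilon> / 4" by simp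
  from lim[OF e] obtain \<phi> where \<phi>: "approximable \<phi>" "\<And>i. (LINT w|Q i. (norm (\<psi> w - \<phi> w))\<^sup>2) < \<epsilon> / 4" by blast
  from \<phi>(1) e obtain p where p: "p \<in> trig T" "\<And>i. (LINT w|Q i. (norm (\<phi> w - p w))\<^sup>2) < \<epsilon> / 4"
    unfolding approximable_def by blast
  have "(LINT w|Q i. (norm (\<psi> w - p w))\<^sup>2) < \<epsilon>" for i
    using square_dist_triangle[OF \<psi> _ square_int_trig[OF p(1)], of \<phi> i] \<phi>(1) p(2)[of i] \<phi>(2)[of i]
    by (simp add: approximable_def)
  then show "\<exists>p\<in>trig T. \<forall>i. (LINT w|Q i. (norm (\<psi> w - p w))\<^sup>2) < \<epsilon>" using p(1) by blast
qed

lemma approximable_trig: "p \<in> trig T \<Longrightarrow> approximable p"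
  unfolding approximable_def using square_int_trig[of p] by (auto intro!: bexI[of _ p])

lemma approximable_add:
  assumes "approximable \<psi>" "approximable \<eta>" shows "approximable (\<lambda>w. \<psi> w + \<eta> w)"
  unfolding approximable_def
proof (intro conjI allI impI)
  show s: "square_int (\<lambda>w. \<psi> w + \<eta> w)" using assms by (auto simp: approximable_def intro: square_int_add)
  fix \<epsilon> :: real assume "0 < \<epsilon>"
  then have e: "0 < \<epsilon> / 4" by simp
  from e assms obtain p where p: "p \<in> trig T" "\<And>i. (LINT w|Q i. (norm (\<psi> w - p w))\<^sup>2) < \<epsilon> / 4"
    unfolding approximable_def by blast
  from e assms obtain q where q: "q \<in> trig T" "\<And>i. (LINT w|Q i. (norm (\<eta> w - q w))\<^sup>2) < \<epsilon> / 4"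
    unfolding approximable_def by blast
  note sp = square_int_trig[OF p(1)] and sq = square_int_trig[OF q(1)]
  have sps: "square_int (\<lambda>w. p w + \<eta> w)" using assms sp by (auto simp: approximable_def intro: square_int_add)
  have "(LINT w|Q i. (norm ((\<psi> w + \<eta> w) - (p w + q w)))\<^sup>2) < \<epsilon>" for i
    using square_dist_triangle[OF s sps square_int_add[OF sp sq], of i] p(2)[of i] q(2)[of i] by simp
  then show "\<exists>p\<in>trig T. \<forall>i. (LINT w|Q i. (norm (\<psi> w + \<eta> w - p w))\<^sup>2) < \<epsilon>"
    using trig_add[OF p(1) q(1)] by (intro bexI[of _ "\<lambda>w. p w + q w"] allI)
qed

text \<open>The factors are replaced one at a time: first \<open>\<eta>\<close> by \<open>q\<close>,
  using the bound on \<open>\<psi>\<close>, then \<open>\<psi>\<close> by \<open>p\<close>, using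
  the sup norm \<open>D\<close> of \<open>q\<close>. Hence \<open>q\<close> is chosen before the
  accuracy of \<open>p\<close> is fixed.\<close>

lemma approximable_mult:
  assumes "approximable \<psi>" "approximable \<eta>" and B: "\<And>w. norm (\<psi> w) \<le> B"
  shows "approximable (\<lambda>w. \<psi> w * \<eta> w)"
proof (rule approximable_limit)
  have s\<psi>: "square_int \<psi>" and s\<eta>: "square_int \<eta>" using assms by (auto simp: approximable_def)
  have B0: "0 \<le> B" using order_trans[OF norm_ge_zero B[of undefined]] .
  have [measurable]: "\<psi> \<in> borel_measurable product_space" "\<eta> \<in> borel_measurable product_space"
    using s\<psi> s\<eta> by (auto simp: square_int_def)
  have bnd: "square_int (\<lambda>w. \<psi> w * \<phi> w) \<and> (\<forall>i. (LINT w|Q i. (norm (\<psi> w * \<phi> w))\<^sup>2) \<le> B\<^sup>2 * (LINT w|Q i. (norm (\<phi> w))\<^sup>2))"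
    if \<phi>: "square_int \<phi>" and bo: "\<And>w. norm (\<psi> w) \<le> B" "0 \<le> B" "\<psi> \<in> borel_measurable product_space" for \<psi> \<phi> B
  proof -
    have le: "(norm (\<psi> w * \<phi> w))\<^sup>2 \<le> B\<^sup>2 * (norm (\<phi> w))\<^sup>2" for w
      using power_mono[OF bo(1), of w 2] by (simp add: norm_mult power_mult_distrib mult_right_mono)
    have m: "(\<lambda>w. \<psi> w * \<phi> w) \<in> borel_measurable product_space"
      using \<phi> bo(3) by (auto simp: square_int_def)
    have i: "integrable (Q i) (\<lambda>w. B\<^sup>2 * (norm (\<phi> w))\<^sup>2)" for i using \<phi> by (auto simp: square_int_def)
    have s: "square_int (\<lambda>w. \<psi> w * \<phi> w)" unfolding square_int_def
    proof (intro conjI allI m)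
      fix i show "integrable (Q i) (\<lambda>w. (norm (\<psi> w * \<phi> w))\<^sup>2)"
        by (rule Bochner_Integration.integrable_bound[OF i]) (use measurable_Q[OF m] le in auto)
    qed
    have "(LINT w|Q i. (norm (\<psi> w * \<phi> w))\<^sup>2) \<le> B\<^sup>2 * (LINT w|Q i. (norm (\<phi> w))\<^sup>2)" for i
      using integral_mono[OF _ i le, of i] s by (simp add: square_int_def)
    with s show ?thesis by simp
  qed
  show spc: "square_int (\<lambda>w. \<psi> w * \<eta> w)" using bnd[OF s\<eta> B B0] by simp
  fix \<epsilon> :: real assume e: "0 < \<epsilon>"
  have pos: "0 < \<epsilon> / (4 * (C\<^sup>2 + 1))" for C :: real
    using e by (intro divide_pos_pos) (auto intro: add_nonneg_pos)
  obtain q where q: "q \<in> trig T" "\<And>i. (LINT w|Q i. (norm (\<eta> w - q w))\<^sup>2) < \<epsilon> / (4 * (B\<^sup>2 + 1))"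
    using assms(2) pos[of B] unfolding approximable_def by blast
  obtain D where D: "0 \<le> D" "\<And>w. norm (q w) \<le> D" using trig_bounded[OF q(1)] by blast
  obtain p where p: "p \<in> trig T" "\<And>i. (LINT w|Q i. (norm (\<psi> w - p w))\<^sup>2) < \<epsilon> / (4 * (D\<^sup>2 + 1))"
    using assms(1) pos[of D] unfolding approximable_def by blast
  note sp = square_int_trig[OF p(1)] and sq = square_int_trig[OF q(1)]
  have qm: "q \<in> borel_measurable product_space" by (rule trig_measurable[OF q(1)])
  have lt: "C\<^sup>2 * x < \<epsilon> / 4" if "0 \<le> x" "x < \<epsilon> / (4 * (C\<^sup>2 + 1))" for C x :: real
  proof -
    have "C\<^sup>2 * x \<le> (C\<^sup>2 + 1) * x" using that by (simp add: mult_right_mono)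
    also have "\<dots> < (C\<^sup>2 + 1) * (\<epsilon> / (4 * (C\<^sup>2 + 1)))" using that by (intro mult_strict_left_mono) (auto intro: add_nonneg_pos)
    also have "\<dots> = \<epsilon> / 4" using add_nonneg_pos[OF zero_le_power2[of C] zero_less_one] by (simp add: field_simps)
    finally show ?thesis .
  qed
  have s2: "square_int (\<lambda>w. \<psi> w * q w)" using bnd[OF sq B B0] by simp
  have "(LINT w|Q i. (norm (\<psi> w * \<eta> w - p w * q w))\<^sup>2) < \<epsilon>" for i
  proof -
    have "(LINT w|Q i. (norm (\<psi> w * \<eta> w - \<psi> w * q w))\<^sup>2) \<le> B\<^sup>2 * (LINT w|Q i. (norm (\<eta> w - q w))\<^sup>2)"
      using bnd[OF square_int_diff[OF s\<eta> sq] B B0] by (simp add: right_diff_distrib)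
    also have "\<dots> < \<epsilon> / 4" using q(2)[of i] by (intro lt) simp_all
    finally have 1: "(LINT w|Q i. (norm (\<psi> w * \<eta> w - \<psi> w * q w))\<^sup>2) < \<epsilon> / 4" .
    have "(LINT w|Q i. (norm (\<psi> w * q w - p w * q w))\<^sup>2) \<le> D\<^sup>2 * (LINT w|Q i. (norm (\<psi> w - p w))\<^sup>2)"
      using bnd[OF square_int_diff[OF s\<psi> sp] D(2) D(1) qm] by (simp add: right_diff_distrib mult.commute)
    also have "\<dots> < \<epsilon> / 4" using p(2)[of i] by (intro lt) simp_all
    finally have 2: "(LINT w|Q i. (norm (\<psi> w * q w - p w * q w))\<^sup>2) < \<epsilon> / 4" .
    from square_dist_triangle[OF spc s2 square_int_trig[OF trig_mult[OF p(1) q(1)]], of i] 1 2 show ?thesis by simp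
  qed
  then show "\<exists>\<phi>. approximable \<phi> \<and> (\<forall>i. (LINT w|Q i. (norm (\<psi> w * \<eta> w - \<phi> w))\<^sup>2) < \<epsilon>)"
    using approximable_trig[OF trig_mult[OF p(1) q(1)]] by (intro exI[of _ "\<lambda>w. p w * q w"]) simp
qed

text \<open>Dominated convergence under each law; two eventual statements hold simultaneously, so
  one index serves both.\<close>

lemma approximable_pointwise_limit:
  assumes \<phi>: "\<And>n. approximable (\<phi> n)" and w: "\<And>i. integrable (Q i) (\<lambda>w. (D w)\<^sup>2)" and D: "D \<in> borel_measurable product_space"
    and bnd: "\<And>n w. w \<in> space product_space \<Longrightarrow> norm (\<phi> n w) \<le> D w"
    and lim: "\<And>w. w \<in> space product_space \<Longrightarrow> (\<lambda>n. \<phi> n w) \<longlonglongrightarrow> \<psi> w"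
  shows "approximable \<psi>"
proof -
  have \<phi>m: "\<phi> n \<in> borel_measurable product_space" for n using \<phi> by (auto simp: approximable_def square_int_def)
  have \<psi>m: "\<psi> \<in> borel_measurable product_space"
    by (rule borel_measurable_LIMSEQ_metric[OF \<phi>m lim])
  note [measurable] = \<phi>m \<psi>m D
  have \<psi>b: "norm (\<psi> w) \<le> D w" if "w \<in> space product_space" for w
    using LIMSEQ_le_const2[OF tendsto_norm[OF lim[OF that]]] bnd[OF that] by blast
  have s: "square_int \<psi>" unfolding square_int_def
  proof (intro conjI allI \<psi>m)
    fix i show "integrable (Q i) (\<lambda>w. (norm (\<psi> w))\<^sup>2)"
      by (rule Bochner_Integration.integrable_bound[OF w]) (use measurable_Q[OF \<psi>m] \<psi>b in \<open>auto simp: space_Q intro!: power_mono\<close>)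
  qed
  have conv: "(\<lambda>n. LINT w|Q i. (norm (\<psi> w - \<phi> n w))\<^sup>2) \<longlonglongrightarrow> (LINT w|Q i. 0)" for i
  proof (rule integral_dominated_convergence[where w="\<lambda>w. 4 * (D w)\<^sup>2"])
    show "(\<lambda>w. (norm (\<psi> w - \<phi> n w))\<^sup>2) \<in> borel_measurable (Q i)" for n by (rule measurable_Q) measurable
    show "integrable (Q i) (\<lambda>w. 4 * (D w)\<^sup>2)" using w by simp
    show "AE w in Q i. (\<lambda>n. (norm (\<psi> w - \<phi> n w))\<^sup>2) \<longlonglongrightarrow> 0"
    proof (rule AE_I2)
      fix w assume "w \<in> space (Q i)"
      then have "(\<lambda>n. \<phi> n w) \<longlonglongrightarrow> \<psi> w" using lim by (simp add: space_Q)
      from tendsto_power[OF tendsto_norm[OF tendsto_diff[OF tendsto_const[of "\<psi> w"] this]], of 2]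
      show "(\<lambda>n. (norm (\<psi> w - \<phi> n w))\<^sup>2) \<longlonglongrightarrow> 0" by simp
    qed
    show "AE w in Q i. norm ((norm (\<psi> w - \<phi> n w))\<^sup>2) \<le> 4 * (D w)\<^sup>2" for n
    proof (rule AE_I2)
      fix w assume "w \<in> space (Q i)"
      then have "norm (\<psi> w - \<phi> n w) \<le> 2 * D w"
        using norm_triangle_ineq4[of "\<psi> w" "\<phi> n w"] bnd[of w n] \<psi>b[of w] by (simp add: space_Q)
      from power_mono[OF this, of 2] show "norm ((norm (\<psi> w - \<phi> n w))\<^sup>2) \<le> 4 * (D w)\<^sup>2" by (simp add: power_mult_distrib)
    qed
  qed simp
  show ?thesis
  proof (rule approximable_limit[OF s])
    fix \<epsilon> :: real assume e: "0 < \<epsilon>"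
    have "\<forall>\<^sub>F n in sequentially. \<forall>i. (LINT w|Q i. (norm (\<psi> w - \<phi> n w))\<^sup>2) < \<epsilon>"
      unfolding all_bool_eq using conv[of True] conv[of False] e by (intro eventually_conj order_tendstoD) auto
    then show "\<exists>\<phi>. approximable \<phi> \<and> (\<forall>i. (LINT w|Q i. (norm (\<psi> w - \<phi> w))\<^sup>2) < \<epsilon>)"
      using \<phi> by (auto simp: eventually_sequentially)
  qed
qed

section \<open>From exponentials to measurable functionals of the path up to
  \<open>T\<close>\<close>

lemma square_int_const: "integrable (Q i) (\<lambda>w. (c::real)\<^sup>2)"
proof -
  interpret prob_space "Q i" by (rule prob)
  show ?thesis by simp
qed

text \<open>A polynomial in a trigonometric polynomial is again one. Weierstrass approximation on
  [-1,1] and uniform convergence then give every continuous function of \<open>s\<close>.\<close>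

lemma approximable_continuous_sin:
  fixes g :: "real \<Rightarrow> real"
  assumes s: "(\<lambda>w. complex_of_real (s w)) \<in> trig T" and s1: "\<And>w. s w \<in> {-1..1}" and g: "continuous_on {-1..1} g"
  shows "approximable (\<lambda>w. complex_of_real (g (s w)))"
proof -
  have poly: "(\<lambda>w. complex_of_real (h (s w))) \<in> trig T" if "real_polynomial_function h" for h
    using that
  proof (induction h rule: real_polynomial_function.induct)
    case (linear f)
    then obtain c where "f = (\<lambda>x. x * c)" using real_bounded_linear by blast
    then show ?case using trig_cmult[OF s, of "of_real c"] by (simp add: mult.commute)
  next
    case (const c) show ?case by (rule trig_const)
  next
    case (add f h) then show ?case using trig_add by fastforce
  next
    case (mult f h) then show ?case using trig_mult by fastforce
  qed
  have "\<exists>h. real_polynomial_function h \<and> (\<forall>x\<in>{-1..1}. \<bar>g x - h x\<bar> < 1 / real (Suc n))" for n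
    using Stone_Weierstrass_real_polynomial_function[OF compact_Icc g, of "1 / real (Suc n)"] by (metis of_nat_0_less_iff zero_less_Suc zero_less_divide_1_iff)
  then obtain h where h: "\<And>n. real_polynomial_function (h n)" "\<And>n x. x \<in> {-1..1} \<Longrightarrow> \<bar>g x - h n x\<bar> < 1 / real (Suc n)" by metis
  obtain B where "\<forall>x\<in>{-1..1}. \<bar>g x\<bar> \<le> B"
    using compact_continuous_image[OF g compact_Icc, THEN compact_imp_bounded] by (auto simp: bounded_iff)
  note B = bspec[OF this]
  show ?thesis
  proof (rule approximable_pointwise_limit[where \<phi>="\<lambda>n w. complex_of_real (h n (s w))" and D="\<lambda>_. B + 1"])
    show "approximable (\<lambda>w. complex_of_real (h n (s w)))" for n by (intro approximable_trig poly h)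
    fix w
    show "norm (complex_of_real (h n (s w))) \<le> B + 1" for n
    proof -
      have "1 / real (Suc n) \<le> 1" by simp
      then show ?thesis unfolding norm_of_real using h(2)[OF s1[of w], of n] B[OF s1[of w]] by linarith
    qed
    have "(\<lambda>n. h n (s w)) \<longlonglongrightarrow> g (s w)"
    proof (rule LIM_zero_cancel, rule Lim_null_comparison)
      show "(\<lambda>n. 1 / real (Suc n)) \<longlonglongrightarrow> 0" by (rule LIMSEQ_inverse_real_of_nat[unfolded inverse_eq_divide])
      show "\<forall>\<^sub>F n in sequentially. norm (h n (s w) - g (s w)) \<le> 1 / real (Suc n)"
        using h(2)[OF s1[of w]] by (intro always_eventually allI) (simp add: abs_minus_commute less_imp_le del: of_nat_Suc)
    qed
    then show "(\<lambda>n. complex_of_real (h n (s w))) \<longlonglongrightarrow> complex_of_real (g (s w))" by (rule tendsto_of_real)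
  qed (use square_int_const in auto)
qed

lemma sin_trig:
  assumes "t \<in> {0..T}"
  shows "(\<lambda>w. complex_of_real (sin (\<theta> * (v \<bullet> w t) - c))) \<in> trig T"
proof -
  have e: "complex_of_real (sin (\<theta> * (v \<bullet> w t) - c)) = (- \<i> / 2 * cis (- c)) * expo [(t, \<theta> *\<^sub>R v)] w + (\<i> / 2 * cis c) * expo [(t, (- \<theta>) *\<^sub>R v)] w" for w
  proof -
    let ?x = "\<theta> * (v \<bullet> w t)"
    have "complex_of_real (sin y) = (cis y - cis (- y)) * (- \<i> / 2)" for y
      by (simp add: complex_eq_iff)
    note this[of "?x - c"]
    moreover have "cis (?x - c) = cis (- c) * cis ?x" "cis (- (?x - c)) = cis c * cis (- ?x)"
      unfolding cis_mult by simp_all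
    moreover have "expo [(t, \<theta> *\<^sub>R v)] w = cis ?x" "expo [(t, (- \<theta>) *\<^sub>R v)] w = cis (- ?x)"
      by (simp_all add: expo_def path_pairing_def)
    moreover have "(A * E - B * F) * (- \<i> / 2) = (- \<i> / 2 * A) * E + (\<i> / 2 * B) * F" for A B E F
      by (simp add: algebra_simps)
    ultimately show ?thesis by (simp only:)
  qed
  show ?thesis unfolding e using assms by (intro trig_add trig_expo) (auto simp: times_upto_def)
qed

text \<open>With \<open>d = v \<bullet> w t - c\<close>, the number \<open>sin (d / k)\<close>
  eventually has the sign of \<open>d\<close>, and for nonzero \<open>d\<close> it is of order
  \<open>d / k\<close>. Multiplied by the square of \<open>k\<close> and clipped to [0,1] it is
  eventually equal to the indicator of \<open>d > 0\<close>.\<close>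

lemma approximable_halfspace:
  assumes t: "t \<in> {0..T}"
  shows "approximable (\<lambda>w. complex_of_real (indicator {w. c < v \<bullet> w t} w))"
proof -
  define G where "G k y = min 1 (max 0 ((real k)\<^sup>2 * y))" for k and y :: real
  define s where "s k w = sin ((1 / real (Suc k)) * (v \<bullet> w t) - c / real (Suc k))" for k w
  show ?thesis
  proof (rule approximable_pointwise_limit[where \<phi>="\<lambda>k w. complex_of_real (G (Suc k) (s k w))" and D="\<lambda>_. 1"])
    show "approximable (\<lambda>w. complex_of_real (G (Suc k) (s k w)))" for k
    proof (rule approximable_continuous_sin[where s="s k" and g="G (Suc k)"])
      show "(\<lambda>w. complex_of_real (s k w)) \<in> trig T" unfolding s_def by (rule sin_trig[OF t])
      show "continuous_on {- 1..1} (G (Suc k))" unfolding G_def by (intro continuous_intros)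
    qed (simp add: s_def)
    fix w
    show "norm (complex_of_real (G (Suc k) (s k w))) \<le> 1" for k by (simp add: G_def)
    define d where "d = v \<bullet> w t - c"
    have s: "s k w = sin (d / real (Suc k))" for k by (simp add: s_def d_def diff_divide_distrib)
    have "\<forall>\<^sub>F k in sequentially. G (Suc k) (s k w) = indicator {w. c < v \<bullet> w t} w"
    proof (cases "0 < d")
      case True
      \<comment> \<open>The part \<open>d < k\<close> puts the argument of the sine into (0,1),
        where it is at least half its argument; the part \<open>2 / d < k\<close> makes the scaled
        value \<open>k * d / 2\<close> exceed 1.\<close>
      obtain N where N: "d + 2 / d < real N" using reals_Archimedean2 by blast
      have "G (Suc k) (s k w) = 1" if k: "N \<le> k" for k
      proof -
        let ?x = "d / real (Suc k)"
        have "real N \<le> real (Suc k)" "0 < 2 / d" using k True by simp_all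
        then have K: "d < real (Suc k)" "2 / d < real (Suc k)" using N True by linarith+
        have x: "0 < ?x" "?x < 1" using True K by auto
        have "?x / 2 \<le> sin ?x"
        proof -
          have "\<bar>sin ?x - (\<Sum>m<3. sin_coeff m * ?x ^ m)\<bar> \<le> inverse (fact 3) * \<bar>?x\<bar> ^ 3" by (rule Maclaurin_sin_bound)
          moreover have "(\<Sum>m<3. sin_coeff m * ?x ^ m) = ?x" by (simp add: numeral_3_eq_3 sin_coeff_def)
          moreover have "inverse (fact 3 :: real) = 1 / 6" by (simp add: fact_numeral)
          ultimately have "?x - ?x ^ 3 / 6 \<le> sin ?x" using x by (simp only: abs_of_pos)
          moreover have "?x ^ 3 \<le> ?x" using power_decreasing[of 1 3 ?x] x by (simp del: of_nat_Suc)
          moreover have "y / 2 \<le> s" if "y - c / 6 \<le> s" "c \<le> y" "0 < y" for y c s :: real using that by linarith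
          ultimately show ?thesis using x(1) by blast
        qed
        then have "(real (Suc k))\<^sup>2 * (?x / 2) \<le> (real (Suc k))\<^sup>2 * sin ?x" by (intro mult_left_mono) auto
        moreover have "(real (Suc k))\<^sup>2 * (?x / 2) = real (Suc k) * d / 2" by (simp add: power2_eq_square del: of_nat_Suc)
        moreover have "2 < real (Suc k) * d" using K(2) True by (simp add: field_simps del: of_nat_Suc)
        ultimately have "1 \<le> (real (Suc k))\<^sup>2 * sin ?x" by linarith
        then show ?thesis unfolding s G_def by simp
      qed
      then show ?thesis using True by (auto simp: eventually_sequentially d_def)
    next
      case False
      obtain N where N: "- d < real N" using reals_Archimedean2 by blast
      have "G (Suc k) (s k w) = 0" if k: "N \<le> k" for k
      proof -
        let ?x = "- d / real (Suc k)"
        have "0 \<le> ?x" "?x \<le> 1" using False N k by (auto simp: field_simps)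
        \<comment> \<open>Here \<open>?x\<close> lies in [0,1], inside the half period on which the
          sine is nonnegative.\<close>
        then have "0 \<le> sin ?x" using pi_gt3 by (intro sin_ge_zero) auto
        then have "sin (d / real (Suc k)) \<le> 0" by simp
        then have "(real (Suc k))\<^sup>2 * sin (d / real (Suc k)) \<le> 0" by (intro mult_nonneg_nonpos) auto
        then show ?thesis unfolding s G_def by simp
      qed
      then show ?thesis using False by (auto simp: eventually_sequentially d_def)
    qed
    then have "(\<lambda>k. G (Suc k) (s k w)) \<longlonglongrightarrow> indicator {w. c < v \<bullet> w t} w" by (rule tendsto_eventually)
    then show "(\<lambda>k. complex_of_real (G (Suc k) (s k w))) \<longlonglongrightarrow> complex_of_real (indicator {w. c < v \<bullet> w t} w)" by (rule tendsto_of_real)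
    show "integrable (Q i) (\<lambda>w. 1\<^sup>2 :: real)" for i by (rule square_int_const)
  qed simp
qed

definition approx_sets :: "(real \<Rightarrow> real ^ 'd) set set" where
  "approx_sets = {A. A \<subseteq> space product_space \<and> approximable (\<lambda>w. complex_of_real (indicator A w))}"

lemma approximable_cong:
  assumes "\<And>w. w \<in> space product_space \<Longrightarrow> \<psi> w = \<eta> w" "approximable \<eta>"
  shows "approximable \<psi>"
proof (rule approximable_pointwise_limit[where \<phi>="\<lambda>_. \<eta>" and D="\<lambda>w. norm (\<eta> w)"])
  show "integrable (Q i) (\<lambda>w. (norm (\<eta> w))\<^sup>2)" for i using assms by (auto simp: approximable_def square_int_def)
  show "(\<lambda>w. norm (\<eta> w)) \<in> borel_measurable product_space" using assms by (auto simp: approximable_def square_int_def)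
qed (use assms in auto)

text \<open>Complements come from \<open>1 - indicator\<close>, finite intersections from products
  of bounded approximable functions, countable intersections from their pointwise limits.\<close>

lemma approx_sets_sigma: "sigma_algebra (space product_space) approx_sets"
  unfolding sigma_algebra_iff2
proof (intro conjI ballI allI impI)
  show "approx_sets \<subseteq> Pow (space product_space)" by (auto simp: approx_sets_def)
  show "{} \<in> approx_sets" using approximable_trig[OF trig_const[of 0]] by (simp add: approx_sets_def)
  have compl: "space product_space - A \<in> approx_sets" if "A \<in> approx_sets" for A
  proof -
    have "approximable (\<lambda>w. 1 + (-1) * complex_of_real (indicator A w))"
      using that approximable_trig[OF trig_const] by (intro approximable_add approximable_mult[where B=1]) (auto simp: approx_sets_def)
    then have "approximable (\<lambda>w. complex_of_real (indicator (space product_space - A) w))"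
      by (rule approximable_cong[rotated]) (auto simp: indicator_def)
    then show ?thesis by (simp add: approx_sets_def)
  qed
  then show "space product_space - A \<in> approx_sets" if "A \<in> approx_sets" for A using that .
  have inter: "A \<inter> B \<in> approx_sets" if "A \<in> approx_sets" "B \<in> approx_sets" for A B
  proof -
    have "approximable (\<lambda>w. complex_of_real (indicator A w) * complex_of_real (indicator B w))"
      using that by (intro approximable_mult[where B=1]) (auto simp: approx_sets_def indicator_def)
    then have "approximable (\<lambda>w. complex_of_real (indicator (A \<inter> B) w))"
      by (rule approximable_cong[rotated]) (auto simp: indicator_def)
    then show ?thesis using that by (auto simp: approx_sets_def)
  qed
  fix A :: "nat \<Rightarrow> _" assume A: "range A \<subseteq> approx_sets"
  have fin: "space product_space \<inter> (\<Inter>i<n. space product_space - A i) \<in> approx_sets" for n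
  proof (induction n)
    case 0
    show ?case using compl[OF \<open>{} \<in> approx_sets\<close>] by simp
  next
    case (Suc n)
    have "space product_space \<inter> (\<Inter>i<Suc n. space product_space - A i) =
      (space product_space \<inter> (\<Inter>i<n. space product_space - A i)) \<inter> (space product_space - A n)"
      by (auto simp: lessThan_Suc)
    moreover have "A n \<in> approx_sets" using A by auto
    ultimately show ?case using inter[OF Suc compl[of "A n"]] by (simp only:)
  qed
  have "space product_space \<inter> (\<Inter>i. space product_space - A i) \<in> approx_sets"
  proof -
    have "approximable (\<lambda>w. complex_of_real (indicator (space product_space \<inter> (\<Inter>i. space product_space - A i)) w))"
    proof (rule approximable_pointwise_limit[where \<phi>="\<lambda>n w. complex_of_real (indicator (space product_space \<inter> (\<Inter>i<n. space product_space - A i)) w)" and D="\<lambda>_. 1"])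
      show "approximable (\<lambda>w. complex_of_real (indicator (space product_space \<inter> (\<Inter>i<n. space product_space - A i)) w))" for n
        using fin by (auto simp: approx_sets_def)
      fix w :: "real \<Rightarrow> real ^ 'd" assume w: "w \<in> space product_space"
      have "\<forall>\<^sub>F n in sequentially. indicator (space product_space \<inter> (\<Inter>i<n. space product_space - A i)) w
        = indicat_real (space product_space \<inter> (\<Inter>i. space product_space - A i)) w"
      proof (cases "\<exists>i. w \<in> A i")
        case True
        then obtain i where "w \<in> A i" by blast
        then show ?thesis by (intro eventually_sequentiallyI[of "Suc i"]) (auto simp: indicator_def lessThan_empty_iff)
      next
        case False
        then show ?thesis using w by (auto simp: indicator_def)
      qed
      then show "(\<lambda>n. complex_of_real (indicator (space product_space \<inter> (\<Inter>i<n. space product_space - A i)) w)) \<longlonglongrightarrow>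
        complex_of_real (indicat_real (space product_space \<inter> (\<Inter>i. space product_space - A i)) w)"
        by (intro tendsto_of_real tendsto_eventually)
    next
      show "integrable (Q i) (\<lambda>w. 1\<^sup>2 :: real)" for i by (rule square_int_const)
    qed (simp_all add: indicator_def)
    then show ?thesis by (simp add: approx_sets_def)
  qed
  from compl[OF this] show "\<Union> (range A) \<in> approx_sets"
  proof -
    have "space product_space - (space product_space \<inter> (\<Inter>i. space product_space - A i)) = \<Union> (range A)"
      using A by (auto simp: approx_sets_def)
    then show ?thesis using \<open>space product_space - (space product_space \<inter> (\<Inter>i. space product_space - A i)) \<in> approx_sets\<close> by simp
  qed
qed

lemma coordinate_approx_sets:
  assumes t: "t \<in> {0..T}" and B: "B \<in> sets borel"
  shows "{w \<in> space product_space. w t \<in> B} \<in> approx_sets"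
proof -
  interpret S: sigma_algebra "space product_space" approx_sets by (rule approx_sets_sigma)
  have "B \<in> sigma_sets UNIV ((\<lambda> (a, i). {x::real ^ 'd. a < x \<bullet> i}) ` (UNIV \<times> Basis))"
    using B by (subst (asm) borel_eq_halfspace_greater) (simp add: sets_measure_of)
  then show ?thesis
  proof induction
    case (Basic a)
    then obtain c i where a: "a = {x. c < x \<bullet> i}" by auto
    have tm: "t \<in> {0..}" using t by auto
    have "approximable (\<lambda>w. complex_of_real (indicator {w \<in> space product_space. w t \<in> a} w))"
      by (rule approximable_cong[OF _ approximable_halfspace[OF t, of c i]]) (auto simp: a indicator_def inner_commute)
    then show ?case by (auto simp: approx_sets_def)
  next
    case Empty
    then show ?case using S.empty_sets by simp
  next
    case (Compl a)
    have "{w \<in> space product_space. w t \<in> UNIV - a} = space product_space - {w \<in> space product_space. w t \<in> a}" by auto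
    then show ?case using S.compl_sets[OF Compl.IH] by simp
  next
    case (Union a)
    have "{w \<in> space product_space. w t \<in> \<Union> (range a)} = (\<Union>i. {w \<in> space product_space. w t \<in> a i})" by auto
    moreover have "(\<Union>i. {w \<in> space product_space. w t \<in> a i}) \<in> approx_sets"
      using Union.IH by (intro S.countable_nat_UN) auto
    ultimately show ?case by (simp only:)
  qed
qed

lemma restrict_approx_sets:
  assumes A: "A \<in> sets (path_upto T)"
  shows "restrict_path T -` A \<inter> space product_space \<in> approx_sets"
proof -
  interpret S: sigma_algebra "space product_space" approx_sets by (rule approx_sets_sigma)
  have A: "A \<in> sigma_sets (\<Pi>\<^sub>E i\<in>{0..T}. space borel) {{f\<in>\<Pi>\<^sub>E i\<in>{0..T}. space borel. f i \<in> B} | i B. i \<in> {0..T} \<and> B \<in> sets borel}"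
    using A unfolding sets_PiM_single .
  have sp: "restrict_path T w \<in> (\<Pi>\<^sub>E i\<in>{0..T}. space borel)" for w :: "real \<Rightarrow> real ^ 'd"
    by (simp add: restrict_path_def)
  from A show ?thesis
  proof induction
    case (Basic a)
    then obtain t B where a: "a = {f\<in>\<Pi>\<^sub>E i\<in>{0..T}. space borel. f t \<in> B}" "t \<in> {0..T}" "B \<in> sets borel" by auto
    have "restrict_path T -` a \<inter> space product_space = {w \<in> space product_space. w t \<in> B}"
      using a(2) sp unfolding a(1) by (auto simp: restrict_path_def)
    then show ?case using coordinate_approx_sets[OF a(2,3)] by simp
  next
    case Empty
    then show ?case using S.empty_sets by simp
  next
    case (Compl a)
    have "restrict_path T -` ((\<Pi>\<^sub>E i\<in>{0..T}. space borel) - a) \<inter> space product_space = space product_space - (restrict_path T -` a \<inter> space product_space)"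
      using sp by auto
    then show ?case using S.compl_sets[OF Compl.IH] by simp
  next
    case (Union a)
    have "restrict_path T -` (\<Union> (range a)) \<inter> space product_space = (\<Union>i. restrict_path T -` a i \<inter> space product_space)" by auto
    moreover have "(\<Union>i. restrict_path T -` a i \<inter> space product_space) \<in> approx_sets"
      using Union.IH by (intro S.countable_nat_UN) auto
    ultimately show ?case by (simp only:)
  qed
qed

text \<open>Induction over nonnegative functions. Nonnegativity matters for square integrability:
  summands and members of an increasing sequence are dominated by the function that they build up
  and inherit it.\<close>

lemma approximable_restrict_nonneg:
  assumes G: "G \<in> borel_measurable (path_upto T)" and nn: "\<And>x. 0 \<le> G x"
    and int: "\<And>i. integrable (Q i) (\<lambda>w. (G (restrict_path T w))\<^sup>2)"
  shows "approximable (\<lambda>w. complex_of_real (G (restrict_path T w)))"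
  using G nn int
proof (induction G rule: borel_measurable_induct_real)
  case (set A)
  show ?case
    by (rule approximable_cong[of _ "\<lambda>w. complex_of_real (indicator (restrict_path T -` A \<inter> space product_space) w)"])
      (use restrict_approx_sets[OF set(1)] in \<open>auto simp: indicator_def approx_sets_def\<close>)
next
  case (mult u c)
  show ?case
  proof (cases "c = 0")
    case True
    then show ?thesis using approximable_trig[OF trig_const[of 0]] by simp
  next
    case False
    then have "integrable (Q i) (\<lambda>w. (u (restrict_path T w))\<^sup>2)" for i
      using mult.prems[of i] by (simp add: power_mult_distrib)
    then have "approximable (\<lambda>w. complex_of_real c * complex_of_real (u (restrict_path T w)))"
      using mult.IH by (intro approximable_mult[where B="\<bar>c\<bar>"] approximable_trig[OF trig_const]) auto
    then show ?thesis by simp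
  qed
next
  case (add u v)
  have *: "integrable (Q i) (\<lambda>w. (u' (restrict_path T w))\<^sup>2)"
    if "u' \<in> borel_measurable (path_upto T)" "\<And>x. 0 \<le> u' x" "\<And>x. u' x \<le> v x + u x" for u' i
  proof (rule Bochner_Integration.integrable_bound[OF add.prems])
    show "(\<lambda>w. (u' (restrict_path T w))\<^sup>2) \<in> borel_measurable (Q i)"
      by (intro measurable_Q borel_measurable_power measurable_compose[OF restrict_path_measurable that(1)])
    show "AE w in Q i. norm ((u' (restrict_path T w))\<^sup>2) \<le> norm ((v (restrict_path T w) + u (restrict_path T w))\<^sup>2)"
      using that(2,3) by (auto intro!: power_mono)
  qed
  have "approximable (\<lambda>w. complex_of_real (v (restrict_path T w)) + complex_of_real (u (restrict_path T w)))"
    using add by (intro approximable_add add.IH *) auto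
  then show ?case by simp
next
  case (seq U)
  have sp: "restrict_path T w \<in> space (path_upto T)" for w :: "real \<Rightarrow> real ^ 'd" by (auto simp: restrict_path_def space_PiM)
  have le: "U n x \<le> G x" if "x \<in> space (path_upto T)" for n x
    using incseq_le[of "\<lambda>n. U n x" "G x"] seq.hyps(3) seq.hyps(4)[OF that] by (auto simp: incseq_def le_fun_def)
  have Gm: "G \<in> borel_measurable (path_upto T)" by (rule borel_measurable_LIMSEQ_metric[OF seq.hyps(1) seq.hyps(4)])
  show ?case
  proof (rule approximable_pointwise_limit[where \<phi>="\<lambda>n w. complex_of_real (U n (restrict_path T w))" and D="\<lambda>w. G (restrict_path T w)"])
    show "approximable (\<lambda>w. complex_of_real (U n (restrict_path T w)))" for n
    proof (rule seq.IH)
      fix i show "integrable (Q i) (\<lambda>w. (U n (restrict_path T w))\<^sup>2)"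
      proof (rule Bochner_Integration.integrable_bound[OF seq.prems])
        show "(\<lambda>w. (U n (restrict_path T w))\<^sup>2) \<in> borel_measurable (Q i)"
          by (intro measurable_Q borel_measurable_power measurable_compose[OF restrict_path_measurable seq.hyps(1)])
        show "AE w in Q i. norm ((U n (restrict_path T w))\<^sup>2) \<le> norm ((G (restrict_path T w))\<^sup>2)"
          using le[OF sp] seq.hyps(2) by (auto intro!: power_mono)
      qed
    qed
    show "(\<lambda>w. G (restrict_path T w)) \<in> borel_measurable product_space" using Gm by measurable
    show "norm (complex_of_real (U n (restrict_path T w))) \<le> G (restrict_path T w)" for n w
      using le[OF sp] seq.hyps(2) by simp
    show "(\<lambda>n. complex_of_real (U n (restrict_path T w))) \<longlonglongrightarrow> complex_of_real (G (restrict_path T w))" for w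
      by (intro tendsto_of_real seq.hyps(4) sp)
  qed (use seq.prems in simp)
qed

lemma approximable_restrict:
  assumes G: "G \<in> borel_measurable (path_upto T)"
    and int: "\<And>i. integrable (Q i) (\<lambda>w. (G (restrict_path T w))\<^sup>2)"
  shows "approximable (\<lambda>w. complex_of_real (G (restrict_path T w)))"
proof -
  note [measurable] = G
  have p: "approximable (\<lambda>w. complex_of_real (max 0 (c * G (restrict_path T w))))" if "\<bar>c\<bar> = 1" for c
  proof (rule approximable_restrict_nonneg[of "\<lambda>x. max 0 (c * G x)"])
    fix i show "integrable (Q i) (\<lambda>w. (max 0 (c * G (restrict_path T w)))\<^sup>2)"
    proof (rule Bochner_Integration.integrable_bound[OF int])
      have "(\<lambda>w. (max 0 (c * G (restrict_path T w)))\<^sup>2) \<in> borel_measurable product_space" by measurable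
      then show "(\<lambda>w. (max 0 (c * G (restrict_path T w)))\<^sup>2) \<in> borel_measurable (Q i)" by (rule measurable_Q)
      have "(max 0 (c * y))\<^sup>2 \<le> y\<^sup>2" for y
        using that by (auto simp: max_def abs_if split: if_splits)
      then show "AE w in Q i. norm ((max 0 (c * G (restrict_path T w)))\<^sup>2) \<le> norm ((G (restrict_path T w))\<^sup>2)" by simp
    qed
  qed auto
  have "approximable (\<lambda>w. complex_of_real (max 0 (1 * G (restrict_path T w))) + (-1) * complex_of_real (max 0 ((-1) * G (restrict_path T w))))"
    by (intro approximable_add approximable_mult[where B=1] p approximable_trig[OF trig_const]) auto
  then show ?thesis by (rule approximable_cong[rotated]) (auto simp: max_def)
qed

end

section \<open>Symmetric tensors and exponential forms\<close>

text \<open>Cauchy-Schwarz recovered from its linearized form by optimizing over \<theta>. The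
  linear form can be summed termwise over the chaos orders with one common \<theta>, which is how it
  is obtained below.\<close>

lemma square_le_of_AM_GM:
  fixes a X Y :: real
  assumes X: "0 \<le> X" and Y: "0 < Y" and le: "\<And>\<theta>. 0 < \<theta> \<Longrightarrow> 2 * a \<le> X / \<theta> + \<theta> * Y" and a: "0 \<le> a"
  shows "a\<^sup>2 \<le> X * Y"
proof (cases "X = 0")
  case True
  have "a \<le> 0"
  proof (rule field_le_epsilon)
    fix e :: real assume "0 < e"
    \<comment> \<open>For \<open>X = 0\<close> no optimal \<theta> exists; this one gives
      \<open>2 * a \<le> 2 * e\<close>.\<close>
    then show "a \<le> 0 + e" using le[of "2 * e / Y"] Y True by simp
  qed
  then show ?thesis using a True by simp
next
  case False
  then have X: "0 < X" using X by simp
  let ?t = "sqrt (X / Y)"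
  have t: "0 < ?t" using X Y by simp
  have "X / ?t = ?t * Y" using X Y t by (simp add: field_simps real_sqrt_divide)
  then have "a \<le> ?t * Y" using le[OF t] by (simp add: mult.commute)
  then have "a\<^sup>2 \<le> (?t * Y)\<^sup>2" using a by (intro power_mono)
  also have "\<dots> = (X / Y) * Y\<^sup>2" using X Y by (simp add: power_mult_distrib)
  also have "\<dots> = X * Y" using Y by (simp add: power2_eq_square)
  finally show ?thesis .
qed

text \<open>The functions \<open>\<phi> u\<close> are the one-particle vectors of a symmetric Fock
  space over L2 of \<open>N\<close>. In the application they are the jump symbols of the
  exponentials occurring in a trigonometric polynomial.\<close>

locale l2_family = sigma_finite_measure N for N :: "'z measure" +
  fixes \<phi> :: "'u \<Rightarrow> 'z \<Rightarrow> complex" and K :: "'u set"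
  assumes fin: "finite K"
    and \<phi>_measurable: "u \<in> K \<Longrightarrow> \<phi> u \<in> borel_measurable N"
    and \<phi>_square: "u \<in> K \<Longrightarrow> integrable N (\<lambda>z. (norm (\<phi> u z))\<^sup>2)"
begin

sublocale P: product_sigma_finite "\<lambda>_::nat. N"
  by (intro product_sigma_finite.intro) (rule sigma_finite_measure_axioms)

definition gram :: "'u \<Rightarrow> 'u \<Rightarrow> complex" where
  "gram u v = (LINT z|N. \<phi> u z * cnj (\<phi> v z))"

definition tensor_comb :: "nat \<Rightarrow> ('u \<Rightarrow> complex) \<Rightarrow> (nat \<Rightarrow> 'z) \<Rightarrow> complex" where
  "tensor_comb n \<beta> z = (\<Sum>u\<in>K. \<beta> u * (\<Prod>j<n. \<phi> u (z j)))"

definition gram_power :: "nat \<Rightarrow> ('u \<Rightarrow> complex) \<Rightarrow> real" where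
  "gram_power n \<beta> = (LINT z|PiM {..<n} (\<lambda>_. N). (norm (tensor_comb n \<beta> z))\<^sup>2)"

lemma integrable_L2_product:
  fixes f g :: "'z \<Rightarrow> complex"
  assumes "f \<in> borel_measurable N" "g \<in> borel_measurable N"
    and "integrable N (\<lambda>z. (norm (f z))\<^sup>2)" "integrable N (\<lambda>z. (norm (g z))\<^sup>2)"
  shows "integrable N (\<lambda>z. f z * g z)"
proof (rule Bochner_Integration.integrable_bound)
  show "integrable N (\<lambda>z. (norm (f z))\<^sup>2 + (norm (g z))\<^sup>2)" using assms by simp
  have "norm (f z * g z) \<le> (norm (f z))\<^sup>2 + (norm (g z))\<^sup>2" for z
  proof -
    have "0 \<le> norm (f z) * norm (g z)" by simp
    then show ?thesis using sum_squares_bound[of "norm (f z)" "norm (g z)"] unfolding norm_mult by linarith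
  qed
  then show "AE z in N. norm (f z * g z) \<le> norm ((norm (f z))\<^sup>2 + (norm (g z))\<^sup>2)"
    by simp
qed (use assms in measurable)

lemma measurable_cnj_\<phi>: "u \<in> K \<Longrightarrow> (\<lambda>z. cnj (\<phi> u z)) \<in> borel_measurable N"
  by (rule borel_measurable_continuous_on[OF continuous_on_cnj[OF continuous_on_id] \<phi>_measurable])

lemma integrable_gram: "u \<in> K \<Longrightarrow> v \<in> K \<Longrightarrow> integrable N (\<lambda>z. \<phi> u z * cnj (\<phi> v z))"
  by (intro integrable_L2_product) (simp_all add: \<phi>_measurable \<phi>_square measurable_cnj_\<phi>)

lemma norm_tensor_comb_square:
  "complex_of_real ((norm (tensor_comb n \<beta> z))\<^sup>2) =
    (\<Sum>u\<in>K. \<Sum>v\<in>K. \<beta> u * cnj (\<beta> v) * (\<Prod>j<n. \<phi> u (z j) * cnj (\<phi> v (z j))))"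
proof -
  have "complex_of_real ((norm (tensor_comb n \<beta> z))\<^sup>2) = tensor_comb n \<beta> z * cnj (tensor_comb n \<beta> z)"
    by (rule complex_norm_square)
  also have "\<dots> = (\<Sum>u\<in>K. \<Sum>v\<in>K. \<beta> u * cnj (\<beta> v) * (\<Prod>j<n. \<phi> u (z j) * cnj (\<phi> v (z j))))"
    unfolding tensor_comb_def cnj_sum sum_product
    by (intro sum.cong) (simp_all add: prod.distrib)
  finally show ?thesis .
qed

lemma integrable_double_sum:
  assumes "\<And>u v. u \<in> K \<Longrightarrow> v \<in> K \<Longrightarrow> integrable L (f u v)"
  shows "integrable L (\<lambda>z. \<Sum>u\<in>K. \<Sum>v\<in>K. c u v * f u v z :: complex)"
    "(LINT z|L. (\<Sum>u\<in>K. \<Sum>v\<in>K. c u v * f u v z)) = (\<Sum>u\<in>K. \<Sum>v\<in>K. c u v * (LINT z|L. f u v z))"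
proof -
  show "integrable L (\<lambda>z. \<Sum>u\<in>K. \<Sum>v\<in>K. c u v * f u v z :: complex)"
    using assms by (intro Bochner_Integration.integrable_sum integrable_mult_right)
  have "(LINT z|L. (\<Sum>u\<in>K. \<Sum>v\<in>K. c u v * f u v z)) = (\<Sum>u\<in>K. LINT z|L. (\<Sum>v\<in>K. c u v * f u v z))"
    using assms by (intro Bochner_Integration.integral_sum Bochner_Integration.integrable_sum integrable_mult_right)
  also have "\<dots> = (\<Sum>u\<in>K. \<Sum>v\<in>K. LINT z|L. c u v * f u v z)"
    using assms by (intro sum.cong refl Bochner_Integration.integral_sum integrable_mult_right)
  finally show "(LINT z|L. (\<Sum>u\<in>K. \<Sum>v\<in>K. c u v * f u v z)) = (\<Sum>u\<in>K. \<Sum>v\<in>K. c u v * (LINT z|L. f u v z))"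
    by simp
qed

lemma gram_tensor:
  assumes "u \<in> K" "v \<in> K"
  shows "integrable (PiM {..<n} (\<lambda>_. N)) (\<lambda>z. \<Prod>j<n. \<phi> u (z j) * cnj (\<phi> v (z j)))"
    "(LINT z|PiM {..<n} (\<lambda>_. N). (\<Prod>j<n. \<phi> u (z j) * cnj (\<phi> v (z j)))) = gram u v ^ n"
  using P.product_integrable_prod[of "{..<n}" "\<lambda>_ z. \<phi> u z * cnj (\<phi> v z)"]
    P.product_integral_prod[of "{..<n}" "\<lambda>_ z. \<phi> u z * cnj (\<phi> v z)"] integrable_gram[OF assms]
  by (simp_all add: gram_def)

lemma integrable_tensor_comb_square: "integrable (PiM {..<n} (\<lambda>_. N)) (\<lambda>z. (norm (tensor_comb n \<beta> z))\<^sup>2)"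
proof -
  have "integrable (PiM {..<n} (\<lambda>_. N)) (\<lambda>z. complex_of_real ((norm (tensor_comb n \<beta> z))\<^sup>2))"
    unfolding norm_tensor_comb_square by (intro integrable_double_sum gram_tensor)
  then show ?thesis by (simp only: complex_of_real_integrable_eq)
qed

lemma gram_power_eq: "complex_of_real (gram_power n \<beta>) = (\<Sum>u\<in>K. \<Sum>v\<in>K. \<beta> u * cnj (\<beta> v) * gram u v ^ n)"
proof -
  have "complex_of_real (gram_power n \<beta>) = (LINT z|PiM {..<n} (\<lambda>_. N). complex_of_real ((norm (tensor_comb n \<beta> z))\<^sup>2))"
    unfolding gram_power_def by (rule integral_complex_of_real[symmetric])
  also have "\<dots> = (\<Sum>u\<in>K. \<Sum>v\<in>K. \<beta> u * cnj (\<beta> v) * gram u v ^ n)"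
    unfolding norm_tensor_comb_square by (subst integrable_double_sum(2)) (simp_all add: gram_tensor)
  finally show ?thesis .
qed

lemma gram_power_nonneg: "0 \<le> gram_power n \<beta>"
  unfolding gram_power_def by simp

text \<open>The squared Fock space norm of the combination, with coefficients
  \<open>\<beta>\<close>, of the exponential vectors of the \<open>\<phi> u\<close>, the
  one-particle inner product being scaled by \<open>r\<close>. The double sum is Hermitian, so the
  real part is its value.\<close>

definition exp_form :: "real \<Rightarrow> ('u \<Rightarrow> complex) \<Rightarrow> real" where
  "exp_form r \<beta> = Re (\<Sum>u\<in>K. \<Sum>v\<in>K. \<beta> u * cnj (\<beta> v) * exp (of_real r * gram u v))"

text \<open>Expanding the exponential decomposes the form into chaos orders, each of which is the
  squared norm of a tensor; nonnegativity of the form follows for nonnegative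
  \<open>r\<close>.\<close>

lemma exp_form_sums: "(\<lambda>n. r ^ n / fact n * gram_power n \<beta>) sums exp_form r \<beta>"
proof -
  have "(\<lambda>n. \<Sum>u\<in>K. \<Sum>v\<in>K. \<beta> u * cnj (\<beta> v) * ((of_real r * gram u v) ^ n /\<^sub>R fact n))
    sums (\<Sum>u\<in>K. \<Sum>v\<in>K. \<beta> u * cnj (\<beta> v) * exp (of_real r * gram u v))"
    by (intro sums_sum sums_mult exp_converges)
  moreover have "(\<Sum>u\<in>K. \<Sum>v\<in>K. \<beta> u * cnj (\<beta> v) * ((of_real r * gram u v) ^ n /\<^sub>R fact n))
    = complex_of_real (r ^ n / fact n * gram_power n \<beta>)" for n
    unfolding of_real_mult[of _ "gram_power n \<beta>"] gram_power_eq sum_distrib_left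
    by (intro sum.cong refl) (simp add: power_mult_distrib scaleR_conv_of_real field_simps)
  ultimately have "(\<lambda>n. complex_of_real (r ^ n / fact n * gram_power n \<beta>))
    sums (\<Sum>u\<in>K. \<Sum>v\<in>K. \<beta> u * cnj (\<beta> v) * exp (of_real r * gram u v))" by simp
  from sums_Re[OF this] show ?thesis unfolding exp_form_def by (simp only: Re_complex_of_real)
qed

lemma exp_form_nonneg: "0 \<le> r \<Longrightarrow> 0 \<le> exp_form r \<beta>"
  using sums_le[OF _ sums_zero exp_form_sums[of r \<beta>]] gram_power_nonneg by simp

context
  fixes q :: "'z \<Rightarrow> real"
  assumes q: "q \<in> borel_measurable N" and q2: "integrable N (\<lambda>z. (q z)\<^sup>2)"
begin

lemma integrable_pairing: "u \<in> K \<Longrightarrow> integrable N (\<lambda>z. \<phi> u z * q z)"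
  using q q2 by (intro integrable_L2_product) (simp_all add: \<phi>_measurable \<phi>_square)

lemma tensor_square_integrable:
  "integrable (PiM {..<n} (\<lambda>_. N)) (\<lambda>z. (\<Prod>j<n. q (z j))\<^sup>2)"
  "(LINT z|PiM {..<n} (\<lambda>_. N). (\<Prod>j<n. q (z j))\<^sup>2) = (LINT z|N. (q z)\<^sup>2) ^ n"
  using P.product_integrable_prod[of "{..<n}" "\<lambda>_ z. (q z)\<^sup>2"]
    P.product_integral_prod[of "{..<n}" "\<lambda>_ z. (q z)\<^sup>2"] q2
  by (simp_all add: prod_power_distrib)

lemma tensor_pairing:
  "integrable (PiM {..<n} (\<lambda>_. N)) (\<lambda>z. tensor_comb n \<beta> z * of_real (\<Prod>j<n. q (z j)))"
  "(LINT z|PiM {..<n} (\<lambda>_. N). tensor_comb n \<beta> z * of_real (\<Prod>j<n. q (z j))) =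
    (\<Sum>u\<in>K. \<beta> u * (LINT z|N. \<phi> u z * q z) ^ n)"
proof -
  have eq: "tensor_comb n \<beta> z * of_real (\<Prod>j<n. q (z j)) = (\<Sum>u\<in>K. \<beta> u * (\<Prod>j<n. \<phi> u (z j) * of_real (q (z j))))" for z
    unfolding tensor_comb_def sum_distrib_right by (intro sum.cong refl) (simp add: prod.distrib)
  have i: "integrable (PiM {..<n} (\<lambda>_. N)) (\<lambda>z. \<Prod>j<n. \<phi> u (z j) * of_real (q (z j)))" if "u \<in> K" for u
    using P.product_integrable_prod[of "{..<n}" "\<lambda>_ z. \<phi> u z * of_real (q z)"] integrable_pairing[OF that] by simp
  show "integrable (PiM {..<n} (\<lambda>_. N)) (\<lambda>z. tensor_comb n \<beta> z * of_real (\<Prod>j<n. q (z j)))"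
    unfolding eq by (intro Bochner_Integration.integrable_sum integrable_mult_right i)
  show "(LINT z|PiM {..<n} (\<lambda>_. N). tensor_comb n \<beta> z * of_real (\<Prod>j<n. q (z j))) =
    (\<Sum>u\<in>K. \<beta> u * (LINT z|N. \<phi> u z * q z) ^ n)"
    unfolding eq using P.product_integral_prod[of "{..<n}" "\<lambda>_ z. \<phi> _ z * of_real (q z)"] integrable_pairing i
    by (subst Bochner_Integration.integral_sum) auto
qed

lemma tensor_pairing_sums:
  "(\<lambda>n. (LINT z|PiM {..<n} (\<lambda>_. N). tensor_comb n \<beta> z * of_real (\<Prod>j<n. q (z j))) /\<^sub>R fact n)
    sums (\<Sum>u\<in>K. \<beta> u * exp (LINT z|N. \<phi> u z * q z))"
  unfolding tensor_pairing(2) scaleR_sum_right mult_scaleR_right[symmetric]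
  by (intro sums_sum sums_mult exp_converges)

text \<open>Cauchy-Schwarz between the combination of exponential vectors and the exponential vector
  of \<open>q\<close>. The parameter \<open>r\<close> weights order \<open>n\<close> by
  \<open>r ^ n\<close> on one side and by its inverse on the other.\<close>

lemma exp_pairing_bound:
  assumes r: "0 < r"
  shows "(norm (\<Sum>u\<in>K. \<beta> u * exp (LINT z|N. \<phi> u z * q z)))\<^sup>2 \<le> exp_form r \<beta> * exp ((LINT z|N. (q z)\<^sup>2) / r)"
proof (rule square_le_of_AM_GM)
  let ?c = "\<lambda>n. LINT z|PiM {..<n} (\<lambda>_. N). tensor_comb n \<beta> z * of_real (\<Prod>j<n. q (z j))"
  let ?I = "LINT z|N. (q z)\<^sup>2"
  fix \<theta> :: real assume \<theta>: "0 < \<theta>"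
  have "(\<lambda>n. (?I / r) ^ n /\<^sub>R fact n) sums exp (?I / r)" by (rule exp_converges)
  then have s: "(\<lambda>n. (r ^ n / fact n * gram_power n \<beta>) / \<theta> + \<theta> * ((?I / r) ^ n /\<^sub>R fact n))
    sums (exp_form r \<beta> / \<theta> + \<theta> * exp (?I / r))"
    by (intro sums_add sums_divide sums_mult exp_form_sums)
  have b: "2 * norm (?c n /\<^sub>R fact n) \<le> (r ^ n / fact n * gram_power n \<beta>) / \<theta> + \<theta> * ((?I / r) ^ n /\<^sub>R fact n)" for n
  proof -
    have "2 * norm (?c n) \<le> 2 * (LINT z|PiM {..<n} (\<lambda>_. N). norm (tensor_comb n \<beta> z * of_real (\<Prod>j<n. q (z j))))"
      by (intro mult_left_mono integral_norm_bound) simp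
    also have "\<dots> = (LINT z|PiM {..<n} (\<lambda>_. N). 2 * norm (tensor_comb n \<beta> z * of_real (\<Prod>j<n. q (z j))))"
      by simp
    also have "\<dots> \<le> (LINT z|PiM {..<n} (\<lambda>_. N). (r ^ n / \<theta>) * (norm (tensor_comb n \<beta> z))\<^sup>2 + (\<theta> / r ^ n) * (\<Prod>j<n. q (z j))\<^sup>2)"
    proof (rule integral_mono)
      fix z
      \<comment> \<open>The two weights are inverse to each other and cancel in the mixed term; in
        the squares they produce the terms of \<open>exp_form r \<beta> / \<theta>\<close> and of
        \<theta> times the exponential series.\<close>
      let ?a = "sqrt (r ^ n / \<theta>) * norm (tensor_comb n \<beta> z)" and ?b = "sqrt (\<theta> / r ^ n) * \<bar>\<Prod>j<n. q (z j)\<bar>"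
      have "2 * (?a * ?b) \<le> ?a\<^sup>2 + ?b\<^sup>2" using sum_squares_bound[of ?a ?b] by simp
      moreover have "sqrt (r ^ n / \<theta>) * sqrt (\<theta> / r ^ n) = 1"
        using r \<theta> by (simp add: real_sqrt_mult[symmetric])
      moreover have "?a * ?b = (sqrt (r ^ n / \<theta>) * sqrt (\<theta> / r ^ n)) * (norm (tensor_comb n \<beta> z) * \<bar>\<Prod>j<n. q (z j)\<bar>)"
        by (simp only: mult_ac)
      ultimately have "?a * ?b = norm (tensor_comb n \<beta> z) * \<bar>\<Prod>j<n. q (z j)\<bar>" "2 * (?a * ?b) \<le> ?a\<^sup>2 + ?b\<^sup>2"
        by (simp_all only: mult_1_left)
      then show "2 * norm (tensor_comb n \<beta> z * of_real (\<Prod>j<n. q (z j))) \<le>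
        (r ^ n / \<theta>) * (norm (tensor_comb n \<beta> z))\<^sup>2 + (\<theta> / r ^ n) * (\<Prod>j<n. q (z j))\<^sup>2"
        using r \<theta> by (simp only: norm_mult norm_of_real power_mult_distrib power2_abs real_sqrt_pow2_iff
            divide_nonneg_pos less_imp_le zero_less_power divide_pos_pos real_sqrt_pow2)
    qed (intro integrable_mult_right integrable_norm tensor_pairing Bochner_Integration.integrable_add
        integrable_tensor_comb_square tensor_square_integrable)+
    also have "\<dots> = (r ^ n / \<theta>) * gram_power n \<beta> + (\<theta> / r ^ n) * ?I ^ n"
      unfolding gram_power_def
      by (subst Bochner_Integration.integral_add)
        (simp_all add: integrable_tensor_comb_square tensor_square_integrable)
    finally have "2 * norm (?c n) / fact n \<le> ((r ^ n / \<theta>) * gram_power n \<beta> + (\<theta> / r ^ n) * ?I ^ n) / fact n"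
      by (rule divide_right_mono) simp
    then show ?thesis by (simp add: field_simps)
  qed
  have sn: "summable (\<lambda>n. 2 * norm (?c n /\<^sub>R fact n))"
    by (rule summable_comparison_test'[OF sums_summable[OF s], of 0]) (use b in simp)
  have "2 * norm (\<Sum>u\<in>K. \<beta> u * exp (LINT z|N. \<phi> u z * q z)) = 2 * norm (\<Sum>n. ?c n /\<^sub>R fact n)"
    using sums_unique[OF tensor_pairing_sums] by simp
  also have "\<dots> \<le> (\<Sum>n. 2 * norm (?c n /\<^sub>R fact n))"
    using summable_norm[of "\<lambda>n. ?c n /\<^sub>R fact n"] sn by (simp add: suminf_mult summable_mult_D)
  also have "\<dots> \<le> exp_form r \<beta> / \<theta> + \<theta> * exp (?I / r)"
    using suminf_le[OF b sn sums_summable[OF s]] sums_unique[OF s] by simp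
  finally show "2 * norm (\<Sum>u\<in>K. \<beta> u * exp (LINT z|N. \<phi> u z * q z)) \<le> exp_form r \<beta> / \<theta> + \<theta> * exp (?I / r)" .
qed (use r in \<open>auto intro: exp_form_nonneg\<close>)

end

lemma exp_form_tensor:
  "exp_form r (\<lambda>u. \<alpha> u * (\<Prod>j<n. \<phi> u (z j))) =
   Re (\<Sum>u\<in>K. \<Sum>v\<in>K. (\<alpha> u * cnj (\<alpha> v) * exp (of_real r * gram u v)) * (\<Prod>j<n. \<phi> u (z j) * cnj (\<phi> v (z j))))"
  unfolding exp_form_def by (intro arg_cong[where f=Re] sum.cong refl) (simp add: prod.distrib)

lemma exp_form_tensor_integral:
  "integrable (PiM {..<n} (\<lambda>_. N)) (\<lambda>z. exp_form r (\<lambda>u. \<alpha> u * (\<Prod>j<n. \<phi> u (z j))))"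
  "(LINT z|PiM {..<n} (\<lambda>_. N). exp_form r (\<lambda>u. \<alpha> u * (\<Prod>j<n. \<phi> u (z j)))) =
    Re (\<Sum>u\<in>K. \<Sum>v\<in>K. (\<alpha> u * cnj (\<alpha> v) * exp (of_real r * gram u v)) * gram u v ^ n)"
  unfolding exp_form_tensor
proof -
  note i = integrable_double_sum[of "PiM {..<n} (\<lambda>_. N)" "\<lambda>u v z. \<Prod>j<n. \<phi> u (z j) * cnj (\<phi> v (z j))"
    "\<lambda>u v. \<alpha> u * cnj (\<alpha> v) * exp (of_real r * gram u v)", OF gram_tensor(1)]
  show "integrable (PiM {..<n} (\<lambda>_. N)) (\<lambda>z. Re (\<Sum>u\<in>K. \<Sum>v\<in>K. (\<alpha> u * cnj (\<alpha> v) * exp (of_real r * gram u v)) * (\<Prod>j<n. \<phi> u (z j) * cnj (\<phi> v (z j)))))"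
    by (rule integrable_Re[OF i(1)])
  show "(LINT z|PiM {..<n} (\<lambda>_. N). Re (\<Sum>u\<in>K. \<Sum>v\<in>K. (\<alpha> u * cnj (\<alpha> v) * exp (of_real r * gram u v)) * (\<Prod>j<n. \<phi> u (z j) * cnj (\<phi> v (z j)))))
    = Re (\<Sum>u\<in>K. \<Sum>v\<in>K. (\<alpha> u * cnj (\<alpha> v) * exp (of_real r * gram u v)) * gram u v ^ n)"
    unfolding integral_Re[OF i(1)] i(2) by (simp add: gram_tensor cong: sum.cong)
qed

text \<open>For fixed \<open>z\<close>, \<open>exp_pairing_bound\<close> with \<open>r = 1/2\<close>
  removes the factors \<open>exp (\<integral> \<phi> h)\<close> at the price of the exponential of
  twice the squared norm of \<open>h\<close>. Integration over \<open>z\<close> leaves the entries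
  \<open>exp (gram / 2) * gram ^ n\<close>. Weighted by \<open>(1/2) ^ n / fact n\<close> they sum
  to \<open>exp (gram / 2) * exp (gram / 2)\<close>, which is the kernel of
  \<open>exp_form 1\<close>; the complementary weight \<open>2 ^ n\<close> falls on
  \<open>q\<close>.\<close>

lemma chaos_bound:
  fixes h q :: "'z \<Rightarrow> real"
  assumes h: "h \<in> borel_measurable N" "integrable N (\<lambda>z. (h z)\<^sup>2)"
    and q: "q \<in> borel_measurable N" "integrable N (\<lambda>z. (q z)\<^sup>2)" and \<theta>: "0 < \<theta>"
  shows "(\<Sum>n. ennreal (1 / fact n) * (\<integral>\<^sup>+z. ennreal (norm (tensor_comb n (\<lambda>u. \<alpha> u * exp (LINT z|N. \<phi> u z * h z)) z) * (\<Prod>j<n. \<bar>q (z j)\<bar>)) \<partial>PiM {..<n} (\<lambda>_. N)))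
    \<le> ennreal (exp (2 * (LINT z|N. (h z)\<^sup>2)) * exp_form 1 \<alpha> / \<theta> + \<theta> * exp (2 * (LINT z|N. (q z)\<^sup>2)))"
proof -
  let ?T = "\<lambda>n. tensor_comb n (\<lambda>u. \<alpha> u * exp (LINT z|N. \<phi> u z * h z))"
  let ?V = "\<lambda>n z. exp_form (1/2) (\<lambda>u. \<alpha> u * (\<Prod>j<n. \<phi> u (z j)))"
  let ?H = "LINT z|N. (h z)\<^sup>2" and ?I = "LINT z|N. (q z)\<^sup>2"
  let ?J = "\<lambda>n. LINT z|PiM {..<n} (\<lambda>_. N). ?V n z"
  have TV: "(norm (?T n z))\<^sup>2 \<le> exp (2 * ?H) * ?V n z" for n z
  proof -
    have "?T n z = (\<Sum>u\<in>K. \<alpha> u * (\<Prod>j<n. \<phi> u (z j)) * exp (LINT z|N. \<phi> u z * h z))"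
      by (simp add: tensor_comb_def ac_simps)
    then have "(norm (?T n z))\<^sup>2 \<le> ?V n z * exp (?H / (1/2))"
      by (simp only:) (rule exp_pairing_bound[OF h], simp)
    then show ?thesis by (simp add: mult.commute)
  qed
  have V0: "0 \<le> ?V n z" for n z by (rule exp_form_nonneg) simp
  have J0: "0 \<le> ?J n" for n by (intro integral_nonneg_AE AE_I2 V0)
  define B where "B n = exp (2 * ?H) / \<theta> * ((1/2) ^ n / fact n * ?J n) + \<theta> * ((2 * ?I) ^ n /\<^sub>R fact n)" for n
  have B0: "0 \<le> B n" for n unfolding B_def using J0 \<theta> by (auto intro!: add_nonneg_nonneg mult_nonneg_nonneg divide_nonneg_nonneg)
  have le: "ennreal (1 / fact n) * (\<integral>\<^sup>+z. ennreal (norm (?T n z) * (\<Prod>j<n. \<bar>q (z j)\<bar>)) \<partial>PiM {..<n} (\<lambda>_. N)) \<le> ennreal (B n)" for n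
  proof -
    have pt: "norm (?T n z) * (\<Prod>j<n. \<bar>q (z j)\<bar>) \<le> (exp (2 * ?H) / \<theta> * (1/2) ^ n) * ?V n z + (\<theta> * 2 ^ n) * (\<Prod>j<n. q (z j))\<^sup>2" for z
    proof -
      let ?p = "\<bar>\<Prod>j<n. q (z j)\<bar>"
      let ?a = "sqrt (1 / (\<theta> * 2 ^ n)) * norm (?T n z)" and ?b = "sqrt (\<theta> * 2 ^ n) * ?p"
      have "0 \<le> ?a * ?b" by (intro mult_nonneg_nonneg abs_ge_zero norm_ge_zero) (use \<theta> in auto)
      then have "?a * ?b \<le> ?a\<^sup>2 + ?b\<^sup>2" using sum_squares_bound[of ?a ?b] unfolding mult.assoc by linarith
      moreover have "sqrt (1 / (\<theta> * 2 ^ n)) * sqrt (\<theta> * 2 ^ n) = 1"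
        using \<theta> by (simp add: real_sqrt_mult[symmetric])
      moreover have "?a * ?b = (sqrt (1 / (\<theta> * 2 ^ n)) * sqrt (\<theta> * 2 ^ n)) * (norm (?T n z) * ?p)"
        by (simp only: mult_ac)
      ultimately have "?a * ?b = norm (?T n z) * ?p" "?a * ?b \<le> ?a\<^sup>2 + ?b\<^sup>2"
        by (simp_all only: mult_1_left)
      note ab = this
      have sq: "?a\<^sup>2 = 1 / (\<theta> * 2 ^ n) * (norm (?T n z))\<^sup>2" "?b\<^sup>2 = \<theta> * 2 ^ n * (\<Prod>j<n. q (z j))\<^sup>2"
        using \<theta> by (simp_all add: power_mult_distrib real_sqrt_pow2)
      have "norm (?T n z) * ?p \<le> 1 / (\<theta> * 2 ^ n) * (norm (?T n z))\<^sup>2 + \<theta> * 2 ^ n * (\<Prod>j<n. q (z j))\<^sup>2"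
        using ab(2) unfolding ab(1) sq .
      also have "\<dots> \<le> 1 / (\<theta> * 2 ^ n) * (exp (2 * ?H) * ?V n z) + \<theta> * 2 ^ n * (\<Prod>j<n. q (z j))\<^sup>2"
        using \<theta> by (intro add_right_mono mult_left_mono TV) simp
      also have "1 / (\<theta> * 2 ^ n) * (exp (2 * ?H) * ?V n z) = (exp (2 * ?H) / \<theta> * (1/2) ^ n) * ?V n z"
        by (simp add: power_one_over)
      finally show ?thesis by (simp only: abs_prod)
    qed
    have int: "integrable (PiM {..<n} (\<lambda>_. N)) (\<lambda>z. (exp (2 * ?H) / \<theta> * (1/2) ^ n) * ?V n z + (\<theta> * 2 ^ n) * (\<Prod>j<n. q (z j))\<^sup>2)"
      by (intro Bochner_Integration.integrable_add integrable_mult_right exp_form_tensor_integral tensor_square_integrable q)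
    have "(\<integral>\<^sup>+z. ennreal (norm (?T n z) * (\<Prod>j<n. \<bar>q (z j)\<bar>)) \<partial>PiM {..<n} (\<lambda>_. N)) \<le>
      (\<integral>\<^sup>+z. ennreal ((exp (2 * ?H) / \<theta> * (1/2) ^ n) * ?V n z + (\<theta> * 2 ^ n) * (\<Prod>j<n. q (z j))\<^sup>2) \<partial>PiM {..<n} (\<lambda>_. N))"
      by (intro nn_integral_mono ennreal_leI pt)
    also have "\<dots> = ennreal (LINT z|PiM {..<n} (\<lambda>_. N). (exp (2 * ?H) / \<theta> * (1/2) ^ n) * ?V n z + (\<theta> * 2 ^ n) * (\<Prod>j<n. q (z j))\<^sup>2)"
      by (intro nn_integral_eq_integral int AE_I2 add_nonneg_nonneg mult_nonneg_nonneg V0) (use \<theta> in auto)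
    also have "(LINT z|PiM {..<n} (\<lambda>_. N). (exp (2 * ?H) / \<theta> * (1/2) ^ n) * ?V n z + (\<theta> * 2 ^ n) * (\<Prod>j<n. q (z j))\<^sup>2)
      = (exp (2 * ?H) / \<theta> * (1/2) ^ n) * ?J n + (\<theta> * 2 ^ n) * ?I ^ n"
      using q by (subst Bochner_Integration.integral_add) (simp_all add: exp_form_tensor_integral(1) tensor_square_integrable)
    finally have "ennreal (1 / fact n) * (\<integral>\<^sup>+z. ennreal (norm (?T n z) * (\<Prod>j<n. \<bar>q (z j)\<bar>)) \<partial>PiM {..<n} (\<lambda>_. N)) \<le>
       ennreal (1 / fact n) * ennreal ((exp (2 * ?H) / \<theta> * (1/2) ^ n) * ?J n + (\<theta> * 2 ^ n) * ?I ^ n)"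
      by (rule mult_left_mono) simp
    also have "\<dots> = ennreal (B n)"
      by (simp add: ennreal_mult'[symmetric] B_def power_mult_distrib field_simps)
    finally show ?thesis .
  qed
  have "(\<lambda>n. Re (\<Sum>u\<in>K. \<Sum>v\<in>K. (\<alpha> u * cnj (\<alpha> v) * exp (of_real (1/2) * gram u v)) * ((of_real (1/2) * gram u v) ^ n /\<^sub>R fact n)))
    sums Re (\<Sum>u\<in>K. \<Sum>v\<in>K. (\<alpha> u * cnj (\<alpha> v) * exp (of_real (1/2) * gram u v)) * exp (of_real (1/2) * gram u v))"
    by (intro sums_Re sums_sum sums_mult exp_converges)
  \<comment> \<open>The two half exponents recombine: one was kept by the bound for fixed
    \<open>z\<close>, the other is the sum over the orders.\<close>
  moreover have "Re (\<Sum>u\<in>K. \<Sum>v\<in>K. (\<alpha> u * cnj (\<alpha> v) * exp (of_real (1/2) * gram u v)) * exp (of_real (1/2) * gram u v)) = exp_form 1 \<alpha>"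
    unfolding exp_form_def
    by (intro arg_cong[where f=Re] sum.cong refl) (simp add: mult.assoc exp_add[symmetric])
  moreover have "Re (\<Sum>u\<in>K. \<Sum>v\<in>K. (\<alpha> u * cnj (\<alpha> v) * exp (of_real (1/2) * gram u v)) * ((of_real (1/2) * gram u v) ^ n /\<^sub>R fact n))
    = (1/2) ^ n / fact n * ?J n" for n
  proof -
    have "Re (\<Sum>u\<in>K. \<Sum>v\<in>K. (\<alpha> u * cnj (\<alpha> v) * exp (of_real (1/2) * gram u v)) * ((of_real (1/2) * gram u v) ^ n /\<^sub>R fact n))
      = Re (of_real ((1/2) ^ n / fact n) * (\<Sum>u\<in>K. \<Sum>v\<in>K. (\<alpha> u * cnj (\<alpha> v) * exp (of_real (1/2) * gram u v)) * gram u v ^ n))"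
      unfolding sum_distrib_left
      by (intro arg_cong[where f=Re] sum.cong refl) (simp add: power_mult_distrib scaleR_conv_of_real field_simps)
    also have "\<dots> = (1/2) ^ n / fact n * ?J n"
    proof -
      have "Re (of_real x * y) = x * Re y" for x y by simp
      then show ?thesis by (simp only: exp_form_tensor_integral(2))
    qed
    finally show ?thesis .
  qed
  ultimately have Js: "(\<lambda>n. (1/2) ^ n / fact n * ?J n) sums exp_form 1 \<alpha>" by simp
  have "(\<lambda>n. (2 * ?I) ^ n /\<^sub>R fact n) sums exp (2 * ?I)" by (rule exp_converges)
  then have Bs: "B sums (exp (2 * ?H) / \<theta> * exp_form 1 \<alpha> + \<theta> * exp (2 * ?I))"
    unfolding B_def[abs_def] by (intro sums_add sums_mult Js)
  have "(\<Sum>n. ennreal (1 / fact n) * (\<integral>\<^sup>+z. ennreal (norm (?T n z) * (\<Prod>j<n. \<bar>q (z j)\<bar>)) \<partial>PiM {..<n} (\<lambda>_. N))) \<le> (\<Sum>n. ennreal (B n))"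
    by (intro suminf_le le) auto
  also have "\<dots> = ennreal (exp (2 * ?H) / \<theta> * exp_form 1 \<alpha> + \<theta> * exp (2 * ?I))"
    using suminf_ennreal_eq[OF B0 Bs] .
  finally show ?thesis by simp
qed

end

section \<open>Laws dominated by the reference law\<close>

text \<open>Complex conjugation of the exponential, so that \<open>u @ neg_times v\<close> stands
  for the frequency difference \<open>u - v\<close> in positive definite kernels.\<close>

definition neg_times :: "(real \<times> (real ^ 'd)) list \<Rightarrow> (real \<times> (real ^ 'd)) list" where
  "neg_times u = map (\<lambda>p. (fst p, - snd p)) u"

lemma path_pairing_neg: "path_pairing (neg_times u) w = - path_pairing u w"
  by (induction u) (auto simp: neg_times_def)

lemma tail_sum_neg: "tail_sum (neg_times u) s = - tail_sum u s"
  by (induction u) (auto simp: neg_times_def)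

lemma tail_sum_append: "tail_sum (u @ v) s = tail_sum u s + tail_sum v s"
  by (simp add: tail_sum_def)

lemma phase_append_neg: "phase (u @ neg_times v) z = phase u z - phase v z"
  by (simp add: phase_def tail_sum_append tail_sum_neg inner_diff_left)

lemma times_upto_neg: "neg_times u \<in> times_upto T \<longleftrightarrow> u \<in> times_upto T"
  by (auto simp: times_upto_def neg_times_def)

lemma times_upto_nonneg: "u \<in> times_upto T \<Longrightarrow> \<forall>p\<in>set u. 0 \<le> fst p"
  by (auto simp: times_upto_def)

definition jump_symbol :: "(real \<times> (real ^ 'd)) list \<Rightarrow> real \<times> (real ^ 'd) \<Rightarrow> complex" where
  "jump_symbol u z = cis (phase u z) - 1"

lemma expo_append_neg: "expo (u @ neg_times v) w = expo u w * cnj (expo v w)"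
  by (simp add: expo_append) (simp add: expo_def path_pairing_neg cis_cnj)

lemma (in prob_space) cauchy_schwarz_prob:
  fixes f :: "'a \<Rightarrow> real"
  assumes "integrable M f" "integrable M (\<lambda>\<omega>. (f \<omega>)\<^sup>2)"
  shows "(expectation f)\<^sup>2 \<le> expectation (\<lambda>\<omega>. (f \<omega>)\<^sup>2)"
  using variance_positive[of f] variance_eq[OF assms] by simp

text \<open>The inequality between the squared modulus of the mean and the second moment, for the
  random variable that the trigonometric polynomial yields on the Wiener path. The second moment is
  the kernel evaluated at frequency differences.\<close>

lemma (in wiener_process) wiener_cf_positive:
  assumes cov: "covariance_matrix \<Sigma>" and K: "finite K" "\<And>u. u \<in> K \<Longrightarrow> \<forall>p\<in>set u. 0 \<le> fst p"
  shows "(norm (\<Sum>u\<in>K. b u * wiener_cf \<Sigma> u))\<^sup>2 \<le>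
    Re (\<Sum>u\<in>K. \<Sum>v\<in>K. b u * cnj (b v) * wiener_cf \<Sigma> (u @ neg_times v))"
proof -
  let ?e = "\<lambda>u \<omega>. cis (path_pairing u (\<lambda>t. W t \<omega>))"
  let ?f = "\<lambda>\<omega>. \<Sum>u\<in>K. b u * ?e u \<omega>"
  have pm: "(\<lambda>\<omega>. path_pairing u (\<lambda>t. W t \<omega>)) \<in> borel_measurable M" if "\<forall>p\<in>set u. 0 \<le> fst p" for u
    using that by (induction u) (auto intro!: borel_measurable_add borel_measurable_inner wiener_measurable)
  have ei: "integrable M (?e u)" if "\<forall>p\<in>set u. 0 \<le> fst p" for u
    using pm[OF that] by (intro integrable_const_bound[of _ 1]) auto
  have nn: "\<forall>p\<in>set (u @ neg_times v). 0 \<le> fst p" if "u \<in> K" "v \<in> K" for u v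
    using K(2)[OF that(1)] K(2)[OF that(2)] by (auto simp: neg_times_def)
  have fi: "integrable M ?f" using K by (intro Bochner_Integration.integrable_sum integrable_mult_right ei) auto
  have sq: "complex_of_real ((norm (?f \<omega>))\<^sup>2) = (\<Sum>u\<in>K. \<Sum>v\<in>K. b u * cnj (b v) * ?e (u @ neg_times v) \<omega>)" for \<omega>
    unfolding complex_norm_square cnj_sum sum_product
    by (intro sum.cong refl) (simp add: expo_append_neg[unfolded expo_def] mult_ac)
  have si: "integrable M (\<lambda>\<omega>. \<Sum>u\<in>K. \<Sum>v\<in>K. b u * cnj (b v) * ?e (u @ neg_times v) \<omega>)"
    using nn by (intro Bochner_Integration.integrable_sum integrable_mult_right ei) auto
  have sqi: "integrable M (\<lambda>\<omega>. (norm (?f \<omega>))\<^sup>2)"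
    using si unfolding sq[symmetric] by (simp only: complex_of_real_integrable_eq)
  have "norm (LINT \<omega>|M. ?f \<omega>) \<le> (LINT \<omega>|M. norm (?f \<omega>))" by (rule integral_norm_bound)
  then have "(norm (LINT \<omega>|M. ?f \<omega>))\<^sup>2 \<le> (LINT \<omega>|M. norm (?f \<omega>))\<^sup>2" by (intro power_mono) auto
  also have "\<dots> \<le> (LINT \<omega>|M. (norm (?f \<omega>))\<^sup>2)"
    using cauchy_schwarz_prob[of "\<lambda>\<omega>. norm (?f \<omega>)"] fi sqi by simp
  also have "\<dots> = Re (complex_of_real (LINT \<omega>|M. (norm (?f \<omega>))\<^sup>2))" by simp
  also have "complex_of_real (LINT \<omega>|M. (norm (?f \<omega>))\<^sup>2) = (LINT \<omega>|M. (\<Sum>u\<in>K. \<Sum>v\<in>K. b u * cnj (b v) * ?e (u @ neg_times v) \<omega>))"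
    unfolding sq[symmetric] by (rule integral_complex_of_real[symmetric])
  also have "\<dots> = (\<Sum>u\<in>K. \<Sum>v\<in>K. b u * cnj (b v) * wiener_cf \<Sigma> (u @ neg_times v))"
  proof -
    have "(LINT \<omega>|M. (\<Sum>u\<in>K. \<Sum>v\<in>K. b u * cnj (b v) * ?e (u @ neg_times v) \<omega>))
      = (\<Sum>u\<in>K. LINT \<omega>|M. (\<Sum>v\<in>K. b u * cnj (b v) * ?e (u @ neg_times v) \<omega>))"
      using nn by (intro Bochner_Integration.integral_sum Bochner_Integration.integrable_sum integrable_mult_right ei) auto
    also have "\<dots> = (\<Sum>u\<in>K. \<Sum>v\<in>K. LINT \<omega>|M. b u * cnj (b v) * ?e (u @ neg_times v) \<omega>)"
      using nn by (intro sum.cong refl Bochner_Integration.integral_sum integrable_mult_right ei) auto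
    also have "\<dots> = (\<Sum>u\<in>K. \<Sum>v\<in>K. b u * cnj (b v) * wiener_cf \<Sigma> (u @ neg_times v))"
      using nn by (intro sum.cong refl) (simp add: wiener_cf[OF cov])
    finally show ?thesis .
  qed
  finally have "(norm (LINT \<omega>|M. ?f \<omega>))\<^sup>2 \<le> Re (\<Sum>u\<in>K. \<Sum>v\<in>K. b u * cnj (b v) * wiener_cf \<Sigma> (u @ neg_times v))" .
  moreover have "(LINT \<omega>|M. ?f \<omega>) = (\<Sum>u\<in>K. b u * wiener_cf \<Sigma> u)"
    using K by (subst Bochner_Integration.integral_sum) (auto simp: wiener_cf[OF cov] ei)
  ultimately show ?thesis by simp
qed

lemma (in levy_ito) levy_ito_measurable:
  assumes \<nu>: "levy_measure \<nu>"
  shows "(\<lambda>\<omega>. \<lambda>t\<in>{0..}. t *\<^sub>R b + W t \<omega> + J t \<omega> + (LINT z:large_jumps t|\<Phi> \<omega>. snd z)) \<in> measurable M product_space"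
  by (intro measurable_restrict borel_measurable_add borel_measurable_const wiener_measurable
    compensated_measurable large_jumps_integral_measurable[OF \<nu>]) auto

lemma measurable_path_space: "X \<in> measurable P path_space \<Longrightarrow> X \<in> measurable P product_space"
  unfolding path_space_def by (simp add: measurable_restrict_space2_iff)

text \<open>The auxiliary probability space of the Levy-Ito construction is eliminated here: later
  arguments use only these facts about the law on path space. The third fact mentions no law, but it
  is the construction that supplies a Wiener process with covariance \<Sigma>.\<close>

lemma levy_process_law:
  fixes X :: "'o \<Rightarrow> real \<Rightarrow> real ^ 'd"
  assumes L: "levy_process TYPE('w) \<Sigma> b \<nu> P X" and cov: "covariance_matrix \<Sigma>" and \<nu>: "levy_measure \<nu>"
  shows "prob_space (distr P product_space X)"
    "u \<in> times_upto T \<Longrightarrow> (LINT w|distr P product_space X. expo u w) = wiener_cf \<Sigma> u * levy_cf b \<nu> u"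
    "finite K \<Longrightarrow> K \<subseteq> times_upto T \<Longrightarrow> (norm (\<Sum>u\<in>K. c u * wiener_cf \<Sigma> u))\<^sup>2 \<le>
      Re (\<Sum>u\<in>K. \<Sum>v\<in>K. c u * cnj (c v) * wiener_cf \<Sigma> (u @ neg_times v))"
proof -
  obtain M :: "'w measure" and W \<Phi> J where LI: "levy_ito M \<Sigma> W \<nu> \<Phi> J"
    and law: "distr P product_space X = distr M product_space (\<lambda>\<omega>. \<lambda>t\<in>{0..}.
          t *\<^sub>R b + W t \<omega> + J t \<omega> + (LINT z:large_jumps t|\<Phi> \<omega>. snd z))"
    using L unfolding levy_process_def by blast
  have P: "prob_space P" "X \<in> measurable P path_space" using L unfolding levy_process_def by blast+
  interpret levy_ito M \<Sigma> W \<nu> \<Phi> J by (rule LI)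
  show "prob_space (distr P product_space X)"
    using P by (intro prob_space.prob_space_distr measurable_path_space)
  let ?Y = "\<lambda>t \<omega>. t *\<^sub>R b + W t \<omega> + J t \<omega> + (LINT z:large_jumps t|\<Phi> \<omega>. snd z)"
  {
    assume u: "u \<in> times_upto T"
    have "path_pairing v (\<lambda>t\<in>{0..}. ?Y t \<omega>) = path_pairing v (\<lambda>t. ?Y t \<omega>)" if "\<forall>p\<in>set v. 0 \<le> fst p" for v \<omega>
      using that by (induction v) auto
    then have "expo u (\<lambda>t\<in>{0..}. ?Y t \<omega>) = cis (path_pairing u (\<lambda>t. ?Y t \<omega>))" for \<omega>
      using times_upto_nonneg[OF u] by (simp add: expo_def)
    then show "(LINT w|distr P product_space X. expo u w) = wiener_cf \<Sigma> u * levy_cf b \<nu> u"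
      unfolding law integral_distr[OF levy_ito_measurable[OF \<nu>] expo_measurable[OF u]]
      by (simp only: levy_ito_cf[OF \<nu> cov times_upto_nonneg[OF u]])
  }
  show "finite K \<Longrightarrow> K \<subseteq> times_upto T \<Longrightarrow> (norm (\<Sum>u\<in>K. c u * wiener_cf \<Sigma> u))\<^sup>2 \<le>
      Re (\<Sum>u\<in>K. \<Sum>v\<in>K. c u * cnj (c v) * wiener_cf \<Sigma> (u @ neg_times v))"
    using times_upto_nonneg by (intro wiener_cf_positive[OF cov]) blast+
qed

lemma jump_symbol_measurable:
  assumes "sets N = sets borel" shows "jump_symbol u \<in> borel_measurable (half_line \<Otimes>\<^sub>M N)"
  unfolding jump_symbol_def[abs_def] using measurable_phase[OF assms] by measurable

lemma jump_symbol_square_integrable: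
  assumes \<nu>: "levy_measure \<nu>" and u: "u \<in> times_upto T" and T: "0 \<le> T"
  shows "integrable (jump_intensity \<nu>) (\<lambda>z. (norm (jump_symbol u z))\<^sup>2)"
proof (rule Bochner_Integration.integrable_bound)
  have uT: "\<forall>p\<in>set u. fst p \<le> T" using u by (auto simp: times_upto_def)
  show "integrable (jump_intensity \<nu>) (\<lambda>z. ((\<Sum>p\<leftarrow>u. norm (snd p))\<^sup>2 + 4) * jump_weight T z)"
    by (intro integrable_mult_right integrable_jump_weight \<nu> T)
  show "AE z in jump_intensity \<nu>. norm ((norm (jump_symbol u z))\<^sup>2) \<le> norm (((\<Sum>p\<leftarrow>u. norm (snd p))\<^sup>2 + 4) * jump_weight T z)"
    using norm_jump_symbol_le[OF uT] by (intro AE_I2) (simp add: jump_symbol_def order_trans[OF _ abs_ge_self])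
  show "(\<lambda>z. (norm (jump_symbol u z))\<^sup>2) \<in> borel_measurable (jump_intensity \<nu>)"
    using jump_symbol_measurable[OF levy_measure_sets[OF \<nu>]] by measurable
qed

text \<open>For \<open>a = cis x - 1\<close> and \<open>c = cis y - 1\<close> one has
  \<open>cis (x - y) - 1 = a + cnj c + a * cnj c\<close>, and the linear compensators match. So the
  characteristic function at a frequency difference is a product of one-sided factors with the
  exponential of a Gram entry.\<close>

lemma levy_cf_append_neg:
  assumes \<nu>: "levy_measure \<nu>" and u: "u \<in> times_upto T" and v: "v \<in> times_upto T" and T: "0 \<le> T"
  shows "levy_cf b \<nu> (u @ neg_times v) = levy_cf b \<nu> u * cnj (levy_cf b \<nu> v) *
    exp (LINT z|jump_intensity \<nu>. jump_symbol u z * cnj (jump_symbol v z))"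
proof -
  interpret F: l2_family "jump_intensity \<nu>" jump_symbol "{u, v}"
    using sigma_finite_jump_intensity[OF \<nu>] jump_symbol_measurable[OF levy_measure_sets[OF \<nu>]]
      jump_symbol_square_integrable[OF \<nu> _ T] u v
    by (auto simp: l2_family_def l2_family_axioms_def)
  have i: "integrable (jump_intensity \<nu>) (levy_integrand u)" "integrable (jump_intensity \<nu>) (\<lambda>z. cnj (levy_integrand v z))"
    using integrable_levy_integrand[OF \<nu> times_upto_nonneg[OF u]] integrable_levy_integrand[OF \<nu> times_upto_nonneg[OF v]] by auto
  have j: "integrable (jump_intensity \<nu>) (\<lambda>z. jump_symbol u z * cnj (jump_symbol v z))"
    by (rule F.integrable_gram) auto
  have "levy_integrand (u @ neg_times v) z = levy_integrand u z + cnj (levy_integrand v z) + jump_symbol u z * cnj (jump_symbol v z)" for z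
  proof -
    have "cis (phase u z - phase v z) = cis (phase u z) * cnj (cis (phase v z))"
      by (simp add: cis_cnj cis_mult)
    then show ?thesis
      unfolding levy_integrand_def jump_symbol_def phase_append_neg by (auto simp: algebra_simps)
  qed
  then have "(LINT z|jump_intensity \<nu>. levy_integrand (u @ neg_times v) z) = (LINT z|jump_intensity \<nu>. levy_integrand u z)
      + cnj (LINT z|jump_intensity \<nu>. levy_integrand v z) + (LINT z|jump_intensity \<nu>. jump_symbol u z * cnj (jump_symbol v z))"
    using i j by (simp add: Bochner_Integration.integral_add)
  moreover have "(\<Sum>p\<leftarrow>neg_times v. fst p *\<^sub>R snd p) = - (\<Sum>p\<leftarrow>v. fst p *\<^sub>R snd p)"
    by (induction v) (auto simp: neg_times_def)
  ultimately show ?thesis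
    unfolding levy_cf_def exp_cnj exp_add[symmetric]
    by (simp add: inner_add_right inner_minus_right algebra_simps)
qed

section \<open>The reference law and the laws comparable with it\<close>

locale reference_law =
  fixes \<Sigma> :: "real ^ 'd ^ 'd" and bs :: "real ^ 'd" and \<nu>s :: "(real ^ 'd) measure"
    and T :: real and Qs :: "(real \<Rightarrow> real ^ 'd) measure"
  assumes levy: "levy_measure \<nu>s" and T: "0 \<le> T"
    and Qs_prob: "prob_space Qs" and Qs_sets: "sets Qs = sets product_space"
    and Qs_cf: "u \<in> times_upto T \<Longrightarrow> (LINT w|Qs. expo u w) = wiener_cf \<Sigma> u * levy_cf bs \<nu>s u"
    and gauss_positive: "\<And>K c. finite K \<Longrightarrow> K \<subseteq> times_upto T \<Longrightarrow> (norm (\<Sum>u\<in>K. c u * wiener_cf \<Sigma> u))\<^sup>2 \<le>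
      Re (\<Sum>u\<in>K. \<Sum>v\<in>K. c u * cnj (c v) * wiener_cf \<Sigma> (u @ neg_times v))"
begin

abbreviation "N \<equiv> jump_intensity \<nu>s"

definition ref_cf :: "(real \<times> (real ^ 'd)) list \<Rightarrow> complex" where
  "ref_cf u = wiener_cf \<Sigma> u * levy_cf bs \<nu>s u"

lemma l2_family_jump_symbol:
  assumes "finite K" "K \<subseteq> times_upto T" shows "l2_family N jump_symbol K"
  using sigma_finite_jump_intensity[OF levy] jump_symbol_measurable[OF levy_measure_sets[OF levy]]
    jump_symbol_square_integrable[OF levy _ T] assms
  by (auto simp: l2_family_def l2_family_axioms_def)

lemma trig_integrable:
  assumes "p \<in> trig T" "prob_space R" "sets R = sets product_space"
  shows "integrable R p" "integrable R (\<lambda>w. (norm (p w))\<^sup>2)"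
proof -
  interpret prob_space R by fact
  have [measurable]: "p \<in> borel_measurable R"
    using trig_measurable[OF assms(1)] measurable_cong_sets[OF assms(3) refl] by blast
  obtain B where B: "0 \<le> B" "\<And>w. norm (p w) \<le> B" using trig_bounded[OF assms(1)] by blast
  show "integrable R p" using B by (intro integrable_const_bound[of _ B]) auto
  show "integrable R (\<lambda>w. (norm (p w))\<^sup>2)"
    using power_mono[OF B(2), where n=2] by (intro integrable_const_bound[of _ "B\<^sup>2"]) auto
qed

lemma trig_poly_integral:
  assumes "finite K" "K \<subseteq> times_upto T" "prob_space R" "sets R = sets product_space"
  shows "(LINT w|R. trig_poly K a w) = (\<Sum>u\<in>K. a u * (LINT w|R. expo u w))"
proof -
  have "integrable R (expo u)" if "u \<in> K" for u
    using trig_integrable(1)[OF trig_expo[of u T 1] assms(3,4)] that assms(2) by auto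
  then show ?thesis unfolding trig_poly_def by (subst Bochner_Integration.integral_sum) auto
qed

text \<open>
  The Gaussian kernel \<open>\<gamma>(u - v) - \<gamma>(u) \<gamma>(v)\<close> is positive semidefinite, and so is each power of the Gram matrix of
  the jump symbols; their product contributes a nonnegative amount to the second moment.
\<close>

lemma bessel:
  assumes K: "finite K" "K \<subseteq> times_upto T"
  shows "l2_family.exp_form N jump_symbol K 1 (\<lambda>u. a u * ref_cf u) \<le> (LINT w|Qs. (norm (trig_poly K a w))\<^sup>2)"
proof -
  interpret F: l2_family N jump_symbol K by (rule l2_family_jump_symbol[OF K])
  let ?P = "levy_cf bs \<nu>s" and ?\<gamma> = "\<lambda>u v. wiener_cf \<Sigma> (u @ neg_times v)"
  let ?A = "\<lambda>u. a u * ?P u"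
  have KK: "u @ neg_times v \<in> times_upto T" if "u \<in> K" "v \<in> K" for u v
    using that K(2) by (auto simp: times_upto_append times_upto_neg)
  \<comment> \<open>A Schur product argument: the inequality for the Gaussian kernel is used at each
    fixed \<open>z\<close>, with the products of jump symbols absorbed into the coefficients, and is
    then integrated over \<open>z\<close>, which produces the \<open>n\<close>-th power of the Gram
    matrix.\<close>
  have tm: "F.gram_power n (\<lambda>u. a u * ref_cf u) \<le> Re (\<Sum>u\<in>K. \<Sum>v\<in>K. ?A u * cnj (?A v) * ?\<gamma> u v * F.gram u v ^ n)" for n
  proof -
    let ?g = "\<lambda>z. \<Sum>u\<in>K. \<Sum>v\<in>K. (?A u * cnj (?A v) * ?\<gamma> u v) * (\<Prod>j<n. jump_symbol u (z j) * cnj (jump_symbol v (z j)))"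
    have gi: "integrable (PiM {..<n} (\<lambda>_. N)) ?g" "(LINT z|PiM {..<n} (\<lambda>_. N). ?g z) = (\<Sum>u\<in>K. \<Sum>v\<in>K. ?A u * cnj (?A v) * ?\<gamma> u v * F.gram u v ^ n)"
    proof -
      note d = F.integrable_double_sum[of "PiM {..<n} (\<lambda>_. N)" "\<lambda>u v z. \<Prod>j<n. jump_symbol u (z j) * cnj (jump_symbol v (z j))"
        "\<lambda>u v. ?A u * cnj (?A v) * ?\<gamma> u v"]
      show "integrable (PiM {..<n} (\<lambda>_. N)) ?g" by (rule d(1)) (rule F.gram_tensor)
      show "(LINT z|PiM {..<n} (\<lambda>_. N). ?g z) = (\<Sum>u\<in>K. \<Sum>v\<in>K. ?A u * cnj (?A v) * ?\<gamma> u v * F.gram u v ^ n)"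
        by (subst d(2)) (simp_all add: F.gram_tensor)
    qed
    have "F.gram_power n (\<lambda>u. a u * ref_cf u) \<le> (LINT z|PiM {..<n} (\<lambda>_. N). Re (?g z))"
      unfolding F.gram_power_def
    proof (rule integral_mono)
      show "integrable (PiM {..<n} (\<lambda>_. N)) (\<lambda>z. Re (?g z))" by (rule integrable_Re[OF gi(1)])
      fix z
      let ?c = "\<lambda>u. ?A u * (\<Prod>j<n. jump_symbol u (z j))"
      have "(norm (\<Sum>u\<in>K. ?c u * wiener_cf \<Sigma> u))\<^sup>2 \<le> Re (\<Sum>u\<in>K. \<Sum>v\<in>K. ?c u * cnj (?c v) * ?\<gamma> u v)"
        by (rule gauss_positive[OF K])
      moreover have "(\<Sum>u\<in>K. ?c u * wiener_cf \<Sigma> u) = F.tensor_comb n (\<lambda>u. a u * ref_cf u) z"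
        unfolding F.tensor_comb_def ref_cf_def by (intro sum.cong refl) (simp only: mult_ac)
      moreover have "(\<Sum>u\<in>K. \<Sum>v\<in>K. ?c u * cnj (?c v) * ?\<gamma> u v) = ?g z"
        by (intro sum.cong refl) (simp add: prod.distrib mult_ac)
      ultimately show "(norm (F.tensor_comb n (\<lambda>u. a u * ref_cf u) z))\<^sup>2 \<le> Re (?g z)" by (simp only:)
    qed (rule F.integrable_tensor_comb_square)
    also have "\<dots> = Re (\<Sum>u\<in>K. \<Sum>v\<in>K. ?A u * cnj (?A v) * ?\<gamma> u v * F.gram u v ^ n)"
      unfolding integral_Re[OF gi(1)] gi(2) ..
    finally show ?thesis .
  qed
  let ?R = "\<lambda>n. Re (\<Sum>u\<in>K. \<Sum>v\<in>K. ?A u * cnj (?A v) * ?\<gamma> u v * (F.gram u v ^ n /\<^sub>R fact n))"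
  have s: "?R sums Re (\<Sum>u\<in>K. \<Sum>v\<in>K. ?A u * cnj (?A v) * ?\<gamma> u v * exp (F.gram u v))"
    by (intro sums_Re sums_sum sums_mult exp_converges)
  have "F.exp_form 1 (\<lambda>u. a u * ref_cf u) \<le> Re (\<Sum>u\<in>K. \<Sum>v\<in>K. ?A u * cnj (?A v) * ?\<gamma> u v * exp (F.gram u v))"
  proof (rule sums_le[OF _ F.exp_form_sums s])
    fix n
    have "?R n = Re (\<Sum>u\<in>K. \<Sum>v\<in>K. ?A u * cnj (?A v) * ?\<gamma> u v * F.gram u v ^ n) / fact n"
      unfolding Re_sum sum_divide_distrib by (intro sum.cong refl) (simp add: divide_inverse mult_ac)
    then show "1 ^ n / fact n * F.gram_power n (\<lambda>u. a u * ref_cf u) \<le> ?R n"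
      using divide_right_mono[OF tm[of n], of "fact n"] by simp
  qed
  \<comment> \<open>By \<open>levy_cf_append_neg\<close> the Gaussian kernel, the one-sided factors
    in \<open>?A\<close> and the exponential of the Gram entry together are the reference
    characteristic function at the difference of \<open>u\<close> and \<open>v\<close>.\<close>
  also have "(\<Sum>u\<in>K. \<Sum>v\<in>K. ?A u * cnj (?A v) * ?\<gamma> u v * exp (F.gram u v)) = (\<Sum>u\<in>K. \<Sum>v\<in>K. a u * cnj (a v) * (LINT w|Qs. expo (u @ neg_times v) w))"
  proof (intro sum.cong refl)
    fix u v assume uv: "u \<in> K" "v \<in> K"
    then have "u \<in> times_upto T" "v \<in> times_upto T" using K(2) by auto
    from levy_cf_append_neg[OF levy this T, of bs]
    show "?A u * cnj (?A v) * ?\<gamma> u v * exp (F.gram u v) = a u * cnj (a v) * (LINT w|Qs. expo (u @ neg_times v) w)"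
      unfolding Qs_cf[OF KK[OF uv]] F.gram_def by (simp add: mult_ac)
  qed
  also have "Re \<dots> = (LINT w|Qs. (norm (trig_poly K a w))\<^sup>2)"
  proof -
    have ei: "integrable Qs (expo (u @ neg_times v))" if "u \<in> K" "v \<in> K" for u v
      using trig_integrable(1)[OF trig_expo[OF KK[OF that], of 1] Qs_prob Qs_sets] by simp
    have "complex_of_real (LINT w|Qs. (norm (trig_poly K a w))\<^sup>2) = (LINT w|Qs. complex_of_real ((norm (trig_poly K a w))\<^sup>2))"
      by (rule integral_complex_of_real[symmetric])
    also have "\<dots> = (LINT w|Qs. (\<Sum>u\<in>K. \<Sum>v\<in>K. a u * cnj (a v) * expo (u @ neg_times v) w))"
      unfolding complex_norm_square trig_poly_def cnj_sum sum_product
      by (intro Bochner_Integration.integral_cong sum.cong refl) (simp add: expo_append_neg mult_ac)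
    also have "\<dots> = (\<Sum>u\<in>K. \<Sum>v\<in>K. a u * cnj (a v) * (LINT w|Qs. expo (u @ neg_times v) w))"
      by (rule F.integrable_double_sum(2)[OF ei])
    finally have eq: "complex_of_real (LINT w|Qs. (norm (trig_poly K a w))\<^sup>2) =
      (\<Sum>u\<in>K. \<Sum>v\<in>K. a u * cnj (a v) * (LINT w|Qs. expo (u @ neg_times v) w))" .
    show ?thesis unfolding eq[symmetric] by (rule Re_complex_of_real)
  qed
  finally show ?thesis .
qed

text \<open>Only the relation between characteristic functions is kept. In this form the notion
  covers the given Levy processes, with \<open>q\<close> equal to \<open>g - 1\<close> up to time
  \<open>T\<close>, and also the law of the path with independent extra jumps.\<close>

definition dominated_law :: "(real \<times> (real ^ 'd) \<Rightarrow> real) \<Rightarrow> (real \<Rightarrow> real ^ 'd) measure \<Rightarrow> bool" where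
  "dominated_law q R \<longleftrightarrow> prob_space R \<and> sets R = sets product_space \<and> q \<in> borel_measurable N \<and>
    integrable N (\<lambda>z. (q z)\<^sup>2) \<and>
    (\<forall>u\<in>times_upto T. (LINT w|R. expo u w) = ref_cf u * exp (LINT z|N. jump_symbol u z * q z))"

text \<open>The mean under \<open>R\<close> pairs the coefficients with the exponential vector of
  \<open>q\<close>; Cauchy-Schwarz with \<open>r = 1\<close> and \<open>bessel\<close> bound it. The
  constant is the one that a density of second moment \<open>exp (\<integral> q\<^sup>2)\<close>
  would give.\<close>

lemma dominated_trig:
  assumes R: "dominated_law q R" and p: "p \<in> trig T"
  shows "(norm (LINT w|R. p w))\<^sup>2 \<le> exp (LINT z|N. (q z)\<^sup>2) * (LINT w|Qs. (norm (p w))\<^sup>2)"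
proof -
  obtain K a where K: "finite K" "K \<subseteq> times_upto T" and pK: "p = trig_poly K a" using p by (rule trigE)
  interpret F: l2_family N jump_symbol K by (rule l2_family_jump_symbol[OF K])
  have "(LINT w|R. p w) = (\<Sum>u\<in>K. a u * (LINT w|R. expo u w))"
    unfolding pK using R K by (intro trig_poly_integral) (auto simp: dominated_law_def)
  also have "\<dots> = (\<Sum>u\<in>K. (a u * ref_cf u) * exp (LINT z|N. jump_symbol u z * q z))"
    using R K(2) by (intro sum.cong refl) (auto simp: dominated_law_def)
  finally have "(norm (LINT w|R. p w))\<^sup>2 \<le> F.exp_form 1 (\<lambda>u. a u * ref_cf u) * exp ((LINT z|N. (q z)\<^sup>2) / 1)"
    using R by (simp only:) (rule F.exp_pairing_bound, auto simp: dominated_law_def)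
  also have "\<dots> \<le> (LINT w|Qs. (norm (trig_poly K a w))\<^sup>2) * exp ((LINT z|N. (q z)\<^sup>2) / 1)"
    by (intro mult_right_mono bessel[OF K]) simp
  finally show ?thesis by (simp add: pK mult.commute)
qed

text \<open>Boundedness makes the functional square integrable under \<open>R\<close> too, so some
  polynomial is close to it under both laws. The factor 4 comes from using the squared triangle
  inequality twice, once under each law.\<close>

lemma dominated_bounded:
  assumes R: "dominated_law q R" and G: "G \<in> borel_measurable (path_upto T)" and B: "\<And>x. \<bar>G x\<bar> \<le> B"
  shows "(LINT w|R. G (restrict_path T w))\<^sup>2 \<le> 4 * exp (LINT z|N. (q z)\<^sup>2) * (LINT w|Qs. (G (restrict_path T w))\<^sup>2)"
proof -
  let ?Q = "\<lambda>i. if i then Qs else R"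
  have R': "prob_space R" "sets R = sets product_space" using R by (auto simp: dominated_law_def)
  interpret L: path_laws ?Q T
  proof (rule path_laws.intro)
    show "prob_space (?Q i)" for i using R'(1) Qs_prob by (cases i) simp_all
    show "sets (?Q i) = sets product_space" for i using R'(2) Qs_sets by (cases i) simp_all
  qed
  let ?G = "\<lambda>w. G (restrict_path T w)" and ?E = "exp (LINT z|N. (q z)\<^sup>2)"
  have Gm: "?G \<in> borel_measurable product_space" by (rule measurable_compose[OF restrict_path_measurable G])
  interpret R: prob_space R by (rule R')
  have sG: "L.square_int (\<lambda>w. complex_of_real (?G w))"
    by (rule L.square_int_bounded[where B=B]) (use Gm B in auto)
  then have iG: "integrable (?Q i) (\<lambda>w. (?G w)\<^sup>2)" for i unfolding L.square_int_def by simp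
  have GiR: "integrable R ?G"
    using L.measurable_Q[OF Gm, of False] B by (intro R.integrable_const_bound[of _ B]) auto
  have appr: "L.approximable (\<lambda>w. complex_of_real (?G w))"
    by (rule L.approximable_restrict[OF G iG])
  have "(LINT w|R. ?G w)\<^sup>2 \<le> 4 * ?E * (LINT w|Qs. (?G w)\<^sup>2) + (2 + 4 * ?E) * e" if e: "0 < e" for e
  proof -
    obtain p where p: "p \<in> trig T" "\<And>i. (LINT w|?Q i. (norm (complex_of_real (?G w) - p w))\<^sup>2) < e"
      using appr e unfolding L.approximable_def by blast
    note ps = L.square_int_trig[OF p(1)]
    have d: "L.square_int (\<lambda>w. complex_of_real (?G w) - p w)" by (rule L.square_int_diff[OF sG ps])
    have pR: "integrable R p" by (rule trig_integrable(1)[OF p(1) R'])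
    have "complex_of_real (LINT w|R. ?G w) = (LINT w|R. complex_of_real (?G w) - p w) + (LINT w|R. p w)"
      using GiR pR by (subst Bochner_Integration.integral_diff) (auto simp del: of_real_eq_iff)
    then have "(LINT w|R. ?G w)\<^sup>2 = (norm ((LINT w|R. complex_of_real (?G w) - p w) + (LINT w|R. p w)))\<^sup>2"
      by (metis norm_of_real power2_abs)
    also have "\<dots> \<le> 2 * (norm (LINT w|R. complex_of_real (?G w) - p w))\<^sup>2 + 2 * (norm (LINT w|R. p w))\<^sup>2"
      by (rule norm_square_add)
    also have "(norm (LINT w|R. complex_of_real (?G w) - p w))\<^sup>2 \<le> e"
    proof -
      have "(norm (LINT w|R. complex_of_real (?G w) - p w))\<^sup>2 \<le> (LINT w|R. norm (complex_of_real (?G w) - p w))\<^sup>2"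
        by (intro power_mono integral_norm_bound) simp
      also have "\<dots> \<le> (LINT w|R. (norm (complex_of_real (?G w) - p w))\<^sup>2)"
        using d GiR pR unfolding L.square_int_def by (intro R.cauchy_schwarz_prob) (auto dest: spec[of _ False])
      finally show ?thesis using p(2)[of False] by simp
    qed
    also have "(norm (LINT w|R. p w))\<^sup>2 \<le> ?E * (LINT w|Qs. (norm (p w))\<^sup>2)"
      by (rule dominated_trig[OF R p(1)])
    also have "(LINT w|Qs. (norm (p w))\<^sup>2) \<le> 2 * (LINT w|Qs. (?G w)\<^sup>2) + 2 * e"
    proof -
      have "L.square_int (\<lambda>w. 0)" by (rule L.square_int_bounded[where B=0]) auto
      from L.square_dist_triangle[OF ps sG this, of True] p(2)[of True]
      show ?thesis by (simp add: norm_minus_commute)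
    qed
    finally show ?thesis by (simp add: algebra_simps)
  qed
  note bound = this
  have "(\<lambda>k. 4 * ?E * (LINT w|Qs. (?G w)\<^sup>2) + (2 + 4 * ?E) * (1 / real (Suc k))) \<longlonglongrightarrow> 4 * ?E * (LINT w|Qs. (?G w)\<^sup>2) + (2 + 4 * ?E) * 0"
    by (intro tendsto_intros LIMSEQ_inverse_real_of_nat[unfolded inverse_eq_divide])
  then have "(LINT w|R. ?G w)\<^sup>2 \<le> 4 * ?E * (LINT w|Qs. (?G w)\<^sup>2) + (2 + 4 * ?E) * 0"
    by (rule LIMSEQ_le_const) (intro exI[of _ 0] allI impI bound, simp)
  then show ?thesis by simp
qed

text \<open>Integrability under \<open>R\<close> is part of the conclusion, so the bound is first
  applied to \<open>|G|\<close> truncated at \<open>k\<close> and then extended by monotone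
  convergence.\<close>

lemma dominated:
  assumes R: "dominated_law q R" and G: "G \<in> borel_measurable (path_upto T)"
    and int: "integrable Qs (\<lambda>w. (G (restrict_path T w))\<^sup>2)"
  shows "(\<integral>\<^sup>+w. ennreal \<bar>G (restrict_path T w)\<bar> \<partial>R) \<le>
    ennreal (2 * exp ((LINT z|N. (q z)\<^sup>2) / 2) * sqrt (LINT w|Qs. (G (restrict_path T w))\<^sup>2))"
    (is "_ \<le> ennreal ?C")
proof -
  interpret R: prob_space R using R by (auto simp: dominated_law_def)
  have Rs: "sets R = sets product_space" using R by (auto simp: dominated_law_def)
  note [measurable] = G
  have rm: "restrict_path T \<in> measurable R (path_upto T)" "restrict_path T \<in> measurable Qs (path_upto T)"
    using restrict_path_measurable measurable_cong_sets[OF Rs refl] measurable_cong_sets[OF Qs_sets refl] by blast+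
  let ?H = "\<lambda>k x. min \<bar>G x\<bar> (real k)"
  have Hm: "?H k \<in> borel_measurable (path_upto T)" for k by measurable
  have "(\<integral>\<^sup>+w. ennreal (?H k (restrict_path T w)) \<partial>R) \<le> ennreal ?C" for k
  proof -
    have HR: "integrable R (\<lambda>w. ?H k (restrict_path T w))"
      using measurable_compose[OF rm(1) Hm] by (intro R.integrable_const_bound[of _ "real k"]) auto
    have "(LINT w|R. ?H k (restrict_path T w))\<^sup>2 \<le> 4 * exp (LINT z|N. (q z)\<^sup>2) * (LINT w|Qs. (?H k (restrict_path T w))\<^sup>2)"
      by (rule dominated_bounded[OF R Hm, of _ "real k"]) auto
    also have "\<dots> \<le> 4 * exp (LINT z|N. (q z)\<^sup>2) * (LINT w|Qs. (G (restrict_path T w))\<^sup>2)"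
    proof (intro mult_left_mono integral_mono_AE int)
      have le: "(?H k x)\<^sup>2 \<le> (G x)\<^sup>2" for x
        using power_mono[of "?H k x" "\<bar>G x\<bar>" 2] by simp
      then show "AE w in Qs. (?H k (restrict_path T w))\<^sup>2 \<le> (G (restrict_path T w))\<^sup>2" by simp
      show "integrable Qs (\<lambda>w. (?H k (restrict_path T w))\<^sup>2)"
        by (rule Bochner_Integration.integrable_bound[OF int]) (use measurable_compose[OF rm(2) Hm] le in auto)
    qed simp
    also have "\<dots> = ?C\<^sup>2"
      by (simp add: power_mult_distrib real_sqrt_pow2 exp_double[symmetric])
    finally have "(LINT w|R. ?H k (restrict_path T w)) \<le> ?C"
      by (rule power2_le_imp_le) (auto intro!: mult_nonneg_nonneg)
    then show ?thesis using nn_integral_eq_integral[OF HR] by (simp add: ennreal_leI)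
  qed
  moreover have "(\<integral>\<^sup>+w. ennreal \<bar>G (restrict_path T w)\<bar> \<partial>R) = (SUP k. \<integral>\<^sup>+w. ennreal (?H k (restrict_path T w)) \<partial>R)"
  proof -
    have "ennreal \<bar>x\<bar> = (SUP k. ennreal (min \<bar>x\<bar> (real k)))" for x
    proof (rule antisym)
      obtain k where "\<bar>x\<bar> \<le> real k" using real_arch_simple by blast
      then have "ennreal \<bar>x\<bar> = ennreal (min \<bar>x\<bar> (real k))" by simp
      also have "\<dots> \<le> (SUP k. ennreal (min \<bar>x\<bar> (real k)))" by (rule SUP_upper) simp
      finally show "ennreal \<bar>x\<bar> \<le> (SUP k. ennreal (min \<bar>x\<bar> (real k)))" .
    qed (auto intro!: SUP_least ennreal_leI)
    then have "(\<integral>\<^sup>+w. ennreal \<bar>G (restrict_path T w)\<bar> \<partial>R) = (\<integral>\<^sup>+w. (SUP k. ennreal (?H k (restrict_path T w))) \<partial>R)" by simp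
    also have "\<dots> = (SUP k. \<integral>\<^sup>+w. ennreal (?H k (restrict_path T w)) \<partial>R)"
    proof (rule nn_integral_monotone_convergence_SUP)
      show "incseq (\<lambda>k w. ennreal (?H k (restrict_path T w)))"
        by (auto simp: incseq_def le_fun_def intro!: ennreal_leI min.mono)
      show "(\<lambda>w. ennreal (?H k (restrict_path T w))) \<in> borel_measurable R" for k
        using measurable_compose[OF rm(1) Hm] by measurable
    qed
    finally show ?thesis .
  qed
  ultimately show ?thesis by (simp add: SUP_least)
qed

end

section \<open>Levy measures with a density and the change of drift\<close>

context reference_law
begin

interpretation \<nu>s: sigma_finite_measure \<nu>s by (rule levy_measure_sigma_finite[OF levy])
interpretation hl: sigma_finite_measure half_line by (rule sigma_finite_half_line)
interpretation PS: pair_sigma_finite half_line \<nu>s ..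

lemma snd_measurable: "snd \<in> borel_measurable N"
  by (rule measurable_snd_jump[OF levy_measure_sets[OF levy]])

lemma borel_\<nu>s: "f \<in> borel_measurable borel \<Longrightarrow> f \<in> borel_measurable \<nu>s"
  using levy_measure_borel[OF levy] by blast

lemma measurable_cutoff_time:
  fixes k :: "real ^ 'd \<Rightarrow> 'b :: {second_countable_topology, topological_space, zero}"
  assumes k: "k \<in> borel_measurable borel"
  shows "(\<lambda>z. if fst z \<le> t then k (snd z) else 0) \<in> borel_measurable N"
proof -
  have [measurable]: "(\<lambda>z. k (snd z)) \<in> borel_measurable N"
    by (rule measurable_compose[OF snd_measurable k])
  show ?thesis by measurable
qed

lemma nn_integral_cutoff_time:
  assumes k: "k \<in> borel_measurable borel" and t: "0 \<le> t"
  shows "(\<integral>\<^sup>+z. (if fst z \<le> t then k (snd z) else 0) \<partial>N) = ennreal t * (\<integral>\<^sup>+x. k x \<partial>\<nu>s)"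
proof -
  have "(\<integral>\<^sup>+z. (if fst z \<le> t then k (snd z) else 0) \<partial>N) = (\<integral>\<^sup>+z. indicator {0..t} (fst z) * k (snd z) \<partial>N)"
    by (intro nn_integral_cong) (auto simp: space_pair_measure indicator_def)
  also have "\<dots> = ennreal t * (\<integral>\<^sup>+x. k x \<partial>\<nu>s)"
    by (rule nn_integral_time_product[OF \<nu>s.sigma_finite_measure_axioms borel_\<nu>s[OF k] t])
  finally show ?thesis .
qed

lemma square_integrable_cutoff:
  fixes k :: "real ^ 'd \<Rightarrow> real"
  assumes k: "k \<in> borel_measurable borel" and fin: "(\<integral>\<^sup>+x. ennreal ((k x)\<^sup>2) \<partial>\<nu>s) < \<infinity>"
  shows "(\<lambda>z. if fst z \<le> T then k (snd z) else 0) \<in> borel_measurable N"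
    "integrable N (\<lambda>z. (if fst z \<le> T then k (snd z) else 0)\<^sup>2)"
proof -
  show m: "(\<lambda>z. if fst z \<le> T then k (snd z) else 0) \<in> borel_measurable N"
    by (rule measurable_cutoff_time[OF k])
  have "(\<integral>\<^sup>+z. ennreal ((if fst z \<le> T then k (snd z) else 0)\<^sup>2) \<partial>N) =
    (\<integral>\<^sup>+z. (if fst z \<le> T then ennreal ((k (snd z))\<^sup>2) else 0) \<partial>N)"
    by (intro nn_integral_cong) auto
  also have "\<dots> = ennreal T * (\<integral>\<^sup>+x. ennreal ((k x)\<^sup>2) \<partial>\<nu>s)"
    using k by (intro nn_integral_cutoff_time T) measurable
  also have "\<dots> < \<infinity>" using fin by (simp add: ennreal_mult_less_top)
  finally show "integrable N (\<lambda>z. (if fst z \<le> T then k (snd z) else 0)\<^sup>2)"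
    using m by (intro integrableI_nonneg) auto
qed

lemma integral_cutoff_time:
  fixes k :: "real ^ 'd \<Rightarrow> real"
  assumes k: "k \<in> borel_measurable borel" and int: "integrable \<nu>s k" and t: "0 \<le> t"
  shows "integrable N (\<lambda>z. if fst z \<le> t then k (snd z) else 0)"
    "(LINT z|N. (if fst z \<le> t then k (snd z) else 0)) = t * (LINT x|\<nu>s. k x)"
proof -
  have m: "(\<lambda>z. if fst z \<le> t then k (snd z) else 0) \<in> borel_measurable N"
    by (rule measurable_cutoff_time[OF k])
  have "(\<integral>\<^sup>+z. ennreal (norm (if fst z \<le> t then k (snd z) else 0)) \<partial>N) =
    (\<integral>\<^sup>+z. (if fst z \<le> t then ennreal (norm (k (snd z))) else 0) \<partial>N)"
    by (intro nn_integral_cong) auto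
  also have "\<dots> = ennreal t * (\<integral>\<^sup>+x. ennreal (norm (k x)) \<partial>\<nu>s)"
    using k by (intro nn_integral_cutoff_time t) measurable
  also have "\<dots> < \<infinity>" using int by (simp add: ennreal_mult_less_top integrable_iff_bounded)
  finally show i: "integrable N (\<lambda>z. if fst z \<le> t then k (snd z) else 0)"
    using m by (intro integrableI_bounded)
  have "(LINT z|N. (if fst z \<le> t then k (snd z) else 0)) = (LINT s|half_line. LINT x|\<nu>s. (if s \<le> t then k x else 0))"
    by (rule trans[OF PS.integral_fst'[OF i, symmetric]]) (simp only: fst_conv snd_conv)
  also have "\<dots> = (LINT s|half_line. indicator {0..t} s * (LINT x|\<nu>s. k x))"
    by (intro Bochner_Integration.integral_cong) (auto simp: indicator_def)
  also have "\<dots> = t * (LINT x|\<nu>s. k x)"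
    using t by (simp add: measure_def emeasure_half_line_Icc Int_absorb1 Icc_half_line subset_iff)
  finally show "(LINT z|N. (if fst z \<le> t then k (snd z) else 0)) = t * (LINT x|\<nu>s. k x)" .
qed

text \<open>A jump is seen by the observation at \<open>t\<close> for all jump times in the interval
  from 0 to \<open>t\<close>, so the time integral contributes the factor \<open>t\<close>. With
  \<open>h = g - 1\<close> the result is the pairing with the difference of the drifts.\<close>

lemma compensated_phase_integral:
  fixes h :: "real ^ 'd \<Rightarrow> real"
  assumes h: "h \<in> borel_measurable borel"
    and fin: "(\<integral>\<^sup>+ x\<in>{x. norm x \<le> 1}. ennreal (norm x * \<bar>h x\<bar>) \<partial>\<nu>s) < \<infinity>" and u: "u \<in> times_upto T"
  shows "integrable N (\<lambda>z. (if norm (snd z) \<le> 1 then phase u z else 0) * h (snd z)) \<and>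
    (LINT z|N. (if norm (snd z) \<le> 1 then phase u z else 0) * h (snd z)) =
      (LINT x:{x. norm x \<le> 1}|\<nu>s. h x *\<^sub>R x) \<bullet> (\<Sum>p\<leftarrow>u. fst p *\<^sub>R snd p)"
  using u
proof (induction u)
  case (Cons p u)
  let ?v = "snd p" and ?t = "fst p"
  define k where "k x = (if norm x \<le> 1 then ?v \<bullet> x * h x else 0)" for x
  have t: "0 \<le> ?t" using Cons.prems by (auto simp: times_upto_def)
  have hx: "(\<lambda>x. indicator {x. norm x \<le> 1} x *\<^sub>R (h x *\<^sub>R x)) \<in> borel_measurable borel"
    using h by measurable
  have ii: "integrable \<nu>s (\<lambda>x. indicator {x. norm x \<le> 1} x *\<^sub>R (h x *\<^sub>R x))"
  proof (rule integrableI_bounded)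
    show "(\<lambda>x. indicator {x. norm x \<le> 1} x *\<^sub>R (h x *\<^sub>R x)) \<in> borel_measurable \<nu>s" by (rule borel_\<nu>s[OF hx])
    have "(\<integral>\<^sup>+ x. ennreal (norm (indicator {x. norm x \<le> 1} x *\<^sub>R (h x *\<^sub>R x))) \<partial>\<nu>s) =
      (\<integral>\<^sup>+ x\<in>{x. norm x \<le> 1}. ennreal (norm x * \<bar>h x\<bar>) \<partial>\<nu>s)"
      by (intro nn_integral_cong) (auto simp: indicator_def mult.commute)
    then show "(\<integral>\<^sup>+ x. ennreal (norm (indicator {x. norm x \<le> 1} x *\<^sub>R (h x *\<^sub>R x))) \<partial>\<nu>s) < \<infinity>" using fin by simp
  qed
  have k_eq: "k x = ?v \<bullet> (indicator {x. norm x \<le> 1} x *\<^sub>R (h x *\<^sub>R x))" for x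
    by (auto simp: k_def indicator_def)
  have km: "k \<in> borel_measurable borel" unfolding k_eq[abs_def] using hx by measurable
  have ki: "integrable \<nu>s k" unfolding k_eq[abs_def] by (rule integrable_inner_right[OF ii])
  have kint: "(LINT x|\<nu>s. k x) = ?v \<bullet> (LINT x:{x. norm x \<le> 1}|\<nu>s. h x *\<^sub>R x)"
    unfolding k_eq set_lebesgue_integral_def by (rule integral_inner_right[OF ii])
  have IH: "integrable N (\<lambda>z. (if norm (snd z) \<le> 1 then phase u z else 0) * h (snd z))"
    "(LINT z|N. (if norm (snd z) \<le> 1 then phase u z else 0) * h (snd z)) =
      (LINT x:{x. norm x \<le> 1}|\<nu>s. h x *\<^sub>R x) \<bullet> (\<Sum>p\<leftarrow>u. fst p *\<^sub>R snd p)"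
    using Cons by (auto simp: times_upto_def)
  have split: "(if norm (snd z) \<le> 1 then phase (p # u) z else 0) * h (snd z) =
    (if fst z \<le> ?t then k (snd z) else 0) + (if norm (snd z) \<le> 1 then phase u z else 0) * h (snd z)" for z
    by (auto simp: k_def algebra_simps)
  show ?case unfolding split using integral_cutoff_time[OF km ki t] IH
    by (simp add: kint inner_add_right inner_commute)
next
  case Nil
  have "(\<lambda>z. (if norm (snd z) \<le> 1 then phase [] z else 0) * h (snd z)) = (\<lambda>z. 0)"
    by (auto simp: fun_eq_iff)
  then show ?case by (simp only:) simp
qed

lemma jump_intensity_density:
  assumes \<nu>: "levy_measure \<nu>" and g: "g \<in> borel_measurable borel" and dens: "\<nu> = density \<nu>s (\<lambda>x. ennreal (g x))"
  shows "jump_intensity \<nu> = density N (\<lambda>z. ennreal (g (snd z)))"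
proof -
  have gm: "(\<lambda>x. ennreal (g x)) \<in> borel_measurable \<nu>s" using g by (intro borel_\<nu>s) measurable
  have "jump_intensity \<nu> = density half_line (\<lambda>_. 1) \<Otimes>\<^sub>M density \<nu>s (\<lambda>x. ennreal (g x))"
    by (simp add: density_1 dens)
  also have "\<dots> = density N (\<lambda>(x, y). 1 * ennreal (g y))"
    using levy_measure_sigma_finite[OF \<nu>] unfolding dens
    by (intro pair_measure_density gm \<nu>s.sigma_finite_measure_axioms) auto
  finally show ?thesis by (simp add: case_prod_unfold)
qed

text \<open>Multiplying the Levy-Khintchine integrand by \<open>g\<close> adds the jump symbol times
  \<open>g - 1\<close> and subtracts the linear compensator times \<open>g - 1\<close>. The first
  addition is integrable by Cauchy-Schwarz, the second by the first moment condition, and the second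
  is cancelled by the change of drift.\<close>

lemma levy_cf_density:
  fixes g :: "real ^ 'd \<Rightarrow> real"
  defines "h \<equiv> \<lambda>z. if fst z \<le> T then g (snd z) - 1 else 0"
  assumes \<nu>: "levy_measure \<nu>" and g: "g \<in> borel_measurable borel" and nn: "AE x in \<nu>s. 0 \<le> g x"
    and dens: "\<nu> = density \<nu>s (\<lambda>x. ennreal (g x))"
    and sq: "(\<integral>\<^sup>+ x. ennreal ((1 - g x)\<^sup>2) \<partial>\<nu>s) < \<infinity>"
    and fin: "(\<integral>\<^sup>+ x\<in>{x. norm x \<le> 1}. ennreal (norm x * \<bar>1 - g x\<bar>) \<partial>\<nu>s) < \<infinity>"
    and b: "b = bs + (LINT x:{x. norm x \<le> 1}|\<nu>s. (g x - 1) *\<^sub>R x)"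
    and u: "u \<in> times_upto T"
  shows "levy_cf b \<nu> u = levy_cf bs \<nu>s u * exp (LINT z|N. jump_symbol u z * h z)"
proof -
  let ?k = "\<lambda>x. g x - 1"
  have km: "?k \<in> borel_measurable borel" using g by measurable
  have sq': "(\<integral>\<^sup>+ x. ennreal ((?k x)\<^sup>2) \<partial>\<nu>s) < \<infinity>" using sq by (simp add: power2_commute)
  have fin': "(\<integral>\<^sup>+ x\<in>{x. norm x \<le> 1}. ennreal (norm x * \<bar>?k x\<bar>) \<partial>\<nu>s) < \<infinity>" using fin by (simp add: abs_minus_commute)
  have h: "h \<in> borel_measurable N" "integrable N (\<lambda>z. (h z)\<^sup>2)"
    unfolding h_def by (rule square_integrable_cutoff[OF km sq'])+
  interpret F: l2_family N jump_symbol "{u}" by (rule l2_family_jump_symbol) (use u in auto)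
  have i1: "integrable N (\<lambda>z. jump_symbol u z * h z)" using F.integrable_pairing[OF h] by simp
  note cp = compensated_phase_integral[OF km fin' u]
  have nnN: "AE z in N. 0 \<le> g (snd z)"
  proof (rule PS.AE_pair_measure)
    show "{z \<in> space N. 0 \<le> g (snd z)} \<in> sets N"
      using measurable_compose[OF snd_measurable g] by measurable
    show "AE s in half_line. AE x in \<nu>s. 0 \<le> g (snd (s, x))" using nn by simp
  qed
  have gm: "(\<lambda>z. g (snd z)) \<in> borel_measurable N" by (rule measurable_compose[OF snd_measurable g])
  have lm: "levy_integrand u \<in> borel_measurable N" by (rule measurable_levy_integrand[OF levy_measure_sets[OF levy]])
  have li: "integrable N (levy_integrand u)" by (rule integrable_levy_integrand[OF levy times_upto_nonneg[OF u]])
  have lg: "integrable N (\<lambda>z. g (snd z) *\<^sub>R levy_integrand u z)"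
    using integrable_levy_integrand[OF \<nu> times_upto_nonneg[OF u]]
    unfolding jump_intensity_density[OF \<nu> g dens] by (subst (asm) integrable_density[OF lm gm nnN])
  have "(LINT z|jump_intensity \<nu>. levy_integrand u z) = (LINT z|N. g (snd z) *\<^sub>R levy_integrand u z)"
    unfolding jump_intensity_density[OF \<nu> g dens] by (rule integral_density[OF lm gm nnN])
  also have "\<dots> = (LINT z|N. levy_integrand u z + (jump_symbol u z * h z - \<i> * of_real ((if norm (snd z) \<le> 1 then phase u z else 0) * ?k (snd z))))"
  proof (rule Bochner_Integration.integral_cong[OF refl])
    fix z
    have uT: "\<forall>p\<in>set u. fst p \<le> T" using u by (auto simp: times_upto_def)
    show "g (snd z) *\<^sub>R levy_integrand u z = levy_integrand u z + (jump_symbol u z * h z - \<i> * of_real ((if norm (snd z) \<le> 1 then phase u z else 0) * ?k (snd z)))"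
    proof (cases "fst z \<le> T")
      case True
      then show ?thesis by (auto simp: levy_integrand_def jump_symbol_def h_def scaleR_conv_of_real algebra_simps)
    next
      \<comment> \<open>After \<open>T\<close> the phase vanishes, so the truncation of
        \<open>h\<close> there changes nothing.\<close>
      case False
      then have "phase u z = 0" using tail_sum_eq_0[OF uT, of "fst z"] by (simp add: phase_def)
      then show ?thesis by (simp add: levy_integrand_def jump_symbol_def h_def)
    qed
  qed
  also have "\<dots> = (LINT z|N. levy_integrand u z) + ((LINT z|N. jump_symbol u z * h z) -
     \<i> * of_real (LINT z|N. (if norm (snd z) \<le> 1 then phase u z else 0) * ?k (snd z)))"
  proof -
    have i2: "integrable N (\<lambda>z. \<i> * of_real ((if norm (snd z) \<le> 1 then phase u z else 0) * ?k (snd z)))"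
      using cp by (intro integrable_mult_right integrable_of_real) blast
    show ?thesis
      unfolding Bochner_Integration.integral_add[OF li Bochner_Integration.integrable_diff[OF i1 i2]]
        Bochner_Integration.integral_diff[OF i1 i2]
      by (simp only: integral_mult_right_zero integral_complex_of_real)
  qed
  also have "(LINT z|N. (if norm (snd z) \<le> 1 then phase u z else 0) * ?k (snd z)) = (b - bs) \<bullet> (\<Sum>p\<leftarrow>u. fst p *\<^sub>R snd p)"
    using cp b by simp
  finally show ?thesis unfolding levy_cf_def exp_add[symmetric] by (simp add: inner_diff_left algebra_simps)
qed

end

section \<open>Differences and added Poissonian jumps\<close>

text \<open>The iterated difference with all signs replaced by plus, as an extended nonnegative
  number: a majorant that can be integrated before anything is known about integrability of shifted
  functionals.\<close>

primrec sumdiff :: "(real \<times> (real ^ 'd)) list \<Rightarrow> ((real \<Rightarrow> real ^ 'd) \<Rightarrow> ennreal) \<Rightarrow> (real \<Rightarrow> real ^ 'd) \<Rightarrow> ennreal" where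
  "sumdiff [] F w = F w"
| "sumdiff (z # zs) F w = sumdiff zs F (add_jump z w) + sumdiff zs F w"

lemma abs_difference_le_sumdiff: "ennreal \<bar>difference zs f w\<bar> \<le> sumdiff zs (\<lambda>w. ennreal \<bar>f w\<bar>) w"
proof (induction zs arbitrary: w)
  case (Cons z zs)
  have "ennreal \<bar>difference (z # zs) f w\<bar> \<le> ennreal (\<bar>difference zs f (add_jump z w)\<bar> + \<bar>difference zs f w\<bar>)"
    by (intro ennreal_leI) simp
  also have "\<dots> = ennreal \<bar>difference zs f (add_jump z w)\<bar> + ennreal \<bar>difference zs f w\<bar>"
    by simp
  also have "\<dots> \<le> sumdiff (z # zs) (\<lambda>w. ennreal \<bar>f w\<bar>) w"
    unfolding sumdiff.simps by (intro add_mono Cons.IH)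
  finally show ?case .
qed simp

text \<open>The last jump is moved from the list into the functional. This is the coordinate that is
  split off when the product integral is reduced by one.\<close>

lemma sumdiff_snoc: "sumdiff (zs @ [z]) F w = sumdiff zs (\<lambda>w. F (add_jump z w) + F w) w"
  by (induction zs arbitrary: w) auto

lemma add_jump_measurable:
  assumes N: "sets N = sets borel" and z: "z \<in> measurable A (half_line \<Otimes>\<^sub>M N)" and w: "w \<in> measurable A product_space"
  shows "(\<lambda>a. add_jump (z a) (w a)) \<in> measurable A product_space"
  unfolding add_jump_def
proof (rule measurable_restrict)
  fix t :: real assume t: "t \<in> {0..}"
  have [measurable]: "(\<lambda>a. fst (z a)) \<in> borel_measurable A" by (rule measurable_compose[OF z measurable_fst_jump])
  have [measurable]: "(\<lambda>a. snd (z a)) \<in> borel_measurable A" by (rule measurable_compose[OF z measurable_snd_jump[OF N]])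
  have [measurable]: "(\<lambda>a. w a t) \<in> borel_measurable A" by (rule measurable_compose[OF w measurable_component_singleton[OF t]])
  show "(\<lambda>a. w a t + (if fst (z a) \<le> t then snd (z a) else 0)) \<in> borel_measurable A" by measurable
qed

lemma add_jump_space: "add_jump z w \<in> space product_space"
  by (auto simp: add_jump_def space_PiM)

text \<open>The path is an arbitrary measurable function of the parameter because the recursion
  moves jumps, which depend on the parameter, into it.\<close>

lemma jumps_measurable:
  assumes N: "sets N = sets borel" and Z: "Z \<in> measurable A (PiM {..<n} (\<lambda>_. half_line \<Otimes>\<^sub>M N))"
    and ix: "set ix \<subseteq> {..<n}" and w: "w \<in> measurable A product_space"
  shows "F \<in> borel_measurable product_space \<Longrightarrow> (\<lambda>a. sumdiff (map (Z a) ix) F (w a)) \<in> borel_measurable A"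
    "f \<in> borel_measurable product_space \<Longrightarrow> (\<lambda>a. difference (map (Z a) ix) f (w a)) \<in> borel_measurable A"
proof -
  have Zi: "(\<lambda>a. Z a i) \<in> measurable A (half_line \<Otimes>\<^sub>M N)" if "i < n" for i
    by (rule measurable_compose[OF Z measurable_component_singleton]) (use that in simp)
  show "(\<lambda>a. sumdiff (map (Z a) ix) F (w a)) \<in> borel_measurable A" if F: "F \<in> borel_measurable product_space"
    using ix w
  proof (induction ix arbitrary: w)
    case Nil
    then show ?case using measurable_compose[OF Nil(2) F] by simp
  next
    case (Cons i ix)
    have "(\<lambda>a. add_jump (Z a i) (w a)) \<in> measurable A product_space"
      using Cons.prems by (intro add_jump_measurable[OF N] Zi) auto
    then show ?case using Cons by auto
  qed
  show "(\<lambda>a. difference (map (Z a) ix) f (w a)) \<in> borel_measurable A" if f: "f \<in> borel_measurable product_space"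
    using ix w
  proof (induction ix arbitrary: w)
    case Nil
    then show ?case using measurable_compose[OF Nil(2) f] by simp
  next
    case (Cons i ix)
    have "(\<lambda>a. add_jump (Z a i) (w a)) \<in> measurable A product_space"
      using Cons.prems by (intro add_jump_measurable[OF N] Zi) auto
    then show ?case using Cons by auto
  qed
qed

lemma expo_add_jump:
  assumes "\<forall>p\<in>set u. 0 \<le> fst p"
  shows "expo u (add_jump z w) = expo u w * (1 + jump_symbol u z)"
proof -
  have "path_pairing u (add_jump z w) = path_pairing u w + phase u z"
    using assms by (induction u) (auto simp: add_jump_def inner_add_right)
  then show ?thesis by (simp add: expo_def jump_symbol_def cis_mult)
qed

context reference_law
begin

interpretation NN: sigma_finite_measure N by (rule sigma_finite_jump_intensity[OF levy])
interpretation PN: product_sigma_finite "\<lambda>_::nat. N" by (intro product_sigma_finite.intro NN.sigma_finite_measure_axioms)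

text \<open>
  Integrable against the jump intensity, yet nowhere zero up to time \<open>T\<close>: the value \<open>1\<close> at jump size \<open>0\<close>, a null
  set, allows dividing by it without exceptions.
\<close>

definition base_weight :: "real \<times> (real ^ 'd) \<Rightarrow> real" where
  "base_weight z = (if fst z \<le> T then (if snd z = 0 then 1 else min ((norm (snd z))\<^sup>2) 1) else 0)"

lemma base_weight_bounds: "0 \<le> base_weight z" "base_weight z \<le> 1"
  by (auto simp: base_weight_def)

lemma base_weight_pos: "fst z \<le> T \<Longrightarrow> 0 < base_weight z"
  by (auto simp: base_weight_def)

lemma base_weight_measurable: "base_weight \<in> borel_measurable N"
proof -
  have [measurable]: "snd \<in> borel_measurable N" by (rule measurable_snd_jump[OF levy_measure_sets[OF levy]])
  show ?thesis unfolding base_weight_def[abs_def] by measurable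
qed

lemma base_weight_integrable: "integrable N base_weight"
proof (rule integrableI_nonneg)
  interpret \<nu>s: sigma_finite_measure \<nu>s by (rule levy_measure_sigma_finite[OF levy])
  let ?f = "\<lambda>x :: real ^ 'd. if x = 0 then 1 else min ((norm x)\<^sup>2) 1"
  have fm: "(\<lambda>x. ennreal (?f x)) \<in> borel_measurable \<nu>s"
    unfolding levy_measure_borel[OF levy] by measurable
  have "(\<integral>\<^sup>+ z. ennreal (base_weight z) \<partial>N) = (\<integral>\<^sup>+ z. indicator {0..T} (fst z) * ennreal (?f (snd z)) \<partial>N)"
    by (intro nn_integral_cong) (auto simp: base_weight_def space_pair_measure)
  also have "\<dots> = ennreal T * (\<integral>\<^sup>+ x. ennreal (?f x) \<partial>\<nu>s)"
    by (rule nn_integral_time_product[OF \<nu>s.sigma_finite_measure_axioms fm T])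
  also have "(\<integral>\<^sup>+ x. ennreal (?f x) \<partial>\<nu>s) = (\<integral>\<^sup>+ x. ennreal (min ((norm x)\<^sup>2) 1) \<partial>\<nu>s)"
  proof (rule nn_integral_cong_AE)
    have "AE x in \<nu>s. x \<notin> {0}" using levy_measure_zero[OF levy] levy_measure_sets[OF levy]
      by (intro AE_not_in) (auto simp: null_sets_def)
    then show "AE x in \<nu>s. ennreal (?f x) = ennreal (min ((norm x)\<^sup>2) 1)" by eventually_elim simp
  qed
  also have "ennreal T * \<dots> < \<infinity>" using levy unfolding levy_measure_def by (simp add: ennreal_mult_less_top)
  finally show "(\<integral>\<^sup>+ z. ennreal (base_weight z) \<partial>N) < \<infinity>" .
qed (auto simp: base_weight_bounds base_weight_measurable)

lemma base_weight_square_integrable: "integrable N (\<lambda>z. (base_weight z)\<^sup>2)"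
proof (rule Bochner_Integration.integrable_bound[OF base_weight_integrable])
  show "(\<lambda>z. (base_weight z)\<^sup>2) \<in> borel_measurable N" using base_weight_measurable by measurable
  show "AE z in N. norm ((base_weight z)\<^sup>2) \<le> norm (base_weight z)"
    using base_weight_bounds by (auto simp: power2_eq_square mult_left_le_one_le)
qed

text \<open>One signless difference step integrated over the jump. Its \<open>n\<close>-th iterate
  is the weighted integral of all signless differences of order \<open>n\<close>, and it acts on
  functionals without reference to the list of jumps.\<close>

definition shift_sum :: "((real \<Rightarrow> real ^ 'd) \<Rightarrow> ennreal) \<Rightarrow> (real \<Rightarrow> real ^ 'd) \<Rightarrow> ennreal" where
  "shift_sum F w = (\<integral>\<^sup>+z. ennreal (base_weight z) * (F (add_jump z w) + F w) \<partial>N)"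

lemma add_jump_pair_measurable:
  "(\<lambda>x. add_jump (snd x) (fst x)) \<in> measurable (product_space \<Otimes>\<^sub>M N) product_space"
  by (rule add_jump_measurable[OF levy_measure_sets[OF levy]]) auto

lemma shift_sum_measurable:
  assumes F: "F \<in> borel_measurable product_space" shows "shift_sum F \<in> borel_measurable product_space"
proof -
  have [measurable]: "(\<lambda>x. F (add_jump (snd x) (fst x))) \<in> borel_measurable (product_space \<Otimes>\<^sub>M N)"
    by (rule measurable_compose[OF add_jump_pair_measurable F])
  note [measurable] = F base_weight_measurable
  have "(\<lambda>(w, z). ennreal (base_weight z) * (F (add_jump z w) + F w)) \<in> borel_measurable (product_space \<Otimes>\<^sub>M N)"
    unfolding case_prod_unfold by measurable
  from NN.borel_measurable_nn_integral[OF this] show ?thesis unfolding shift_sum_def[abs_def] .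
qed

lemma shift_sum_funpow_measurable:
  "F \<in> borel_measurable product_space \<Longrightarrow> (shift_sum ^^ n) F \<in> borel_measurable product_space"
  by (induction n) (auto intro: shift_sum_measurable)

lemma add_jump_measurable_jump: "w \<in> space product_space \<Longrightarrow> (\<lambda>z. add_jump z w) \<in> measurable N product_space"
  by (rule add_jump_measurable[OF levy_measure_sets[OF levy]]) auto

lemma sumdiff_measurable_jump:
  assumes "\<And>w. w \<in> space product_space \<Longrightarrow> (\<lambda>z. H z w) \<in> borel_measurable N" "w \<in> space product_space"
  shows "(\<lambda>z. sumdiff zs (H z) w) \<in> borel_measurable N"
  using assms(2) by (induction zs arbitrary: w) (auto intro!: assms(1) add_jump_space borel_measurable_add)

lemma sumdiff_shift_sum:
  assumes F: "F \<in> borel_measurable product_space" and w: "w \<in> space product_space"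
  shows "(\<integral>\<^sup>+z. ennreal (base_weight z) * sumdiff zs (\<lambda>w. F (add_jump z w) + F w) w \<partial>N) = sumdiff zs (shift_sum F) w"
  using w
proof (induction zs arbitrary: w)
  case Nil
  then show ?case by (simp add: shift_sum_def)
next
  case (Cons z' zs)
  let ?H = "\<lambda>z w. F (add_jump z w) + F w"
  have H: "(\<lambda>z. ?H z w) \<in> borel_measurable N" if "w \<in> space product_space" for w
    using measurable_compose[OF add_jump_measurable_jump[OF that] F] by measurable
  have m: "(\<lambda>z. ennreal (base_weight z) * sumdiff zs (?H z) w) \<in> borel_measurable N" if "w \<in> space product_space" for w
    using sumdiff_measurable_jump[OF H that] base_weight_measurable by measurable
  have "(\<integral>\<^sup>+z. ennreal (base_weight z) * sumdiff (z' # zs) (?H z) w \<partial>N) =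
    (\<integral>\<^sup>+z. ennreal (base_weight z) * sumdiff zs (?H z) (add_jump z' w) + ennreal (base_weight z) * sumdiff zs (?H z) w \<partial>N)"
    by (simp add: distrib_left)
  also have "\<dots> = sumdiff zs (shift_sum F) (add_jump z' w) + sumdiff zs (shift_sum F) w"
    by (subst nn_integral_add[OF m m]) (simp_all add: Cons add_jump_space)
  finally show ?case by simp
qed

text \<open>Integrating out the last coordinate turns \<open>F\<close> into
  \<open>shift_sum F\<close> and lowers the order by one; hence \<open>F\<close> is generalized in
  the induction while \<open>w\<close> stays fixed.\<close>

lemma sumdiff_power_integral:
  assumes "F \<in> borel_measurable product_space" and w: "w \<in> space product_space"
  shows "(\<integral>\<^sup>+z. ennreal (\<Prod>j<n. base_weight (z j)) * sumdiff (map z [0..<n]) F w \<partial>PiM {..<n} (\<lambda>_. N)) = (shift_sum ^^ n) F w"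
  using assms(1)
proof (induction n arbitrary: F)
  case 0
  show ?case by (simp add: nn_integral_empty PiM_empty nn_integral_count_space_finite)
next
  case (Suc n)
  let ?f = "\<lambda>z. ennreal (\<Prod>j<Suc n. base_weight (z j)) * sumdiff (map z [0..<Suc n]) F w"
  have idm: "(\<lambda>z. z) \<in> measurable (PiM {..<Suc n} (\<lambda>_. N)) (PiM {..<Suc n} (\<lambda>_. N))" by simp
  have m1: "(\<lambda>z. sumdiff (map z [0..<Suc n]) F w) \<in> borel_measurable (PiM {..<Suc n} (\<lambda>_. N))"
    by (rule jumps_measurable(1)[OF levy_measure_sets[OF levy] idm _ measurable_const[OF w] Suc.prems]) auto
  have m2: "(\<lambda>z. \<Prod>j<Suc n. base_weight (z j)) \<in> borel_measurable (PiM {..<Suc n} (\<lambda>_. N))"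
  proof (rule borel_measurable_prod)
    fix j assume j: "j \<in> {..<Suc n}"
    show "(\<lambda>z. base_weight (z j)) \<in> borel_measurable (PiM {..<Suc n} (\<lambda>_. N))"
      by (rule measurable_compose[OF measurable_component_singleton[OF j] base_weight_measurable])
  qed
  have fm: "?f \<in> borel_measurable (PiM (insert n {..<n}) (\<lambda>_. N))"
    using m1 m2 unfolding lessThan_Suc by measurable
  have "(\<integral>\<^sup>+z. ?f z \<partial>PiM {..<Suc n} (\<lambda>_. N)) = (\<integral>\<^sup>+x. \<integral>\<^sup>+y. ?f (x(n := y)) \<partial>N \<partial>PiM {..<n} (\<lambda>_. N))"
    unfolding lessThan_Suc using fm[unfolded lessThan_Suc] by (intro PN.product_nn_integral_insert) (simp_all add: lessThan_Suc)
  also have "\<dots> = (\<integral>\<^sup>+x. ennreal (\<Prod>j<n. base_weight (x j)) * sumdiff (map x [0..<n]) (shift_sum F) w \<partial>PiM {..<n} (\<lambda>_. N))"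
  proof (rule nn_integral_cong)
    fix x :: "nat \<Rightarrow> real \<times> (real ^ 'd)"
    have map: "map (x(n := y)) [0..<Suc n] = map x [0..<n] @ [y]" for y by auto
    have pr: "(\<Prod>j<Suc n. base_weight ((x(n := y)) j)) = (\<Prod>j<n. base_weight (x j)) * base_weight y" for y by simp
    have Hm: "(\<lambda>z. F (add_jump z w) + F w) \<in> borel_measurable N" if "w \<in> space product_space" for w
      using measurable_compose[OF add_jump_measurable_jump[OF that] Suc.prems] by measurable
    have m: "(\<lambda>y. ennreal (base_weight y) * sumdiff (map x [0..<n]) (\<lambda>w. F (add_jump y w) + F w) w) \<in> borel_measurable N"
      using sumdiff_measurable_jump[OF Hm w] base_weight_measurable by measurable
    have "(\<integral>\<^sup>+y. ?f (x(n := y)) \<partial>N) = (\<integral>\<^sup>+y. ennreal (\<Prod>j<n. base_weight (x j)) * (ennreal (base_weight y) * sumdiff (map x [0..<n]) (\<lambda>w. F (add_jump y w) + F w) w) \<partial>N)"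
      unfolding map pr sumdiff_snoc by (simp add: ennreal_mult base_weight_bounds prod_nonneg mult.assoc)
    also have "\<dots> = ennreal (\<Prod>j<n. base_weight (x j)) * sumdiff (map x [0..<n]) (shift_sum F) w"
      by (subst nn_integral_cmult[OF m]) (simp add: sumdiff_shift_sum[OF Suc.prems w])
    finally show "(\<integral>\<^sup>+y. ?f (x(n := y)) \<partial>N) = ennreal (\<Prod>j<n. base_weight (x j)) * sumdiff (map x [0..<n]) (shift_sum F) w" .
  qed
  also have "\<dots> = (shift_sum ^^ n) (shift_sum F) w" by (rule Suc.IH[OF shift_sum_measurable[OF Suc.prems]])
  also have "\<dots> = (shift_sum ^^ Suc n) F w" by (simp add: funpow_swap1)
  finally show ?case .
qed

section \<open>Independent extra jumps in Poissonian number\<close>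

definition total_weight :: real where "total_weight = (LINT z|N. base_weight z)"

text \<open>If \<open>total_weight\<close> is 0 the quotient is 0 by convention and this is the zero
  measure rather than a probability; that case is treated separately.\<close>

definition jump_law :: "(real \<times> (real ^ 'd)) measure" where
  "jump_law = density N (\<lambda>z. ennreal (base_weight z / total_weight))"

primrec jump_iterate :: "(real \<Rightarrow> real ^ 'd) measure \<Rightarrow> nat \<Rightarrow> (real \<Rightarrow> real ^ 'd) measure" where
  "jump_iterate Q 0 = Q"
| "jump_iterate Q (Suc n) = distr (jump_iterate Q n \<Otimes>\<^sub>M jump_law) product_space (\<lambda>x. add_jump (snd x) (fst x))"

text \<open>A compound Poisson perturbation in the form of a mixture over the number of jumps. The
  mixture form shows each fixed number of jumps as a component with positive weight.\<close>

definition poisson_shift :: "(real \<Rightarrow> real ^ 'd) measure \<Rightarrow> (real \<Rightarrow> real ^ 'd) measure" where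
  "poisson_shift Q = measure_pmf (poisson_pmf total_weight) \<bind> jump_iterate Q"

context
  assumes c: "0 < total_weight"
begin

lemma jump_law_prob: "prob_space jump_law"
proof
  have "emeasure jump_law (space jump_law) = (\<integral>\<^sup>+z. ennreal (base_weight z / total_weight) \<partial>N)"
    unfolding jump_law_def using base_weight_measurable by (subst emeasure_density) (auto intro!: nn_integral_cong)
  also have "\<dots> = ennreal (LINT z|N. base_weight z / total_weight)"
    using c by (intro nn_integral_eq_integral) (auto simp: base_weight_integrable base_weight_bounds)
  also have "\<dots> = 1" using c by (simp add: total_weight_def[symmetric])
  finally show "emeasure jump_law (space jump_law) = 1" .
qed

lemma jump_law_sets: "sets jump_law = sets N"
  by (simp add: jump_law_def)

lemma nn_integral_jump_law:
  assumes "f \<in> borel_measurable N"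
  shows "ennreal total_weight * (\<integral>\<^sup>+z. f z \<partial>jump_law) = (\<integral>\<^sup>+z. ennreal (base_weight z) * f z \<partial>N)"
proof -
  have m: "(\<lambda>z. ennreal (base_weight z / total_weight)) \<in> borel_measurable N" using base_weight_measurable by measurable
  have "ennreal total_weight * (\<integral>\<^sup>+z. f z \<partial>jump_law) = (\<integral>\<^sup>+z. ennreal total_weight * (ennreal (base_weight z / total_weight) * f z) \<partial>N)"
    unfolding jump_law_def nn_integral_density[OF m assms]
    by (intro nn_integral_cmult[symmetric] borel_measurable_times_ennreal m assms)
  also have "\<dots> = (\<integral>\<^sup>+z. ennreal (base_weight z) * f z \<partial>N)"
  proof (rule nn_integral_cong)
    fix z
    have "ennreal total_weight * (ennreal (base_weight z / total_weight) * f z) = ennreal (total_weight * (base_weight z / total_weight)) * f z"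
      using c base_weight_bounds[of z] by (subst ennreal_mult) (simp_all add: mult.assoc)
    then show "ennreal total_weight * (ennreal (base_weight z / total_weight) * f z) = ennreal (base_weight z) * f z"
      using c by simp
  qed
  finally show ?thesis .
qed

context
  fixes Q and h
  assumes Q: "dominated_law h Q"
begin

lemma iterate_prob: "prob_space (jump_iterate Q n)" and iterate_sets: "sets (jump_iterate Q n) = sets product_space"
proof (induction n)
  case 0
  show "prob_space (jump_iterate Q 0)" "sets (jump_iterate Q 0) = sets product_space" using Q by (auto simp: dominated_law_def)
next
  case (Suc n)
  interpret J: prob_space jump_law by (rule jump_law_prob)
  interpret I: prob_space "jump_iterate Q n" by (rule Suc(1))
  interpret PP: pair_prob_space "jump_iterate Q n" jump_law ..
  have "sets (jump_iterate Q n \<Otimes>\<^sub>M jump_law) = sets (product_space \<Otimes>\<^sub>M N)"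
    using Suc(2) jump_law_sets by (intro sets_pair_measure_cong)
  then have "(\<lambda>x. add_jump (snd x) (fst x)) \<in> measurable (jump_iterate Q n \<Otimes>\<^sub>M jump_law) product_space"
    using add_jump_pair_measurable measurable_cong_sets by blast
  then show "prob_space (jump_iterate Q (Suc n))" by (simp add: PP.prob_space_distr)
  show "sets (jump_iterate Q (Suc n)) = sets product_space" by simp
qed

lemma iterate_pair_measurable:
  "(\<lambda>x. add_jump (snd x) (fst x)) \<in> measurable (jump_iterate Q n \<Otimes>\<^sub>M jump_law) product_space"
proof -
  have "sets (jump_iterate Q n \<Otimes>\<^sub>M jump_law) = sets (product_space \<Otimes>\<^sub>M N)"
    using iterate_sets jump_law_sets by (intro sets_pair_measure_cong)
  then show ?thesis using add_jump_pair_measurable measurable_cong_sets by blast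
qed

lemma iterate_measurable: "f \<in> borel_measurable product_space \<Longrightarrow> f \<in> borel_measurable (jump_iterate Q n)"
  using measurable_cong_sets[OF iterate_sets refl] by blast

lemma nn_integral_iterate_Suc:
  assumes F: "F \<in> borel_measurable product_space"
  shows "(\<integral>\<^sup>+w. F w \<partial>jump_iterate Q (Suc n)) = (\<integral>\<^sup>+w. \<integral>\<^sup>+z. F (add_jump z w) \<partial>jump_law \<partial>jump_iterate Q n)"
proof -
  interpret J: prob_space jump_law by (rule jump_law_prob)
  have "(\<integral>\<^sup>+w. F w \<partial>jump_iterate Q (Suc n)) = (\<integral>\<^sup>+x. F (add_jump (snd x) (fst x)) \<partial>(jump_iterate Q n \<Otimes>\<^sub>M jump_law))"
    unfolding jump_iterate.simps by (rule nn_integral_distr[OF iterate_pair_measurable]) (simp add: F)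
  also have "\<dots> = (\<integral>\<^sup>+w. \<integral>\<^sup>+z. F (add_jump z w) \<partial>jump_law \<partial>jump_iterate Q n)"
    using J.nn_integral_fst[of "\<lambda>x. F (add_jump (snd x) (fst x))" "jump_iterate Q n"]
      measurable_compose[OF iterate_pair_measurable F] by simp
  finally show ?thesis .
qed

text \<open>One signless step either adds a jump, leading from \<open>n\<close> to
  \<open>n + 1\<close> independent jumps, or adds none; \<open>total_weight\<close> undoes the
  normalization of \<open>jump_law\<close>.\<close>

lemma shift_sum_iterate:
  assumes F: "F \<in> borel_measurable product_space"
  shows "(\<integral>\<^sup>+w. shift_sum F w \<partial>jump_iterate Q n) =
    ennreal total_weight * (\<integral>\<^sup>+w. F w \<partial>jump_iterate Q (Suc n)) + ennreal total_weight * (\<integral>\<^sup>+w. F w \<partial>jump_iterate Q n)"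
proof -
  interpret J: prob_space jump_law by (rule jump_law_prob)
  have sp: "space (jump_iterate Q n) = space product_space" using sets_eq_imp_space_eq[OF iterate_sets] .
  have eq: "shift_sum F w = ennreal total_weight * (\<integral>\<^sup>+z. F (add_jump z w) \<partial>jump_law) + ennreal total_weight * F w"
    if w: "w \<in> space product_space" for w
  proof -
    have m: "(\<lambda>z. F (add_jump z w)) \<in> borel_measurable N" by (rule measurable_compose[OF add_jump_measurable_jump[OF w] F])
    then have m': "(\<lambda>z. F (add_jump z w)) \<in> borel_measurable jump_law" using measurable_cong_sets[OF jump_law_sets refl] by blast
    have "shift_sum F w = ennreal total_weight * (\<integral>\<^sup>+z. F (add_jump z w) + F w \<partial>jump_law)"
      unfolding shift_sum_def by (intro nn_integral_jump_law[symmetric] borel_measurable_add borel_measurable_const m)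
    also have "\<dots> = ennreal total_weight * ((\<integral>\<^sup>+z. F (add_jump z w) \<partial>jump_law) + F w)"
      using m' by (subst nn_integral_add) (simp_all add: J.emeasure_space_1)
    finally show ?thesis by (simp add: distrib_left)
  qed
  have m1: "(\<lambda>w. \<integral>\<^sup>+z. F (add_jump z w) \<partial>jump_law) \<in> borel_measurable (jump_iterate Q n)"
    using J.borel_measurable_nn_integral[of "\<lambda>w z. F (add_jump z w)" "jump_iterate Q n"]
      measurable_compose[OF iterate_pair_measurable F] by (simp add: case_prod_unfold)
  note [measurable] = m1 iterate_measurable[OF F]
  have "(\<integral>\<^sup>+w. shift_sum F w \<partial>jump_iterate Q n) = (\<integral>\<^sup>+w. ennreal total_weight * (\<integral>\<^sup>+z. F (add_jump z w) \<partial>jump_law) + ennreal total_weight * F w \<partial>jump_iterate Q n)"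
    by (intro nn_integral_cong eq) (simp add: sp)
  also have "\<dots> = ennreal total_weight * (\<integral>\<^sup>+w. \<integral>\<^sup>+z. F (add_jump z w) \<partial>jump_law \<partial>jump_iterate Q n) + ennreal total_weight * (\<integral>\<^sup>+w. F w \<partial>jump_iterate Q n)"
    by (subst nn_integral_add) (auto simp: nn_integral_cmult)
  finally show ?thesis unfolding nn_integral_iterate_Suc[OF F] .
qed

text \<open>An added jump multiplies the exponential by 1 plus its symbol. The jumps are independent
  of the path and of each other, so the means of these factors multiply.\<close>

lemma iterate_expo:
  assumes u: "u \<in> times_upto T"
  shows "(LINT w|jump_iterate Q n. expo u w) = (LINT w|Q. expo u w) * (1 + (LINT z|N. jump_symbol u z * base_weight z) / total_weight) ^ n"
proof (induction n)
  case (Suc n)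
  interpret J: prob_space jump_law by (rule jump_law_prob)
  interpret I: prob_space "jump_iterate Q n" by (rule iterate_prob)
  interpret PP: pair_prob_space "jump_iterate Q n" jump_law ..
  interpret F: l2_family N jump_symbol "{u}" by (rule l2_family_jump_symbol) (use u in auto)
  have em: "expo u \<in> borel_measurable product_space" by (rule expo_measurable[OF u])
  have jm: "jump_symbol u \<in> borel_measurable N" by (rule jump_symbol_measurable[OF levy_measure_sets[OF levy]])
  have jm': "jump_symbol u \<in> borel_measurable jump_law" using jm measurable_cong_sets[OF jump_law_sets refl] by blast
  have ji: "integrable jump_law (jump_symbol u)"
    using jm' norm_cis_minus_1' by (intro J.integrable_const_bound[of _ 2]) (auto simp: jump_symbol_def)
  have m: "(\<lambda>x. expo u (add_jump (snd x) (fst x))) \<in> borel_measurable (jump_iterate Q n \<Otimes>\<^sub>M jump_law)"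
    by (rule measurable_compose[OF iterate_pair_measurable em])
  have i: "integrable (jump_iterate Q n \<Otimes>\<^sub>M jump_law) (\<lambda>x. expo u (add_jump (snd x) (fst x)))"
    using m by (intro PP.integrable_const_bound[of _ 1]) auto
  have "(LINT w|jump_iterate Q (Suc n). expo u w) = (LINT x|(jump_iterate Q n \<Otimes>\<^sub>M jump_law). expo u (add_jump (snd x) (fst x)))"
    unfolding jump_iterate.simps by (rule integral_distr[OF iterate_pair_measurable em])
  also have "\<dots> = (LINT w|jump_iterate Q n. LINT z|jump_law. expo u (add_jump z w))"
    using PP.integral_fst'[OF i] by simp
  also have "\<dots> = (LINT w|jump_iterate Q n. expo u w * (1 + (LINT z|jump_law. jump_symbol u z)))"
  proof (rule Bochner_Integration.integral_cong[OF refl])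
    fix w
    have "(LINT z|jump_law. expo u (add_jump z w)) = (LINT z|jump_law. expo u w * (1 + jump_symbol u z))"
      by (simp only: expo_add_jump[OF times_upto_nonneg[OF u]])
    also have "\<dots> = expo u w * (LINT z|jump_law. 1 + jump_symbol u z)" by simp
    also have "(LINT z|jump_law. 1 + jump_symbol u z) = 1 + (LINT z|jump_law. jump_symbol u z)"
      using ji by (subst Bochner_Integration.integral_add) (auto simp: J.prob_space)
    finally show "(LINT z|jump_law. expo u (add_jump z w)) = expo u w * (1 + (LINT z|jump_law. jump_symbol u z))" .
  qed
  also have "\<dots> = (LINT w|jump_iterate Q n. expo u w) * (1 + (LINT z|jump_law. jump_symbol u z))" by simp
  also have "(LINT z|jump_law. jump_symbol u z) = (LINT z|N. (base_weight z / total_weight) *\<^sub>R jump_symbol u z)"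
    unfolding jump_law_def using c base_weight_bounds base_weight_measurable jm by (intro integral_density) auto
  also have "\<dots> = (LINT z|N. (jump_symbol u z * base_weight z) / total_weight)"
    by (intro Bochner_Integration.integral_cong refl) (simp add: scaleR_conv_of_real)
  also have "\<dots> = (LINT z|N. jump_symbol u z * base_weight z) / total_weight" by simp
  finally show ?case using Suc by simp
qed simp

lemma iterate_kernel: "jump_iterate Q \<in> measurable (measure_pmf p) (subprob_algebra product_space)"
proof (rule measurableI)
  fix n
  have "jump_iterate Q n \<in> space (subprob_algebra (jump_iterate Q n))"
    using prob_space.M_in_subprob[OF iterate_prob] .
  then show "jump_iterate Q n \<in> space (subprob_algebra product_space)"
    using subprob_algebra_cong[OF iterate_sets] by simp
qed simp

lemma poisson_shift_sets: "sets (poisson_shift Q) = sets product_space"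
  unfolding poisson_shift_def by (rule sets_bind) (auto simp: iterate_sets)

lemma poisson_shift_prob: "prob_space (poisson_shift Q)"
  unfolding poisson_shift_def
  by (rule prob_space.prob_space_bind[OF prob_space_measure_pmf _ iterate_kernel]) (simp add: iterate_prob)

text \<open>One term of the mixture is at most the whole, and the constant is the reciprocal of the
  Poisson weight of \<open>n\<close>.\<close>

lemma iterate_le_poisson_shift:
  assumes F: "F \<in> borel_measurable product_space"
  shows "(\<integral>\<^sup>+w. F w \<partial>jump_iterate Q n) \<le> ennreal (exp total_weight * fact n / total_weight ^ n) * (\<integral>\<^sup>+w. F w \<partial>poisson_shift Q)"
proof -
  let ?a = "total_weight ^ n / fact n * exp (- total_weight)"
  have "(\<integral>\<^sup>+w. F w \<partial>poisson_shift Q) = (\<integral>\<^sup>+n. (\<integral>\<^sup>+w. F w \<partial>jump_iterate Q n) \<partial>measure_pmf (poisson_pmf total_weight))"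
    unfolding poisson_shift_def by (rule nn_integral_bind[OF F iterate_kernel])
  also have "\<dots> = (\<integral>\<^sup>+n. ennreal (pmf (poisson_pmf total_weight) n) * (\<integral>\<^sup>+w. F w \<partial>jump_iterate Q n) \<partial>count_space UNIV)"
    by (rule nn_integral_measure_pmf)
  also have "\<dots> \<ge> ennreal (pmf (poisson_pmf total_weight) n) * (\<integral>\<^sup>+w. F w \<partial>jump_iterate Q n)"
    by (rule nn_integral_ge_point) simp
  finally have le: "ennreal ?a * (\<integral>\<^sup>+w. F w \<partial>jump_iterate Q n) \<le> (\<integral>\<^sup>+w. F w \<partial>poisson_shift Q)"
    using c by simp
  have "(\<integral>\<^sup>+w. F w \<partial>jump_iterate Q n) = ennreal (exp total_weight * fact n / total_weight ^ n) * (ennreal ?a * (\<integral>\<^sup>+w. F w \<partial>jump_iterate Q n))"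
  proof -
    have "(exp total_weight * fact n / total_weight ^ n) * ?a = 1" using c by (simp add: exp_minus field_simps)
    then have "ennreal (exp total_weight * fact n / total_weight ^ n) * ennreal ?a = 1"
      using c by (subst ennreal_mult[symmetric]) (auto simp: ennreal_1)
    then show ?thesis by (simp add: mult.assoc[symmetric])
  qed
  also have "\<dots> \<le> ennreal (exp total_weight * fact n / total_weight ^ n) * (\<integral>\<^sup>+w. F w \<partial>poisson_shift Q)"
    by (intro mult_left_mono le) simp
  finally show ?thesis .
qed

lemma integral_poisson_pmf:
  fixes x :: complex
  assumes "norm x \<le> 1"
  shows "(LINT n|measure_pmf (poisson_pmf total_weight). x ^ n) = exp (total_weight * (x - 1))"
proof -
  let ?f = "\<lambda>n. pmf (poisson_pmf total_weight) n *\<^sub>R x ^ n"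
  have s: "?f sums exp (total_weight * (x - 1))"
  proof -
    have "(\<lambda>n. of_real (exp (- total_weight)) * ((of_real total_weight * x) ^ n /\<^sub>R fact n)) sums (of_real (exp (- total_weight)) * exp (of_real total_weight * x))"
      by (intro sums_mult exp_converges)
    moreover have "of_real (exp (- total_weight)) * exp (of_real total_weight * x) = exp (total_weight * (x - 1))"
      by (simp add: exp_of_real[symmetric] exp_add[symmetric] algebra_simps)
    moreover have "of_real (exp (- total_weight)) * ((of_real total_weight * x) ^ n /\<^sub>R fact n) = ?f n" for n
      using c by (simp add: scaleR_conv_of_real power_mult_distrib field_simps)
    ultimately show ?thesis by simp
  qed
  have i: "integrable (count_space UNIV) ?f"
  proof (subst integrable_count_space_nat_iff, rule summable_comparison_test')
    show "summable (\<lambda>n. pmf (poisson_pmf total_weight) n)"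
    proof -
      have "(\<lambda>n. exp (- total_weight) * (total_weight ^ n /\<^sub>R fact n)) sums (exp (- total_weight) * exp total_weight)"
        by (intro sums_mult exp_converges)
      then have "summable (\<lambda>n. exp (- total_weight) * (total_weight ^ n /\<^sub>R fact n))" by (rule sums_summable)
      then show ?thesis using c by (simp add: divide_inverse mult_ac)
    qed
    show "norm (norm (?f n)) \<le> pmf (poisson_pmf total_weight) n" if "0 \<le> n" for n
      using power_le_one[OF norm_ge_zero assms, of n] by (simp add: norm_power mult_left_le)
  qed
  have "(LINT n|measure_pmf (poisson_pmf total_weight). x ^ n) = (LINT n|count_space UNIV. ?f n)"
    unfolding measure_pmf_eq_density by (subst integral_density) auto
  also have "\<dots> = exp (total_weight * (x - 1))"
    using sums_unique2[OF sums_integral_count_space_nat[OF i] s] .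
  finally show ?thesis .
qed

lemma poisson_shift_expo:
  assumes u: "u \<in> times_upto T"
  shows "(LINT w|poisson_shift Q. expo u w) = (LINT w|Q. expo u w) * exp (LINT z|N. jump_symbol u z * base_weight z)"
proof -
  let ?I = "LINT z|N. jump_symbol u z * base_weight z"
  let ?x = "1 + ?I / total_weight"
  let ?p = "poisson_pmf total_weight"
  have em: "expo u \<in> borel_measurable product_space" by (rule expo_measurable[OF u])
  \<comment> \<open>The mixture formula is applied to real and imaginary part separately; both are
    bounded by the modulus of the exponential, which is 1.\<close>
  have bind: "(LINT w|poisson_shift Q. g (expo u w)) = (LINT n|measure_pmf ?p. LINT w|jump_iterate Q n. g (expo u w))"
    if g: "g \<in> borel_measurable borel" "\<And>x. \<bar>g x\<bar> \<le> norm x" for g :: "complex \<Rightarrow> real"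
    unfolding poisson_shift_def
  proof (rule integral_bind)
    show "(\<lambda>w. g (expo u w)) \<in> borel_measurable product_space" by (rule measurable_compose[OF em g(1)])
    show "\<And>w. w \<in> space product_space \<Longrightarrow> \<bar>g (expo u w)\<bar> \<le> 1" using g(2)[of "expo u _"] by simp
    show "jump_iterate Q \<in> measurable (measure_pmf ?p) (subprob_algebra product_space)" by (rule iterate_kernel)
    show "finite_measure (measure_pmf ?p)" by (rule measure_pmf.finite_measure_axioms)
    show "AE n in measure_pmf ?p. emeasure (jump_iterate Q n) (space (jump_iterate Q n)) \<le> ennreal 1"
      using prob_space.emeasure_space_1[OF iterate_prob] by simp
  qed
  have ie: "integrable (jump_iterate Q n) (expo u)" for n
    using trig_integrable(1)[OF trig_expo[OF u, of 1] iterate_prob iterate_sets] by simp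
  have ip: "integrable (poisson_shift Q) (expo u)"
    using trig_integrable(1)[OF trig_expo[OF u, of 1] poisson_shift_prob poisson_shift_sets] by simp
  have le1: "norm (LINT w|jump_iterate Q n. expo u w) \<le> 1" for n
  proof -
    interpret I: prob_space "jump_iterate Q n" by (rule iterate_prob)
    have "norm (LINT w|jump_iterate Q n. expo u w) \<le> (LINT w|jump_iterate Q n. norm (expo u w))" by (rule integral_norm_bound)
    then show ?thesis by (simp add: I.prob_space)
  qed
  have ii: "integrable (measure_pmf ?p) (\<lambda>n. LINT w|jump_iterate Q n. expo u w)"
    using le1 by (intro measure_pmf.integrable_const_bound[of _ 1]) auto
  have "(LINT w|poisson_shift Q. expo u w) = (LINT n|measure_pmf ?p. LINT w|jump_iterate Q n. expo u w)"
  proof (rule complex_eqI)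
    show "Re (LINT w|poisson_shift Q. expo u w) = Re (LINT n|measure_pmf ?p. LINT w|jump_iterate Q n. expo u w)"
      using bind[of Re] abs_Re_le_cmod by (simp add: integral_Re[OF ip, symmetric] integral_Re[OF ii, symmetric] integral_Re[OF ie, symmetric] del: integral_Re)
    show "Im (LINT w|poisson_shift Q. expo u w) = Im (LINT n|measure_pmf ?p. LINT w|jump_iterate Q n. expo u w)"
      using bind[of Im] abs_Im_le_cmod by (simp add: integral_Im[OF ip, symmetric] integral_Im[OF ii, symmetric] integral_Im[OF ie, symmetric] del: integral_Im)
  qed
  also have "\<dots> = (LINT w|Q. expo u w) * (LINT n|measure_pmf ?p. ?x ^ n)"
    by (simp add: iterate_expo[OF u])
  also have "(LINT n|measure_pmf ?p. ?x ^ n) = exp (total_weight * (?x - 1))"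
  proof (rule integral_poisson_pmf)
    \<comment> \<open>The base \<open>?x\<close> is the mean of \<open>cis (phase u z)\<close> under
      the probability \<open>jump_law\<close>, hence of modulus at most 1, as the generating
      function of the Poisson distribution is used on the unit disc.\<close>
    interpret J: prob_space jump_law by (rule jump_law_prob)
    have jm: "jump_symbol u \<in> borel_measurable N" by (rule jump_symbol_measurable[OF levy_measure_sets[OF levy]])
    have jm': "jump_symbol u \<in> borel_measurable jump_law" using jm measurable_cong_sets[OF jump_law_sets refl] by blast
    have ji: "integrable jump_law (jump_symbol u)"
      using jm' norm_cis_minus_1' by (intro J.integrable_const_bound[of _ 2]) (auto simp: jump_symbol_def)
    have "(LINT z|jump_law. jump_symbol u z) = (LINT z|N. (base_weight z / total_weight) *\<^sub>R jump_symbol u z)"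
      unfolding jump_law_def using c base_weight_bounds base_weight_measurable jm by (intro integral_density) auto
    also have "\<dots> = (LINT z|N. (jump_symbol u z * base_weight z) / total_weight)"
      by (intro Bochner_Integration.integral_cong refl) (simp add: scaleR_conv_of_real)
    finally have "?x = (LINT z|jump_law. 1 + jump_symbol u z)"
      using ji by (subst Bochner_Integration.integral_add) (auto simp: J.prob_space)
    also have "norm \<dots> \<le> (LINT z|jump_law. norm (1 + jump_symbol u z))" by (rule integral_norm_bound)
    also have "\<dots> = 1" by (simp add: jump_symbol_def J.prob_space)
    finally show "norm ?x \<le> 1" .
  qed
  also have "total_weight * (?x - 1) = ?I" using c by simp
  finally show ?thesis .
qed

text \<open>Superposing independent Poissonian jumps adds their intensity, so \<open>h\<close> is
  replaced by \<open>h + base_weight\<close>. The new weight is integrable with values in [0,1],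
  hence square integrable.\<close>

lemma poisson_shift_dominated: "dominated_law (\<lambda>z. h z + base_weight z) (poisson_shift Q)"
  unfolding dominated_law_def
proof (intro conjI ballI poisson_shift_prob poisson_shift_sets)
  have h: "h \<in> borel_measurable N" "integrable N (\<lambda>z. (h z)\<^sup>2)" using Q by (auto simp: dominated_law_def)
  note [measurable] = h(1) base_weight_measurable
  show "(\<lambda>z. h z + base_weight z) \<in> borel_measurable N" by measurable
  show "integrable N (\<lambda>z. (h z + base_weight z)\<^sup>2)"
  proof (rule Bochner_Integration.integrable_bound)
    show "integrable N (\<lambda>z. 2 * (h z)\<^sup>2 + 2 * (base_weight z)\<^sup>2)" using h base_weight_square_integrable by simp
    show "AE z in N. norm ((h z + base_weight z)\<^sup>2) \<le> norm (2 * (h z)\<^sup>2 + 2 * (base_weight z)\<^sup>2)"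
    proof (rule AE_I2)
      fix z
      have "(h z + base_weight z)\<^sup>2 \<le> 2 * (h z)\<^sup>2 + 2 * (base_weight z)\<^sup>2"
        using sum_squares_bound[of "h z" "base_weight z"] by (simp add: power2_sum)
      then show "norm ((h z + base_weight z)\<^sup>2) \<le> norm (2 * (h z)\<^sup>2 + 2 * (base_weight z)\<^sup>2)" by simp
    qed
  qed measurable
  fix u :: "(real \<times> (real ^ 'd)) list" assume u: "u \<in> times_upto T"
  interpret F: l2_family N jump_symbol "{u}" by (rule l2_family_jump_symbol) (use u in auto)
  have "(LINT z|N. jump_symbol u z * (h z + base_weight z)) = (LINT z|N. jump_symbol u z * h z + jump_symbol u z * base_weight z)"
    by (simp add: distrib_left)
  also have "\<dots> = (LINT z|N. jump_symbol u z * h z) + (LINT z|N. jump_symbol u z * base_weight z)"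
    using F.integrable_pairing[OF h] F.integrable_pairing[OF base_weight_measurable base_weight_square_integrable]
    by (intro Bochner_Integration.integral_add) auto
  finally show "(LINT w|poisson_shift Q. expo u w) = ref_cf u * exp (LINT z|N. jump_symbol u z * complex_of_real (h z + base_weight z))"
    using Q u by (simp add: poisson_shift_expo dominated_law_def exp_add mult.assoc)
qed

text \<open>A step from \<open>k\<close> jumps leads to \<open>k\<close> and \<open>k + 1\<close>
  jumps, so the induction on \<open>n\<close> needs all \<open>k\<close>. Only finitely many
  iterates occur, each bounded by the one mixture; the constant does not depend on
  \<open>F\<close>.\<close>

lemma shift_sum_bound:
  "\<exists>C\<ge>0. \<forall>F\<in>borel_measurable product_space. (\<integral>\<^sup>+w. (shift_sum ^^ n) F w \<partial>jump_iterate Q k) \<le> ennreal C * (\<integral>\<^sup>+w. F w \<partial>poisson_shift Q)"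
proof (induction n arbitrary: k)
  case 0
  show ?case using iterate_le_poisson_shift[of _ k] c
    by (intro exI[of _ "exp total_weight * fact k / total_weight ^ k"]) auto
next
  case (Suc n)
  obtain C1 where C1: "0 \<le> C1" "\<And>F. F \<in> borel_measurable product_space \<Longrightarrow> (\<integral>\<^sup>+w. (shift_sum ^^ n) F w \<partial>jump_iterate Q (Suc k)) \<le> ennreal C1 * (\<integral>\<^sup>+w. F w \<partial>poisson_shift Q)"
    using Suc[of "Suc k"] by blast
  obtain C2 where C2: "0 \<le> C2" "\<And>F. F \<in> borel_measurable product_space \<Longrightarrow> (\<integral>\<^sup>+w. (shift_sum ^^ n) F w \<partial>jump_iterate Q k) \<le> ennreal C2 * (\<integral>\<^sup>+w. F w \<partial>poisson_shift Q)"
    using Suc[of k] by blast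
  show ?case
  proof (intro exI[of _ "total_weight * C1 + total_weight * C2"] conjI ballI)
    show "0 \<le> total_weight * C1 + total_weight * C2" using c C1 C2 by simp
    fix F :: "(real \<Rightarrow> real ^ 'd) \<Rightarrow> ennreal" assume F: "F \<in> borel_measurable product_space"
    have "(\<integral>\<^sup>+w. (shift_sum ^^ Suc n) F w \<partial>jump_iterate Q k) = (\<integral>\<^sup>+w. shift_sum ((shift_sum ^^ n) F) w \<partial>jump_iterate Q k)" by simp
    also have "\<dots> = ennreal total_weight * (\<integral>\<^sup>+w. (shift_sum ^^ n) F w \<partial>jump_iterate Q (Suc k)) + ennreal total_weight * (\<integral>\<^sup>+w. (shift_sum ^^ n) F w \<partial>jump_iterate Q k)"
      by (rule shift_sum_iterate[OF shift_sum_funpow_measurable[OF F]])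
    also have "\<dots> \<le> ennreal total_weight * (ennreal C1 * (\<integral>\<^sup>+w. F w \<partial>poisson_shift Q)) + ennreal total_weight * (ennreal C2 * (\<integral>\<^sup>+w. F w \<partial>poisson_shift Q))"
      by (intro add_mono mult_left_mono C1 C2 F) auto
    also have "\<dots> = ennreal (total_weight * C1 + total_weight * C2) * (\<integral>\<^sup>+w. F w \<partial>poisson_shift Q)"
      using c C1 C2 by (simp add: ennreal_mult ennreal_plus[symmetric] distrib_right mult.assoc del: ennreal_plus)
        (simp add: ennreal_mult ennreal_plus distrib_right mult.assoc)
    finally show "(\<integral>\<^sup>+w. (shift_sum ^^ Suc n) F w \<partial>jump_iterate Q k) \<le> ennreal (total_weight * C1 + total_weight * C2) * (\<integral>\<^sup>+w. F w \<partial>poisson_shift Q)" .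
  qed
qed

end
end

lemma shift_sum_zero:
  assumes "total_weight = 0" shows "shift_sum F w = 0"
proof -
  have "AE z in N. base_weight z = 0"
    using integral_nonneg_eq_0_iff_AE[OF base_weight_integrable] base_weight_bounds assms by (simp add: total_weight_def)
  then have "AE z in N. ennreal (base_weight z) * (F (add_jump z w) + F w) = 0" by eventually_elim simp
  then have "shift_sum F w = (\<integral>\<^sup>+z. 0 \<partial>N)" unfolding shift_sum_def by (rule nn_integral_cong_AE)
  then show ?thesis by simp
qed

text \<open>
  Adding Poissonian many jumps with intensity \<open>base_weight\<close> to the path turns all shifted
  expectations into pieces of a single law of the same exponential form.
\<close>

lemma shift_dominated:
  assumes Q: "dominated_law h Q"
  shows "\<exists>C\<ge>0. \<forall>G\<in>borel_measurable (path_upto T). integrable Qs (\<lambda>w. (G (restrict_path T w))\<^sup>2) \<longrightarrow>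
    (\<integral>\<^sup>+w. (shift_sum ^^ n) (\<lambda>w. ennreal \<bar>G (restrict_path T w)\<bar>) w \<partial>Q) \<le> ennreal (C * sqrt (LINT w|Qs. (G (restrict_path T w))\<^sup>2))"
proof (cases "0 < total_weight")
  case True
  obtain C where C: "0 \<le> C" "\<And>F. F \<in> borel_measurable product_space \<Longrightarrow> (\<integral>\<^sup>+w. (shift_sum ^^ n) F w \<partial>Q) \<le> ennreal C * (\<integral>\<^sup>+w. F w \<partial>poisson_shift Q)"
    using shift_sum_bound[OF True Q, where n=n and k=0] by (simp only: jump_iterate.simps) blast
  let ?D = "2 * exp ((LINT z|N. (h z + base_weight z)\<^sup>2) / 2)"
  show ?thesis
  proof (intro exI[of _ "C * ?D"] conjI ballI impI)
    fix G :: "(real \<Rightarrow> real ^ 'd) \<Rightarrow> real" assume G: "G \<in> borel_measurable (path_upto T)" and int: "integrable Qs (\<lambda>w. (G (restrict_path T w))\<^sup>2)"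
    have m: "(\<lambda>w. ennreal \<bar>G (restrict_path T w)\<bar>) \<in> borel_measurable product_space"
      using measurable_compose[OF restrict_path_measurable G] by measurable
    have "(\<integral>\<^sup>+w. (shift_sum ^^ n) (\<lambda>w. ennreal \<bar>G (restrict_path T w)\<bar>) w \<partial>Q) \<le> ennreal C * (\<integral>\<^sup>+w. ennreal \<bar>G (restrict_path T w)\<bar> \<partial>poisson_shift Q)"
      by (rule C(2)[OF m])
    also have "\<dots> \<le> ennreal C * ennreal (?D * sqrt (LINT w|Qs. (G (restrict_path T w))\<^sup>2))"
      by (intro mult_left_mono dominated[OF poisson_shift_dominated[OF True Q] G int]) simp
    also have "\<dots> = ennreal (C * ?D * sqrt (LINT w|Qs. (G (restrict_path T w))\<^sup>2))"
      using C(1) by (simp add: ennreal_mult[symmetric] mult.assoc)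
    finally show "(\<integral>\<^sup>+w. (shift_sum ^^ n) (\<lambda>w. ennreal \<bar>G (restrict_path T w)\<bar>) w \<partial>Q) \<le> ennreal (C * ?D * sqrt (LINT w|Qs. (G (restrict_path T w))\<^sup>2))" .
  qed (use C in simp)
next
  \<comment> \<open>Here \<open>base_weight\<close> vanishes almost everywhere, so
    \<open>shift_sum\<close> is 0 and only order 0 is left, which is \<open>dominated\<close> for
    \<open>Q\<close> itself.\<close>
  case False
  have "0 \<le> total_weight" unfolding total_weight_def by (simp add: base_weight_bounds)
  then have z: "total_weight = 0" using False by simp
  let ?D = "2 * exp ((LINT z|N. (h z)\<^sup>2) / 2)"
  show ?thesis
  proof (intro exI[of _ ?D] conjI ballI impI)
    fix G :: "(real \<Rightarrow> real ^ 'd) \<Rightarrow> real" assume G: "G \<in> borel_measurable (path_upto T)" and int: "integrable Qs (\<lambda>w. (G (restrict_path T w))\<^sup>2)"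
    show "(\<integral>\<^sup>+w. (shift_sum ^^ n) (\<lambda>w. ennreal \<bar>G (restrict_path T w)\<bar>) w \<partial>Q) \<le> ennreal (?D * sqrt (LINT w|Qs. (G (restrict_path T w))\<^sup>2))"
      using dominated[OF Q G int] by (cases n) (simp_all add: shift_sum_zero[OF z])
  qed simp
qed

end

section \<open>Functionals of the path up to a fixed time\<close>

text \<open>The Doob-Dynkin factorization for nonnegative functions; a factor is built along with
  each step of the approximation, and suprema of the factors need no convergence argument in the
  extended half line.\<close>

lemma doob_dynkin_nonneg:
  fixes f :: "'a \<Rightarrow> ennreal"
  assumes f: "f \<in> borel_measurable (vimage_algebra S \<rho> N)" and \<rho>: "\<rho> \<in> S \<rightarrow> space N"
  shows "\<exists>G\<in>borel_measurable N. \<forall>w\<in>S. f w = G (\<rho> w)"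
  using f
proof (induction f rule: borel_measurable_induct)
  case (cong f g)
  then show ?case by simp
next
  case (set A)
  then obtain B where "B \<in> sets N" "A = \<rho> -` B \<inter> S" unfolding sets_vimage_algebra2[OF \<rho>] by blast
  then show ?case by (intro bexI[of _ "indicator B"]) (auto simp: indicator_def)
next
  case (mult u c)
  then obtain G where "G \<in> borel_measurable N" "\<forall>w\<in>S. u w = G (\<rho> w)" by blast
  then show ?case by (intro bexI[of _ "\<lambda>x. c * G x"]) auto
next
  case (add u v)
  then obtain G H where "G \<in> borel_measurable N" "\<forall>w\<in>S. u w = G (\<rho> w)" "H \<in> borel_measurable N" "\<forall>w\<in>S. v w = H (\<rho> w)"
    by blast
  then show ?case by (intro bexI[of _ "\<lambda>x. H x + G x"]) auto
next
  case (seq U)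
  then obtain G where "\<And>i. G i \<in> borel_measurable N" "\<And>i. \<forall>w\<in>S. U i w = G i (\<rho> w)" by metis
  then show ?case by (intro bexI[of _ "\<lambda>x. SUP i. G i x"]) (auto simp: image_comp)
qed

lemma doob_dynkin:
  fixes f :: "'a \<Rightarrow> real"
  assumes f: "f \<in> borel_measurable (vimage_algebra S \<rho> N)" and \<rho>: "\<rho> \<in> S \<rightarrow> space N"
  shows "\<exists>G\<in>borel_measurable N. \<forall>w\<in>S. f w = G (\<rho> w)"
proof -
  have "(\<lambda>w. ennreal (f w)) \<in> borel_measurable (vimage_algebra S \<rho> N)"
    "(\<lambda>w. ennreal (- f w)) \<in> borel_measurable (vimage_algebra S \<rho> N)" using f by auto
  from this[THEN doob_dynkin_nonneg[OF _ \<rho>]]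
  obtain G H where G: "G \<in> borel_measurable N" "\<forall>w\<in>S. ennreal (f w) = G (\<rho> w)"
    and H: "H \<in> borel_measurable N" "\<forall>w\<in>S. ennreal (- f w) = H (\<rho> w)" by blast
  \<comment> \<open>Since \<open>ennreal\<close> sends negative numbers to 0, the two terms are the
    positive and the negative part.\<close>
  have "f w = enn2real (ennreal (f w)) - enn2real (ennreal (- f w))" for w
    by (cases "0 \<le> f w") (simp_all add: ennreal_neg)
  then have "\<forall>w\<in>S. f w = enn2real (G (\<rho> w)) - enn2real (H (\<rho> w))" using G(2) H(2) by metis
  then show ?thesis using G(1) H(1)
    by (intro bexI[of _ "\<lambda>x. enn2real (G x) - enn2real (H x)"]) auto
qed

lemma cadlag_stopped_path:
  assumes w: "w \<in> cadlag_paths" and s: "0 \<le> s"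
  shows "stopped_path s w \<in> cadlag_paths"
proof -
  have c: "continuous (at_right t) w" if "0 \<le> t" for t using w that by (auto simp: cadlag_paths_def)
  have l: "\<exists>l. (w \<longlongrightarrow> l) (at_left t)" if "0 < t" for t using w that by (auto simp: cadlag_paths_def)
  have "continuous (at_right t) (stopped_path s w)" if t: "0 \<le> t" for t
  proof (cases "t < s")
    case True
    have "\<forall>\<^sub>F x in at_right t. w x = stopped_path s w x"
      using eventually_at_right_real[OF True] by eventually_elim (use t in \<open>auto simp: stopped_path_def min_def\<close>)
    moreover have "stopped_path s w t = w t" using True t by (simp add: stopped_path_def min_def)
    ultimately show ?thesis using c[OF t] unfolding continuous_within by (auto intro: Lim_transform_eventually)
  next
    case False
    have "\<forall>\<^sub>F x in at_right t. w s = stopped_path s w x"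
      using eventually_at_right_less[of t] by eventually_elim (use False t in \<open>auto simp: stopped_path_def min_def\<close>)
    moreover have "stopped_path s w t = w s" using False t by (simp add: stopped_path_def min_def)
    ultimately show ?thesis unfolding continuous_within using Lim_transform_eventually[OF tendsto_const] by simp
  qed
  moreover have "\<exists>l. (stopped_path s w \<longlongrightarrow> l) (at_left t)" if t: "0 < t" for t
  proof (cases "t \<le> s")
    case True
    have "\<forall>\<^sub>F x in at_left t. w x = stopped_path s w x"
      using eventually_at_left_real[OF t] by eventually_elim (use True in \<open>auto simp: stopped_path_def min_def\<close>)
    then show ?thesis using l[OF t] by (auto intro: Lim_transform_eventually)
  next
    case False
    then have "s < t" by simp
    have "\<forall>\<^sub>F x in at_left t. w s = stopped_path s w x"
      using eventually_at_left_real[OF \<open>s < t\<close>] by eventually_elim (use s in \<open>auto simp: stopped_path_def min_def\<close>)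
    from Lim_transform_eventually[OF tendsto_const this] show ?thesis by blast
  qed
  moreover have "stopped_path s w \<in> extensional {0..}" by (auto simp: stopped_path_def)
  ultimately show ?thesis by (auto simp: cadlag_paths_def)
qed

lemma cadlag_add_jump:
  assumes w: "w \<in> cadlag_paths"
  shows "add_jump z w \<in> cadlag_paths"
proof -
  obtain s x where z: "z = (s, x)" by (cases z)
  have c: "continuous (at_right t) w" if "0 \<le> t" for t using w that by (auto simp: cadlag_paths_def)
  have l: "\<exists>l. (w \<longlongrightarrow> l) (at_left t)" if "0 < t" for t using w that by (auto simp: cadlag_paths_def)
  have "continuous (at_right t) (add_jump z w)" if t: "0 \<le> t" for t
  proof -
    let ?j = "if s \<le> t then x else 0"
    have "\<forall>\<^sub>F y in at_right t. w y + ?j = add_jump z w y"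
    proof (cases "s \<le> t")
      case True
      show ?thesis using eventually_at_right_less[of t]
        by eventually_elim (use True t in \<open>auto simp: add_jump_def z\<close>)
    next
      case False
      then have "t < s" by simp
      show ?thesis using eventually_at_right_real[OF \<open>t < s\<close>]
        by eventually_elim (use False t in \<open>auto simp: add_jump_def z\<close>)
    qed
    moreover have "add_jump z w t = w t + ?j" using t by (simp add: add_jump_def z)
    moreover have "((\<lambda>y. w y + ?j) \<longlongrightarrow> w t + ?j) (at_right t)"
      using c[OF t] unfolding continuous_within by (intro tendsto_add tendsto_const)
    ultimately show ?thesis unfolding continuous_within by (simp only:) (rule Lim_transform_eventually)
  qed
  moreover have "\<exists>l. (add_jump z w \<longlongrightarrow> l) (at_left t)" if t: "0 < t" for t
  proof -
    let ?j = "if s < t then x else 0"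
    obtain k where k: "(w \<longlongrightarrow> k) (at_left t)" using l[OF t] by blast
    have "\<forall>\<^sub>F y in at_left t. w y + ?j = add_jump z w y"
    proof (cases "s < t")
      case True
      have "max 0 s < t" using True t by simp
      show ?thesis using eventually_at_left_real[OF \<open>max 0 s < t\<close>]
        by eventually_elim (use True in \<open>auto simp: add_jump_def z\<close>)
    next
      case False
      show ?thesis using eventually_at_left_real[OF t]
        by eventually_elim (use False in \<open>auto simp: add_jump_def z\<close>)
    qed
    moreover have "((\<lambda>y. w y + ?j) \<longlongrightarrow> k + ?j) (at_left t)" using k by (intro tendsto_add tendsto_const)
    ultimately show ?thesis by (blast intro: Lim_transform_eventually)
  qed
  moreover have "add_jump z w \<in> extensional {0..}" by (auto simp: add_jump_def)
  ultimately show ?thesis by (auto simp: cadlag_paths_def)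
qed

lemma cadlag_in_product_space: "w \<in> cadlag_paths \<Longrightarrow> w \<in> space product_space"
  by (auto simp: cadlag_paths_def space_PiM PiE_def)

text \<open>The stopped path is recovered from the restriction to the interval from 0 to
  \<open>s\<close> by the measurable map \<open>?E\<close>. So \<open>f\<close> is measurable for
  the \<sigma>-field of the restriction and factors through it.\<close>

lemma path_algebra_factor:
  fixes f :: "(real \<Rightarrow> real ^ 'd) \<Rightarrow> real"
  assumes f: "f \<in> borel_measurable (path_algebra_upto s)" and s: "0 \<le> s"
  shows "\<exists>G\<in>borel_measurable (path_upto s). \<forall>w\<in>cadlag_paths. f w = G (restrict_path s w)"
proof (rule doob_dynkin)
  let ?E = "\<lambda>x::real \<Rightarrow> real ^ 'd. \<lambda>t\<in>{0..}. x (min t s)"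
  show \<rho>: "restrict_path s \<in> cadlag_paths \<rightarrow> space (path_upto s :: (real \<Rightarrow> real ^ 'd) measure)"
    by (auto simp: restrict_path_def space_PiM)
  have Em: "?E \<in> measurable (path_upto s) product_space"
    using s by (intro measurable_restrict measurable_component_singleton) auto
  have Er: "?E (restrict_path s w) = stopped_path s w" for w :: "real \<Rightarrow> real ^ 'd"
    using s by (auto simp: restrict_path_def stopped_path_def fun_eq_iff)
  show "f \<in> borel_measurable (vimage_algebra cadlag_paths (restrict_path s) (path_upto s))"
  proof (rule measurableI)
    fix A :: "real set" assume "A \<in> sets borel"
    then have "f -` A \<inter> cadlag_paths \<in> sets (path_algebra_upto s)"
      using measurable_sets[OF f] by (simp add: path_algebra_upto_def)
    moreover have "stopped_path s \<in> cadlag_paths \<rightarrow> space path_space"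
      using cadlag_stopped_path[OF _ s] cadlag_in_product_space
      by (auto simp: path_space_def space_restrict_space)
    ultimately obtain B where B: "B \<in> sets path_space" "f -` A \<inter> cadlag_paths = stopped_path s -` B \<inter> cadlag_paths"
      unfolding path_algebra_upto_def by (subst (asm) sets_vimage_algebra2) auto
    obtain C where C: "C \<in> sets product_space" "B = cadlag_paths \<inter> C"
      using B(1) unfolding path_space_def sets_restrict_space by auto
    have "f -` A \<inter> cadlag_paths = restrict_path s -` (?E -` C \<inter> space (path_upto s)) \<inter> cadlag_paths"
      unfolding B(2) C(2) using cadlag_stopped_path[OF _ s] \<rho> by (auto simp: Er)
    then show "f -` A \<inter> space (vimage_algebra cadlag_paths (restrict_path s) (path_upto s)) \<in>
      sets (vimage_algebra cadlag_paths (restrict_path s) (path_upto s))"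
      using in_vimage_algebra[OF measurable_sets[OF Em C(1)]] by simp
  qed simp
qed

lemma difference_diff: "difference zs (\<lambda>w. f w - g w) w = difference zs f w - difference zs g w"
  by (induction zs arbitrary: w) auto

lemma difference_cong_cadlag:
  assumes "\<And>w. w \<in> cadlag_paths \<Longrightarrow> f w = g w" "w \<in> cadlag_paths"
  shows "difference zs f w = difference zs g w"
  using assms(2) by (induction zs arbitrary: w) (auto simp: assms(1) cadlag_add_jump)

lemma restrict_path_add_jump:
  assumes "restrict_path T w = restrict_path T w'"
  shows "restrict_path T (add_jump z w) = restrict_path T (add_jump z w')"
proof -
  have "w t = w' t" if "t \<in> {0..T}" for t
    using fun_cong[OF assms, of t] that by (simp add: restrict_path_def)
  then show ?thesis by (auto simp: restrict_path_def add_jump_def restrict_def fun_eq_iff)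
qed

lemma difference_restrict_cong:
  assumes "restrict_path T w = restrict_path T w'"
  shows "difference zs (\<lambda>w. G (restrict_path T w)) w = difference zs (\<lambda>w. G (restrict_path T w)) w'"
  using assms
proof (induction zs arbitrary: w w')
  case (Cons z zs)
  from Cons.IH[OF Cons.prems] Cons.IH[OF restrict_path_add_jump[OF Cons.prems]] show ?case
    by (simp only: difference.simps)
qed simp

text \<open>A jump after \<open>T\<close> is not seen, so the two terms of its difference cancel.
  The integrals over the infinite time axis are thereby reduced to times up to
  \<open>T\<close>.\<close>

lemma difference_late:
  assumes "z \<in> set zs" "T < fst z"
  shows "difference zs (\<lambda>w. G (restrict_path T w)) w = 0"
  using assms(1)
proof (induction zs arbitrary: w)
  case (Cons y zs)
  show ?case
  proof (cases "z \<in> set zs")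
    case True
    then show ?thesis using Cons.IH by simp
  next
    case False
    then have "y = z" using Cons.prems by simp
    then have "restrict_path T (add_jump y w) = restrict_path T w"
      using assms(2) by (auto simp: restrict_path_def add_jump_def fun_eq_iff)
    from difference_restrict_cong[OF this] show ?thesis by simp
  qed
qed simp

lemma path_pairing_restrict:
  assumes "u \<in> times_upto T" shows "path_pairing u (restrict_path T w) = path_pairing u w"
  using assms by (induction u) (auto simp: times_upto_def restrict_path_def)

lemma trig_restrict: "p \<in> trig T \<Longrightarrow> p (restrict_path T w) = p w"
  by (erule trigE) (auto simp: trig_poly_def expo_def path_pairing_restrict subset_iff intro!: sum.cong)

lemma trig_measurable_upto: "p \<in> trig T \<Longrightarrow> p \<in> borel_measurable (path_upto T)"
proof (erule trigE)
  fix K a assume K: "K \<subseteq> times_upto T" "p = trig_poly K a"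
  have "path_pairing u \<in> borel_measurable (path_upto T)" if "u \<in> times_upto T" for u :: "(real \<times> (real ^ 'a)) list"
    using that
  proof (induction u)
    case (Cons p u)
    have "fst p \<in> {0..T}" using Cons.prems by (auto simp: times_upto_def)
    then have "(\<lambda>w. w (fst p)) \<in> borel_measurable (path_upto T)" by (rule measurable_component_singleton)
    moreover have "path_pairing u \<in> borel_measurable (path_upto T)" using Cons by (auto simp: times_upto_def)
    ultimately have "(\<lambda>w. snd p \<bullet> w (fst p) + path_pairing u w) \<in> borel_measurable (path_upto T)" by measurable
    then show ?case by (simp add: path_pairing_def)
  qed (simp add: path_pairing_def[abs_def])
  then show "p \<in> borel_measurable (path_upto T)"
    unfolding K(2) trig_poly_def[abs_def] expo_def using K(1)
    by (intro borel_measurable_sum borel_measurable_times borel_measurable_const measurable_cis) auto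
qed

lemma difference_trig:
  assumes K: "K \<subseteq> times_upto T"
  shows "difference zs (\<lambda>w. Re (trig_poly K a w)) w = Re (\<Sum>u\<in>K. a u * expo u w * (\<Prod>z\<leftarrow>zs. jump_symbol u z))"
proof (induction zs arbitrary: w)
  case (Cons z zs)
  have "difference (z # zs) (\<lambda>w. Re (trig_poly K a w)) w =
    Re (\<Sum>u\<in>K. a u * expo u (add_jump z w) * (\<Prod>z\<leftarrow>zs. jump_symbol u z)) - Re (\<Sum>u\<in>K. a u * expo u w * (\<Prod>z\<leftarrow>zs. jump_symbol u z))"
    by (simp only: difference.simps Cons)
  also have "\<dots> = Re (\<Sum>u\<in>K. a u * expo u (add_jump z w) * (\<Prod>z\<leftarrow>zs. jump_symbol u z) - a u * expo u w * (\<Prod>z\<leftarrow>zs. jump_symbol u z))"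
    by (simp add: sum_subtractf)
  also have "\<dots> = Re (\<Sum>u\<in>K. a u * expo u w * (\<Prod>z\<leftarrow>z # zs. jump_symbol u z))"
  proof (intro arg_cong[where f=Re] sum.cong refl)
    fix u assume "u \<in> K"
    then have "u \<in> times_upto T" using K by auto
    from expo_add_jump[OF times_upto_nonneg[OF this]]
    show "a u * expo u (add_jump z w) * (\<Prod>z\<leftarrow>zs. jump_symbol u z) - a u * expo u w * (\<Prod>z\<leftarrow>zs. jump_symbol u z)
      = a u * expo u w * (\<Prod>z\<leftarrow>z # zs. jump_symbol u z)" by (simp add: algebra_simps)
  qed
  finally show ?case .
qed (simp add: trig_poly_def)

lemma prod_list_upt: "(\<Prod>x\<leftarrow>map z [0..<n]. f x) = (\<Prod>j<n. f (z j) :: 'a :: comm_monoid_mult)"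
  by (induction n) auto

section \<open>The expansion\<close>

text \<open>In the application \<open>q\<close> is \<open>h' - h\<close>; the expansion itself uses
  only the relation between the two characteristic functions and the square integrability of
  \<open>q\<close>.\<close>

locale perturbed_law = reference_law \<Sigma> bs \<nu>s T Qs
  for \<Sigma> :: "real ^ 'd ^ 'd" and bs :: "real ^ 'd" and \<nu>s T Qs +
  fixes Q Q' :: "(real \<Rightarrow> real ^ 'd) measure" and h h' q :: "real \<times> (real ^ 'd) \<Rightarrow> real"
  assumes Q: "dominated_law h Q" and Q': "dominated_law h' Q'"
    and q: "q \<in> borel_measurable N" and q2: "integrable N (\<lambda>z. (q z)\<^sup>2)"
    and cf: "u \<in> times_upto T \<Longrightarrow> (LINT w|Q'. expo u w) = (LINT w|Q. expo u w) * exp (LINT z|N. jump_symbol u z * q z)"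
begin

abbreviation "NP n \<equiv> PiM {..<n} (\<lambda>_. N)"

definition mean_diff :: "nat \<Rightarrow> ((real \<Rightarrow> real ^ 'd) \<Rightarrow> real) \<Rightarrow> (nat \<Rightarrow> real \<times> (real ^ 'd)) \<Rightarrow> real" where
  "mean_diff n f z = (LINT w|Q. difference_at n z f w)"

definition weight_power :: "nat \<Rightarrow> (nat \<Rightarrow> real \<times> (real ^ 'd)) \<Rightarrow> real" where
  "weight_power n z = (\<Prod>j<n. q (z j))"

lemma Q_prob: "prob_space Q" and Q_sets: "sets Q = sets product_space"
  and Q'_prob: "prob_space Q'" and Q'_sets: "sets Q' = sets product_space"
  and h: "h \<in> borel_measurable N" "integrable N (\<lambda>z. (h z)\<^sup>2)"
  using Q Q' by (auto simp: dominated_law_def)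

interpretation QQ: prob_space Q by (rule Q_prob)
interpretation QQ': prob_space Q' by (rule Q'_prob)
interpretation QS: prob_space Qs by (rule Qs_prob)
interpretation NN: sigma_finite_measure N by (rule sigma_finite_jump_intensity[OF levy])
interpretation PN: product_sigma_finite "\<lambda>_::nat. N" by (intro product_sigma_finite.intro NN.sigma_finite_measure_axioms)

lemma weight_power_measurable: "weight_power n \<in> borel_measurable (NP n)"
  unfolding weight_power_def[abs_def]
proof (rule borel_measurable_prod)
  fix j assume j: "j \<in> {..<n}"
  show "(\<lambda>z. q (z j)) \<in> borel_measurable (NP n)"
    by (rule measurable_compose[OF measurable_component_singleton[OF j] q])
qed

lemma measurable_Q: "f \<in> borel_measurable product_space \<Longrightarrow> f \<in> borel_measurable Q"
  using measurable_cong_sets[OF Q_sets refl] by blast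

lemma difference_measurable:
  assumes f: "f \<in> borel_measurable product_space"
  shows "(\<lambda>(z, w). difference_at n z f w) \<in> borel_measurable (NP n \<Otimes>\<^sub>M Q)"
    "z \<in> space (NP n) \<Longrightarrow> (\<lambda>w. difference_at n z f w) \<in> borel_measurable Q"
proof -
  have snd: "snd \<in> measurable (NP n \<Otimes>\<^sub>M Q) product_space"
    using measurable_snd[of "NP n" Q] measurable_cong_sets[OF refl Q_sets] by blast
  have "(\<lambda>x. difference (map (fst x) [0..<n]) f (snd x)) \<in> borel_measurable (NP n \<Otimes>\<^sub>M Q)"
    by (rule jumps_measurable(2)[OF levy_measure_sets[OF levy] measurable_fst _ snd f]) auto
  then show "(\<lambda>(z, w). difference_at n z f w) \<in> borel_measurable (NP n \<Otimes>\<^sub>M Q)"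
    by (simp add: case_prod_unfold)
  have idm: "(\<lambda>w. w) \<in> measurable Q product_space" by (rule measurable_ident_sets[OF Q_sets])
  show "(\<lambda>w. difference_at n z f w) \<in> borel_measurable Q" if "z \<in> space (NP n)"
    by (rule jumps_measurable(2)[OF levy_measure_sets[OF levy] measurable_const[OF that] _ idm f]) auto
qed

lemma mean_diff_measurable: "f \<in> borel_measurable product_space \<Longrightarrow> mean_diff n f \<in> borel_measurable (NP n)"
  unfolding mean_diff_def[abs_def] by (rule QQ.borel_measurable_lebesgue_integral[OF difference_measurable(1)])

lemma Re_trig_measurable: "p \<in> trig T \<Longrightarrow> (\<lambda>w. Re (p w)) \<in> borel_measurable product_space"
  using trig_measurable[of p T] by measurable

lemma difference_trig_integrable:
  assumes p: "p \<in> trig T" and z: "z \<in> space (NP n)"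
  shows "integrable Q (\<lambda>w. difference_at n z (\<lambda>w. Re (p w)) w)"
proof -
  obtain K a where K: "finite K" "K \<subseteq> times_upto T" "p = trig_poly K a" using p by (rule trigE)
  let ?B = "\<Sum>u\<in>K. norm (a u) * norm (\<Prod>z\<leftarrow>map z [0..<n]. jump_symbol u z)"
  have "\<bar>difference_at n z (\<lambda>w. Re (p w)) w\<bar> \<le> ?B" for w
    unfolding K(3) difference_trig[OF K(2)]
    by (rule order_trans[OF abs_Re_le_cmod order_trans[OF norm_sum]]) (simp add: norm_mult)
  then show ?thesis
    using difference_measurable(2)[OF Re_trig_measurable[OF p] z] by (intro QQ.integrable_const_bound[of _ ?B]) auto
qed

lemma mean_diff_trig:
  assumes K: "finite K" "K \<subseteq> times_upto T"
  shows "mean_diff n (\<lambda>w. Re (trig_poly K a w)) z =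
    Re (l2_family.tensor_comb jump_symbol K n (\<lambda>u. a u * (LINT w|Q. expo u w)) z)"
proof -
  interpret F: l2_family N jump_symbol K by (rule l2_family_jump_symbol[OF K])
  have ei: "integrable Q (expo u)" if "u \<in> K" for u
    using trig_integrable(1)[OF trig_expo[of u T 1] Q_prob Q_sets] that K by auto
  have "mean_diff n (\<lambda>w. Re (trig_poly K a w)) z = (LINT w|Q. Re (\<Sum>u\<in>K. a u * expo u w * (\<Prod>j<n. jump_symbol u (z j))))"
    unfolding mean_diff_def difference_trig[OF K(2)] prod_list_upt ..
  also have "\<dots> = Re (LINT w|Q. (\<Sum>u\<in>K. a u * expo u w * (\<Prod>j<n. jump_symbol u (z j))))"
    using ei by (intro integral_Re Bochner_Integration.integrable_sum integrable_mult_left integrable_mult_right)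
  also have "(LINT w|Q. (\<Sum>u\<in>K. a u * expo u w * (\<Prod>j<n. jump_symbol u (z j)))) = (\<Sum>u\<in>K. a u * (LINT w|Q. expo u w) * (\<Prod>j<n. jump_symbol u (z j)))"
    using ei by (subst Bochner_Integration.integral_sum) (auto intro!: integrable_mult_left integrable_mult_right)
  finally show ?thesis unfolding F.tensor_comb_def .
qed

text \<open>Defined for an arbitrary function \<open>\<tau>\<close> of \<open>n\<close> jumps,
  because it is applied both to mean differences and to differences of two of them; extended values
  allow bounds to precede integrability.\<close>

definition chaos_norm :: "((nat \<Rightarrow> real \<times> (real ^ 'd)) \<Rightarrow> real) \<Rightarrow> nat \<Rightarrow> ennreal" where
  "chaos_norm \<tau> n = ennreal (1 / fact n) * (\<integral>\<^sup>+z. ennreal (\<bar>\<tau> z\<bar> * \<bar>weight_power n z\<bar>) \<partial>NP n)"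

definition coeff :: "nat \<Rightarrow> ((real \<Rightarrow> real ^ 'd) \<Rightarrow> real) \<Rightarrow> real" where
  "coeff n f = 1 / fact n * (LINT z|NP n. mean_diff n f z * weight_power n z)"

lemma chaos_integrable:
  assumes \<tau>: "\<tau> \<in> borel_measurable (NP n)" and fin: "chaos_norm \<tau> n < \<infinity>"
  shows "integrable (NP n) (\<lambda>z. \<tau> z * weight_power n z)"
    "ennreal \<bar>1 / fact n * (LINT z|NP n. \<tau> z * weight_power n z)\<bar> \<le> chaos_norm \<tau> n"
proof -
  have f0: "ennreal (1 / fact n) \<noteq> 0" by simp
  have "(\<integral>\<^sup>+z. ennreal (norm (\<tau> z * weight_power n z)) \<partial>NP n) < \<infinity>"
    using fin f0 unfolding chaos_norm_def by (auto simp: abs_mult ennreal_mult_less_top)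
  then show i: "integrable (NP n) (\<lambda>z. \<tau> z * weight_power n z)"
    using \<tau> weight_power_measurable by (intro integrableI_bounded) measurable
  have "ennreal \<bar>1 / fact n * (LINT z|NP n. \<tau> z * weight_power n z)\<bar> \<le> ennreal (1 / fact n * (LINT z|NP n. norm (\<tau> z * weight_power n z)))"
    using integral_norm_bound[of "NP n" "\<lambda>z. \<tau> z * weight_power n z"]
    by (intro ennreal_leI) (simp add: abs_mult divide_right_mono)
  also have "\<dots> = ennreal (1 / fact n) * ennreal (LINT z|NP n. norm (\<tau> z * weight_power n z))"
    by (intro ennreal_mult) auto
  also have "\<dots> = chaos_norm \<tau> n"
    unfolding chaos_norm_def using nn_integral_eq_integral[OF integrable_norm[OF i]] by (simp add: abs_mult)
  finally show "ennreal \<bar>1 / fact n * (LINT z|NP n. \<tau> z * weight_power n z)\<bar> \<le> chaos_norm \<tau> n" .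
qed

text \<open>With \<open>bound_B\<close>, the two constants of \<open>chaos_bound\<close>: the cost
  of passing from the reference law to \<open>Q\<close>, and the cost of the weight
  \<open>q\<close>.\<close>

definition bound_A :: real where "bound_A = exp (2 * (LINT z|N. (h z)\<^sup>2))"
definition bound_B :: real where "bound_B = exp (2 * (LINT z|N. (q z)\<^sup>2))"

lemma chaos_norm_eq:
  assumes "\<tau> \<in> borel_measurable (NP n)"
  shows "chaos_norm \<tau> n = (\<integral>\<^sup>+z. ennreal (1 / fact n * (\<bar>\<tau> z\<bar> * \<bar>weight_power n z\<bar>)) \<partial>NP n)"
proof -
  note [measurable] = assms weight_power_measurable[of n]
  have "chaos_norm \<tau> n = (\<integral>\<^sup>+z. ennreal (1 / fact n) * ennreal (\<bar>\<tau> z\<bar> * \<bar>weight_power n z\<bar>) \<partial>NP n)"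
    unfolding chaos_norm_def by (rule nn_integral_cmult[symmetric]) measurable
  then show ?thesis by (simp only: ennreal_mult' zero_le_divide_1_iff fact_ge_zero)
qed

text \<open>Combines \<open>chaos_bound\<close> with \<open>bessel\<close>. The parameter \<theta>
  stays free so that, for a polynomial of small norm, both summands can be made small.\<close>

lemma chaos_norm_trig:
  assumes p: "p \<in> trig T" and \<theta>: "0 < \<theta>"
  shows "(\<Sum>n. chaos_norm (mean_diff n (\<lambda>w. Re (p w))) n) \<le>
    ennreal (bound_A * (LINT w|Qs. (norm (p w))\<^sup>2) / \<theta> + \<theta> * bound_B)"
proof -
  obtain K a where K: "finite K" "K \<subseteq> times_upto T" and pK: "p = trig_poly K a" using p by (rule trigE)
  interpret F: l2_family N jump_symbol K by (rule l2_family_jump_symbol[OF K])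
  let ?\<alpha> = "\<lambda>u. a u * ref_cf u"
  have eq: "F.tensor_comb n (\<lambda>u. a u * (LINT w|Q. expo u w)) = F.tensor_comb n (\<lambda>u. ?\<alpha> u * exp (LINT z|N. jump_symbol u z * h z))" for n
    unfolding F.tensor_comb_def using Q K(2) by (intro ext sum.cong refl) (auto simp: dominated_law_def)
  have "(\<Sum>n. chaos_norm (mean_diff n (\<lambda>w. Re (p w))) n) \<le>
    (\<Sum>n. ennreal (1 / fact n) * (\<integral>\<^sup>+z. ennreal (norm (F.tensor_comb n (\<lambda>u. ?\<alpha> u * exp (LINT z|N. jump_symbol u z * h z)) z) * (\<Prod>j<n. \<bar>q (z j)\<bar>)) \<partial>NP n))"
    unfolding chaos_norm_def pK mean_diff_trig[OF K] eq weight_power_def abs_prod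
    by (intro suminf_le mult_left_mono nn_integral_mono ennreal_leI mult_right_mono abs_Re_le_cmod prod_nonneg) auto
  also have "\<dots> \<le> ennreal (bound_A * F.exp_form 1 ?\<alpha> / \<theta> + \<theta> * bound_B)"
    unfolding bound_A_def bound_B_def by (rule F.chaos_bound[OF h q q2 \<theta>])
  also have "\<dots> \<le> ennreal (bound_A * (LINT w|Qs. (norm (p w))\<^sup>2) / \<theta> + \<theta> * bound_B)"
    unfolding pK using \<theta> by (intro ennreal_leI add_right_mono divide_right_mono mult_left_mono bessel[OF K]) (auto simp: bound_A_def)
  finally show ?thesis .
qed

lemma trig_expansion:
  assumes p: "p \<in> trig T"
  shows "(\<lambda>n. 1 / fact n * (LINT z|NP n. mean_diff n (\<lambda>w. Re (p w)) z * weight_power n z)) sums (LINT w|Q'. Re (p w))"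
proof -
  obtain K a where K: "finite K" "K \<subseteq> times_upto T" and pK: "p = trig_poly K a" using p by (rule trigE)
  interpret F: l2_family N jump_symbol K by (rule l2_family_jump_symbol[OF K])
  let ?\<beta> = "\<lambda>u. a u * (LINT w|Q. expo u w)"
  have "(\<lambda>n. Re ((LINT z|NP n. F.tensor_comb n ?\<beta> z * of_real (\<Prod>j<n. q (z j))) /\<^sub>R fact n)) sums
    Re (\<Sum>u\<in>K. ?\<beta> u * exp (LINT z|N. jump_symbol u z * q z))"
    by (rule sums_Re[OF F.tensor_pairing_sums[OF q q2]])
  moreover have "Re ((LINT z|NP n. F.tensor_comb n ?\<beta> z * of_real (\<Prod>j<n. q (z j))) /\<^sub>R fact n) =
    1 / fact n * (LINT z|NP n. mean_diff n (\<lambda>w. Re (p w)) z * weight_power n z)" for n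
  proof -
    have "Re (LINT z|NP n. F.tensor_comb n ?\<beta> z * of_real (\<Prod>j<n. q (z j))) = (LINT z|NP n. Re (F.tensor_comb n ?\<beta> z * of_real (\<Prod>j<n. q (z j))))"
      by (rule integral_Re[OF F.tensor_pairing(1)[OF q q2], symmetric])
    also have "\<dots> = (LINT z|NP n. mean_diff n (\<lambda>w. Re (p w)) z * weight_power n z)"
      unfolding pK mean_diff_trig[OF K] weight_power_def by (intro Bochner_Integration.integral_cong refl) (simp del: of_real_prod)
    finally show ?thesis by (simp add: divide_inverse)
  qed
  moreover have "Re (\<Sum>u\<in>K. ?\<beta> u * exp (LINT z|N. jump_symbol u z * q z)) = (LINT w|Q'. Re (p w))"
  proof -
    have "(\<Sum>u\<in>K. ?\<beta> u * exp (LINT z|N. jump_symbol u z * q z)) = (\<Sum>u\<in>K. a u * (LINT w|Q'. expo u w))"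
      using K(2) by (intro sum.cong refl) (auto simp: cf)
    also have "\<dots> = (LINT w|Q'. p w)" unfolding pK by (rule trig_poly_integral[OF K Q'_prob Q'_sets, symmetric])
    finally show ?thesis using integral_Re[OF trig_integrable(1)[OF p Q'_prob Q'_sets]] by simp
  qed
  ultimately show ?thesis by simp
qed

section \<open>Passage from trigonometric polynomials to square integrable functionals\<close>

context
  fixes G :: "(real \<Rightarrow> real ^ 'd) \<Rightarrow> real"
  assumes G: "G \<in> borel_measurable (path_upto T)" and G2: "integrable Qs (\<lambda>w. (G (restrict_path T w))\<^sup>2)"
begin

abbreviation "gpath w \<equiv> G (restrict_path T w)"

lemma gpath_measurable: "gpath \<in> borel_measurable product_space"
  by (rule measurable_compose[OF restrict_path_measurable G])

text \<open>The rate makes the L2 distance to the functional at most \<open>(1/4) ^ l\<close>.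
  Errors summable in \<open>l\<close> are what gives convergence almost everywhere along the whole
  sequence.\<close>

definition approx_seq :: "nat \<Rightarrow> (real \<Rightarrow> real ^ 'd) \<Rightarrow> complex" where
  "approx_seq l = (SOME p. p \<in> trig T \<and> integrable Qs (\<lambda>w. (norm (complex_of_real (gpath w) - p w))\<^sup>2) \<and>
     (LINT w|Qs. (norm (complex_of_real (gpath w) - p w))\<^sup>2) \<le> (1/16) ^ l)"

lemma approx_seq: "approx_seq l \<in> trig T"
    "integrable Qs (\<lambda>w. (norm (complex_of_real (gpath w) - approx_seq l w))\<^sup>2)"
    "(LINT w|Qs. (norm (complex_of_real (gpath w) - approx_seq l w))\<^sup>2) \<le> (1/16) ^ l"
proof -
  interpret L: path_laws "\<lambda>_. Qs" T by (rule path_laws.intro) (rule Qs_prob Qs_sets)+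
  have appr: "L.approximable (\<lambda>w. complex_of_real (gpath w))" by (rule L.approximable_restrict[OF G G2])
  have "\<exists>p. p \<in> trig T \<and> integrable Qs (\<lambda>w. (norm (complex_of_real (gpath w) - p w))\<^sup>2) \<and>
     (LINT w|Qs. (norm (complex_of_real (gpath w) - p w))\<^sup>2) \<le> (1/16) ^ l"
  proof -
    have "(0::real) < (1/16) ^ l" by simp
    then obtain p where p: "p \<in> trig T" "(LINT w|Qs. (norm (complex_of_real (gpath w) - p w))\<^sup>2) < (1/16) ^ l"
      using appr unfolding L.approximable_def by blast
    have "L.square_int (\<lambda>w. complex_of_real (gpath w) - p w)"
      using appr L.square_int_trig[OF p(1)] by (intro L.square_int_diff) (auto simp: L.approximable_def)
    then show ?thesis using p by (intro exI[of _ p]) (auto simp: L.square_int_def)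
  qed
  from someI_ex[OF this, folded approx_seq_def]
  show "approx_seq l \<in> trig T" "integrable Qs (\<lambda>w. (norm (complex_of_real (gpath w) - approx_seq l w))\<^sup>2)"
    "(LINT w|Qs. (norm (complex_of_real (gpath w) - approx_seq l w))\<^sup>2) \<le> (1/16) ^ l" by blast+
qed

abbreviation "re_seq l w \<equiv> Re (approx_seq l w)"

definition err :: "nat \<Rightarrow> (real \<Rightarrow> real ^ 'd) \<Rightarrow> real" where "err l x = G x - re_seq l x"

lemma err_restrict: "err l (restrict_path T w) = gpath w - re_seq l w"
  by (simp add: err_def trig_restrict[OF approx_seq(1)])

lemma err_measurable: "err l \<in> borel_measurable (path_upto T)"
  unfolding err_def[abs_def] using G trig_measurable_upto[OF approx_seq(1)] by measurable

lemma err_square: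
  "integrable Qs (\<lambda>w. (err l (restrict_path T w))\<^sup>2)" "sqrt (LINT w|Qs. (err l (restrict_path T w))\<^sup>2) \<le> (1/4) ^ l"
proof -
  have le: "(err l (restrict_path T w))\<^sup>2 \<le> (norm (complex_of_real (gpath w) - approx_seq l w))\<^sup>2" for w
    unfolding err_restrict using power_mono[OF abs_Re_le_cmod[of "complex_of_real (gpath w) - approx_seq l w"], where n=2] by simp
  have m: "(\<lambda>w. (err l (restrict_path T w))\<^sup>2) \<in> borel_measurable Qs"
    using measurable_compose[OF restrict_path_measurable err_measurable, of l] measurable_cong_sets[OF Qs_sets refl]
    by (intro borel_measurable_power) blast
  show i: "integrable Qs (\<lambda>w. (err l (restrict_path T w))\<^sup>2)"
    by (rule Bochner_Integration.integrable_bound[OF approx_seq(2) m]) (use le in auto)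
  have "(LINT w|Qs. (err l (restrict_path T w))\<^sup>2) \<le> (LINT w|Qs. (norm (complex_of_real (gpath w) - approx_seq l w))\<^sup>2)"
    by (rule integral_mono[OF i approx_seq(2) le])
  also have "\<dots> \<le> ((1/4) ^ l)\<^sup>2" using approx_seq(3)[of l] by (simp add: power2_eq_square power_mult_distrib[symmetric])
  finally have "sqrt (LINT w|Qs. (err l (restrict_path T w))\<^sup>2) \<le> sqrt (((1/4) ^ l)\<^sup>2)" by (rule real_sqrt_le_mono)
  then show "sqrt (LINT w|Qs. (err l (restrict_path T w))\<^sup>2) \<le> (1/4) ^ l" by simp
qed

definition err_diff :: "nat \<Rightarrow> nat \<Rightarrow> (nat \<Rightarrow> real \<times> (real ^ 'd)) \<Rightarrow> ennreal" where
  "err_diff n l z = (\<integral>\<^sup>+w. sumdiff (map z [0..<n]) (\<lambda>w. ennreal \<bar>err l (restrict_path T w)\<bar>) w \<partial>Q)"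

lemma err_abs_measurable: "(\<lambda>w. ennreal \<bar>err l (restrict_path T w)\<bar>) \<in> borel_measurable product_space"
  using measurable_compose[OF restrict_path_measurable err_measurable] by measurable

lemma sumdiff_err_measurable:
  "(\<lambda>(z, w). sumdiff (map z [0..<n]) (\<lambda>w. ennreal \<bar>err l (restrict_path T w)\<bar>) w) \<in> borel_measurable (NP n \<Otimes>\<^sub>M Q)"
proof -
  have snd: "snd \<in> measurable (NP n \<Otimes>\<^sub>M Q) product_space"
    using measurable_snd[of "NP n" Q] measurable_cong_sets[OF refl Q_sets] by blast
  have "(\<lambda>x. sumdiff (map (fst x) [0..<n]) (\<lambda>w. ennreal \<bar>err l (restrict_path T w)\<bar>) (snd x)) \<in> borel_measurable (NP n \<Otimes>\<^sub>M Q)"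
    by (rule jumps_measurable(1)[OF levy_measure_sets[OF levy] measurable_fst _ snd err_abs_measurable]) auto
  then show ?thesis by (simp add: case_prod_unfold)
qed

lemma err_diff_measurable: "err_diff n l \<in> borel_measurable (NP n)"
  unfolding err_diff_def[abs_def] by (rule QQ.borel_measurable_nn_integral[OF sumdiff_err_measurable])

lemma base_power_measurable: "(\<lambda>z. \<Prod>j<n. base_weight (z j)) \<in> borel_measurable (NP n)"
proof (rule borel_measurable_prod)
  fix j assume j: "j \<in> {..<n}"
  show "(\<lambda>z. base_weight (z j)) \<in> borel_measurable (NP n)"
    by (rule measurable_compose[OF measurable_component_singleton[OF j] base_weight_measurable])
qed

text \<open>Tonelli's theorem turns the weighted integral of the \<open>l\<close>-th error into an
  iterate of \<open>shift_sum\<close>, so \<open>shift_dominated\<close> bounds it by a constant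
  independent of \<open>l\<close> times \<open>(1/4) ^ l\<close>. A sum with finite integral is
  finite almost everywhere.\<close>

lemma err_diff_summable: "AE z in NP n. (\<Sum>l. ennreal (\<Prod>j<n. base_weight (z j)) * err_diff n l z) \<noteq> \<infinity>"
proof (rule nn_integral_PInf_AE)
  let ?b = "\<lambda>z. ennreal (\<Prod>j<n. base_weight (z j))"
  let ?F = "\<lambda>l w. ennreal \<bar>err l (restrict_path T w)\<bar>"
  note [measurable] = base_power_measurable[of n]
  show "(\<lambda>z. \<Sum>l. ?b z * err_diff n l z) \<in> borel_measurable (NP n)"
    using err_diff_measurable by measurable
  obtain C where C: "0 \<le> C" "\<And>l. (\<integral>\<^sup>+w. (shift_sum ^^ n) (?F l) w \<partial>Q) \<le> ennreal (C * sqrt (LINT w|Qs. (err l (restrict_path T w))\<^sup>2))"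
    using shift_dominated[OF Q, of n] err_measurable err_square(1) by blast
  have le: "(\<integral>\<^sup>+z. ?b z * err_diff n l z \<partial>NP n) \<le> ennreal (C * (1/4) ^ l)" for l
  proof -
    interpret NPn: sigma_finite_measure "NP n" by (rule PN.sigma_finite) simp
    interpret PP: pair_sigma_finite "NP n" Q ..
    have sm: "(\<lambda>x. sumdiff (map (fst x) [0..<n]) (?F l) (snd x)) \<in> borel_measurable (NP n \<Otimes>\<^sub>M Q)"
      using sumdiff_err_measurable by (simp add: case_prod_unfold)
    have bm: "(\<lambda>x. ?b (fst x)) \<in> borel_measurable (NP n \<Otimes>\<^sub>M Q)"
      by (rule measurable_compose[OF measurable_fst]) measurable
    have m: "(\<lambda>(z, w). ?b z * sumdiff (map z [0..<n]) (?F l) w) \<in> borel_measurable (NP n \<Otimes>\<^sub>M Q)"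
      unfolding case_prod_unfold by (rule borel_measurable_times_ennreal[OF bm sm])
    have "(\<integral>\<^sup>+z. ?b z * err_diff n l z \<partial>NP n) = (\<integral>\<^sup>+z. \<integral>\<^sup>+w. ?b z * sumdiff (map z [0..<n]) (?F l) w \<partial>Q \<partial>NP n)"
    proof (rule nn_integral_cong)
      fix z assume z: "z \<in> space (NP n)"
      have "(\<lambda>w. sumdiff (map z [0..<n]) (?F l) w) \<in> borel_measurable Q"
        using measurable_compose[OF measurable_Pair1'[OF z] sm] by simp
      then show "?b z * err_diff n l z = (\<integral>\<^sup>+w. ?b z * sumdiff (map z [0..<n]) (?F l) w \<partial>Q)"
        unfolding err_diff_def by (rule nn_integral_cmult[symmetric])
    qed
    also have "\<dots> = (\<integral>\<^sup>+w. \<integral>\<^sup>+z. ?b z * sumdiff (map z [0..<n]) (?F l) w \<partial>NP n \<partial>Q)"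
      by (rule PP.Fubini'[OF m, symmetric])
    also have "\<dots> = (\<integral>\<^sup>+w. (shift_sum ^^ n) (?F l) w \<partial>Q)"
      by (intro nn_integral_cong sumdiff_power_integral err_abs_measurable) (simp add: sets_eq_imp_space_eq[OF Q_sets])
    also have "\<dots> \<le> ennreal (C * sqrt (LINT w|Qs. (err l (restrict_path T w))\<^sup>2))" by (rule C(2))
    also have "\<dots> \<le> ennreal (C * (1/4) ^ l)" by (intro ennreal_leI mult_left_mono err_square(2) C(1))
    finally show ?thesis .
  qed
  have "(\<integral>\<^sup>+z. (\<Sum>l. ?b z * err_diff n l z) \<partial>NP n) = (\<Sum>l. \<integral>\<^sup>+z. ?b z * err_diff n l z \<partial>NP n)"
    using err_diff_measurable by (intro nn_integral_suminf) measurable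
  also have "\<dots> \<le> (\<Sum>l. ennreal (C * (1/4) ^ l))" by (intro suminf_le le) auto
  also have "\<dots> = ennreal (\<Sum>l. C * (1/4) ^ l)"
    using C by (intro suminf_ennreal2 summable_mult summable_geometric) auto
  also have "\<dots> < \<infinity>" by simp
  finally show "(\<integral>\<^sup>+z. (\<Sum>l. ?b z * err_diff n l z) \<partial>NP n) \<noteq> \<infinity>" by simp
qed

text \<open>If some jump comes after \<open>T\<close>, all differences vanish. Otherwise the product
  of base weights is positive and can be divided out of the summable errors, which therefore tend to
  0.\<close>

lemma mean_diff_converges:
  "AE z in NP n. integrable Q (\<lambda>w. difference_at n z gpath w) \<and>
    (\<lambda>l. mean_diff n (re_seq l) z) \<longlonglongrightarrow> mean_diff n gpath z"
  using err_diff_summable[of n] AE_space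
proof eventually_elim
  case (elim z)
  show ?case
  proof (cases "\<exists>j<n. T < fst (z j)")
    case True
    then obtain j where j: "j < n" "T < fst (z j)" by blast
    have zero: "difference_at n z (\<lambda>w. H (restrict_path T w)) w = 0" for H w
      by (rule difference_late[of "z j"]) (use j in auto)
    have re: "re_seq l = (\<lambda>w. re_seq l (restrict_path T w))" for l
      by (simp add: trig_restrict[OF approx_seq(1)])
    have "difference_at n z (re_seq l) w = 0" for l w
      by (subst re) (rule zero)
    then show ?thesis by (simp add: zero mean_diff_def)
  next
    case False
    let ?x = "\<Prod>j<n. base_weight (z j)"
    have x: "0 < ?x" using False by (intro prod_pos base_weight_pos) (meson lessThan_iff not_less)
    have fin: "ennreal ?x * err_diff n l z < \<infinity>" for l
      using ennreal_suminf_lessD[of "\<lambda>l. ennreal ?x * err_diff n l z" \<infinity> l] elim(1) by (simp add: less_top)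
    have E: "err_diff n l z < \<infinity>" for l
    proof (rule ccontr)
      assume "\<not> ?thesis"
      then have "err_diff n l z = top" by (simp add: less_top[symmetric])
      moreover have "ennreal ?x \<noteq> 0" using x by (simp only: ennreal_eq_0_iff not_le)
      ultimately have "ennreal ?x * err_diff n l z = top" unfolding ennreal_mult_eq_top_iff by blast
      then show False using fin[of l] by simp
    qed
    define e where "e l = enn2real (err_diff n l z)" for l
    have e: "err_diff n l z = ennreal (e l)" "0 \<le> e l" for l using E[of l] by (auto simp: e_def less_top)
    have "summable (\<lambda>l. ?x * e l)"
    proof (rule summable_suminf_not_top)
      show "0 \<le> ?x * e l" for l using x e by simp
      have "(\<Sum>l. ennreal (?x * e l)) = (\<Sum>l. ennreal ?x * err_diff n l z)"
        using x e by (intro suminf_cong) (simp add: ennreal_mult)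
      then show "(\<Sum>l. ennreal (?x * e l)) \<noteq> \<top>" using elim(1) by simp
    qed
    then have "(\<lambda>l. ?x * e l) \<longlonglongrightarrow> 0" by (rule summable_LIMSEQ_zero)
    then have e0: "e \<longlonglongrightarrow> 0"
      using tendsto_mult_left_iff[OF less_imp_neq[OF x, symmetric], of e 0 sequentially] by (simp only: mult_zero_right)
    have eint: "integrable Q (\<lambda>w. difference_at n z (\<lambda>w. gpath w - re_seq l w) w)"
      and ele: "\<bar>LINT w|Q. difference_at n z (\<lambda>w. gpath w - re_seq l w) w\<bar> \<le> e l" for l
    proof -
      let ?D = "difference_at n z (\<lambda>w. gpath w - re_seq l w)"
      have Dm: "?D \<in> borel_measurable Q"
        using gpath_measurable Re_trig_measurable[OF approx_seq(1)] by (intro difference_measurable(2) elim(2)) measurable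
      have "(\<integral>\<^sup>+w. ennreal (norm (?D w)) \<partial>Q) \<le> err_diff n l z"
        unfolding err_diff_def err_restrict using abs_difference_le_sumdiff by (intro nn_integral_mono) simp
      also have "\<dots> = ennreal (e l)" by (rule e)
      finally have le: "(\<integral>\<^sup>+w. ennreal (norm (?D w)) \<partial>Q) \<le> ennreal (e l)" .
      then have "(\<integral>\<^sup>+w. ennreal (norm (?D w)) \<partial>Q) < \<infinity>" by (rule order.strict_trans1) simp
      then show i: "integrable Q ?D" by (rule integrableI_bounded[OF Dm])
      have "\<bar>LINT w|Q. ?D w\<bar> \<le> (LINT w|Q. norm (?D w))" using integral_norm_bound[of Q ?D] by simp
      also have "ennreal \<dots> \<le> ennreal (e l)"
        using le nn_integral_eq_integral[OF integrable_norm[OF i]] by simp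
      then have "(LINT w|Q. norm (?D w)) \<le> e l" using e(2)[of l] by simp
      finally show "\<bar>LINT w|Q. ?D w\<bar> \<le> e l" .
    qed
    have ri: "integrable Q (\<lambda>w. difference_at n z (re_seq l) w)" for l
      by (rule difference_trig_integrable[OF approx_seq(1) elim(2)])
    have gi: "integrable Q (\<lambda>w. difference_at n z gpath w)"
      using Bochner_Integration.integrable_add[OF eint[of 0] ri[of 0]] by (simp add: difference_diff)
    have "\<bar>mean_diff n (re_seq l) z - mean_diff n gpath z\<bar> \<le> e l" for l
      using ele[of l] gi ri[of l] unfolding difference_diff mean_diff_def
      by (subst (asm) Bochner_Integration.integral_diff) (auto simp: abs_minus_commute)
    then have "(\<lambda>l. mean_diff n (re_seq l) z - mean_diff n gpath z) \<longlonglongrightarrow> 0"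
      by (intro Lim_null_comparison[OF _ e0]) simp
    from conjI[OF gi LIM_zero_cancel[OF this]] show ?thesis .
  qed
qed

text \<open>The difference of two approximants is a trigonometric polynomial of small norm, so
  \<open>chaos_norm_trig\<close> applies. Fatou's lemma, first in the jumps and then in the order
  \<open>n\<close>, replaces the finer approximant by the functional itself.\<close>

lemma chaos_norm_error:
  "(\<Sum>n. chaos_norm (\<lambda>z. mean_diff n gpath z - mean_diff n (re_seq k) z) n) \<le> ennreal ((4 * bound_A + bound_B) * (1/4) ^ k)"
proof -
  let ?X = "\<lambda>l n. chaos_norm (\<lambda>z. mean_diff n (re_seq l) z - mean_diff n (re_seq k) z) n"
  let ?C = "ennreal ((4 * bound_A + bound_B) * (1/4) ^ k)"
  note gm = mean_diff_measurable[OF gpath_measurable] and rm = mean_diff_measurable[OF Re_trig_measurable[OF approx_seq(1)]]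
  have le: "(\<Sum>n. ?X l n) \<le> ?C" if l: "k \<le> l" for l
  proof -
    let ?p = "\<lambda>w. approx_seq l w - approx_seq k w"
    have pt: "?p \<in> trig T" by (intro trig_diff approx_seq(1))
    have md: "mean_diff n (\<lambda>w. Re (?p w)) z = mean_diff n (re_seq l) z - mean_diff n (re_seq k) z" if "z \<in> space (NP n)" for n z
      unfolding mean_diff_def minus_complex.sel difference_diff
      by (intro Bochner_Integration.integral_diff difference_trig_integrable approx_seq(1) that)
    have "chaos_norm (mean_diff n (\<lambda>w. Re (?p w))) n = ?X l n" for n
      unfolding chaos_norm_def by (intro arg_cong2[where f="(*)"] nn_integral_cong refl) (simp only: md)
    then have "(\<Sum>n. ?X l n) = (\<Sum>n. chaos_norm (mean_diff n (\<lambda>w. Re (?p w))) n)" by simp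
    \<comment> \<open>The choice \<open>\<theta> = (1/4) ^ k\<close> balances the bound: the squared
      norm is at most \<open>4 * (1/16) ^ k\<close>, so both summands are of order
      \<open>(1/4) ^ k\<close>.\<close>
    also have "\<dots> \<le> ennreal (bound_A * (LINT w|Qs. (norm (?p w))\<^sup>2) / (1/4) ^ k + (1/4) ^ k * bound_B)"
      by (rule chaos_norm_trig[OF pt]) simp
    also have "\<dots> \<le> ?C"
    proof (rule ennreal_leI)
      have "(LINT w|Qs. (norm (?p w))\<^sup>2) \<le> (LINT w|Qs. 2 * (norm (complex_of_real (gpath w) - approx_seq k w))\<^sup>2 + 2 * (norm (complex_of_real (gpath w) - approx_seq l w))\<^sup>2)"
      proof (rule integral_mono)
        fix w
        have "(norm ((complex_of_real (gpath w) - approx_seq k w) + (- (complex_of_real (gpath w) - approx_seq l w))))\<^sup>2 \<le>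
          2 * (norm (complex_of_real (gpath w) - approx_seq k w))\<^sup>2 + 2 * (norm (- (complex_of_real (gpath w) - approx_seq l w)))\<^sup>2"
          by (rule norm_square_add)
        then show "(norm (?p w))\<^sup>2 \<le> 2 * (norm (complex_of_real (gpath w) - approx_seq k w))\<^sup>2 + 2 * (norm (complex_of_real (gpath w) - approx_seq l w))\<^sup>2"
          by (simp only: norm_minus_cancel) (simp add: algebra_simps)
      qed (use trig_integrable(2)[OF pt Qs_prob Qs_sets] approx_seq(2) in auto)
      also have "\<dots> = 2 * (LINT w|Qs. (norm (complex_of_real (gpath w) - approx_seq k w))\<^sup>2) + 2 * (LINT w|Qs. (norm (complex_of_real (gpath w) - approx_seq l w))\<^sup>2)"
        using approx_seq(2) by (subst Bochner_Integration.integral_add) auto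
      also have "\<dots> \<le> 2 * (1/16) ^ k + 2 * (1/16) ^ k"
        using approx_seq(3)[of k] order_trans[OF approx_seq(3)[of l] power_decreasing[OF l, of "1/16"]] by simp
      finally have s: "(LINT w|Qs. (norm (?p w))\<^sup>2) \<le> 4 * (1/16) ^ k" by simp
      have "bound_A * (LINT w|Qs. (norm (?p w))\<^sup>2) / (1/4) ^ k \<le> bound_A * (4 * (1/16) ^ k) / (1/4) ^ k"
        by (intro divide_right_mono mult_left_mono s) (auto simp: bound_A_def)
      also have "(1/16 :: real) ^ k = (1/4) ^ k * (1/4) ^ k" by (simp add: power_mult_distrib[symmetric])
      also have "bound_A * (4 * ((1/4) ^ k * (1/4) ^ k)) / (1/4) ^ k = 4 * bound_A * (1/4) ^ k" by simp
      finally show "bound_A * (LINT w|Qs. (norm (?p w))\<^sup>2) / (1/4) ^ k + (1/4) ^ k * bound_B \<le> (4 * bound_A + bound_B) * (1/4) ^ k"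
        unfolding distrib_right by simp
    qed
    finally show ?thesis .
  qed
  have pt: "chaos_norm (\<lambda>z. mean_diff n gpath z - mean_diff n (re_seq k) z) n \<le> liminf (\<lambda>l. ?X l n)" for n
  proof -
    let ?w = "\<lambda>z. \<bar>weight_power n z\<bar>"
    note [measurable] = gm rm weight_power_measurable[of n]
    have m: "(\<lambda>z. mean_diff n (re_seq l) z - mean_diff n (re_seq k) z) \<in> borel_measurable (NP n)"
      "(\<lambda>z. mean_diff n gpath z - mean_diff n (re_seq k) z) \<in> borel_measurable (NP n)" for l
      by measurable
    have "chaos_norm (\<lambda>z. mean_diff n gpath z - mean_diff n (re_seq k) z) n =
      (\<integral>\<^sup>+z. liminf (\<lambda>l. ennreal (1 / fact n * (\<bar>mean_diff n (re_seq l) z - mean_diff n (re_seq k) z\<bar> * ?w z))) \<partial>NP n)"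
      unfolding chaos_norm_eq[OF m(2)]
    proof (rule nn_integral_cong_AE)
      show "AE z in NP n. ennreal (1 / fact n * (\<bar>mean_diff n gpath z - mean_diff n (re_seq k) z\<bar> * ?w z)) =
        liminf (\<lambda>l. ennreal (1 / fact n * (\<bar>mean_diff n (re_seq l) z - mean_diff n (re_seq k) z\<bar> * ?w z)))"
        using mean_diff_converges[of n]
      proof eventually_elim
        case (elim z)
        then have "(\<lambda>l. ennreal (1 / fact n * (\<bar>mean_diff n (re_seq l) z - mean_diff n (re_seq k) z\<bar> * ?w z))) \<longlonglongrightarrow>
          ennreal (1 / fact n * (\<bar>mean_diff n gpath z - mean_diff n (re_seq k) z\<bar> * ?w z))"
          by (intro tendsto_ennrealI tendsto_mult tendsto_rabs tendsto_diff tendsto_const) auto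
        then show ?case by (intro lim_imp_Liminf[symmetric]) auto
      qed
    qed
    also have "\<dots> \<le> liminf (\<lambda>l. \<integral>\<^sup>+z. ennreal (1 / fact n * (\<bar>mean_diff n (re_seq l) z - mean_diff n (re_seq k) z\<bar> * ?w z)) \<partial>NP n)"
      by (rule nn_integral_liminf) measurable
    finally show ?thesis unfolding chaos_norm_eq[OF m(1)] .
  qed
  have "(\<Sum>n. chaos_norm (\<lambda>z. mean_diff n gpath z - mean_diff n (re_seq k) z) n) \<le> (\<Sum>n. liminf (\<lambda>l. ?X l n))"
    by (intro suminf_le pt) auto
  \<comment> \<open>The series over the orders is read as an integral for counting measure, so that
    Fatou's lemma applies to it as well.\<close>
  also have "\<dots> = (\<integral>\<^sup>+n. liminf (\<lambda>l. ?X l n) \<partial>count_space UNIV)" by (rule nn_integral_count_space_nat[symmetric])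
  also have "\<dots> \<le> liminf (\<lambda>l. \<integral>\<^sup>+n. ?X l n \<partial>count_space UNIV)" by (rule nn_integral_liminf) simp
  also have "\<dots> \<le> liminf (\<lambda>l. ?C)"
    using le by (intro Liminf_mono eventually_sequentiallyI[of k]) (simp add: nn_integral_count_space_nat)
  also have "\<dots> = ?C" by (simp add: Liminf_const)
  finally show ?thesis .
qed

lemma chaos_norm_gpath_finite: "(\<Sum>n. chaos_norm (mean_diff n gpath) n) < \<infinity>"
proof -
  note [measurable] = mean_diff_measurable[OF gpath_measurable] mean_diff_measurable[OF Re_trig_measurable[OF approx_seq(1)]] weight_power_measurable
  have "chaos_norm (mean_diff n gpath) n \<le> chaos_norm (\<lambda>z. mean_diff n gpath z - mean_diff n (re_seq 0) z) n + chaos_norm (mean_diff n (re_seq 0)) n" for n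
  proof -
    let ?w = "\<lambda>z. \<bar>weight_power n z\<bar>"
    have "(\<integral>\<^sup>+z. ennreal (\<bar>mean_diff n gpath z\<bar> * ?w z) \<partial>NP n) \<le>
      (\<integral>\<^sup>+z. ennreal (\<bar>mean_diff n gpath z - mean_diff n (re_seq 0) z\<bar> * ?w z) + ennreal (\<bar>mean_diff n (re_seq 0) z\<bar> * ?w z) \<partial>NP n)"
      by (intro nn_integral_mono, subst ennreal_plus[symmetric]) (auto intro!: ennreal_leI mult_right_mono simp flip: distrib_right)
    also have "\<dots> = (\<integral>\<^sup>+z. ennreal (\<bar>mean_diff n gpath z - mean_diff n (re_seq 0) z\<bar> * ?w z) \<partial>NP n) + (\<integral>\<^sup>+z. ennreal (\<bar>mean_diff n (re_seq 0) z\<bar> * ?w z) \<partial>NP n)"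
      by (rule nn_integral_add) measurable
    finally show ?thesis unfolding chaos_norm_def distrib_left[symmetric] by (intro mult_left_mono) simp_all
  qed
  then have "(\<Sum>n. chaos_norm (mean_diff n gpath) n) \<le> (\<Sum>n. chaos_norm (\<lambda>z. mean_diff n gpath z - mean_diff n (re_seq 0) z) n + chaos_norm (mean_diff n (re_seq 0)) n)"
    by (intro suminf_le) auto
  also have "\<dots> = (\<Sum>n. chaos_norm (\<lambda>z. mean_diff n gpath z - mean_diff n (re_seq 0) z) n) + (\<Sum>n. chaos_norm (mean_diff n (re_seq 0)) n)"
    by (intro suminf_add[symmetric]) auto
  also have "\<dots> < \<infinity>"
    using order.strict_trans1[OF chaos_norm_error[of 0] ennreal_less_top] order.strict_trans1[OF chaos_norm_trig[OF approx_seq(1) zero_less_one] ennreal_less_top]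
    by simp
  finally show ?thesis .
qed

lemma gpath_integrable: "integrable Q gpath" "integrable Q' gpath"
proof -
  have *: "integrable R gpath" if "dominated_law k R" for R k
  proof (rule integrableI_bounded)
    show "gpath \<in> borel_measurable R"
      using gpath_measurable that measurable_cong_sets[of R product_space] by (auto simp: dominated_law_def)
    show "(\<integral>\<^sup>+w. ennreal (norm (gpath w)) \<partial>R) < \<infinity>"
      using order.strict_trans1[OF dominated[OF that G G2] ennreal_less_top] by simp
  qed
  show "integrable Q gpath" "integrable Q' gpath" by (rule *[OF Q], rule *[OF Q'])
qed

text \<open>The identity is exact for the approximants. Replacing them by the functional changes the
  mean under \<open>Q'\<close> by a multiple of \<open>(1/4) ^ k\<close>, by
  \<open>dominated\<close>, and the series by another such multiple, by
  \<open>chaos_norm_error\<close>.\<close>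

lemma expansion: "(\<lambda>n. coeff n gpath) sums (LINT w|Q'. gpath w)"
proof -
  note gm = mean_diff_measurable[OF gpath_measurable] and rm = mean_diff_measurable[OF Re_trig_measurable[OF approx_seq(1)]]
  note fg = ennreal_suminf_lessD[OF chaos_norm_gpath_finite]
  have fr: "chaos_norm (mean_diff n (re_seq k)) n < \<infinity>" for n k
    using ennreal_suminf_lessD[of "\<lambda>n. chaos_norm (mean_diff n (re_seq k)) n"] order.strict_trans1[OF chaos_norm_trig[OF approx_seq(1) zero_less_one] ennreal_less_top]
    by simp
  have fe: "(\<Sum>n. chaos_norm (\<lambda>z. mean_diff n gpath z - mean_diff n (re_seq k) z) n) < \<infinity>" for k
    using order.strict_trans1[OF chaos_norm_error ennreal_less_top] by simp
  have sG: "summable (\<lambda>n. \<bar>coeff n gpath\<bar>)"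
  proof (rule summable_suminf_not_top)
    have "(\<Sum>n. ennreal \<bar>coeff n gpath\<bar>) \<le> (\<Sum>n. chaos_norm (mean_diff n gpath) n)"
      unfolding coeff_def by (intro suminf_le chaos_integrable(2)[OF gm fg]) auto
    then show "(\<Sum>n. ennreal \<bar>coeff n gpath\<bar>) \<noteq> \<top>" using chaos_norm_gpath_finite by (auto simp: top_unique)
  qed simp
  have err_le: "\<bar>(LINT w|Q'. gpath w) - (\<Sum>n. coeff n gpath)\<bar> \<le> 2 * exp ((LINT z|N. (h' z)\<^sup>2) / 2) * (1/4) ^ k + (4 * bound_A + bound_B) * (1/4) ^ k" for k
  proof -
    have ir: "integrable Q' (re_seq k)" using trig_integrable(1)[OF approx_seq(1) Q'_prob Q'_sets] by (rule integrable_Re)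
    have "\<bar>(LINT w|Q'. gpath w) - (LINT w|Q'. re_seq k w)\<bar> = \<bar>LINT w|Q'. err k (restrict_path T w)\<bar>"
      unfolding err_restrict using gpath_integrable(2) ir by simp
    also have "\<dots> \<le> (LINT w|Q'. \<bar>err k (restrict_path T w)\<bar>)"
      using integral_norm_bound[of Q' "\<lambda>w. err k (restrict_path T w)"] by simp
    also have "\<dots> \<le> 2 * exp ((LINT z|N. (h' z)\<^sup>2) / 2) * (1/4) ^ k"
    proof -
      have ie: "integrable Q' (\<lambda>w. \<bar>err k (restrict_path T w)\<bar>)"
        unfolding err_restrict using gpath_integrable(2) ir by auto
      have "ennreal (LINT w|Q'. \<bar>err k (restrict_path T w)\<bar>) \<le> ennreal (2 * exp ((LINT z|N. (h' z)\<^sup>2) / 2) * sqrt (LINT w|Qs. (err k (restrict_path T w))\<^sup>2))"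
        using dominated[OF Q' err_measurable[of k] err_square(1)] nn_integral_eq_integral[OF ie] by simp
      then have "(LINT w|Q'. \<bar>err k (restrict_path T w)\<bar>) \<le> 2 * exp ((LINT z|N. (h' z)\<^sup>2) / 2) * sqrt (LINT w|Qs. (err k (restrict_path T w))\<^sup>2)"
        by (subst (asm) ennreal_le_iff) (intro mult_nonneg_nonneg real_sqrt_ge_zero Bochner_Integration.integral_nonneg, auto)
      also have "\<dots> \<le> 2 * exp ((LINT z|N. (h' z)\<^sup>2) / 2) * (1/4) ^ k"
        by (intro mult_left_mono err_square(2)) simp
      finally show ?thesis .
    qed
    finally have 1: "\<bar>(LINT w|Q'. gpath w) - (LINT w|Q'. re_seq k w)\<bar> \<le> 2 * exp ((LINT z|N. (h' z)\<^sup>2) / 2) * (1/4) ^ k" .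
    have sr: "(\<lambda>n. coeff n (re_seq k)) sums (LINT w|Q'. re_seq k w)"
      unfolding coeff_def by (rule trig_expansion[OF approx_seq(1)])
    have d: "coeff n gpath - coeff n (re_seq k) = 1 / fact n * (LINT z|NP n. (mean_diff n gpath z - mean_diff n (re_seq k) z) * weight_power n z)" for n
      unfolding coeff_def left_diff_distrib
      using chaos_integrable(1)[OF gm fg, of n] chaos_integrable(1)[OF rm fr, of n k] by (simp add: right_diff_distrib)
    have dle: "ennreal \<bar>coeff n gpath - coeff n (re_seq k)\<bar> \<le> chaos_norm (\<lambda>z. mean_diff n gpath z - mean_diff n (re_seq k) z) n" for n
      unfolding d using gm rm by (intro chaos_integrable(2) ennreal_suminf_lessD[OF fe]) measurable
    have dsum: "(\<Sum>n. ennreal \<bar>coeff n gpath - coeff n (re_seq k)\<bar>) \<le> ennreal ((4 * bound_A + bound_B) * (1/4) ^ k)"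
      by (rule order_trans[OF suminf_le[OF dle] chaos_norm_error]) auto
    have ds: "summable (\<lambda>n. \<bar>coeff n gpath - coeff n (re_seq k)\<bar>)"
      by (rule summable_suminf_not_top) (use dsum in \<open>auto simp: top_unique\<close>)
    have "\<bar>(\<Sum>n. coeff n gpath) - (LINT w|Q'. re_seq k w)\<bar> = \<bar>\<Sum>n. coeff n gpath - coeff n (re_seq k)\<bar>"
      using suminf_diff[OF summable_rabs_cancel[OF sG] sums_summable[OF sr]] sums_unique[OF sr] by simp
    also have "\<dots> \<le> (\<Sum>n. \<bar>coeff n gpath - coeff n (re_seq k)\<bar>)" by (rule summable_rabs[OF ds])
    also have "\<dots> \<le> (4 * bound_A + bound_B) * (1/4) ^ k"
    proof -
      have "ennreal (\<Sum>n. \<bar>coeff n gpath - coeff n (re_seq k)\<bar>) \<le> ennreal ((4 * bound_A + bound_B) * (1/4) ^ k)"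
        using dsum unfolding suminf_ennreal2[OF abs_ge_zero ds] .
      moreover have "0 \<le> (4 * bound_A + bound_B) * (1/4) ^ k"
        unfolding bound_A_def bound_B_def by (intro mult_nonneg_nonneg add_nonneg_nonneg) auto
      ultimately show ?thesis using ennreal_le_iff by blast
    qed
    finally show ?thesis using 1 by linarith
  qed
  have "(\<lambda>k. 2 * exp ((LINT z|N. (h' z)\<^sup>2) / 2) * (1/4) ^ k + (4 * bound_A + bound_B) * (1/4) ^ k) \<longlonglongrightarrow>
    2 * exp ((LINT z|N. (h' z)\<^sup>2) / 2) * 0 + (4 * bound_A + bound_B) * 0"
    by (intro tendsto_intros LIMSEQ_power_zero) auto
  then have "\<bar>(LINT w|Q'. gpath w) - (\<Sum>n. coeff n gpath)\<bar> \<le> 2 * exp ((LINT z|N. (h' z)\<^sup>2) / 2) * 0 + (4 * bound_A + bound_B) * 0"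
    by (rule LIMSEQ_le_const) (use err_le in blast)
  then have "(LINT w|Q'. gpath w) = (\<Sum>n. coeff n gpath)" by simp
  then show ?thesis using summable_sums[OF summable_rabs_cancel[OF sG]] by simp
qed

end

end

section \<open>Transfer to the given Levy processes\<close>

lemma (in reference_law) dominated_law_density:
  fixes g :: "real ^ 'd \<Rightarrow> real" and X :: "'o \<Rightarrow> real \<Rightarrow> real ^ 'd"
  assumes cov: "covariance_matrix \<Sigma>" and \<nu>: "levy_measure \<nu>"
    and g: "g \<in> borel_measurable borel" "AE x in \<nu>s. 0 \<le> g x"
    and dens: "\<nu> = density \<nu>s (\<lambda>x. ennreal (g x))"
    and sq: "(\<integral>\<^sup>+ x. ennreal ((1 - g x)\<^sup>2) \<partial>\<nu>s) < \<infinity>"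
    and fin: "(\<integral>\<^sup>+ x\<in>{x. norm x \<le> 1}. ennreal (norm x * \<bar>1 - g x\<bar>) \<partial>\<nu>s) < \<infinity>"
    and b: "b = bs + (LINT x:{x. norm x \<le> 1}|\<nu>s. (g x - 1) *\<^sub>R x)"
    and X: "levy_process TYPE('w) \<Sigma> b \<nu> P X"
  shows "dominated_law (\<lambda>z. if fst z \<le> T then g (snd z) - 1 else 0) (distr P product_space X)"
  unfolding dominated_law_def
proof (intro conjI ballI)
  show "prob_space (distr P product_space X)" by (rule levy_process_law(1)[OF X cov \<nu>])
  have gm: "(\<lambda>x. g x - 1) \<in> borel_measurable borel" using g(1) by measurable
  have sq': "(\<integral>\<^sup>+ x. ennreal ((g x - 1)\<^sup>2) \<partial>\<nu>s) < \<infinity>" using sq by (simp only: power2_commute)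
  show "(\<lambda>z. if fst z \<le> T then g (snd z) - 1 else 0) \<in> borel_measurable N"
    "integrable N (\<lambda>z. (if fst z \<le> T then g (snd z) - 1 else 0)\<^sup>2)"
    by (rule square_integrable_cutoff[OF gm sq'])+
  fix u assume u: "u \<in> (times_upto T :: (real \<times> (real ^ 'd)) list set)"
  show "(LINT w|distr P product_space X. expo u w) =
    ref_cf u * exp (LINT z|N. jump_symbol u z * (if fst z \<le> T then g (snd z) - 1 else 0))"
    unfolding levy_process_law(2)[OF X cov \<nu> u] levy_cf_density[OF \<nu> g dens sq fin b u] ref_cf_def
    by (simp only: mult.assoc)
qed simp

context perturbed_law
begin

lemma mean_diff_late:
  assumes "j < n" "T < fst (z j)"
  shows "mean_diff n (\<lambda>w. G (restrict_path T w)) z = 0"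
proof -
  have "difference_at n z (\<lambda>w. G (restrict_path T w)) w = 0" for w
    by (rule difference_late[of "z j"]) (use assms in auto)
  then show ?thesis by (simp add: mean_diff_def)
qed

text \<open>The weight \<open>q\<close> agrees with \<open>k\<close> only up to time
  \<open>T\<close>. The mean difference is 0 as soon as one jump is later, so the truncated weight
  may be exchanged for the full tensor power.\<close>

lemma mean_diff_weight_power:
  assumes k: "\<And>z. fst z \<le> T \<Longrightarrow> q z = k (snd z)"
  shows "mean_diff n (\<lambda>w. G (restrict_path T w)) z * weight_power n z =
      mean_diff n (\<lambda>w. G (restrict_path T w)) z * tensor_power n k z"
    "\<bar>mean_diff n (\<lambda>w. G (restrict_path T w)) z\<bar> * \<bar>weight_power n z\<bar> =
      \<bar>mean_diff n (\<lambda>w. G (restrict_path T w)) z\<bar> * tensor_power n (\<lambda>x. \<bar>k x\<bar>) z"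
proof -
  have "mean_diff n (\<lambda>w. G (restrict_path T w)) z = 0 \<or> weight_power n z = tensor_power n k z"
  proof (cases "\<exists>j<n. T < fst (z j)")
    case False
    then show ?thesis unfolding weight_power_def tensor_power_def
      by (intro disjI2 prod.cong refl k) (meson lessThan_iff not_less)
  qed (use mean_diff_late in blast)
  moreover have "tensor_power n (\<lambda>x. \<bar>k x\<bar>) z = \<bar>tensor_power n k z\<bar>"
    by (simp add: tensor_power_def abs_prod)
  ultimately show
    "mean_diff n (\<lambda>w. G (restrict_path T w)) z * weight_power n z =
      mean_diff n (\<lambda>w. G (restrict_path T w)) z * tensor_power n k z"
    "\<bar>mean_diff n (\<lambda>w. G (restrict_path T w)) z\<bar> * \<bar>weight_power n z\<bar> =
      \<bar>mean_diff n (\<lambda>w. G (restrict_path T w)) z\<bar> * tensor_power n (\<lambda>x. \<bar>k x\<bar>) z"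
    by auto
qed

end

theorem theorem7p1:
  fixes \<Sigma> :: "real ^ 'd ^ 'd"
    and \<nu> \<nu>' \<nu>s :: "(real ^ 'd) measure"
    and b b' bs :: "real ^ 'd"
    and g g' :: "real ^ 'd \<Rightarrow> real"
    and P P' Ps :: "'o measure"
    and X :: "'o \<Rightarrow> real \<Rightarrow> real ^ 'd"
    and f :: "(real \<Rightarrow> real ^ 'd) \<Rightarrow> real"
    and t0 :: real
  assumes "covariance_matrix \<Sigma>"
    and "levy_measure \<nu>" and "levy_measure \<nu>'" and "levy_measure \<nu>s"
    and "g \<in> borel_measurable borel" and "AE x in \<nu>s. 0 \<le> g x"
    and "\<nu> = density \<nu>s (\<lambda>x. ennreal (g x))"
    and "g' \<in> borel_measurable borel" and "AE x in \<nu>s. 0 \<le> g' x"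
    and "\<nu>' = density \<nu>s (\<lambda>x. ennreal (g' x))"
    and "(\<integral>\<^sup>+ x. ennreal ((1 - g x)\<^sup>2) \<partial>\<nu>s) + (\<integral>\<^sup>+ x. ennreal ((1 - g' x)\<^sup>2) \<partial>\<nu>s) < \<infinity>"
    and "(\<integral>\<^sup>+ x\<in>{x. norm x \<le> 1}. ennreal (norm x * \<bar>1 - g x\<bar>) \<partial>\<nu>s)
       + (\<integral>\<^sup>+ x\<in>{x. norm x \<le> 1}. ennreal (norm x * \<bar>1 - g' x\<bar>) \<partial>\<nu>s) < \<infinity>"
    and "b = bs + (LINT x:{x. norm x \<le> 1}|\<nu>s. (g x - 1) *\<^sub>R x)"
    and "b' = bs + (LINT x:{x. norm x \<le> 1}|\<nu>s. (g' x - 1) *\<^sub>R x)"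
    and "levy_process TYPE('w) \<Sigma> b \<nu> P X"
    and "levy_process TYPE('w1) \<Sigma> b' \<nu>' P' X"
    and "levy_process TYPE('w2) \<Sigma> bs \<nu>s Ps X"
    and "t0 > 0" and "f \<in> borel_measurable (path_algebra_upto t0)"
    and "(\<integral>\<^sup>+ \<omega>. ennreal ((f (X \<omega>))\<^sup>2) \<partial>Ps) < \<infinity>"
  shows
    "integrable P (\<lambda>\<omega>. f (X \<omega>)) \<and> integrable P' (\<lambda>\<omega>. f (X \<omega>)) \<and>
     (\<forall>n. AE z in jump_power n \<nu>s. tensor_power n (\<lambda>x. \<bar>g' x - g x\<bar>) z \<noteq> 0 \<longrightarrow>
        integrable P (\<lambda>\<omega>. difference_at n z f (X \<omega>))) \<and>
     (\<forall>n. integrable (jump_power n \<nu>s) (\<lambda>z.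
        (LINT \<omega>|P. difference_at n z f (X \<omega>)) * tensor_power n (\<lambda>x. g' x - g x) z)) \<and>
     (\<Sum>n. ennreal (1 / fact n) *
        (\<integral>\<^sup>+ z. ennreal (\<bar>LINT \<omega>|P. difference_at n z f (X \<omega>)\<bar> *
                       tensor_power n (\<lambda>x. \<bar>g' x - g x\<bar>) z) \<partial>jump_power n \<nu>s)) < \<infinity> \<and>
     (LINT \<omega>|P'. f (X \<omega>)) = (LINT \<omega>|P. f (X \<omega>)) +
       (\<Sum>n. 1 / fact (Suc n) *
          (LINT z|jump_power (Suc n) \<nu>s. (LINT \<omega>|P. difference_at (Suc n) z f (X \<omega>)) *
             tensor_power (Suc n) (\<lambda>x. g' x - g x) z))"
proof -
  note cov = assms(1) and levy = assms(4)
  let ?law = "\<lambda>R. distr R product_space X"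
  define h h' q :: "real \<times> (real ^ 'd) \<Rightarrow> real" where
    "h = (\<lambda>z. if fst z \<le> t0 then g (snd z) - 1 else 0)" and
    "h' = (\<lambda>z. if fst z \<le> t0 then g' (snd z) - 1 else 0)" and
    "q = (\<lambda>z. if fst z \<le> t0 then g' (snd z) - g (snd z) else 0)"
  have Xm: "X \<in> measurable R product_space" "\<omega> \<in> space R \<Longrightarrow> X \<omega> \<in> cadlag_paths"
    if "X \<in> measurable R path_space" for R \<omega>
  proof -
    show "X \<in> measurable R product_space" by (rule measurable_path_space[OF that])
    show "\<omega> \<in> space R \<Longrightarrow> X \<omega> \<in> cadlag_paths"
      using measurable_space[OF that] by (auto simp: path_space_def space_restrict_space)
  qed
  have XP: "X \<in> measurable P path_space" "X \<in> measurable P' path_space" "X \<in> measurable Ps path_space"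
    using assms(15-17) by (auto simp: levy_process_def)
  interpret R: reference_law \<Sigma> bs \<nu>s t0 "?law Ps"
    by (rule reference_law.intro[OF levy less_imp_le[OF assms(18)] levy_process_law(1)[OF assms(17) cov levy]
          sets_distr levy_process_law(2,3)[OF assms(17) cov levy]])
  have sq: "(\<integral>\<^sup>+ x. ennreal ((1 - g x)\<^sup>2) \<partial>\<nu>s) < \<infinity>" "(\<integral>\<^sup>+ x. ennreal ((1 - g' x)\<^sup>2) \<partial>\<nu>s) < \<infinity>"
    using assms(11) by simp_all
  have fin: "(\<integral>\<^sup>+ x\<in>{x. norm x \<le> 1}. ennreal (norm x * \<bar>1 - g x\<bar>) \<partial>\<nu>s) < \<infinity>"
    "(\<integral>\<^sup>+ x\<in>{x. norm x \<le> 1}. ennreal (norm x * \<bar>1 - g' x\<bar>) \<partial>\<nu>s) < \<infinity>"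
    using assms(12) by simp_all
  have dom: "R.dominated_law h (?law P)" "R.dominated_law h' (?law P')"
    unfolding h_def h'_def
    by (rule R.dominated_law_density[OF cov assms(2,5,6,7) sq(1) fin(1) assms(13,15)])
      (rule R.dominated_law_density[OF cov assms(3,8,9,10) sq(2) fin(2) assms(14,16)])
  have km: "(\<lambda>x. g' x - g x) \<in> borel_measurable borel" using assms(5,8) by measurable
  have "(\<integral>\<^sup>+ x. ennreal ((g' x - g x)\<^sup>2) \<partial>\<nu>s) \<le> (\<integral>\<^sup>+ x. 2 * ennreal ((1 - g x)\<^sup>2) + 2 * ennreal ((1 - g' x)\<^sup>2) \<partial>\<nu>s)"
  proof (rule nn_integral_mono)
    fix x
    have "(g' x - g x)\<^sup>2 \<le> 2 * (1 - g x)\<^sup>2 + 2 * (1 - g' x)\<^sup>2"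
      \<comment> \<open>Parallelogram identity for \<open>1 - g x\<close> and
        \<open>1 - g' x\<close>: the square of their sum is dropped.\<close>
      using zero_le_power2[of "(1 - g x) + (1 - g' x)"] by (simp add: power2_eq_square algebra_simps)
    then have "ennreal ((g' x - g x)\<^sup>2) \<le> ennreal (2 * (1 - g x)\<^sup>2 + 2 * (1 - g' x)\<^sup>2)" by (rule ennreal_leI)
    also have "\<dots> = 2 * ennreal ((1 - g x)\<^sup>2) + 2 * ennreal ((1 - g' x)\<^sup>2)"
      by (simp add: ennreal_mult')
    finally show "ennreal ((g' x - g x)\<^sup>2) \<le> 2 * ennreal ((1 - g x)\<^sup>2) + 2 * ennreal ((1 - g' x)\<^sup>2)" .
  qed
  also have "\<dots> = 2 * (\<integral>\<^sup>+ x. ennreal ((1 - g x)\<^sup>2) \<partial>\<nu>s) + 2 * (\<integral>\<^sup>+ x. ennreal ((1 - g' x)\<^sup>2) \<partial>\<nu>s)"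
  proof -
    note [measurable] = R.borel_\<nu>s[OF assms(5)] R.borel_\<nu>s[OF assms(8)]
    show ?thesis by (simp add: nn_integral_add nn_integral_cmult)
  qed
  also have "\<dots> < \<infinity>" using sq by (simp add: ennreal_mult_less_top)
  finally have kfin: "(\<integral>\<^sup>+ x. ennreal ((g' x - g x)\<^sup>2) \<partial>\<nu>s) < \<infinity>" .
  have qm: "q \<in> borel_measurable (jump_intensity \<nu>s)" "integrable (jump_intensity \<nu>s) (\<lambda>z. (q z)\<^sup>2)"
    unfolding q_def by (rule R.square_integrable_cutoff[OF km kfin])+
  interpret L: perturbed_law \<Sigma> bs \<nu>s t0 "?law Ps" "?law P" "?law P'" h h' q
  proof (intro perturbed_law.intro R.reference_law_axioms perturbed_law_axioms.intro dom qm)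
    fix u assume u: "u \<in> (times_upto t0 :: (real \<times> (real ^ 'd)) list set)"
    interpret F: l2_family "jump_intensity \<nu>s" jump_symbol "{u}"
      by (rule R.l2_family_jump_symbol) (use u in auto)
    \<comment> \<open>By construction \<open>q\<close> is \<open>h' - h\<close>, so the exponents of
      the two characteristic functions differ by the pairing with \<open>q\<close>.\<close>
    have "jump_symbol u z * h' z = jump_symbol u z * h z + jump_symbol u z * q z" for z
      by (simp add: h_def h'_def q_def algebra_simps)
    then have "(LINT z|jump_intensity \<nu>s. jump_symbol u z * h' z) =
      (LINT z|jump_intensity \<nu>s. jump_symbol u z * h z) + (LINT z|jump_intensity \<nu>s. jump_symbol u z * q z)"
      using F.integrable_pairing[of h u] F.integrable_pairing[of q u] dom(1) qm
      by (simp add: R.dominated_law_def)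
    then show "(LINT w|?law P'. expo u w) = (LINT w|?law P. expo u w) * exp (LINT z|jump_intensity \<nu>s. jump_symbol u z * q z)"
      using dom u by (simp add: R.dominated_law_def exp_add)
  qed
  \<comment> \<open>From here on \<open>f\<close> is represented by a functional on the whole
    product space; the two agree on cadlag paths, the only ones that occur.\<close>
  obtain G where G: "G \<in> borel_measurable (path_upto t0)" and fG: "\<And>w. w \<in> cadlag_paths \<Longrightarrow> f w = G (restrict_path t0 w)"
    using path_algebra_factor[OF assms(19)] assms(18) by force
  let ?F = "\<lambda>w. G (restrict_path t0 w)"
  have Fm: "?F \<in> borel_measurable product_space" by (rule measurable_compose[OF restrict_path_measurable G])
  have G2: "integrable (?law Ps) (\<lambda>w. (?F w)\<^sup>2)"
  proof (rule integrableI_bounded)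
    show "(\<lambda>w. (?F w)\<^sup>2) \<in> borel_measurable (?law Ps)" using Fm by simp
    have "(\<integral>\<^sup>+w. ennreal (norm ((?F w)\<^sup>2)) \<partial>?law Ps) = (\<integral>\<^sup>+\<omega>. ennreal ((?F (X \<omega>))\<^sup>2) \<partial>Ps)"
      using Fm by (subst nn_integral_distr[OF Xm(1)[OF XP(3)]]) auto
    also have "\<dots> = (\<integral>\<^sup>+\<omega>. ennreal ((f (X \<omega>))\<^sup>2) \<partial>Ps)"
      by (intro nn_integral_cong) (simp add: fG Xm(2)[OF XP(3)])
    finally show "(\<integral>\<^sup>+w. ennreal (norm ((?F w)\<^sup>2)) \<partial>?law Ps) < \<infinity>" using assms(20) by simp
  qed
  have int_F: "integrable R (\<lambda>\<omega>. f (X \<omega>))" "(LINT \<omega>|R. f (X \<omega>)) = (LINT w|?law R. ?F w)"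
    if XR: "X \<in> measurable R path_space" and i: "integrable (?law R) ?F" for R
  proof -
    have c: "f (X \<omega>) = ?F (X \<omega>)" if "\<omega> \<in> space R" for \<omega> by (rule fG[OF Xm(2)[OF XR that]])
    show "integrable R (\<lambda>\<omega>. f (X \<omega>))"
      using i integrable_distr_eq[OF Xm(1)[OF XR] Fm] by (simp add: c cong: Bochner_Integration.integrable_cong)
    show "(LINT \<omega>|R. f (X \<omega>)) = (LINT w|?law R. ?F w)"
      unfolding integral_distr[OF Xm(1)[OF XR] Fm] by (intro Bochner_Integration.integral_cong refl c)
  qed
  \<comment> \<open>Adding jumps preserves the cadlag property, so \<open>f\<close> and its
    representative agree at every shifted path entering the difference.\<close>
  have diff_F: "difference_at n z f (X \<omega>) = difference_at n z ?F (X \<omega>)" if "\<omega> \<in> space P" for n z \<omega>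
    by (rule difference_cong_cadlag[OF fG Xm(2)[OF XP(1) that]])
  have dm: "difference_at n z ?F \<in> borel_measurable product_space" if "z \<in> space (jump_power n \<nu>s)" for n z
    using L.difference_measurable(2)[OF Fm that] by simp
  have mean: "(LINT \<omega>|P. difference_at n z f (X \<omega>)) = L.mean_diff n ?F z"
    if z: "z \<in> space (jump_power n \<nu>s)" for n z
    unfolding L.mean_diff_def integral_distr[OF Xm(1)[OF XP(1)] dm[OF z]]
    by (intro Bochner_Integration.integral_cong refl diff_F)
  have weight: "L.mean_diff n ?F z * L.weight_power n z = L.mean_diff n ?F z * tensor_power n (\<lambda>x. g' x - g x) z"
    "\<bar>L.mean_diff n ?F z\<bar> * tensor_power n (\<lambda>x. \<bar>g' x - g x\<bar>) z = \<bar>L.mean_diff n ?F z\<bar> * \<bar>L.weight_power n z\<bar>" for n z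
    by (rule L.mean_diff_weight_power L.mean_diff_weight_power(2)[symmetric], simp add: q_def)+
  note finite = L.chaos_norm_gpath_finite[OF G G2]
  have coeff_eq: "L.coeff n ?F = 1 / fact n * (LINT z|jump_power n \<nu>s. (LINT \<omega>|P. difference_at n z f (X \<omega>)) * tensor_power n (\<lambda>x. g' x - g x) z)" for n
    unfolding L.coeff_def weight(1)
    by (intro arg_cong2[where f="(*)"] refl Bochner_Integration.integral_cong) (simp add: mean)
  \<comment> \<open>The product measure over the empty index set is a unit point mass and the empty
    product of weights is 1, so the term of order 0 is the unperturbed mean.\<close>
  have zero: "L.coeff 0 ?F = (LINT \<omega>|P. f (X \<omega>))"
    unfolding coeff_eq by (simp add: tensor_power_def PiM_empty lebesgue_integral_count_space_finite)
  have "L.coeff 0 ?F + (\<Sum>n. L.coeff (Suc n) ?F) = (LINT w|?law P'. ?F w)"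
    using L.expansion[OF G G2] suminf_split_head[OF sums_summable[OF L.expansion[OF G G2]]] by (simp add: sums_iff)
  then have "(LINT \<omega>|P'. f (X \<omega>)) = (LINT \<omega>|P. f (X \<omega>)) + (\<Sum>n. L.coeff (Suc n) ?F)"
    unfolding zero int_F(2)[OF XP(2) L.gpath_integrable(2)[OF G G2]] by simp
  moreover have "integrable (jump_power n \<nu>s) (\<lambda>z.
        (LINT \<omega>|P. difference_at n z f (X \<omega>)) * tensor_power n (\<lambda>x. g' x - g x) z)" for n
  proof -
    have "integrable (jump_power n \<nu>s) (\<lambda>z. L.mean_diff n ?F z * L.weight_power n z)"
      by (rule L.chaos_integrable(1)[OF L.mean_diff_measurable[OF Fm] ennreal_suminf_lessD[OF finite]])
    then show ?thesis unfolding weight(1) by (simp add: mean cong: Bochner_Integration.integrable_cong)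
  qed
  moreover have "AE z in jump_power n \<nu>s. tensor_power n (\<lambda>x. \<bar>g' x - g x\<bar>) z \<noteq> 0 \<longrightarrow>
      integrable P (\<lambda>\<omega>. difference_at n z f (X \<omega>))" for n
    using L.mean_diff_converges[OF G G2, of n] AE_space
  proof eventually_elim
    case (elim z)
    then show ?case using integrable_distr_eq[OF Xm(1)[OF XP(1)] dm[OF elim(2)]]
      by (simp add: diff_F cong: Bochner_Integration.integrable_cong)
  qed
  moreover have "(\<integral>\<^sup>+ z. ennreal (\<bar>LINT \<omega>|P. difference_at n z f (X \<omega>)\<bar> *
                       tensor_power n (\<lambda>x. \<bar>g' x - g x\<bar>) z) \<partial>jump_power n \<nu>s) =
    (\<integral>\<^sup>+ z. ennreal (\<bar>L.mean_diff n ?F z\<bar> * \<bar>L.weight_power n z\<bar>) \<partial>jump_power n \<nu>s)" for n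
    by (intro nn_integral_cong) (simp add: mean weight(2))
  ultimately show ?thesis
    using int_F(1)[OF XP(1) L.gpath_integrable(1)[OF G G2]] int_F(1)[OF XP(2) L.gpath_integrable(2)[OF G G2]] finite
    unfolding coeff_eq[symmetric] L.chaos_norm_def by auto
qed

end
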